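(* Let $\{P_n(z)\}_{n=0}^\infty$ be the family of monic polynomials ($\deg P_n=n$) orthogonal with respect to the weight $w(z)\,d_qz$, i.e. $\int_{-\infty}^{\infty}P_n(x)P_m(x)w(x)\,d_qx=\gamma_n\delta_{n,m}$. Put $t=zq^{n/2}$. Then, as $n\to\infty$ through even $n\in\mathbb{N}$, \[ P_n(z)=\begin{cases}(-1)^{n/2}q^{-\frac n2\left(\frac n2-1\right)}\,a(z)\left(\dfrac{\mu_2}{\eta_2}+O(q^{n/4})\right) & \text{for } |z|\le q^{-n/4},\\[2mm] z^n a_\infty(t)\left(1+O(q^{n/4})\right) & \text{for } |z|>q^{-n/4},\end{cases} \] and \[ P_{n-1}(z)=\begin{cases}(-1)^{n/2}q^{\frac n2\left(\frac n2-1\right)}\gamma_{n-1}\,b(z)\left(\dfrac{\lambda_3}{c_\Psi}+O(q^{n/4})\right) & \text{for } |z|\le q^{-n/4},\\[2mm] \dfrac{q^{n\left(\frac n2-1\right)}\gamma_{n-1}}{\mu_4\,\mathcal{H}\,c_\Psi}\,z^n b_\infty(t)\left(1+O(q^{n/4})\right) & \text{for } |z|>q^{-n/4}.\end{cases} \] Here the functions $a,b,a_\infty,b_\infty$ (independent of $n$) and the constants $\mu_2,\eta_2,\lambda_3,\mu_4,\mathcal{H},c_\Psi$ (independent of $z$ and $n$) are those defined in the context.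
   Context: Throughout $q\in\mathbb{R}$, $0<q<1$, and $\mathbb{N}=\{0,1,2,\dots\}$. Notation: $(x;q)_\infty=\prod_{j\ge0}(1-xq^j)$, $(x_1,x_2;q)_\infty=(x_1;q)_\infty(x_2;q)_\infty$; $\int_{-\infty}^{\infty}f(x)\,d_qx=\sum_{k\in\mathbb{Z}}q^k\big(f(q^k)+f(-q^k)\big)$. Functions: $w(z)=1/(-z^4;q^4)_\infty$; $g(z)=(z^2;q^2)_\infty(q^2z^{-2};q^2)_\infty$; $\omega(z)=1/(-z^4,-q^4z^{-4};q^4)_\infty$; $h_q(z)=\sum_{k\in\mathbb{Z}}\frac{2zq^k}{z^2-q^{2k}}$. Near-field functions. Consider (N) $y(q^{-2}z)+\big(q^{-3}z^2(1+q^{-1})-(1+q^{-1})\big)y(q^{-1}z)+q^{-1}(1+q^{-4}z^4)y(z)=0$. $a(z)$ is the even entire solution of (N) with $a(0)=1$; $b(z)$ is the odd entire solution of (N) whose coefficient of $z$ is $1$. $\phi_{even}(z)$ is the solution, analytic in $\mathbb{C}\setminus\{0\}$ and given by an even power series in $z^{-1}$ with constant term $1$, of $(q^6z^{-4}+q^{-2})v(q^{-2}z)+(z^{-2}q(1+q)-q^{-1}(1+q^{-1}))v(q^{-1}z)+q^{-1}v(z)=0$. $\varphi_{even}(z)$, $\varphi_{odd}(z)$ are the solutions, analytic in $|z|>q$, of $q^{-5}u(q^{-2}z)+q^{-1}(z^{-2}(1+q^{-1})-q^{-3}(1+q^{-1}))u(q^{-1}z)+(z^{-4}+q^{-4})u(z)=0$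 given respectively by an even power series in $z^{-1}$ with constant term $1$ and an odd power series in $z^{-1}$ whose coefficient of $z^{-1}$ is $1$. The constants $\eta_1,\eta_2$ are defined by $a(z)g(z)^{-1}=\eta_1h_q(z)\varphi_{odd}(z)+\eta_2\varphi_{even}(z)$, and $\lambda_3,\lambda_4$ by $\phi_{even}(z)=g(z)w(z)\big(\lambda_3h_q(z)b(z)+\lambda_4a(z)\big)$. Far-field functions. $a_\infty(t)=\sum_{j\ge0}a_{2j}t^{-2j}$, $a_0=1$, is the solution, analytic in $\mathbb{C}\setminus\{0\}$, of (F1) $q^7t^{-4}y(q^{-2}t)-(1-q^2(q+1)t^{-2})y(q^{-1}t)+y(t)=0$, and $b_\infty(t)=\sum_{j\ge0}b_{2j+1}t^{-2j-1}$, $b_1=1$, is the solution, analytic in $\mathbb{C}\setminus\{0\}$, of (F2) $q^7t^{-4}y(q^{-2}t)-(q^{-1}-q^2(q+1)t^{-2})y(q^{-1}t)+y(t)=0$. $\Psi_{even},\Psi_{odd}$ are the even and odd entire solutions of $q\alpha(q^{-2}t)+(t^2q^{-2}-(1+q))\alpha(q^{-1}t)+\alpha(t)=0$, and $\widetilde\Psi_{even},\widetilde\Psi_{odd}$ are the even and odd entire solutions of $q\beta(q^{-2}t)+(t^2q^{-3}-(1+q))\beta(q^{-1}t)+\beta(t)=0$, each normalised so that its first non-zero Taylor coefficient (of $t^0$ in the even case, of $t^1$ in the odd case) is $1$. The constants $\mu_1,\dots,\mu_4$ are defined by $a_\infty(t)g(t)^{-1}=\mu_1h_q(t)\Psi_{odd}(t)+\mu_2\Psi_{even}(t)$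 and $b_\infty(t)g(t)^{-1}=\mu_3\widetilde\Psi_{odd}(t)+\mu_4h_q(t)\widetilde\Psi_{even}(t)$. $\mathcal{H}=\omega(q)g(q)^2h_q(q)^2$, where $g(q)h_q(q)$ is understood as $\lim_{z\to q}g(z)h_q(z)$. $c_\Psi$ is the non-zero constant with $\widetilde\Psi_{even}(t)g(t)^{-1}=c_\Psi+O(t^{-1})$ as $t\to\infty$ with $t$ staying at distance more than some fixed $r>0$ from all the points $\pm q^k$, $k\in\mathbb{Z}$.
   Formalization: The factors (c+O(q^{n/4})) fail at zeros of the leading term; they are proved uniformly outside discs of radius δ|ζ| about its zeros ζ, for each δ>0, and at every z with an additive error O(q^{n/4}) times the maximum modulus of the leading term on the circle through z. *)

theory Defs
  imports
    "HOL-Analysis.Analysis"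
    "HOL-Computational_Algebra.Polynomial"
    "HOL-Library.Landau_Symbols"
begin

section \<open>Infinite products, the weight and the Jackson integral\<close>

definition qpoch_inf :: "complex \<Rightarrow> real \<Rightarrow> complex" where
  "qpoch_inf x p = (\<Prod>j. 1 - x * complex_of_real p ^ j)"

definition w_fun :: "real \<Rightarrow> complex \<Rightarrow> complex" where
  "w_fun q z = 1 / qpoch_inf (- (z ^ 4)) (q ^ 4)"

definition g_fun :: "real \<Rightarrow> complex \<Rightarrow> complex" where
  "g_fun q z = qpoch_inf (z ^ 2) (q ^ 2) * qpoch_inf (complex_of_real q ^ 2 / z ^ 2) (q ^ 2)"

definition omega_fun :: "real \<Rightarrow> complex \<Rightarrow> complex" where
  "omega_fun q z =
     1 / (qpoch_inf (- (z ^ 4)) (q ^ 4) * qpoch_inf (- (complex_of_real q ^ 4 / z ^ 4)) (q ^ 4))"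

definition h_fun :: "real \<Rightarrow> complex \<Rightarrow> complex" where
  "h_fun q z =
     (\<Sum>\<^sub>\<infinity>k\<in>(UNIV :: int set).
        2 * z * complex_of_real q powi k / (z ^ 2 - complex_of_real q powi (2 * k)))"

definition q_lattice :: "real \<Rightarrow> complex set" where
  "q_lattice q = {x. \<exists>k :: int. x = complex_of_real q powi k \<or> x = - (complex_of_real q powi k)}"

definition jackson_integral :: "real \<Rightarrow> (complex \<Rightarrow> complex) \<Rightarrow> complex" where
  "jackson_integral q f =
     (\<Sum>\<^sub>\<infinity>k\<in>(UNIV :: int set).
        complex_of_real q powi k *
          (f (complex_of_real q powi k) + f (- (complex_of_real q powi k))))"

text \<open>
  The pairing below is bilinear (no complex conjugation). The monic orthogonal polynomials have
  real coefficients; complex coefficients are allowed only because the polynomials are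
  evaluated at complex arguments.
\<close>

definition monic_orthogonal_family ::
    "real \<Rightarrow> (nat \<Rightarrow> complex poly) \<Rightarrow> (nat \<Rightarrow> complex) \<Rightarrow> bool" where
  "monic_orthogonal_family q P \<gamma> \<longleftrightarrow>
     (\<forall>n. degree (P n) = n \<and> lead_coeff (P n) = 1) \<and>
     (\<forall>n m. jackson_integral q (\<lambda>x. poly (P n) x * poly (P m) x * w_fun q x)
              = (if n = m then \<gamma> n else 0))"

text \<open>The factor \<open>g_fun q z * h_fun q z\<close> has a removable singularity at \<open>z = q\<close>.\<close>

definition H_const :: "real \<Rightarrow> complex" where
  "H_const q = omega_fun q (complex_of_real q) *
     (Lim (at (complex_of_real q)) (\<lambda>z. g_fun q z * h_fun q z)) ^ 2"

section \<open>Normalised even and odd solutions\<close>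

definition normalised_even_entire :: "(complex \<Rightarrow> complex) \<Rightarrow> bool" where
  "normalised_even_entire f \<longleftrightarrow>
     f holomorphic_on UNIV \<and> (\<forall>z. f (- z) = f z) \<and> f 0 = 1"

definition normalised_odd_entire :: "(complex \<Rightarrow> complex) \<Rightarrow> bool" where
  "normalised_odd_entire f \<longleftrightarrow>
     f holomorphic_on UNIV \<and> (\<forall>z. f (- z) = - f z) \<and> deriv f 0 = 1"

text \<open>
  Expansions in powers of \<open>1/z\<close>, convergent (hence analytic) for \<open>|z| > R\<close>; with \<open>R = 0\<close> this is
  the punctured plane.
\<close>

definition normalised_even_series_at_infinity :: "real \<Rightarrow> (complex \<Rightarrow> complex) \<Rightarrow> bool" where
  "normalised_even_series_at_infinity R f \<longleftrightarrow>
     (\<exists>c :: nat \<Rightarrow> complex. c 0 = 1 \<and>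
        (\<forall>z. norm z > R \<longrightarrow> (\<lambda>j. c j / z ^ (2 * j)) sums f z))"

definition normalised_odd_series_at_infinity :: "real \<Rightarrow> (complex \<Rightarrow> complex) \<Rightarrow> bool" where
  "normalised_odd_series_at_infinity R f \<longleftrightarrow>
     (\<exists>c :: nat \<Rightarrow> complex. c 0 = 1 \<and>
        (\<forall>z. norm z > R \<longrightarrow> (\<lambda>j. c j / z ^ (2 * j + 1)) sums f z))"

section \<open>The q-difference equations at a point\<close>

definition near_eq :: "real \<Rightarrow> (complex \<Rightarrow> complex) \<Rightarrow> complex \<Rightarrow> bool" where
  "near_eq q y z \<longleftrightarrow>
     (let Q = complex_of_real q in
        y (z / Q ^ 2) + (z ^ 2 / Q ^ 3 * (1 + 1 / Q) - (1 + 1 / Q)) * y (z / Q)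
          + 1 / Q * (1 + z ^ 4 / Q ^ 4) * y z = 0)"

definition phi_eq :: "real \<Rightarrow> (complex \<Rightarrow> complex) \<Rightarrow> complex \<Rightarrow> bool" where
  "phi_eq q v z \<longleftrightarrow>
     (let Q = complex_of_real q in
        (Q ^ 6 / z ^ 4 + 1 / Q ^ 2) * v (z / Q ^ 2)
          + (Q * (1 + Q) / z ^ 2 - 1 / Q * (1 + 1 / Q)) * v (z / Q)
          + 1 / Q * v z = 0)"

definition varphi_eq :: "real \<Rightarrow> (complex \<Rightarrow> complex) \<Rightarrow> complex \<Rightarrow> bool" where
  "varphi_eq q u z \<longleftrightarrow>
     (let Q = complex_of_real q in
        1 / Q ^ 5 * u (z / Q ^ 2)
          + 1 / Q * (1 / z ^ 2 * (1 + 1 / Q) - 1 / Q ^ 3 * (1 + 1 / Q)) * u (z / Q)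
          + (1 / z ^ 4 + 1 / Q ^ 4) * u z = 0)"

definition far_even_eq :: "real \<Rightarrow> (complex \<Rightarrow> complex) \<Rightarrow> complex \<Rightarrow> bool" where
  "far_even_eq q y t \<longleftrightarrow>
     (let Q = complex_of_real q in
        Q ^ 7 / t ^ 4 * y (t / Q ^ 2) - (1 - Q ^ 2 * (Q + 1) / t ^ 2) * y (t / Q) + y t = 0)"

definition far_odd_eq :: "real \<Rightarrow> (complex \<Rightarrow> complex) \<Rightarrow> complex \<Rightarrow> bool" where
  "far_odd_eq q y t \<longleftrightarrow>
     (let Q = complex_of_real q in
        Q ^ 7 / t ^ 4 * y (t / Q ^ 2) - (1 / Q - Q ^ 2 * (Q + 1) / t ^ 2) * y (t / Q) + y t = 0)"

definition Psi_eq :: "real \<Rightarrow> (complex \<Rightarrow> complex) \<Rightarrow> complex \<Rightarrow> bool" where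
  "Psi_eq q \<alpha> t \<longleftrightarrow>
     (let Q = complex_of_real q in
        Q * \<alpha> (t / Q ^ 2) + (t ^ 2 / Q ^ 2 - (1 + Q)) * \<alpha> (t / Q) + \<alpha> t = 0)"

definition tPsi_eq :: "real \<Rightarrow> (complex \<Rightarrow> complex) \<Rightarrow> complex \<Rightarrow> bool" where
  "tPsi_eq q \<beta> t \<longleftrightarrow>
     (let Q = complex_of_real q in
        Q * \<beta> (t / Q ^ 2) + (t ^ 2 / Q ^ 3 - (1 + Q)) * \<beta> (t / Q) + \<beta> t = 0)"

section \<open>Uniform asymptotics with a relative error\<close>

text \<open>
  \<open>uniform_asymp_even F A c \<epsilon> D\<close> expresses \<open>F n z = A n z * (c + O(\<epsilon> n))\<close>, uniformly for \<open>z \<in> D n\<close>,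
  as \<open>n\<close> tends to infinity through the even numbers.

  A relative error bound cannot hold at, or asymptotically close to, the zeros of \<open>A n\<close>: for
  instance consecutive orthogonal polynomials of the same parity have no common nonzero zero, so
  they cannot all vanish at a zero of a leading term that does not depend on \<open>n\<close>. Accordingly the
  relative bound is required, for every \<open>\<delta> > 0\<close>, at all \<open>z \<in> D n\<close> lying outside the discs of radius
  \<open>\<delta> * norm \<zeta>\<close> around the zeros \<open>\<zeta>\<close> of \<open>A n\<close>. The radius is proportional to \<open>norm \<zeta>\<close> because the zeros
  are asymptotically distributed like a geometric progression; a zero at the origin excludes
  nothing. In addition, at every \<open>z \<in> D n\<close> without exception, the error \<open>F n z - A n z * c\<close> is
  bounded by \<open>O(\<epsilon> n)\<close> times a value of \<open>A n\<close> on the circle through \<open>z\<close> about the origin, i.e. times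
  the maximum modulus of \<open>A n\<close> on that circle.
\<close>

definition zero_separated :: "real \<Rightarrow> (complex \<Rightarrow> complex) \<Rightarrow> complex \<Rightarrow> bool" where
  "zero_separated \<delta> f z \<longleftrightarrow> (\<forall>\<zeta>. f \<zeta> = 0 \<longrightarrow> \<delta> * norm \<zeta> \<le> dist z \<zeta>)"

definition uniform_asymp_even ::
    "(nat \<Rightarrow> complex \<Rightarrow> complex) \<Rightarrow> (nat \<Rightarrow> complex \<Rightarrow> complex) \<Rightarrow> complex \<Rightarrow> (nat \<Rightarrow> real) \<Rightarrow>
     (nat \<Rightarrow> complex set) \<Rightarrow> bool" where
  "uniform_asymp_even F A c \<epsilon> D \<longleftrightarrow>
     (\<forall>\<delta>>0. \<exists>K N. \<forall>n\<ge>N. even n \<longrightarrow> (\<forall>z\<in>D n.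
        (zero_separated \<delta> (A n) z \<longrightarrow>
           (\<exists>e. norm e \<le> K * \<epsilon> n \<and> F n z = A n z * (c + e))) \<and>
        (\<exists>\<zeta>. norm \<zeta> = norm z \<and> norm (F n z - A n z * c) \<le> K * \<epsilon> n * norm (A n \<zeta>))))"

end

theory Submission
  imports Defs "HOL-Complex_Analysis.Complex_Analysis"
begin

text \<open>
  The Cauchy transform of \<open>P\<^sub>n w d\<^sub>qx\<close> has simple poles on the \<open>q\<close>-lattice whose residues are cancelled by
  those of \<open>h P\<^sub>n w\<close>. Hence a suitable row \<open>(N\<^sub>1, N\<^sub>2)\<close> of functions, with \<open>N\<^sub>2\<close> singular on the lattice and at
  the poles of \<open>w\<close> only, combines with \<open>P\<^sub>n\<close> and its transform to an analytic function. The rows with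
  \<open>N\<^sub>1 = a, b\<close> give functions entire in \<open>z\<close>; those with \<open>N\<^sub>1\<close> proportional to \<open>z\<^sup>n a\<^sub>\<infinity>(t)\<close>, \<open>z\<^sup>n b\<^sub>\<infinity>(t)\<close> give functions
  entire in \<open>1/z\<close>, normalised at infinity. On circles of radius about \<open>q\<^bsup>-n/4\<^esup>\<close> that avoid the lattice, the
  connection formulas show that the two systems differ by a constant diagonal matrix up to \<open>O(q\<^bsup>n/4\<^esup>)\<close>.
  Comparing an entire function of \<open>z\<close> with one of \<open>1/z\<close> on two concentric circles by the maximum principle
  shows that both are nearly constant, and Cramer's rule returns \<open>P\<^sub>n\<close> and \<open>P\<^sub>n\<^sub>-\<^sub>1\<close>.

  The errors are relative because an entire function that agrees with a theta function along the good
  circles at infinity is bounded below by its growth function away from its zeros: rescaled by powers of \<open>q\<close>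
  it converges locally uniformly to a multiple of the theta function, so Hurwitz's theorem applies.
\<close>


section \<open>Infinite q-Pochhammer products\<close>

text \<open>What fixes the exponent: with n = 2m the near functions differ from multiples of theta
  functions by O(1/z), the far ones by O(t) with t = z q^m. Both are O(q^(m/2)) = O(q^(n/4)) exactly
  where |z| is about q^(-n/4). What makes the rows work: one identity between theta functions,
  \<open>h_square\<close>, whose constant \<open>kap\<close> equals H eta2 lam4. It makes the second
  entries of the rows regular at the zeros of \<open>W\<close>, and it turns the connection formulas
  for a and phi_even into the asymptotics of b, \<open>Qa\<close> and \<open>Qb\<close>. The
  obstacle: those formulas are usable only away from the lattice, and only where h can be divided
  by. So estimates are available on circles of radius \<sigma> q^k alone, with \<sigma> chosen so
  that h has no zero on them; whatever lies in between is reached by the maximum principle. Absolute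
  errors are not enough either: b vanishes at the origin and b_inf at infinity. The off-diagonal
  columns must therefore be small there to the same order, which follows from parity and from the
  normalisation at infinity.\<close>

lemma qpoch_inf_uniform:
  fixes p :: real
  assumes "0 \<le> p" "p < 1" "compact K"
  shows "uniform_limit K (\<lambda>N x. \<Prod>j<N. 1 - x * complex_of_real p ^ j) (\<lambda>x. qpoch_inf x p) sequentially"
proof -
  obtain B where B: "\<And>x. x \<in> K \<Longrightarrow> norm x \<le> B" using assms(3) compact_imp_bounded bounded_iff by metis
  have "uniformly_convergent_on K (\<lambda>N x. \<Sum>n<N. norm (- x * complex_of_real p ^ n))"
  proof (rule Weierstrass_m_test')
    show "summable (\<lambda>n. B * p ^ n)" using assms by (intro summable_mult summable_geometric) auto
    show "norm (norm (- x * complex_of_real p ^ n)) \<le> B * p ^ n" if "x \<in> K" for n x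
      using B[OF that] assms by (simp add: norm_mult norm_power mult_right_mono)
  qed
  then have "uniformly_convergent_on K (\<lambda>N x. \<Prod>n<N. 1 + (- x * complex_of_real p ^ n))"
    by (intro uniformly_convergent_on_prod') (auto intro!: continuous_intros assms)
  then have 1: "uniform_limit K (\<lambda>N x. \<Prod>n<N. 1 - x * complex_of_real p ^ n)
       (\<lambda>x. lim (\<lambda>N. \<Prod>n<N. 1 - x * complex_of_real p ^ n)) sequentially"
    by (simp add: uniformly_convergent_uniform_limit_iff)
  have 2: "(\<lambda>N. \<Prod>n<N. 1 - x * complex_of_real p ^ n) \<longlonglongrightarrow> qpoch_inf x p" for x
  proof -
    have "abs_convergent_prod (\<lambda>n. 1 + (- x * complex_of_real p ^ n))"
      unfolding abs_convergent_prod_conv_summable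
      using assms by (simp add: norm_mult norm_power summable_mult summable_geometric)
    then have "convergent_prod (\<lambda>n. 1 - x * complex_of_real p ^ n)"
      by (simp add: abs_convergent_prod_imp_convergent_prod)
    then have "(\<lambda>n. \<Prod>i\<le>n. 1 - x * complex_of_real p ^ i) \<longlonglongrightarrow> qpoch_inf x p"
      unfolding qpoch_inf_def by (rule convergent_prod_LIMSEQ)
    then show ?thesis by (simp only: LIMSEQ_lessThan_iff_atMost)
  qed
  show ?thesis using 1 limI[OF 2] by simp
qed

lemma qpoch_inf_has_prod:
  fixes p :: real
  assumes "0 \<le> p" "p < 1"
  shows "convergent_prod (\<lambda>n. 1 - x * complex_of_real p ^ n)"
    "(\<lambda>N. \<Prod>n<N. 1 - x * complex_of_real p ^ n) \<longlonglongrightarrow> qpoch_inf x p"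
proof -
  have "abs_convergent_prod (\<lambda>n. 1 + (- x * complex_of_real p ^ n))"
    unfolding abs_convergent_prod_conv_summable
    using assms by (simp add: norm_mult norm_power summable_mult summable_geometric)
  then show "convergent_prod (\<lambda>n. 1 - x * complex_of_real p ^ n)"
    by (simp add: abs_convergent_prod_imp_convergent_prod)
  show "(\<lambda>N. \<Prod>n<N. 1 - x * complex_of_real p ^ n) \<longlonglongrightarrow> qpoch_inf x p"
    using tendsto_uniform_limitI[OF qpoch_inf_uniform[OF assms, of "{x}"]] by auto
qed

lemma holomorphic_qpoch_inf:
  fixes p :: real
  assumes "0 \<le> p" "p < 1"
  shows "(\<lambda>x. qpoch_inf x p) holomorphic_on UNIV"
proof (rule holomorphic_uniform_sequence[OF open_UNIV])
  show "(\<lambda>x. \<Prod>j<n. 1 - x * complex_of_real p ^ j) holomorphic_on UNIV" for n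
    by (intro holomorphic_intros)
  show "\<exists>d>0. cball x d \<subseteq> UNIV \<and>
     uniform_limit (cball x d) (\<lambda>n x. \<Prod>j<n. 1 - x * complex_of_real p ^ j) (\<lambda>x. qpoch_inf x p) sequentially" for x
    using qpoch_inf_uniform[OF assms compact_cball] by (intro exI[of _ 1]) auto
qed

lemma qpoch_inf_compose [holomorphic_intros]:
  fixes p :: real
  assumes "0 \<le> p" "p < 1" "f holomorphic_on S"
  shows "(\<lambda>z. qpoch_inf (f z) p) holomorphic_on S"
  using holomorphic_on_compose_gen[OF assms(3) holomorphic_qpoch_inf[OF assms(1,2)], unfolded o_def] by auto

lemma qpoch_inf_rec:
  fixes p :: real
  assumes "0 \<le> p" "p < 1"
  shows "qpoch_inf x p = (1 - x) * qpoch_inf (x * p) p"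
proof -
  have "(\<lambda>N. \<Prod>n<Suc N. 1 - x * complex_of_real p ^ n) \<longlonglongrightarrow> qpoch_inf x p"
    using qpoch_inf_has_prod(2)[OF assms] by (rule LIMSEQ_Suc)
  moreover have "(\<Prod>n<Suc N. 1 - x * complex_of_real p ^ n) = (1 - x) * (\<Prod>n<N. 1 - (x * p) * complex_of_real p ^ n)" for N
    by (subst prod.lessThan_Suc_shift) (simp add: mult_ac)
  ultimately have "(\<lambda>N. (1 - x) * (\<Prod>n<N. 1 - (x * p) * complex_of_real p ^ n)) \<longlonglongrightarrow> qpoch_inf x p" by simp
  moreover have "(\<lambda>N. (1 - x) * (\<Prod>n<N. 1 - (x * p) * complex_of_real p ^ n)) \<longlonglongrightarrow> (1 - x) * qpoch_inf (x * p) p"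
    by (intro tendsto_intros qpoch_inf_has_prod(2)[OF assms])
  ultimately show ?thesis by (rule LIMSEQ_unique)
qed

lemma qpoch_inf_eq_0_iff:
  fixes p :: real
  assumes "0 \<le> p" "p < 1"
  shows "qpoch_inf x p = 0 \<longleftrightarrow> (\<exists>j. x * complex_of_real p ^ j = 1)"
proof
  assume "qpoch_inf x p = 0"
  then show "\<exists>j. x * complex_of_real p ^ j = 1"
    using prodinf_nonzero[OF qpoch_inf_has_prod(1)[OF assms], of x] unfolding qpoch_inf_def by force
next
  assume "\<exists>j. x * complex_of_real p ^ j = 1"
  then obtain j where j: "x * complex_of_real p ^ j = 1" by blast
  have "eventually (\<lambda>N. (\<Prod>n<N. 1 - x * complex_of_real p ^ n) = 0) sequentially"
    using eventually_gt_at_top[of j] by eventually_elim (use j in \<open>auto intro!: prod_zero bexI[of _ j]\<close>)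
  then have "(\<lambda>N. \<Prod>n<N. 1 - x * complex_of_real p ^ n) \<longlonglongrightarrow> 0" by (rule tendsto_eventually)
  then show "qpoch_inf x p = 0" using qpoch_inf_has_prod(2)[OF assms] LIMSEQ_unique by blast
qed

lemma qpoch_inf_0 [simp]: "qpoch_inf 0 p = 1"
  unfolding qpoch_inf_def by simp

text \<open>At negative arguments the partial products increase, so each of them is a lower bound.
  Since N is arbitrary, this later shows that the weight decays faster than any power on the
  lattice.\<close>

lemma qpoch_inf_ge:
  fixes p u :: real
  assumes "0 \<le> p" "p < 1" "0 \<le> u"
  shows "\<exists>v. qpoch_inf (- complex_of_real u) p = complex_of_real v \<and> (\<Prod>n<N. 1 + u * p ^ n) \<le> v"
proof -
  have lim: "(\<lambda>N. complex_of_real (\<Prod>n<N. 1 + u * p ^ n)) \<longlonglongrightarrow> qpoch_inf (- complex_of_real u) p"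
    using qpoch_inf_has_prod(2)[OF assms(1,2), of "- complex_of_real u"] by simp
  define v where "v = Re (qpoch_inf (- complex_of_real u) p)"
  have 1: "(\<lambda>N. (\<Prod>n<N. 1 + u * p ^ n)) \<longlonglongrightarrow> v"
    using tendsto_Re[OF lim] unfolding v_def Re_complex_of_real .
  have "mono (\<lambda>N. \<Prod>n<N. 1 + u * p ^ n)"
    by (rule incseq_SucI)
       (use assms in \<open>auto intro!: prod_nonneg add_nonneg_nonneg mult_nonneg_nonneg simp: mult_le_cancel_left1 algebra_simps\<close>)
  then have 2: "(\<Prod>n<N. 1 + u * p ^ n) \<le> v" using 1 incseq_le by blast
  have "qpoch_inf (- complex_of_real u) p = complex_of_real v"
    using lim 1 tendsto_of_real[OF 1, where 'a=complex] LIMSEQ_unique by blast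
  then show ?thesis using 2 by blast
qed

section \<open>Splitting functions on an annulus\<close>

lemma maximum_modulus_annulus:
  fixes f :: "complex \<Rightarrow> complex"
  assumes "f holomorphic_on - {0}" "0 < r1" "r1 \<le> norm z" "norm z \<le> r2"
    and "\<And>w. norm w = r1 \<Longrightarrow> norm (f w) \<le> B" "\<And>w. norm w = r2 \<Longrightarrow> norm (f w) \<le> B"
  shows "norm (f z) \<le> B"
proof (rule maximum_modulus_frontier[where S = "cball 0 r2 - ball 0 r1" and f = f])
  have cl: "closed (cball 0 r2 - ball 0 r1 :: complex set)" by (intro closed_Diff) auto
  have sub: "cball 0 r2 - ball 0 r1 \<subseteq> - {0::complex}" using assms(2) by auto
  show "f holomorphic_on interior (cball 0 r2 - ball 0 r1)"
    using holomorphic_on_subset[OF assms(1)] sub interior_subset by blast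
  show "continuous_on (closure (cball 0 r2 - ball 0 r1)) f"
    using holomorphic_on_imp_continuous_on[OF holomorphic_on_subset[OF assms(1) sub]] cl by simp
  show "bounded (cball 0 r2 - ball 0 r1 :: complex set)" by (meson bounded_cball bounded_diff)
  show "z \<in> cball 0 r2 - ball 0 r1" using assms by auto
  fix w :: complex assume w: "w \<in> frontier (cball 0 r2 - ball 0 r1)"
  have "ball 0 r2 - cball 0 r1 \<subseteq> interior (cball 0 r2 - ball 0 r1 :: complex set)"
    by (rule interior_maximal) (auto intro!: open_Diff)
  then have "w \<in> cball 0 r2 - ball 0 r1" "w \<notin> ball 0 r2 - cball 0 r1"
    using w cl unfolding frontier_def by auto
  then have "norm w = r1 \<or> norm w = r2" by auto
  then show "norm (f w) \<le> B" using assms(5,6) by blast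
qed

lemma maximum_modulus_cball:
  fixes f :: "complex \<Rightarrow> complex"
  assumes "f holomorphic_on UNIV" "norm z \<le> r" "0 < r"
    and "\<And>w. norm w = r \<Longrightarrow> norm (f w) \<le> B"
  shows "norm (f z) \<le> B"
proof (rule maximum_modulus_frontier[where S = "cball 0 r" and f = f])
  show "f holomorphic_on interior (cball 0 r)" using assms(1) holomorphic_on_subset by blast
  show "continuous_on (closure (cball 0 r)) f"
    using assms(1) holomorphic_on_imp_continuous_on holomorphic_on_subset by blast
qed (use assms in auto)

text \<open>The maximum principle for the difference quotient at 0, whose removable singularity is
  filled by the derivative.\<close>

lemma schwarz_growth:
  fixes f :: "complex \<Rightarrow> complex"
  assumes "f holomorphic_on UNIV" "norm z \<le> r" "0 < r"
    and "\<And>w. norm w = r \<Longrightarrow> norm (f w - f 0) \<le> B"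
  shows "norm (f z - f 0) \<le> B * norm z / r"
proof -
  define g where "g = (\<lambda>z. if z = 0 then deriv f 0 else (f z - f 0) / (z - 0))"
  have "g holomorphic_on UNIV" unfolding g_def
    by (rule pole_lemma_open) (use assms in auto)
  then have "norm (g z) \<le> B / r"
    by (rule maximum_modulus_cball[OF _ assms(2,3)])
       (use assms in \<open>auto simp: g_def norm_divide divide_right_mono\<close>)
  then have 1: "norm (g z) * norm z \<le> B / r * norm z" by (rule mult_right_mono) simp
  have "f z - f 0 = g z * z" unfolding g_def by (cases "z = 0") simp_all
  then have "norm (f z - f 0) = norm (g z) * norm z" by (simp only: norm_mult)
  with 1 show ?thesis by (simp only: times_divide_eq_left)
qed

lemma norm_attains_sup_circle:
  fixes f :: "complex \<Rightarrow> complex"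
  assumes "f holomorphic_on S" "sphere 0 r \<subseteq> S" "0 \<le> r"
  obtains w where "norm w = r" "\<And>z. norm z = r \<Longrightarrow> norm (f z) \<le> norm (f w)"
proof -
  have 1: "continuous_on (sphere 0 r) (\<lambda>z. norm (f z))"
    by (intro continuous_on_norm holomorphic_on_imp_continuous_on holomorphic_on_subset[OF assms(1,2)])
  have "complex_of_real r \<in> sphere 0 r" using assms(3) by simp
  then have 2: "sphere 0 r \<noteq> ({} :: complex set)" by blast
  obtain w where "w \<in> sphere 0 r" "\<forall>z\<in>sphere 0 r. norm (f z) \<le> norm (f w)"
    using continuous_attains_sup[OF compact_sphere 2 1] by (elim bexE)
  then show ?thesis using that[of w] by simp
qed

lemma holomorphic_circle_ge_center:
  fixes f :: "complex \<Rightarrow> complex"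
  assumes "f holomorphic_on UNIV" "0 \<le> r"
  shows "\<exists>w. norm w = r \<and> norm (f 0) \<le> norm (f w)"
proof (cases "r = 0")
  case False
  obtain w where w: "norm w = r" "\<And>z. norm z = r \<Longrightarrow> norm (f z) \<le> norm (f w)"
    using norm_attains_sup_circle[OF assms(1) _ assms(2)] by blast
  have "norm (f 0) \<le> norm (f w)"
    by (rule maximum_modulus_cball[OF assms(1), of 0 r]) (use False assms w in auto)
  then show ?thesis using w by blast
qed auto

text \<open>Only the maximum principle is needed to split a function defined on an annulus: \<open>p - j o(0)\<close> does
  not decrease and \<open>o(1/z) - o(0)\<close> shrinks by the factor \<open>\<kappa>\<close> between the circles, while the two differ
  by at most \<open>E\<close> on both circles.\<close>

lemma annulus_splitting:
  fixes p u :: "complex \<Rightarrow> complex"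
  assumes p: "p holomorphic_on UNIV" and u: "u holomorphic_on UNIV"
    and r: "0 < r1" "0 < \<kappa>" "\<kappa> < 1" "r2 = r1 / \<kappa>"
    and E1: "\<And>z. norm z = r1 \<Longrightarrow> norm (p z - j * u (1 / z)) \<le> E"
    and E2: "\<And>z. norm z = r2 \<Longrightarrow> norm (p z - j * u (1 / z)) \<le> E"
  shows "norm z \<le> r2 \<Longrightarrow> norm (p z - j * u 0) \<le> 2 * E / (1 - \<kappa>)"
    and "norm s \<le> 1 / r1 \<Longrightarrow> norm (j * u s - j * u 0) \<le> 2 * E / (1 - \<kappa>) * (r1 * norm s)"
proof -
  define P where "P = (\<lambda>z. p z - j * u 0)"
  define U where "U = (\<lambda>z. j * u z)"
  have hP: "P holomorphic_on UNIV" unfolding P_def by (intro holomorphic_intros p)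
  have hU: "U holomorphic_on UNIV" unfolding U_def by (intro holomorphic_intros u)
  have hU': "(\<lambda>z. U z - U 0) holomorphic_on UNIV" by (intro holomorphic_intros hU)
  have r2: "r1 < r2" "0 < r2" using r mult_strict_left_mono[of \<kappa> 1 r1] by (auto simp: pos_less_divide_eq)
  obtain w1 where w1: "norm w1 = r1" "\<And>z. norm z = r1 \<Longrightarrow> norm (P z) \<le> norm (P w1)"
    using norm_attains_sup_circle[OF hP] r(1) by (metis less_imp_le top_greatest)
  obtain w2 where w2: "norm w2 = r2" "\<And>z. norm z = r2 \<Longrightarrow> norm (P z) \<le> norm (P w2)"
    using norm_attains_sup_circle[OF hP] r2(2) by (metis less_imp_le top_greatest)
  obtain v1 where v1: "norm v1 = 1 / r1" "\<And>z. norm z = 1 / r1 \<Longrightarrow> norm (U z - U 0) \<le> norm (U v1 - U 0)"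
    using norm_attains_sup_circle[OF hU', of "1 / r1"] r(1) by (metis less_imp_le top_greatest zero_less_divide_1_iff)
  have a12: "norm (P w1) \<le> norm (P w2)"
    by (rule maximum_modulus_cball[OF hP, of _ r2]) (use w1 w2 r2 in auto)
  have e1: "norm (P z - (U (1 / z) - U 0)) \<le> E" if "norm z = r1 \<or> norm z = r2" for z
    using E1[of z] E2[of z] that unfolding P_def U_def by auto
  have schw: "norm (U s - U 0) \<le> norm (U v1 - U 0) * (r1 * norm s)" if "norm s \<le> 1 / r1" for s
    using schwarz_growth[OF hU that, of "norm (U v1 - U 0)"] v1 r(1) by (simp add: mult_ac)
  have b2: "norm (U (1 / w2) - U 0) \<le> norm (U v1 - U 0) * \<kappa>"
  proof -
    have "norm (1 / w2) \<le> 1 / r1" using w2(1) r2 r(1) by (simp add: norm_divide field_simps)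
    moreover have "r1 * norm (1 / w2) = \<kappa>" using w2(1) r by (simp add: norm_divide)
    ultimately show ?thesis using schw by metis
  qed
  have a2: "norm (P w2) \<le> norm (U v1 - U 0) * \<kappa> + E"
    using e1[of w2] w2 b2 norm_triangle_ineq[of "P w2 - (U (1 / w2) - U 0)" "U (1 / w2) - U 0"] by simp
  have nz: "v1 \<noteq> 0" using v1(1) r(1) by auto
  have nv: "norm (1 / v1) = r1" using v1(1) by (simp add: norm_divide)
  have b1: "norm (U v1 - U 0) \<le> norm (P w1) + E"
  proof -
    have "norm (U v1 - U 0) \<le> norm (P (1 / v1)) + norm (P (1 / v1) - (U v1 - U 0))"
      by (metis norm_triangle_sub norm_minus_commute)
    also have "norm (P (1 / v1)) \<le> norm (P w1)" using w1(2) nv by blast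
    also have "norm (P (1 / v1) - (U v1 - U 0)) \<le> E" using e1[of "1 / v1"] nv by simp
    finally show ?thesis by simp
  qed
  \<comment> \<open>The chain closes on itself: the maximum M of |U - U 0| on the circle of radius
    1/r1 satisfies M \<le> |P w1| + E \<le> |P w2| + E \<le> \<kappa> M + 2 E.\<close>
  have "norm (U v1 - U 0) * (1 - \<kappa>) \<le> 2 * E" using a12 a2 b1 by (simp add: algebra_simps)
  then have B1: "norm (U v1 - U 0) \<le> 2 * E / (1 - \<kappa>)" using r by (simp add: pos_le_divide_eq)
  have "norm (P w2) \<le> 2 * E / (1 - \<kappa>) * \<kappa> + E"
    using a2 mult_right_mono[OF B1, of \<kappa>] r by linarith
  also have "E \<ge> 0" using e1[of w1] w1 norm_ge_zero order_trans by blast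
  then have "2 * E / (1 - \<kappa>) * \<kappa> + E \<le> 2 * E / (1 - \<kappa>)"
    using r zero_le_power2[of "1 - \<kappa>"] mult_left_mono[of "\<kappa> * 2" "1 + \<kappa> * \<kappa>" E]
    by (simp add: field_simps power2_eq_square)
  finally have A2: "norm (P w2) \<le> 2 * E / (1 - \<kappa>)" .
  show "norm (p z - j * u 0) \<le> 2 * E / (1 - \<kappa>)" if "norm z \<le> r2"
    using maximum_modulus_cball[OF hP that r2(2), of "norm (P w2)"] w2 A2 unfolding P_def by force
  show "norm (j * u s - j * u 0) \<le> 2 * E / (1 - \<kappa>) * (r1 * norm s)" if "norm s \<le> 1 / r1"
  proof -
    have "norm (U s - U 0) \<le> norm (U v1 - U 0) * (r1 * norm s)" using schw[OF that] .
    also have "\<dots> \<le> 2 * E / (1 - \<kappa>) * (r1 * norm s)" by (intro mult_right_mono B1) (use r in auto)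
    finally show ?thesis unfolding U_def .
  qed
qed

text \<open>The errors are relative to the unknown functions themselves. With N bounding both of
  them, the scalar lemma applies with E = \<epsilon> N. Smallness of \<epsilon> then gives N \<le> L
  + N/2, where L involves only the values at 0, so N \<le> 2 L replaces the unknown by known
  data.\<close>

lemma annulus_splitting_system:
  fixes p1 p2 u1 u2 :: "complex \<Rightarrow> complex"
  assumes p: "p1 holomorphic_on UNIV" "p2 holomorphic_on UNIV"
    and u: "u1 holomorphic_on UNIV" "u2 holomorphic_on UNIV"
    and r: "0 < r1" "0 < \<kappa>" "\<kappa> < 1" "r2 = r1 / \<kappa>" and \<epsilon>: "0 \<le> \<epsilon>"
    and E: "\<And>z. norm z = r1 \<or> norm z = r2 \<Longrightarrow>
              norm (p1 z - j1 * u1 (1 / z)) \<le> \<epsilon> * (norm (u1 (1 / z)) + norm (u2 (1 / z)))"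
           "\<And>z. norm z = r1 \<or> norm z = r2 \<Longrightarrow>
              norm (p2 z - j2 * u2 (1 / z)) \<le> \<epsilon> * (norm (u1 (1 / z)) + norm (u2 (1 / z)))"
    and j: "j1 \<noteq> 0" "j2 \<noteq> 0"
    and small: "2 / (1 - \<kappa>) * \<epsilon> * (1 / norm j1 + 1 / norm j2) \<le> 1 / 2"
  defines "K \<equiv> 4 / (1 - \<kappa>) * \<epsilon> * (norm (u1 0) + norm (u2 0))"
  shows "norm z \<le> r2 \<Longrightarrow> norm (p1 z - j1 * u1 0) \<le> K"
    and "norm z \<le> r2 \<Longrightarrow> norm (p2 z - j2 * u2 0) \<le> K"
    and "norm s \<le> 1 / r1 \<Longrightarrow> norm (j1 * u1 s - j1 * u1 0) \<le> K * (r1 * norm s)"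
    and "norm s \<le> 1 / r1 \<Longrightarrow> norm (j2 * u2 s - j2 * u2 0) \<le> K * (r1 * norm s)"
proof -
  obtain w1 where w1: "norm w1 = 1 / r1" "\<And>z. norm z = 1 / r1 \<Longrightarrow> norm (u1 z) \<le> norm (u1 w1)"
    using norm_attains_sup_circle[OF u(1), of "1 / r1"] r(1) by (metis less_imp_le top_greatest zero_less_divide_1_iff)
  obtain w2 where w2: "norm w2 = 1 / r1" "\<And>z. norm z = 1 / r1 \<Longrightarrow> norm (u2 z) \<le> norm (u2 w2)"
    using norm_attains_sup_circle[OF u(2), of "1 / r1"] r(1) by (metis less_imp_le top_greatest zero_less_divide_1_iff)
  define N where "N = norm (u1 w1) + norm (u2 w2)"
  have b: "norm (u1 s) + norm (u2 s) \<le> N" if "norm s \<le> 1 / r1" for s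
    unfolding N_def
    by (intro add_mono maximum_modulus_cball[OF u(1) that] maximum_modulus_cball[OF u(2) that])
       (use r w1 w2 in auto)
  have r2: "r1 < r2" using r mult_strict_left_mono[of \<kappa> 1 r1] by (auto simp: pos_less_divide_eq)
  have le: "norm (1 / z) \<le> 1 / r1" if "norm z = r1 \<or> norm z = r2" for z :: complex
    using that r2 r(1) frac_le[of 1 1 r1 "norm z"] by (auto simp: norm_divide)
  have E': "norm (p1 z - j1 * u1 (1 / z)) \<le> \<epsilon> * N" "norm (p2 z - j2 * u2 (1 / z)) \<le> \<epsilon> * N"
    if "norm z = r1 \<or> norm z = r2" for z
    using order_trans[OF E(1)[OF that] mult_left_mono[OF b[OF le[OF that]] \<epsilon>]]
      order_trans[OF E(2)[OF that] mult_left_mono[OF b[OF le[OF that]] \<epsilon>]] by auto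
  note S1 = annulus_splitting[OF p(1) u(1) r, of j1 "\<epsilon> * N", OF E'(1) E'(1)]
  note S2 = annulus_splitting[OF p(2) u(2) r, of j2 "\<epsilon> * N", OF E'(2) E'(2)]
  define L where "L = norm (u1 0) + norm (u2 0)"
  have step: "norm (u w) \<le> norm (u 0) + 2 * (\<epsilon> * N) / (1 - \<kappa>) * (1 / norm j)"
    if "norm (j * u w - j * u 0) \<le> 2 * (\<epsilon> * N) / (1 - \<kappa>) * (r1 * norm w)" "norm w = 1 / r1" "j \<noteq> 0"
    for u :: "complex \<Rightarrow> complex" and j w
  proof -
    have "norm j * norm (u w - u 0) \<le> 2 * (\<epsilon> * N) / (1 - \<kappa>)"
      using that r(1) by (simp add: right_diff_distrib[symmetric] norm_mult)
    then have "norm (u w - u 0) * norm j \<le> 2 * (\<epsilon> * N) / (1 - \<kappa>)" by (simp only: mult.commute)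
    then have "norm (u w - u 0) \<le> 2 * (\<epsilon> * N) / (1 - \<kappa>) / norm j"
      by (subst pos_le_divide_eq) (use that(3) in auto)
    then have "norm (u w - u 0) \<le> 2 * (\<epsilon> * N) / (1 - \<kappa>) * (1 / norm j)" by simp
    then show ?thesis using norm_triangle_sub[of "u w" "u 0"] by linarith
  qed
  have "N \<le> L + (2 / (1 - \<kappa>) * \<epsilon> * (1 / norm j1 + 1 / norm j2)) * N"
    using step[OF S1(2)[of w1]] step[OF S2(2)[of w2]] w1(1) w2(1) j unfolding N_def[symmetric] L_def
    by (auto simp: N_def algebra_simps add_divide_distrib)
  also have "\<dots> \<le> L + 1 / 2 * N"
    by (intro add_left_mono mult_right_mono small) (simp add: N_def)
  finally have "N \<le> 2 * L" by simp
  then have K: "2 * (\<epsilon> * N) / (1 - \<kappa>) \<le> K"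
    using mult_left_mono[of N "2 * L" "2 * \<epsilon> / (1 - \<kappa>)"] \<epsilon> r unfolding K_def L_def[symmetric]
    by (simp add: mult_ac)
  show "norm z \<le> r2 \<Longrightarrow> norm (p1 z - j1 * u1 0) \<le> K" using S1(1)[of z] K by auto
  show "norm z \<le> r2 \<Longrightarrow> norm (p2 z - j2 * u2 0) \<le> K" using S2(1)[of z] K by auto
  show "norm (j1 * u1 s - j1 * u1 0) \<le> K * (r1 * norm s)" if "norm s \<le> 1 / r1"
    using S1(2)[OF _ _ that] mult_right_mono[OF K, of "r1 * norm s"] r(1) by (auto intro: order_trans)
  show "norm (j2 * u2 s - j2 * u2 0) \<le> K * (r1 * norm s)" if "norm s \<le> 1 / r1"
    using S2(2)[OF _ _ that] mult_right_mono[OF K, of "r1 * norm s"] r(1) by (auto intro: order_trans)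
qed

section \<open>Holomorphy of infinite sums and removal of discrete singularities\<close>

lemma holomorphic_infsum:
  fixes F :: "'a \<Rightarrow> complex \<Rightarrow> complex"
  assumes "open U" and hol: "\<And>x. x \<in> S \<Longrightarrow> F x holomorphic_on U"
    and M: "\<And>z0. z0 \<in> U \<Longrightarrow> \<exists>d>0. \<exists>M. M summable_on S \<and> (\<forall>x\<in>S. \<forall>z\<in>ball z0 d. norm (F x z) \<le> M x)"
  shows "(\<lambda>z. \<Sum>\<^sub>\<infinity>x\<in>S. F x z) holomorphic_on U"
proof -
  have "\<exists>d>0. (\<lambda>z. \<Sum>\<^sub>\<infinity>x\<in>S. F x z) holomorphic_on ball z0 d" if z0: "z0 \<in> U" for z0
  proof -
    obtain d M where d: "d > 0" and M: "M summable_on S" "\<And>x z. x \<in> S \<Longrightarrow> z \<in> ball z0 d \<Longrightarrow> norm (F x z) \<le> M x"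
      using M[OF z0] by blast
    obtain e where e: "e > 0" "ball z0 e \<subseteq> U" using z0 assms(1) openE by blast
    define r where "r = min d e / 2"
    have r: "r > 0" "cball z0 r \<subseteq> ball z0 d" "cball z0 r \<subseteq> U"
      using d e unfolding r_def by (auto simp: subset_iff)
    have "uniform_limit (cball z0 r) (\<lambda>X z. \<Sum>x\<in>X. F x z) (\<lambda>z. \<Sum>\<^sub>\<infinity>x\<in>S. F x z) (finite_subsets_at_top S)"
      by (rule Weierstrass_m_test_general[OF _ M(1)]) (use M(2) r in auto)
    then obtain "(\<lambda>z. \<Sum>\<^sub>\<infinity>x\<in>S. F x z) holomorphic_on ball z0 r"
    proof (rule holomorphic_uniform_limit[rotated])
      show "\<forall>\<^sub>F X in finite_subsets_at_top S. continuous_on (cball z0 r) (\<lambda>z. \<Sum>x\<in>X. F x z) \<and>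
         (\<lambda>z. \<Sum>x\<in>X. F x z) holomorphic_on ball z0 r"
      proof (rule eventually_finite_subsets_at_top_weakI)
        fix X assume X: "finite X" "X \<subseteq> S"
        have "(\<lambda>z. \<Sum>x\<in>X. F x z) holomorphic_on cball z0 r"
          by (intro holomorphic_on_sum holomorphic_on_subset[OF hol r(3)]) (use X in auto)
        then show "continuous_on (cball z0 r) (\<lambda>z. \<Sum>x\<in>X. F x z) \<and>
         (\<lambda>z. \<Sum>x\<in>X. F x z) holomorphic_on ball z0 r"
          using holomorphic_on_imp_continuous_on holomorphic_on_subset ball_subset_cball by blast
      qed
    qed (auto simp: finite_subsets_at_top_neq_bot)
    then show ?thesis using r(1) by blast
  qed
  then obtain d where d: "\<And>z. z \<in> U \<Longrightarrow> d z > 0 \<and> (\<lambda>z. \<Sum>\<^sub>\<infinity>x\<in>S. F x z) holomorphic_on ball z (d z)" by metis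
  then have "(\<lambda>z. \<Sum>\<^sub>\<infinity>x\<in>S. F x z) holomorphic_on (\<Union>z\<in>U. ball z (d z))"
    by (intro holomorphic_on_UN_open) auto
  moreover have "U \<subseteq> (\<Union>z\<in>U. ball z (d z))" using d by auto
  ultimately show ?thesis by (rule holomorphic_on_subset)
qed

text \<open>Riemann's theorem at each point of B separately. The limits that define G at the points
  of B agree with the local extensions, so these patch together.\<close>

lemma holomorphic_extend_discrete:
  fixes F :: "complex \<Rightarrow> complex"
  assumes S: "open S" and B: "\<And>x. x \<in> S \<Longrightarrow> \<exists>r>0. ball x r \<inter> B \<subseteq> {x}"
    and hol: "F holomorphic_on S - B"
    and lim: "\<And>x. x \<in> B \<Longrightarrow> x \<in> S \<Longrightarrow> ((\<lambda>z. (z - x) * F z) \<longlongrightarrow> 0) (at x)"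
  obtains G where "G holomorphic_on S" "\<And>z. z \<in> S - B \<Longrightarrow> G z = F z"
proof -
  define G where "G = (\<lambda>z. if z \<in> B then Lim (at z) F else F z)"
  have "\<exists>r>0. G holomorphic_on ball x r" if x: "x \<in> S" for x
  proof -
    obtain r0 where r0: "r0 > 0" "ball x r0 \<inter> B \<subseteq> {x}" using B[OF x] by blast
    obtain r1 where r1: "r1 > 0" "ball x r1 \<subseteq> S" using x S openE by blast
    define r where "r = min r0 r1"
    have r: "r > 0" "ball x r \<inter> B \<subseteq> {x}" "ball x r \<subseteq> S" using r0 r1 unfolding r_def by auto
    have h: "F holomorphic_on ball x r - {x}" by (rule holomorphic_on_subset[OF hol]) (use r in auto)
    show ?thesis
    proof (cases "x \<in> B")
      case True
      have "\<exists>g. g holomorphic_on ball x r \<and> (\<forall>z\<in>ball x r - {x}. g z = F z)"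
        by (subst holomorphic_on_extend_lim[OF h]) (use r lim True x in auto)
      then obtain g where g: "g holomorphic_on ball x r" "\<And>z. z \<in> ball x r - {x} \<Longrightarrow> g z = F z" by blast
      have "isCont g x" using g(1) r(1)
        by (metis centre_in_ball continuous_on_interior holomorphic_on_imp_continuous_on interior_open open_ball)
      then have "g \<midarrow>x\<rightarrow> g x" by (simp add: isCont_def)
      moreover have "eventually (\<lambda>z. g z = F z) (at x)"
        unfolding eventually_at using r(1) g(2) by (intro exI[of _ r]) (auto simp: dist_commute)
      ultimately have "F \<midarrow>x\<rightarrow> g x" using tendsto_cong by blast
      then have L: "Lim (at x) F = g x" by (simp add: tendsto_Lim)
      have "G holomorphic_on ball x r"
        by (rule holomorphic_transform[OF g(1)]) (use L g(2) r(2) True in \<open>auto simp: G_def\<close>)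
      then show ?thesis using r(1) by blast
    next
      case False
      have "G holomorphic_on ball x r"
        by (rule holomorphic_transform[OF holomorphic_on_subset[OF hol]]) (use False r in \<open>auto simp: G_def\<close>)
      then show ?thesis using r(1) by blast
    qed
  qed
  then obtain d where d: "\<And>z. z \<in> S \<Longrightarrow> d z > 0 \<and> G holomorphic_on ball z (d z)" by metis
  then have "G holomorphic_on (\<Union>z\<in>S. ball z (d z))" by (intro holomorphic_on_UN_open) auto
  then have "G holomorphic_on S" by (rule holomorphic_on_subset) (use d in auto)
  then show ?thesis using that unfolding G_def by auto
qed

section \<open>The lattice and the functions g and h\<close>

text \<open>The bound has to grow with |x|: the terms of h are then at most a constant times |x| /
  (1 + |x|)^2, which is summable over the lattice both towards 0 and towards infinity.\<close>

lemma closed_distance_bound: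
  fixes T :: "complex set"
  assumes "closed T" "z0 \<notin> T"
  obtains d c where "d > 0" "c > 0" "\<And>z x. z \<in> ball z0 d \<Longrightarrow> x \<in> T \<Longrightarrow> c * (1 + norm x) \<le> norm (z - x)"
proof -
  have "open (- T)" "z0 \<in> - T" using assms by auto
  then obtain e where e: "e > 0" "ball z0 e \<subseteq> - T" using openE by blast
  define d where "d = e / 2"
  define c where "c = 1 / (1 + (1 + norm z0 + d) / d)"
  have d: "d > 0" using e unfolding d_def by simp
  have n: "0 < 1 + (1 + norm z0 + d) / d" using d by (intro add_pos_pos divide_pos_pos add_pos_nonneg) auto
  have c: "c > 0" unfolding c_def using n by simp
  have "c * (1 + norm x) \<le> norm (z - x)" if z: "z \<in> ball z0 d" and x: "x \<in> T" for z x
  proof -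
    have "e \<le> dist z0 x" using e(2) x by (meson ComplD linorder_not_le mem_ball subsetD)
    moreover have "dist z0 x \<le> dist z0 z + dist z x" by (rule dist_triangle)
    moreover have "dist z0 z < d" using z by simp
    ultimately have 1: "d \<le> norm (z - x)" unfolding d_def dist_norm by linarith
    have nz: "norm z \<le> norm z0 + d"
      using z norm_triangle_sub[of z z0] by (simp add: dist_norm norm_minus_commute)
    have "1 + norm x \<le> (1 + norm z0 + d) + norm (z - x)"
      using nz norm_triangle_sub[of x z] by (simp add: norm_minus_commute)
    also have "(1 + norm z0 + d) = (1 + norm z0 + d) / d * d" using d by simp
    also have "\<dots> \<le> (1 + norm z0 + d) / d * norm (z - x)"
      using 1 d by (intro mult_left_mono) (auto intro!: divide_nonneg_pos add_nonneg_nonneg)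
    finally have "1 + norm x \<le> (1 + (1 + norm z0 + d) / d) * norm (z - x)" by (simp add: algebra_simps)
    then show ?thesis using n unfolding c_def by (simp add: pos_divide_le_eq mult.commute)
  qed
  then show ?thesis using that d c by blast
qed

text \<open>Carries identities that are computed off the poles over to the points where both sides
  have removable singularities.\<close>

lemma eq_off_discrete:
  fixes f g :: "complex \<Rightarrow> complex"
  assumes "open S" "continuous_on S f" "continuous_on S g"
    and B: "\<And>x. x \<in> S \<Longrightarrow> \<exists>r>0. ball x r \<inter> B \<subseteq> {x}"
    and eq: "\<And>z. z \<in> S - B \<Longrightarrow> f z = g z" and x: "x \<in> S"
  shows "f x = g x"
proof -
  obtain r0 where r0: "r0 > 0" "ball x r0 \<inter> B \<subseteq> {x}" using B[OF x] by blast
  obtain r1 where r1: "r1 > 0" "ball x r1 \<subseteq> S" using x assms(1) openE by blast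
  have "eventually (\<lambda>z. f z = g z) (at x)"
    unfolding eventually_at using r0 r1
    by (intro exI[of _ "min r0 r1"]) (auto intro!: eq simp: subset_iff dist_commute)
  moreover have "f \<midarrow>x\<rightarrow> f x" "g \<midarrow>x\<rightarrow> g x"
    using assms(1-3) x by (auto simp: continuous_on_eq_continuous_at isCont_def)
  ultimately show ?thesis using tendsto_cong LIM_unique by metis
qed

lemma summable_on_powi_abs:
  fixes p :: real
  assumes "0 \<le> p" "p < 1"
  shows "(\<lambda>k::int. p ^ nat \<bar>k\<bar>) summable_on UNIV"
proof -
  have s: "(\<lambda>n::nat. p ^ n) summable_on UNIV"
    by (rule norm_summable_imp_summable_on) (use assms in auto)
  have 1: "(\<lambda>k::int. p ^ nat \<bar>k\<bar>) summable_on (range int)"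
    by (subst summable_on_reindex) (use s in \<open>auto simp: o_def\<close>)
  have 2: "(\<lambda>k::int. p ^ nat \<bar>k\<bar>) summable_on (range (\<lambda>n. - int (Suc n)))"
    by (subst summable_on_reindex)
       (use summable_on_cmult_right[OF s, of p] in \<open>auto simp: o_def inj_def nat_add_distrib\<close>)
  have "UNIV = range int \<union> range (\<lambda>n. - int (Suc n))"
    by (metis (no_types, lifting) UNIV_eq_I Un_iff int_cases rangeI)
  moreover have "range int \<inter> range (\<lambda>n. - int (Suc n)) = {}" by auto
  ultimately show ?thesis using summable_on_Un_disjoint[OF 1 2] by simp
qed

locale qpar =
  fixes q :: real
  assumes q0: "0 < q" and q1: "q < 1"
begin

abbreviation "Q \<equiv> complex_of_real q"
abbreviation "Lam \<equiv> q_lattice q"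
abbreviation "g \<equiv> g_fun q"
abbreviation "h \<equiv> h_fun q"

lemma q_pows: "0 \<le> q ^ n" "0 < n \<Longrightarrow> q ^ n < 1"
  using q0 q1 by (auto simp: power_less_one_iff)

lemma q_nz [simp]: "q \<noteq> 0" using q0 by simp

lemma Q_nz: "Q \<noteq> 0" by simp

lemma Q_powi: "Q powi k = complex_of_real (q powi k)"
  by (simp add: of_real_power_int)

lemma qpowi_pos [simp]: "0 < q powi k" using q0 by simp

lemma qpowi_eq_1_iff: "q powi k = 1 \<longleftrightarrow> k = 0"
proof -
  have "q powi k \<noteq> 1" if "k > 0" using q_pows(2)[of "nat k"] that by (simp add: power_int_def)
  moreover have "q powi k \<noteq> 1" if "k < 0"
    using q_pows(2)[of "nat (- k)"] that by (simp add: power_int_def power_inverse)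
  ultimately show ?thesis by (cases k "0::int" rule: linorder_cases) auto
qed

lemma Q_powi_double: "Q powi (2 * k) = complex_of_real (q powi k) ^ 2"
  by (subst mult.commute) (simp add: power_int_mult)

lemma Lam_iff: "x \<in> Lam \<longleftrightarrow> (\<exists>k. x = complex_of_real (q powi k) \<or> x = - complex_of_real (q powi k))"
  unfolding q_lattice_def Q_powi by simp

lemma Lam_nz: "x \<in> Lam \<Longrightarrow> x \<noteq> 0"
  using q0 by (auto simp: Lam_iff)

lemma Lam_uminus: "x \<in> Lam \<Longrightarrow> - x \<in> Lam" by (auto simp: Lam_iff)

lemma Lam_mult: "x \<in> Lam \<Longrightarrow> y \<in> Lam \<Longrightarrow> x * y \<in> Lam"
proof -
  assume "x \<in> Lam" "y \<in> Lam"
  then obtain k l where "x = Q powi k \<or> x = - (Q powi k)" "y = Q powi l \<or> y = - (Q powi l)"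
    unfolding q_lattice_def by blast
  moreover have "Q powi k * Q powi l = Q powi (k + l)" for k l by (simp add: power_int_add)
  ultimately show ?thesis unfolding q_lattice_def by auto
qed

lemma Lam_powi: "Q powi k \<in> Lam" by (auto simp: q_lattice_def)
lemma Lam_Q: "Q \<in> Lam" using Lam_powi[of 1] by simp
lemma Lam_inverse: "x \<in> Lam \<Longrightarrow> 1 / x \<in> Lam"
  unfolding q_lattice_def
  by (auto simp: power_int_minus field_simps intro: exI[of _ "- _"])

lemma Lam_mult_iff: "y \<in> Lam \<Longrightarrow> x * y \<in> Lam \<longleftrightarrow> x \<in> Lam"
  using Lam_mult[of x y] Lam_mult[of "x * y" "1 / y"] Lam_inverse[of y] Lam_nz[of y] by auto

lemma g_split: "z \<noteq> 0 \<Longrightarrow> g z = (1 - z ^ 2) * qpoch_inf (z ^ 2 * Q ^ 2) (q ^ 2) * qpoch_inf (Q ^ 2 / z ^ 2) (q ^ 2)"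
  unfolding g_fun_def using qpoch_inf_rec[of "q ^ 2" "z ^ 2"] q_pows[of 2] by simp

lemma g_quasi: "z \<noteq> 0 \<Longrightarrow> g (Q * z) = - g z / z ^ 2"
proof -
  assume z: "z \<noteq> 0"
  have "qpoch_inf (1 / z ^ 2) (q ^ 2) = (1 - 1 / z ^ 2) * qpoch_inf (1 / z ^ 2 * of_real (q ^ 2)) (q ^ 2)"
    using qpoch_inf_rec[of "q ^ 2" "1 / z ^ 2"] q_pows[of 2] by simp
  then have "g (Q * z) = qpoch_inf (z ^ 2 * Q ^ 2) (q ^ 2) * ((1 - 1 / z ^ 2) * qpoch_inf (Q ^ 2 / z ^ 2) (q ^ 2))"
    using z unfolding g_fun_def by (simp add: power_mult_distrib mult_ac)
  then show ?thesis unfolding g_split[OF z] using z by (simp add: field_simps)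
qed

lemma g_inverse: "z \<noteq> 0 \<Longrightarrow> g (1 / z) = - g z / z ^ 2"
proof -
  assume z: "z \<noteq> 0"
  have "qpoch_inf (1 / z ^ 2) (q ^ 2) = (1 - 1 / z ^ 2) * qpoch_inf (1 / z ^ 2 * of_real (q ^ 2)) (q ^ 2)"
    using qpoch_inf_rec[of "q ^ 2" "1 / z ^ 2"] q_pows[of 2] by simp
  then have "g (1 / z) = qpoch_inf (z ^ 2 * Q ^ 2) (q ^ 2) * ((1 - 1 / z ^ 2) * qpoch_inf (Q ^ 2 / z ^ 2) (q ^ 2))"
    using z unfolding g_fun_def by (simp add: power_divide mult_ac)
  then show ?thesis unfolding g_split[OF z] using z by (simp add: field_simps)
qed

lemma g_even: "g (- z) = g z" unfolding g_fun_def by simp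

lemma holomorphic_g: "g holomorphic_on - {0}"
  unfolding g_fun_def using q_pows[of 2] by (intro holomorphic_intros) auto

text \<open>The two factors share out the even powers of q: the first vanishes for z^2 = q^(-2j),
  the second for z^2 = q^(2j+2), with j \<ge> 0 in both cases.\<close>

lemma g_eq_0_iff:
  assumes "z \<noteq> 0"
  shows "g z = 0 \<longleftrightarrow> z \<in> Lam"
proof -
  have sq: "z ^ 2 = w ^ 2 \<longleftrightarrow> z = w \<or> z = - w" for w by (rule power2_eq_iff)
  have 1: "z ^ 2 * complex_of_real (q ^ 2) ^ j = 1 \<longleftrightarrow> z ^ 2 = (Q powi (- int j)) ^ 2" for j
  proof -
    have a: "complex_of_real (q ^ 2) ^ j = (Q ^ j) ^ 2" by (simp add: mult.commute flip: power_mult)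
    have b: "(Q powi (- int j)) ^ 2 = 1 / (Q ^ j) ^ 2" by (simp add: power_int_minus power_one_over inverse_eq_divide)
    have "Q ^ j \<noteq> 0" by simp
    then show ?thesis unfolding a b by (simp add: eq_divide_eq)
  qed
  have 2: "Q ^ 2 / z ^ 2 * complex_of_real (q ^ 2) ^ j = 1 \<longleftrightarrow> z ^ 2 = (Q powi (int (Suc j))) ^ 2" for j
    using assms by (auto simp: field_simps power_int_of_nat simp flip: power_mult simp del: of_nat_Suc)
  have "g z = 0 \<longleftrightarrow> (\<exists>j. z ^ 2 = (Q powi (- int j)) ^ 2) \<or> (\<exists>j. z ^ 2 = (Q powi (int (Suc j))) ^ 2)"
    unfolding g_fun_def mult_eq_0_iff using q_pows[of 2]
    by (simp only: qpoch_inf_eq_0_iff 1 2)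
  also have "\<dots> \<longleftrightarrow> (\<exists>k. z ^ 2 = (Q powi k) ^ 2)"
    by (metis int_cases3 add.inverse_neutral of_nat_0 gr0_implies_Suc)
  also have "\<dots> \<longleftrightarrow> z \<in> Lam" unfolding q_lattice_def sq by simp
  finally show ?thesis .
qed

text \<open>As the lattice is the zero set of g, its topology comes from g: closedness by continuity
  here, discreteness from isolated zeros below.\<close>

lemma closed_Lam0: "closed (insert 0 Lam)"
proof -
  have "open (g -` (- {0}) \<inter> - {0})"
    by (subst Int_commute, rule continuous_open_preimage[OF holomorphic_on_imp_continuous_on[OF holomorphic_g]]) auto
  moreover have "g -` (- {0}) \<inter> - {0} = - insert 0 Lam" using g_eq_0_iff by auto
  ultimately show ?thesis by (simp add: closed_def)
qed

lemma Lam_discrete: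
  assumes "x \<noteq> 0"
  shows "\<exists>r>0. ball x r \<inter> insert 0 Lam \<subseteq> {x}"
proof (cases "x \<in> Lam")
  case True
  have c: "connected (- {0::complex})" by (rule connected_punctured_universe) simp
  have "\<i> \<notin> Lam" by (auto simp: Lam_iff complex_eq_iff simp del: of_real_power_int)
  then have "g \<i> \<noteq> 0" using g_eq_0_iff by auto
  then obtain r where r: "0 < r" "ball x r \<subseteq> - {0}" "\<And>z. z \<in> ball x r - {x} \<Longrightarrow> g z \<noteq> 0"
    using isolated_zeros[OF holomorphic_g _ c, of x \<i>] assms True g_eq_0_iff by auto
  show ?thesis
    by (intro exI[of _ r] conjI r(1)) (use r g_eq_0_iff in blast)
next
  case False
  then have "open (- insert 0 Lam)" "x \<in> - insert 0 Lam" using closed_Lam0 assms by auto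
  then obtain r where "r > 0" "ball x r \<subseteq> - insert 0 Lam" using openE by blast
  then show ?thesis by blast
qed

definition lat :: "int set \<Rightarrow> complex set" where
  "lat K = (\<lambda>k. complex_of_real (q powi k)) ` K \<union> (\<lambda>k. - complex_of_real (q powi k)) ` K"

text \<open>Partial sums of h over a set of exponents. Leaving out k = 0 removes the poles at 1 and
  -1 and isolates the residue there.\<close>

definition h_part :: "int set \<Rightarrow> complex \<Rightarrow> complex" where
  "h_part K z = (\<Sum>\<^sub>\<infinity>k\<in>K. 2 * z * Q powi k / (z ^ 2 - Q powi (2 * k)))"

lemma lat_UNIV: "lat UNIV = Lam" by (auto simp: lat_def Lam_iff)

lemma lat_term_bound:
  fixes x :: real
  assumes "0 < x" "0 < c" "norm z \<le> B"
    and "c * (1 + x) \<le> norm (z - complex_of_real x)" "c * (1 + x) \<le> norm (z + complex_of_real x)"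
  shows "norm (2 * z * complex_of_real x / (z ^ 2 - complex_of_real x ^ 2)) \<le> 2 * B / c ^ 2 * (x / (1 + x) ^ 2)"
proof -
  have "norm (z ^ 2 - complex_of_real x ^ 2) = norm (z - complex_of_real x) * norm (z + complex_of_real x)"
    by (simp add: power2_eq_square algebra_simps flip: norm_mult)
  also have "\<dots> \<ge> (c * (1 + x)) * (c * (1 + x))"
    using assms by (intro mult_mono) auto
  finally have 1: "(c * (1 + x)) ^ 2 \<le> norm (z ^ 2 - complex_of_real x ^ 2)" by (simp add: power2_eq_square)
  have "norm (2 * z * complex_of_real x / (z ^ 2 - complex_of_real x ^ 2)) = 2 * norm z * x / norm (z ^ 2 - complex_of_real x ^ 2)"
    using assms by (simp add: norm_divide norm_mult)
  also have "\<dots> \<le> 2 * B * x / (c * (1 + x)) ^ 2"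
    using assms order_trans[OF norm_ge_zero assms(3)] by (intro frac_le mult_right_mono 1) auto
  finally show ?thesis by (simp add: power_mult_distrib)
qed

text \<open>The weight x / (1 + x)^2 is unchanged by x \<mapsto> 1/x, so negative exponents behave
  like positive ones.\<close>

lemma lat_weight_le: "q powi k / (1 + q powi k) ^ 2 \<le> q ^ nat \<bar>k\<bar>"
proof (cases "k \<ge> 0")
  case True
  then have "q powi k = q ^ nat \<bar>k\<bar>" by (simp add: power_int_def)
  moreover have "1 \<le> (1 + q ^ nat \<bar>k\<bar>) ^ 2" using q0 by (intro one_le_power) simp
  then have "q ^ nat \<bar>k\<bar> / (1 + q ^ nat \<bar>k\<bar>) ^ 2 \<le> q ^ nat \<bar>k\<bar> / 1"
    using q0 zero_less_power[OF q0, of "nat \<bar>k\<bar>"] by (intro divide_left_mono) (auto simp del: zero_less_power)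
  ultimately show ?thesis by simp
next
  case False
  define y where "y = q ^ nat \<bar>k\<bar>"
  have y: "y > 0" using q0 unfolding y_def by simp
  have *: "q powi k = 1 / y" using False unfolding y_def by (simp add: power_int_def field_simps)
  have "1 / y / (1 + 1 / y) ^ 2 = y / (1 + y) ^ 2" using y by (simp add: field_simps power2_eq_square)
  also have "\<dots> \<le> y / 1" using y by (intro divide_left_mono one_le_power) auto
  finally show ?thesis unfolding * using y_def by simp
qed

lemma h_part_facts:
  assumes T: "closed (insert 0 (lat K))"
  shows "h_part K holomorphic_on - insert 0 (lat K)"
    and "z \<notin> insert 0 (lat K) \<Longrightarrow> (\<lambda>k. 2 * z * Q powi k / (z ^ 2 - Q powi (2 * k))) summable_on K"
proof -
  have b: "\<exists>d>0. \<exists>M. M summable_on K \<and> (\<forall>k\<in>K. \<forall>z\<in>ball z0 d. norm (2 * z * Q powi k / (z ^ 2 - Q powi (2 * k))) \<le> M k)"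
    if z0: "z0 \<notin> insert 0 (lat K)" for z0
  proof -
    obtain d c where dc: "d > 0" "c > 0" "\<And>z x. z \<in> ball z0 d \<Longrightarrow> x \<in> insert 0 (lat K) \<Longrightarrow> c * (1 + norm x) \<le> norm (z - x)"
      using closed_distance_bound[OF T z0] by blast
    define M where "M = (\<lambda>k::int. 2 * (norm z0 + d) / c ^ 2 * q ^ nat \<bar>k\<bar>)"
    have "M summable_on K"
      unfolding M_def
      by (intro summable_on_cmult_right summable_on_subset_banach[OF summable_on_powi_abs]) (use q0 q1 in auto)
    moreover have "norm (2 * z * Q powi k / (z ^ 2 - Q powi (2 * k))) \<le> M k" if "k \<in> K" "z \<in> ball z0 d" for k z
    proof -
      have eq: "2 * z * Q powi k / (z ^ 2 - Q powi (2 * k)) =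
          2 * z * complex_of_real (q powi k) / (z ^ 2 - complex_of_real (q powi k) ^ 2)"
        by (simp only: Q_powi_double of_real_power_int)
      have "norm (2 * z * complex_of_real (q powi k) / (z ^ 2 - complex_of_real (q powi k) ^ 2))
           \<le> 2 * (norm z0 + d) / c ^ 2 * (q powi k / (1 + q powi k) ^ 2)"
      proof (rule lat_term_bound[OF qpowi_pos dc(2)])
        show "norm z \<le> norm z0 + d"
          using that(2) norm_triangle_sub[of z z0] by (simp add: dist_norm norm_minus_commute)
        show "c * (1 + q powi k) \<le> norm (z - complex_of_real (q powi k))"
          using dc(3)[OF that(2), of "complex_of_real (q powi k)"] that(1) q0 by (auto simp: lat_def norm_power_int)
        show "c * (1 + q powi k) \<le> norm (z + complex_of_real (q powi k))"
          using dc(3)[OF that(2), of "- complex_of_real (q powi k)"] that(1) q0 by (auto simp: lat_def norm_power_int)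
      qed
      also have "\<dots> \<le> M k" unfolding M_def
        by (intro mult_left_mono lat_weight_le) (use dc in auto)
      finally show ?thesis unfolding eq .
    qed
    ultimately show ?thesis using dc(1) by blast
  qed
  have ne: "z ^ 2 - Q powi (2 * k) \<noteq> 0" if "z \<notin> insert 0 (lat K)" "k \<in> K" for z k
    using that unfolding Q_powi_double lat_def by (auto simp: power2_eq_iff simp del: of_real_power_int)
  show "h_part K holomorphic_on - insert 0 (lat K)"
    unfolding h_part_def
    by (rule holomorphic_infsum)
       (use T ne b in \<open>auto intro!: holomorphic_intros simp: open_Compl\<close>)
  show "(\<lambda>k. 2 * z * Q powi k / (z ^ 2 - Q powi (2 * k))) summable_on K" if z: "z \<notin> insert 0 (lat K)"
  proof -
    obtain d M where "d > 0" "M summable_on K" "\<forall>k\<in>K. \<forall>z\<in>ball z d. norm (2 * z * Q powi k / (z ^ 2 - Q powi (2 * k))) \<le> M k"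
      using b[OF z] by blast
    then show ?thesis
      using abs_summable_summable[OF Infinite_Sum.abs_summable_on_comparison_test'[of M K "\<lambda>k. 2 * z * Q powi k / (z ^ 2 - Q powi (2 * k))"]]
      by auto
  qed
qed

lemma holomorphic_h: "h holomorphic_on - insert 0 Lam"
  using h_part_facts(1)[of UNIV] closed_Lam0 unfolding lat_UNIV h_part_def h_fun_def by simp

lemma h_odd: "h (- z) = - h z"
  unfolding h_fun_def by (simp flip: infsum_uminus)

lemma h_periodic: "h (Q * z) = h z"
proof -
  have "h (Q * z) = (\<Sum>\<^sub>\<infinity>k\<in>UNIV. 2 * (Q * z) * Q powi (k + 1) / ((Q * z) ^ 2 - Q powi (2 * (k + 1))))"
    unfolding h_fun_def
    by (rule infsum_reindex_bij_betw[symmetric]) (auto simp: bij_betw_def inj_def intro!: image_eqI[of _ _ "_ - 1"])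
  also have "\<dots> = h z" unfolding h_fun_def
  proof (rule infsum_cong)
    fix k :: int
    have "2 * (Q * z) * Q powi (k + 1) = Q ^ 2 * (2 * z * Q powi k)"
      by (simp add: power_int_add power2_eq_square)
    moreover have "(Q * z) ^ 2 - Q powi (2 * (k + 1)) = Q ^ 2 * (z ^ 2 - Q powi (2 * k))"
      by (simp add: power_int_add algebra_simps power2_eq_square)
    ultimately show "2 * (Q * z) * Q powi (k + 1) / ((Q * z) ^ 2 - Q powi (2 * (k + 1))) = 2 * z * Q powi k / (z ^ 2 - Q powi (2 * k))"
      by (simp only: mult_divide_mult_cancel_left_if) simp
  qed
  finally show ?thesis .
qed

lemma h_inverse: "z \<noteq> 0 \<Longrightarrow> h (1 / z) = - h z"
proof -
  assume z: "z \<noteq> 0"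
  have "h (1 / z) = (\<Sum>\<^sub>\<infinity>k\<in>UNIV. 2 * (1 / z) * Q powi (- k) / ((1 / z) ^ 2 - Q powi (2 * (- k))))"
    unfolding h_fun_def
    by (rule infsum_reindex_bij_betw[symmetric]) (auto simp: bij_betw_def inj_def intro!: image_eqI[of _ _ "- _"])
  also have "\<dots> = (\<Sum>\<^sub>\<infinity>k\<in>UNIV. - (2 * z * Q powi k / (z ^ 2 - Q powi (2 * k))))"
  proof (rule infsum_cong)
    fix k :: int
    define y where "y = Q powi k"
    have y: "y \<noteq> 0" "Q powi (- k) = 1 / y" "Q powi (2 * (- k)) = 1 / y ^ 2" "Q powi (2 * k) = y ^ 2"
      unfolding y_def by (auto simp: power_int_minus power_int_mult mult.commute[of 2] field_simps)
    show "2 * (1 / z) * Q powi (- k) / ((1 / z) ^ 2 - Q powi (2 * (- k))) = - (2 * z * Q powi k / (z ^ 2 - Q powi (2 * k)))"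
    \<comment> \<open>On the lattice both denominators are 0, and both quotients are 0 by the
      convention for division.\<close>
    proof (cases "z ^ 2 = y ^ 2")
      case True
      then show ?thesis using y z by (simp add: power_divide)
    next
      case False
      have eq: "(1 / z) ^ 2 - 1 / y ^ 2 = - (z ^ 2 - y ^ 2) / (z ^ 2 * y ^ 2)"
        using z y(1) by (simp add: field_simps)
      have "2 * (1 / z) * (1 / y) / (- D / (z ^ 2 * y ^ 2)) = - (2 * z * y / D)" if "D \<noteq> 0" for D
        using that z y(1) by (simp add: divide_simps power2_eq_square)
      then show ?thesis unfolding y(2-4) y_def[symmetric] eq using False by (metis right_minus_eq)
    qed
  qed
  also have "\<dots> = - h z" unfolding h_fun_def by (simp add: infsum_uminus)
  finally show ?thesis .
qed

lemma periodic_powi: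
  assumes "\<And>z. f (Q * z) = f z"
  shows "f (Q powi k * z) = f z"
proof -
  have n: "f (Q ^ n * z) = f z" for n z
    by (induction n) (auto simp: assms mult.assoc)
  show ?thesis
  proof (cases "k \<ge> 0")
    case True then show ?thesis using n[of "nat k" z] by (simp add: power_int_def)
  next
    case False
    then show ?thesis using n[of "nat (- k)" "Q powi k * z"] by (simp add: power_int_def field_simps)
  qed
qed

text \<open>The term k = 0 is 2z / ((z - 1)(z + 1)), with residue 1, and the sum of the other terms
  is continuous at 1.\<close>

lemma h_residue_1: "((\<lambda>z. (z - 1) * h z) \<longlongrightarrow> 1) (at 1)"
proof -
  let ?K = "UNIV - {0::int}"
  obtain r1 where r1: "r1 > 0" "ball 1 r1 \<inter> insert 0 Lam \<subseteq> {1}" using Lam_discrete[of 1] by auto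
  obtain r2 where r2: "r2 > 0" "ball (- 1) r2 \<inter> insert 0 Lam \<subseteq> {- 1}" using Lam_discrete[of "- 1"] by auto
  have lat: "lat ?K = Lam - {1, - 1}"
  proof -
    have "complex_of_real (q powi k) = 1 \<longleftrightarrow> k = 0" "- complex_of_real (q powi k) = - 1 \<longleftrightarrow> k = 0"
      "complex_of_real (q powi k) \<noteq> - 1" "- complex_of_real (q powi k) \<noteq> 1" "- 1 \<noteq> complex_of_real (q powi k)" for k
    proof -
      have "(complex_of_real r = 1 \<longleftrightarrow> r = 1) \<and> (- complex_of_real r = - 1 \<longleftrightarrow> r = 1) \<and>
        complex_of_real r \<noteq> - 1 \<and> - complex_of_real r \<noteq> 1 \<and> - 1 \<noteq> complex_of_real r" if "r > 0" for r
        using that by (auto simp: complex_eq_iff)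
      from this[OF qpowi_pos[of k]] qpowi_eq_1_iff[of k]
      show "complex_of_real (q powi k) = 1 \<longleftrightarrow> k = 0" "- complex_of_real (q powi k) = - 1 \<longleftrightarrow> k = 0"
        "complex_of_real (q powi k) \<noteq> - 1" "- complex_of_real (q powi k) \<noteq> 1" "- 1 \<noteq> complex_of_real (q powi k)" by blast+
    qed
    then show ?thesis unfolding lat_def by (auto simp: Lam_iff simp del: of_real_power_int)
  qed
  have "insert 0 (lat ?K) = insert 0 Lam \<inter> - (ball 1 r1 \<union> ball (- 1) r2)"
    unfolding lat using r1 r2 by (auto simp: dist_norm) 
  then have cl: "closed (insert 0 (lat ?K))" using closed_Lam0 by (auto intro!: closed_Int simp: closed_Compl)
  have nl: "1 \<notin> insert 0 (lat ?K)" unfolding lat by auto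
  have "isCont (h_part ?K) 1"
    using holomorphic_on_imp_continuous_on[OF h_part_facts(1)[OF cl]] nl cl
    by (metis ComplI continuous_on_eq_continuous_at open_Compl)
  then have c: "(h_part ?K \<longlongrightarrow> h_part ?K 1) (at 1)" by (simp add: isCont_def)
  have "((\<lambda>z. 2 * z / (z + 1) + (z - 1) * h_part ?K z) \<longlongrightarrow> 2 * 1 / (1 + 1) + (1 - 1) * h_part ?K 1) (at 1)"
    by (intro tendsto_intros c) auto
  moreover have "eventually (\<lambda>z. 2 * z / (z + 1) + (z - 1) * h_part ?K z = (z - 1) * h z) (at 1)"
  proof -
    have "open (- insert 0 (lat ?K))" using cl by (rule open_Compl)
    then have "eventually (\<lambda>z. z \<in> - insert 0 (lat ?K)) (at 1)"
      using nl by (intro eventually_at_in_open') auto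
    moreover have "eventually (\<lambda>z. z \<noteq> 1) (at (1::complex))" by (simp add: eventually_at_filter)
    moreover have "eventually (\<lambda>z. z \<noteq> - 1) (at (1::complex))"
      by (rule eventually_at_in_open'[of "- {- 1}", simplified]) auto
    ultimately show ?thesis
    proof eventually_elim
      case (elim z)
      have "h z = h_part (insert 0 ?K) z" unfolding h_fun_def h_part_def by (simp add: insert_absorb)
      also have "\<dots> = 2 * z / (z ^ 2 - 1) + h_part ?K z" unfolding h_part_def
        by (subst infsum_insert) (use h_part_facts(2)[OF cl, of z] elim in auto)
      finally have "h z = 2 * z / ((z - 1) * (z + 1)) + h_part ?K z" by (simp add: power2_eq_square algebra_simps)
      moreover have "z - 1 \<noteq> 0" "z + 1 \<noteq> 0" using elim by (auto simp: eq_neg_iff_add_eq_0)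
      then have "(z - 1) * (2 * z / ((z - 1) * (z + 1))) = 2 * z / (z + 1)" by simp
      ultimately show ?case by (simp only: distrib_left)
    qed
  qed
  ultimately show ?thesis using tendsto_cong by fastforce
qed

text \<open>Scaling 1 to q^k multiplies the residue by q^k, and oddness removes the sign. The
  resulting |x| is the mass of x in the Jackson integral, which is why h can match the poles of a
  Cauchy transform of the weight.\<close>

lemma h_residue:
  assumes "x \<in> Lam"
  shows "((\<lambda>z. (z - x) * h z) \<longlongrightarrow> norm x) (at x)"
proof -
  have x0: "x \<noteq> 0" using assms Lam_nz by auto
  have fl: "filterlim (\<lambda>z. z / x) (at 1) (at x)"
    using x0 by (intro filterlim_atI tendsto_eq_intros) (auto simp: eventually_at_filter)
  obtain k s where s: "s = 1 \<or> s = - 1" "x = s * Q powi k"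
  proof -
    obtain k where "x = 1 * Q powi k \<or> x = (- 1) * Q powi k" using assms unfolding q_lattice_def by auto
    then show ?thesis using that by blast
  qed
  have hz: "h z = s * h (z / x)" for z
  proof -
    have "h z = h (Q powi k * (s * (z / x)))" using s x0 by (auto simp: field_simps)
    also have "\<dots> = h (s * (z / x))" using periodic_powi[of h] h_periodic by blast
    finally show ?thesis using s(1) h_odd[of "z / x"] by auto
  qed
  have "((\<lambda>z. x * s * ((z / x - 1) * h (z / x))) \<longlongrightarrow> x * s * 1) (at x)"
    by (intro tendsto_mult tendsto_const filterlim_compose[OF h_residue_1 fl])
  moreover have "x * s * ((z / x - 1) * h (z / x)) = (z - x) * h z" for z
    using x0 hz[of z] by (simp add: field_simps)
  moreover have "x * s * 1 = complex_of_real (norm x)"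
    using s q0 by (auto simp: norm_mult norm_power_int)
  ultimately show ?thesis by simp
qed

end

section \<open>Theta functions and the quadratic identity for h\<close>

lemma entire_diff_bigo:
  fixes F :: "complex \<Rightarrow> complex"
  assumes "F holomorphic_on UNIV"
  shows "(\<lambda>s. F s - F 0) \<in> O[at 0](\<lambda>s. s)"
proof -
  have "(F has_field_derivative deriv F 0) (at 0)"
    using assms holomorphic_derivI by blast
  then have "((\<lambda>s. (F s - F 0) / s) \<longlongrightarrow> deriv F 0) (at 0)"
    by (simp add: has_field_derivative_iff)
  then show ?thesis by (rule bigoI_tendsto) (simp add: eventually_at_filter)
qed

lemma holomorphic_scale:
  fixes f :: "complex \<Rightarrow> complex"
  assumes "f holomorphic_on - {0}" "c \<noteq> 0"
  shows "(\<lambda>z. f (c * z)) holomorphic_on - {0}"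
proof -
  have "(f \<circ> (\<lambda>z. c * z)) holomorphic_on - {0}"
    by (rule holomorphic_on_compose_gen[OF _ assms(1)]) (use assms(2) in \<open>auto intro!: holomorphic_intros\<close>)
  then show ?thesis by (simp add: o_def)
qed

lemma filterlim_inverse_at_0: "filterlim (\<lambda>z::complex. 1 / z) (at 0) at_infinity"
proof -
  have "filterlim inverse (at (0::complex)) at_infinity"
    by (rule filterlim_atI[OF tendsto_inverse_0])
       (use eventually_not_equal_at_infinity[of "0::complex"] in eventually_elim, simp)
  moreover have "inverse = (\<lambda>z::complex. 1 / z)" by (auto simp: inverse_eq_divide)
  ultimately show ?thesis by simp
qed

context qpar
begin

lemma Lam_Q_mult: "Q * z \<in> Lam \<longleftrightarrow> z \<in> Lam"
  using Lam_mult_iff[OF Lam_Q, of z] by (simp add: mult.commute)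

abbreviation "W z \<equiv> qpoch_inf (- (z ^ 4)) (q ^ 4)"

text \<open>The factor of the theta function 1/\<omega> that lives at the origin. It tends to 1 at
  infinity, so \<open>Th\<close> and \<open>W\<close> agree there to leading order.\<close>

definition ff :: "complex \<Rightarrow> complex" where
  "ff z = qpoch_inf (- (Q ^ 4 / z ^ 4)) (q ^ 4)"

definition Th :: "complex \<Rightarrow> complex" where "Th z = W z * ff z"

lemma w_fun_W: "w_fun q z = 1 / W z" by (simp add: w_fun_def)

lemma omega_Th: "omega_fun q z = 1 / Th z" by (simp add: omega_fun_def Th_def ff_def)

lemma holomorphic_W: "(\<lambda>z. W z) holomorphic_on S"
  using q_pows[of 4] by (intro holomorphic_intros) auto

lemma holomorphic_ff: "ff holomorphic_on - {0}"
  unfolding ff_def using q_pows[of 4] by (intro holomorphic_intros) auto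

lemma holomorphic_Th: "Th holomorphic_on - {0}"
  unfolding Th_def by (intro holomorphic_intros holomorphic_W holomorphic_ff)

lemma W_rec: "W z = (1 + z ^ 4) * W (Q * z)"
  using qpoch_inf_rec[of "q ^ 4" "- (z ^ 4)"] q_pows[of 4] by (simp add: power_mult_distrib mult.commute)

lemma ff_rec: "z \<noteq> 0 \<Longrightarrow> ff (Q * z) = (1 + 1 / z ^ 4) * ff z"
  using qpoch_inf_rec[of "q ^ 4" "- (1 / z ^ 4)"] q_pows[of 4] by (simp add: ff_def power_mult_distrib)

lemma Th_quasi: "z \<noteq> 0 \<Longrightarrow> Th (Q * z) = Th z / z ^ 4"
  unfolding Th_def W_rec[of z] ff_rec by (simp add: field_simps)

lemma Th_inverse: "z \<noteq> 0 \<Longrightarrow> Th (1 / z) = Th z / z ^ 4"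
proof -
  assume z: "z \<noteq> 0"
  have 1: "W (1 / z) = (1 + 1 / z ^ 4) * ff z"
    using qpoch_inf_rec[of "q ^ 4" "- (1 / z ^ 4)"] q_pows[of 4] by (simp add: ff_def power_divide)
  have 2: "ff (1 / z) = W (Q * z)" by (simp add: ff_def power_divide power_mult_distrib)
  show ?thesis unfolding Th_def W_rec[of z] 1 2 using z by (simp add: field_simps)
qed

lemma Th_even: "Th (- z) = Th z" by (simp add: Th_def ff_def)

lemma W_ge:
  assumes "z ^ 4 = complex_of_real u" "0 \<le> u"
  shows "\<exists>v. W z = complex_of_real v \<and> (\<Prod>n<N. 1 + u * (q ^ 4) ^ n) \<le> v"
  using qpoch_inf_ge[of "q ^ 4" u N] q_pows[of 4] assms by simp

lemma W_pos:
  assumes "z ^ 4 = complex_of_real u" "0 \<le> u"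
  shows "\<exists>v. W z = complex_of_real v \<and> 1 \<le> v"
  using W_ge[OF assms, of 0] by simp

lemma ff_pos:
  assumes "z ^ 4 = complex_of_real u" "0 \<le> u"
  shows "\<exists>v. ff z = complex_of_real v \<and> 1 \<le> v"
  using qpoch_inf_ge[of "q ^ 4" "q ^ 4 / u" 0] q_pows[of 4] assms by (simp add: ff_def)

lemma Lam_power4: "x \<in> Lam \<Longrightarrow> x ^ 4 = complex_of_real (norm x ^ 4)"
  by (auto simp: q_lattice_def norm_power_int q0 less_imp_le)

lemma W_Lam_nz: "x \<in> Lam \<Longrightarrow> W x \<noteq> 0"
  using W_pos[OF Lam_power4] by force

text \<open>The zeros of \<open>W\<close> are off the real axis but have the same moduli as lattice
  points. Circles between the lattice circles therefore avoid them as well.\<close>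

lemma W_eq_0_norm: "W z = 0 \<Longrightarrow> \<exists>j::int. norm z = q powi j"
proof -
  assume "W z = 0"
  then obtain j where "- (z ^ 4) * complex_of_real (q ^ 4) ^ j = 1"
    using qpoch_inf_eq_0_iff[of "q ^ 4" "- (z ^ 4)"] q_pows[of 4] by auto
  then have "norm (- (z ^ 4) * complex_of_real (q ^ 4) ^ j) = 1" by simp
  then have "(norm z * q ^ j) ^ 4 = 1"
    using q0 by (simp add: norm_mult norm_power power_mult_distrib mult.commute flip: power_mult)
  then have "norm z * q ^ j = 1"
    using q0 by (metis abs_of_nonneg norm_ge_zero power_eq_1_iff real_norm_def zero_le_mult_iff zero_le_power less_imp_le zero_neq_numeral)
  then have "norm z = q powi (- int j)" by (simp add: power_int_minus field_simps)
  then show ?thesis by blast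
qed

lemma ff_bigo: "(\<lambda>z. ff z - 1) \<in> O[at_infinity](\<lambda>z. 1 / z)"
proof -
  note filterlim_inverse_at_0
  moreover have "(\<lambda>s. qpoch_inf (- ((Q * s) ^ 4)) (q ^ 4) - qpoch_inf (- ((Q * 0) ^ 4)) (q ^ 4)) \<in> O[at 0](\<lambda>s. s)"
    by (rule entire_diff_bigo) (use q_pows[of 4] in \<open>intro holomorphic_intros; simp\<close>)
  ultimately show ?thesis
    using landau_o.big.compose by (fastforce simp: ff_def power_divide power_mult_distrib)
qed

lemma gh_extends:
  "\<exists>G. G holomorphic_on - {0} \<and> (\<forall>z\<in>- {0} - Lam. G z = g z * h z)"
proof (rule holomorphic_extend_discrete[of "- {0}" Lam "\<lambda>z. g z * h z"])
  show "\<exists>r>0. ball x r \<inter> Lam \<subseteq> {x}" if "x \<in> - {0}" for x using Lam_discrete[of x] that by auto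
  show "(\<lambda>z. g z * h z) holomorphic_on - {0} - Lam"
    by (intro holomorphic_intros holomorphic_on_subset[OF holomorphic_g] holomorphic_on_subset[OF holomorphic_h]) auto
  fix x assume x: "x \<in> Lam" "x \<in> - {0}"
  have "isCont g x" using holomorphic_g x by (metis continuous_on_eq_continuous_at holomorphic_on_imp_continuous_on open_Compl closed_singleton)
  then have "((\<lambda>z. g z * ((z - x) * h z)) \<longlongrightarrow> g x * norm x) (at x)"
    by (intro tendsto_mult h_residue x) (simp add: isCont_def)
  then show "((\<lambda>z. (z - x) * (g z * h z)) \<longlongrightarrow> 0) (at x)"
    using g_eq_0_iff[of x] x by (simp add: mult_ac)
qed (auto simp: open_Compl)

text \<open>The product g h with its removable singularities filled: the second function with the
  same quasi-period as g, and the one to which b and b_inf are compared.\<close>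

definition GH :: "complex \<Rightarrow> complex" where
  "GH = (SOME G. G holomorphic_on - {0} \<and> (\<forall>z\<in>- {0} - Lam. G z = g z * h z))"

lemma holomorphic_GH: "GH holomorphic_on - {0}"
  and GH_eq: "z \<noteq> 0 \<Longrightarrow> z \<notin> Lam \<Longrightarrow> GH z = g z * h z"
  using someI_ex[OF gh_extends] unfolding GH_def by auto

lemma eventually_not_Lam: "x \<noteq> 0 \<Longrightarrow> eventually (\<lambda>z. z \<notin> insert 0 Lam) (at x)"
  using Lam_discrete[of x] unfolding eventually_at by (force simp: dist_commute)

lemma isCont_holo: "f holomorphic_on - {0} \<Longrightarrow> x \<noteq> 0 \<Longrightarrow> (f \<longlongrightarrow> f x) (at x)"
  for f :: "complex \<Rightarrow> complex"
  by (metis ComplI closed_singleton continuous_on_eq_continuous_at holomorphic_on_imp_continuous_on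
      isCont_def open_Compl singletonD)

lemma gh_tendsto: "x \<noteq> 0 \<Longrightarrow> ((\<lambda>z. g z * h z) \<longlongrightarrow> GH x) (at x)"
proof -
  assume x: "x \<noteq> 0"
  have "eventually (\<lambda>z. GH z = g z * h z) (at x)"
    using eventually_not_Lam[OF x] by eventually_elim (auto simp: GH_eq)
  with isCont_holo[OF holomorphic_GH x] show ?thesis by (rule Lim_transform_eventually)
qed

lemma GH_quasi: "z \<noteq> 0 \<Longrightarrow> GH (Q * z) = - GH z / z ^ 2"
proof -
  assume z: "z \<noteq> 0"
  have hol: "(\<lambda>z. GH (Q * z)) holomorphic_on - {0}"
    by (rule holomorphic_scale[OF holomorphic_GH Q_nz])
  show ?thesis
  proof (rule eq_off_discrete[of "- {0}" "\<lambda>z. GH (Q * z)" "\<lambda>z. - GH z / z ^ 2" Lam])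
    show "continuous_on (- {0}) (\<lambda>z. GH (Q * z))" by (rule holomorphic_on_imp_continuous_on[OF hol])
    show "continuous_on (- {0}) (\<lambda>z. - GH z / z ^ 2)"
      by (intro continuous_intros holomorphic_on_imp_continuous_on holomorphic_GH) auto
    show "\<exists>r>0. ball x r \<inter> Lam \<subseteq> {x}" if "x \<in> - {0}" for x using Lam_discrete[of x] that by auto
    show "GH (Q * z) = - GH z / z ^ 2" if "z \<in> - {0} - Lam" for z
      using that Lam_Q_mult[of z] by (simp add: GH_eq g_quasi h_periodic)
  qed (use z in auto)
qed

text \<open>A simple zero of g meets a simple pole of residue 1. With g = -(z - 1)(z + 1) A the
  value is -2 A(1), and no factor of A vanishes at 1.\<close>

lemma GH_1_nz: "GH 1 \<noteq> 0"
proof -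
  define A where "A = (\<lambda>z. qpoch_inf (z ^ 2 * Q ^ 2) (q ^ 2) * qpoch_inf (Q ^ 2 / z ^ 2) (q ^ 2))"
  have A: "A holomorphic_on - {0}" unfolding A_def using q_pows[of 2] by (intro holomorphic_intros) auto
  have "(\<lambda>z. - (z + 1) * A z * ((z - 1) * h z)) \<midarrow>1\<rightarrow> - (1 + 1) * A 1 * 1"
    by (intro tendsto_intros isCont_holo[OF A] h_residue_1) auto
  moreover have "eventually (\<lambda>z. - (z + 1) * A z * ((z - 1) * h z) = g z * h z) (at 1)"
    using eventually_not_Lam[OF one_neq_zero]
    by eventually_elim (simp add: g_split A_def algebra_simps power2_eq_square)
  ultimately have "(\<lambda>z. g z * h z) \<midarrow>1\<rightarrow> - (1 + 1) * A 1 * 1" by (rule Lim_transform_eventually)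
  then have "(\<lambda>z. g z * h z) \<midarrow>1\<rightarrow> - 2 * A 1" by simp
  then have "GH 1 = - 2 * A 1" using gh_tendsto[of 1] LIM_unique one_neq_zero by blast
  moreover have "Q ^ 2 * complex_of_real (q ^ 2) ^ j \<noteq> 1" for j
  proof -
    have "q ^ 2 * (q ^ 2) ^ j \<noteq> 1"
      using q_pows(2)[of "2 + 2 * j"] unfolding power_add power_mult by simp
    then show ?thesis by (metis of_real_eq_1_iff of_real_mult of_real_power)
  qed
  then have "A 1 \<noteq> 0" unfolding A_def using q_pows[of 2] by (simp add: qpoch_inf_eq_0_iff)
  ultimately show ?thesis by simp
qed

abbreviation "H \<equiv> H_const q"

lemma Th_1_nz: "Th 1 \<noteq> 0"
  using W_pos[of 1 1] ff_pos[of 1 1] unfolding Th_def by auto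

text \<open>H is defined at the point q, whereas the double pole is cancelled at 1.
  Quasi-periodicity moves it: \<open>GH\<close> changes sign from 1 to q, which the square forgets,
  and \<open>Th\<close> keeps its value.\<close>

lemma H_Th: "H * Th 1 = GH 1 ^ 2"
proof -
  have "Lim (at Q) (\<lambda>z. g z * h z) = GH Q" using gh_tendsto[OF Q_nz] by (simp add: tendsto_Lim)
  moreover have "GH Q = - GH 1" using GH_quasi[of 1] by simp
  moreover have "Th Q = Th 1" using Th_quasi[of 1] by simp
  ultimately show ?thesis unfolding H_const_def omega_Th using Th_1_nz by simp
qed

lemma H_nz: "H \<noteq> 0" using H_Th GH_1_nz Th_1_nz by auto

lemma q_scale:
  assumes "0 < r"
  shows "\<exists>k. q < r * q powi k \<and> r * q powi k \<le> 1"
proof -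
  define L where "L = log q r"
  have r: "r = q powr L" unfolding L_def using q0 q1 assms by simp
  define k where "k = - \<lfloor>L\<rfloor>"
  have "q powi k = q powr (of_int k)" using q0 by (simp add: powr_real_of_int')
  then have e: "r * q powi k = q powr (L - of_int \<lfloor>L\<rfloor>)"
    using r by (simp add: k_def flip: powr_add)
  have "0 \<le> L - of_int \<lfloor>L\<rfloor>" "L - of_int \<lfloor>L\<rfloor> < 1" by linarith+
  then have "q powr 1 < r * q powi k" "r * q powi k \<le> q powr 0"
    unfolding e using q0 q1 powr_less_mono'[of q "L - of_int \<lfloor>L\<rfloor>" 1] powr_mono'[of 0 "L - of_int \<lfloor>L\<rfloor>" q]
    by auto
  then show ?thesis using q0 by (intro exI[of _ k]) auto
qed

text \<open>By periodicity the modulus attains its supremum on the compact annulus between q and 1,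
  hence at an interior point of the punctured plane, and the maximum modulus principle
  applies.\<close>

lemma q_periodic_constant:
  assumes hol: "f holomorphic_on - {0}" and per: "\<And>z. z \<noteq> 0 \<Longrightarrow> f (Q * z) = f z"
    and "z \<noteq> 0" "w \<noteq> 0"
  shows "f z = f w"
proof -
  let ?A = "cball 0 1 - ball 0 q :: complex set"
  have sub: "?A \<subseteq> - {0}" using q0 by auto
  have per': "f (Q powi k * z) = f z" if "z \<noteq> 0" for k z
    using periodic_powi[of "\<lambda>z. if z = 0 then 0 else f z" k z] per that by auto
  have comp: "compact ?A" by (intro compact_diff) auto
  have "complex_of_real 1 \<in> ?A" using q1 by simp
  then have ne: "?A \<noteq> {}" by blast
  have cont: "continuous_on ?A (\<lambda>z. norm (f z))"
    by (intro continuous_on_norm holomorphic_on_imp_continuous_on holomorphic_on_subset[OF hol sub])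
  then obtain z1 where z1: "z1 \<in> ?A" "\<forall>z\<in>?A. norm (f z) \<le> norm (f z1)"
    using continuous_attains_sup[OF comp ne cont] by (elim bexE)
  have "norm (f z) \<le> norm (f z1)" if nz: "z \<noteq> 0" for z
  proof -
    obtain k where "q < norm z * q powi k" "norm z * q powi k \<le> 1" using q_scale[of "norm z"] nz by auto
    then have "Q powi k * z \<in> ?A" using q0 by (auto simp: norm_mult norm_power_int mult.commute)
    then show ?thesis using z1(2) per'[OF nz, of k] by metis
  qed
  moreover have "connected (- {0::complex})" by (rule connected_punctured_universe) simp
  moreover have "z1 \<in> - {0}" using z1(1) sub by blast
  ultimately have "f constant_on - {0}"
    using maximum_modulus_principle[OF hol, of "- {0}" z1] by (auto simp: open_Compl)
  then show ?thesis using assms(3,4) unfolding constant_on_def by auto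
qed

definition kap :: complex where "kap = H * Th \<i> / g \<i> ^ 2 - h \<i> ^ 2"

text \<open>\<open>H Th / g\<^sup>2 - h\<^sup>2\<close> is \<open>q\<close>-periodic; its double poles cancel by the choice of \<open>H\<close>, and no simple poles are
  left because it is invariant under \<open>z \<mapsto> 1/z\<close>, which changes the sign of a residue at 1.\<close>

lemma h_square:
  assumes "z \<noteq> 0" "z \<notin> Lam"
  shows "H * Th z / g z ^ 2 = h z ^ 2 + kap"
proof -
  define F where "F = (\<lambda>z. H * Th z / g z ^ 2 - h z ^ 2)"
  have hol: "F holomorphic_on - insert 0 Lam"
    unfolding F_def
    by (intro holomorphic_intros holomorphic_on_subset[OF holomorphic_g] holomorphic_on_subset[OF holomorphic_h]
         holomorphic_on_subset[OF holomorphic_Th]) (auto simp: g_eq_0_iff)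
  have per: "F (Q * z) = F z" if "z \<noteq> 0" for z
  proof -
    have "(- g z / z ^ 2) ^ 2 = g z ^ 2 / z ^ 4" by (simp add: power_divide flip: power_mult)
    then show ?thesis unfolding F_def using that by (simp add: g_quasi h_periodic Th_quasi)
  qed
  have inv: "F (1 / z) = F z" if "z \<noteq> 0" for z
  proof -
    have "(- g z / z ^ 2) ^ 2 = g z ^ 2 / z ^ 4" by (simp add: power_divide flip: power_mult)
    then show ?thesis unfolding F_def using that by (simp add: g_inverse h_inverse Th_inverse)
  qed
  have ev: "F (- z) = F z" for z unfolding F_def by (simp add: g_even h_odd Th_even)
  \<comment> \<open>The factor (z - 1)^2 / g^2 is written as ((z - 1) h / (g h))^2, so that only the
    residue of h and the value of \<open>GH\<close> at 1 enter. The limit is 0 because H Th 1 = (GH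
    1)^2.\<close>
  have "((\<lambda>z. H * Th z * ((z - 1) * h z / (g z * h z)) ^ 2 - ((z - 1) * h z) ^ 2)
          \<longlongrightarrow> H * Th 1 * (1 / GH 1) ^ 2 - 1 ^ 2) (at 1)"
    by (intro tendsto_intros isCont_holo[OF holomorphic_Th] h_residue_1 gh_tendsto GH_1_nz) auto
  also have "H * Th 1 * (1 / GH 1) ^ 2 - 1 ^ 2 = 0" using H_Th GH_1_nz by (simp add: power_divide)
  finally have "((\<lambda>z. H * Th z * ((z - 1) * h z / (g z * h z)) ^ 2 - ((z - 1) * h z) ^ 2) \<longlongrightarrow> 0) (at 1)" .
  moreover have "eventually (\<lambda>z. H * Th z * ((z - 1) * h z / (g z * h z)) ^ 2 - ((z - 1) * h z) ^ 2
       = (z - 1) * ((z - 1) * F z)) (at 1)"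
  proof -
    have "eventually (\<lambda>z. g z * h z \<noteq> 0) (at 1)"
      by (rule tendsto_imp_eventually_ne[OF gh_tendsto GH_1_nz]) simp
    then show ?thesis by eventually_elim (simp add: F_def power2_eq_square field_simps)
  qed
  ultimately have d2: "((\<lambda>z. (z - 1) * ((z - 1) * F z)) \<longlongrightarrow> 0) (at 1)" by (rule Lim_transform_eventually)
  obtain r where r: "r > 0" "ball 1 r \<inter> insert 0 Lam \<subseteq> {1}" using Lam_discrete[of 1] by auto
  have "\<exists>k. k holomorphic_on ball 1 r \<and> (\<forall>z\<in>ball 1 r - {1}. k z = (z - 1) * F z)"
  proof (subst holomorphic_on_extend_lim)
    show "(\<lambda>z. (z - 1) * F z) holomorphic_on ball 1 r - {1}"
      by (intro holomorphic_intros holomorphic_on_subset[OF hol]) (use r in auto)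
  qed (use r d2 in auto)
  then obtain k where k: "k holomorphic_on ball 1 r" "\<And>z. z \<in> ball 1 r - {1} \<Longrightarrow> k z = (z - 1) * F z" by blast
  have "isCont k 1"
    using k(1) r(1) by (metis centre_in_ball continuous_on_interior holomorphic_on_imp_continuous_on interior_open open_ball)
  moreover have "eventually (\<lambda>z. k z = (z - 1) * F z) (at 1)"
    unfolding eventually_at using r(1) k(2) by (intro exI[of _ r]) (auto simp: dist_commute)
  ultimately have l1: "((\<lambda>z. (z - 1) * F z) \<longlongrightarrow> k 1) (at 1)"
    unfolding isCont_def by (rule Lim_transform_eventually)
  have "filterlim (\<lambda>z::complex. 1 / z) (at 1) (at 1)"
    by (intro filterlim_atI tendsto_eq_intros) (auto simp: eventually_at_filter)
  from filterlim_compose[OF l1 this] have l2: "((\<lambda>z. (1 / z - 1) * F (1 / z)) \<longlongrightarrow> k 1) (at 1)" .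
  have "((\<lambda>z. - (1 / z) * ((z - 1) * F z)) \<longlongrightarrow> - (1 / 1) * k 1) (at 1)"
    by (intro tendsto_intros l1) auto
  moreover have "eventually (\<lambda>z. - (1 / z) * ((z - 1) * F z) = (1 / z - 1) * F (1 / z)) (at 1)"
    using eventually_not_Lam[OF one_neq_zero] by eventually_elim (auto simp: inv field_simps)
  ultimately have "((\<lambda>z. (1 / z - 1) * F (1 / z)) \<longlongrightarrow> - (1 / 1) * k 1) (at 1)"
    by (rule Lim_transform_eventually)
  from LIM_unique[OF l2 this] have "k 1 = - (1 / 1) * k 1" .
  then have "k 1 = 0" by simp
  then have lim1: "((\<lambda>z. (z - 1) * F z) \<longlongrightarrow> 0) (at 1)" using l1 by simp
  have per': "F (Q powi k * z) = F z" if "z \<noteq> 0" for k z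
    using periodic_powi[of "\<lambda>z. if z = 0 then 0 else F z" k z] per that by auto
  have limx: "((\<lambda>z. (z - x) * F z) \<longlongrightarrow> 0) (at x)" if x: "x \<in> Lam" for x
  proof -
    have x0: "x \<noteq> 0" using x Lam_nz by auto
    have fl: "filterlim (\<lambda>z. z / x) (at 1) (at x)"
      using x0 by (intro filterlim_atI tendsto_eq_intros) (auto simp: eventually_at_filter)
    obtain k where k: "x = Q powi k \<or> x = - (Q powi k)" using x unfolding q_lattice_def by blast
    have Fz: "F (z / x) = F z" if "z \<noteq> 0" for z
      using k per'[of "z / x" k] ev[of "Q powi k * (z / x)"] that x0 by auto
    have "((\<lambda>z. x * ((z / x - 1) * F (z / x))) \<longlongrightarrow> x * 0) (at x)"
      by (intro tendsto_mult tendsto_const filterlim_compose[OF lim1 fl])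
    moreover have "eventually (\<lambda>z. x * ((z / x - 1) * F (z / x)) = (z - x) * F z) (at x)"
      using eventually_not_Lam[OF x0] by eventually_elim (use x0 in \<open>auto simp: Fz field_simps\<close>)
    ultimately have "((\<lambda>z. (z - x) * F z) \<longlongrightarrow> x * 0) (at x)" by (rule Lim_transform_eventually)
    then show ?thesis by simp
  qed
  have "\<exists>G. G holomorphic_on - {0} \<and> (\<forall>z\<in>- {0} - Lam. G z = F z)"
  proof (rule holomorphic_extend_discrete[of "- {0}" Lam F])
    show "\<exists>r>0. ball x r \<inter> Lam \<subseteq> {x}" if "x \<in> - {0}" for x using Lam_discrete[of x] that by auto
    show "F holomorphic_on - {0} - Lam" by (rule holomorphic_on_subset[OF hol]) auto
  qed (use limx in \<open>auto simp: open_Compl\<close>)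
  then obtain G where G: "G holomorphic_on - {0}" "\<And>z. z \<in> - {0} - Lam \<Longrightarrow> G z = F z" by blast
  have Gper: "G (Q * z) = G z" if z: "z \<noteq> 0" for z
  proof (rule eq_off_discrete[of "- {0}" "\<lambda>z. G (Q * z)" G Lam])
    have "(\<lambda>z. G (Q * z)) holomorphic_on - {0}" by (rule holomorphic_scale[OF G(1) Q_nz])
    then show "continuous_on (- {0}) (\<lambda>z. G (Q * z))" by (rule holomorphic_on_imp_continuous_on)
    show "continuous_on (- {0}) G" by (rule holomorphic_on_imp_continuous_on[OF G(1)])
    show "\<exists>r>0. ball x r \<inter> Lam \<subseteq> {x}" if "x \<in> - {0}" for x using Lam_discrete[of x] that by auto
    show "G (Q * z) = G z" if "z \<in> - {0} - Lam" for z
      using that Lam_Q_mult[of z] by (simp add: G(2) per)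
  qed (use z in auto)
  have "\<i> \<notin> Lam" by (auto simp: Lam_iff complex_eq_iff simp del: of_real_power_int)
  then have "F z = F \<i>"
    using q_periodic_constant[OF G(1) Gper assms(1), of \<i>] G(2) assms by auto
  then show ?thesis unfolding F_def kap_def by (simp add: algebra_simps)
qed

abbreviation "sq \<equiv> complex_of_real (sqrt q)"

text \<open>The point z = sqrt q satisfies 1/z = z/q. Hence periodicity gives h (1/z) = h z while
  inversion gives -h z, and h must vanish.\<close>

lemma sq_facts: "sq \<noteq> 0" "sq ^ 2 = Q" "sq \<notin> Lam" "h sq = 0"
proof -
  show nz: "sq \<noteq> 0" using q0 by simp
  show sq2: "sq ^ 2 = Q" using q0 by (simp flip: of_real_power)
  show "sq \<notin> Lam"
  proof
    assume "sq \<in> Lam"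
    then obtain k where "sq = Q powi k \<or> sq = - (Q powi k)" unfolding q_lattice_def by blast
    then have "sq ^ 2 = (Q powi k) ^ 2" by auto
    then have "complex_of_real q = complex_of_real ((q powi k) ^ 2)" unfolding sq2 by simp
    then have "q = (q powi k) ^ 2" by (simp only: of_real_eq_iff)
    also have "\<dots> = q powi (2 * k)" by (subst mult.commute) (simp add: power_int_mult)
    finally have "q powi (2 * k - 1) = 1" by (simp add: power_int_diff)
    then show False using qpowi_eq_1_iff[of "2 * k - 1"] by presburger
  qed
  have "Q * (1 / sq) = sq" using nz unfolding sq2[symmetric] by (simp add: power2_eq_square)
  then have "h sq = h (1 / sq)" using h_periodic[of "1 / sq"] by simp
  then show "h sq = 0" using h_inverse[OF nz] by simp
qed

text \<open>At a zero of h only the theta quotient survives. This form shows that \<open>kap\<close>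
  is nonzero and later links it with the connection constants.\<close>

lemma kap_sq: "kap = H * Th sq / g sq ^ 2"
  using h_square[of sq] sq_facts by simp

lemma Th_sq_nz: "Th sq \<noteq> 0"
  using W_pos[of sq "sqrt q ^ 4"] ff_pos[of sq "sqrt q ^ 4"] q0 unfolding Th_def by auto

lemma kap_nz: "kap \<noteq> 0"
  unfolding kap_sq using H_nz Th_sq_nz g_eq_0_iff[of sq] sq_facts by simp

end

section \<open>Moments and functions of the second kind\<close>

lemma poly_growth:
  fixes A :: "complex poly"
  shows "\<exists>K\<ge>0. \<exists>n. \<forall>x. norm (poly A x) \<le> K * (1 + norm x) ^ n"
proof (induction A)
  case 0
  show ?case by (intro exI[of _ 0]) auto
next
  case (pCons a A)
  then obtain K n where K: "K \<ge> 0" "\<And>x. norm (poly A x) \<le> K * (1 + norm x) ^ n" by blast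
  have "norm (poly (pCons a A) x) \<le> (norm a + K) * (1 + norm x) ^ Suc n" for x
  proof -
    have "norm (poly (pCons a A) x) \<le> norm a + norm x * norm (poly A x)"
      by (simp add: norm_triangle_le norm_mult)
    also have "norm x * norm (poly A x) \<le> (1 + norm x) * (K * (1 + norm x) ^ n)"
      using K by (intro mult_mono) auto
    also have "norm a \<le> norm a * (1 + norm x) ^ Suc n" using mult_left_mono[OF one_le_power[of "1 + norm x" "Suc n"], of "norm a"] by (simp del: power_Suc)
    finally show ?thesis by (simp add: algebra_simps)
  qed
  then show ?case using K(1) by (intro exI[of _ "norm a + K"] conjI exI[of _ "Suc n"]) auto
qed

context qpar
begin

text \<open>The mass of x in w d_qx: both q^k and -q^k carry the Jackson weight q^k = |x|, so the
  integral becomes a single sum over the lattice.\<close>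

definition lw :: "complex \<Rightarrow> complex" where "lw x = complex_of_real (norm x) / W x"

text \<open>A summable weight on the lattice. Its square is the |x| / (1 + |x|)^2 of
  \<open>lw_poly_bound\<close>, so one factor pays for summability and the other is left for powers
  of |x|.\<close>

definition ss :: "complex \<Rightarrow> real" where "ss x = sqrt (norm x) / (1 + norm x)"

definition cau :: "complex poly \<Rightarrow> complex \<Rightarrow> complex" where
  "cau A z = (\<Sum>\<^sub>\<infinity>x\<in>Lam. lw x * poly A x / (z - x))"

definition mom :: "complex poly \<Rightarrow> complex" where
  "mom A = (\<Sum>\<^sub>\<infinity>x\<in>Lam. lw x * poly A x)"

lemma ss_nonneg [simp]: "0 \<le> ss x" by (simp add: ss_def)

lemma Lam_parts:
  "Lam = range (\<lambda>k. Q powi k) \<union> range (\<lambda>k. - (Q powi k))"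
  "range (\<lambda>k. Q powi k) \<inter> range (\<lambda>k. - (Q powi k)) = {}"
  "inj (\<lambda>k. Q powi k)" "inj (\<lambda>k. - (Q powi k))"
proof -
  show "Lam = range (\<lambda>k. Q powi k) \<union> range (\<lambda>k. - (Q powi k))" by (auto simp: q_lattice_def)
  show i: "inj (\<lambda>k. Q powi k)"
  proof (rule injI)
    fix k l assume "Q powi k = Q powi l"
    then have "complex_of_real (q powi (k - l)) = complex_of_real 1" by (simp add: power_int_diff)
    then have "q powi (k - l) = 1" by (simp only: of_real_eq_iff)
    then show "k = l" using qpowi_eq_1_iff by simp
  qed
  then show "inj (\<lambda>k. - (Q powi k))" by (auto simp: inj_def)
  have "Q powi k \<noteq> - (Q powi l)" for k l
  proof
    assume "Q powi k = - (Q powi l)"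
    then have "complex_of_real (q powi k) = complex_of_real (- (q powi l))" by simp
    then have "q powi k = - (q powi l)" by (simp only: of_real_eq_iff)
    then show False using qpowi_pos[of k] qpowi_pos[of l] by linarith
  qed
  then show "range (\<lambda>k. Q powi k) \<inter> range (\<lambda>k. - (Q powi k)) = {}" by auto
qed

lemma norm_Q_powi: "norm (Q powi k) = q powi k"
  using q0 by (simp add: norm_power_int)

lemma ss_powi_le: "ss (Q powi k) \<le> sqrt q ^ nat \<bar>k\<bar>"
proof -
  define y where "y = sqrt q ^ nat \<bar>k\<bar>"
  have y: "y > 0" using q0 unfolding y_def by simp
  have yy: "y ^ 2 = q ^ nat \<bar>k\<bar>" unfolding y_def power_mult[symmetric] mult.commute[of _ 2] unfolding power_mult using q0 by simp
  have sy: "sqrt (q ^ nat \<bar>k\<bar>) = y" using y yy by (metis less_imp_le real_sqrt_unique)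
  show ?thesis
  proof (cases "k \<ge> 0")
    case True
    then have "norm (Q powi k) = y ^ 2" unfolding yy norm_Q_powi by (simp add: power_int_def)
    then have "ss (Q powi k) = y / (1 + y ^ 2)" unfolding ss_def using y by simp
    also have "\<dots> \<le> y / 1" using y by (intro divide_left_mono) (auto intro!: mult_pos_pos add_pos_pos)
    finally show ?thesis unfolding y_def by simp
  next
    case False
    then have "norm (Q powi k) = 1 / y ^ 2" unfolding yy norm_Q_powi by (simp add: power_int_def field_simps)
    then have "ss (Q powi k) = (1 / y) / (1 + 1 / y ^ 2)" unfolding ss_def using y by (simp add: real_sqrt_divide)
    also have "\<dots> = y / (1 + y ^ 2)" using y by (simp add: field_simps power2_eq_square)
    also have "\<dots> \<le> y / 1" using y by (intro divide_left_mono) (auto intro!: mult_pos_pos add_pos_pos)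
    finally show ?thesis unfolding y_def by simp
  qed
qed

lemma ss_summable: "ss summable_on Lam"
proof -
  have s: "(\<lambda>k. sqrt q ^ nat \<bar>k\<bar>) summable_on UNIV"
    using q0 q1 by (intro summable_on_powi_abs) auto
  have 1: "(\<lambda>k. ss (Q powi k)) summable_on UNIV"
    by (rule summable_on_comparison_test[OF s]) (auto simp: ss_powi_le)
  have 2: "(\<lambda>k. ss (- (Q powi k))) summable_on UNIV" using 1 by (simp add: ss_def)
  have "ss summable_on range (\<lambda>k. Q powi k)" "ss summable_on range (\<lambda>k. - (Q powi k))"
    using 1 2 summable_on_reindex[OF Lam_parts(3), of ss] summable_on_reindex[OF Lam_parts(4), of ss]
    by (auto simp: o_def)
  then show ?thesis
    unfolding Lam_parts(1) using Lam_parts(2) by (intro summable_on_Un_disjoint) auto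
qed

text \<open>On the lattice z^4 is a positive number, and each factor 1 + |x|^4 q^(4n) dominates 1 +
  |x| up to a constant. N factors give N powers, so all moments exist.\<close>

lemma W_Lam_ge:
  assumes "x \<in> Lam"
  shows "(1 + norm x) ^ N \<le> (\<Prod>n<N. 2 / (q ^ 4) ^ n) * norm (W x)"
proof -
  obtain v where v: "W x = complex_of_real v" "(\<Prod>n<N. 1 + norm x ^ 4 * (q ^ 4) ^ n) \<le> v"
    using W_ge[OF Lam_power4[OF assms], of N] by auto
  have "(1 + norm x) ^ N = (\<Prod>n<N. 1 + norm x)" by simp
  also have "\<dots> \<le> (\<Prod>n<N. 2 / (q ^ 4) ^ n * (1 + norm x ^ 4 * (q ^ 4) ^ n))"
  proof (intro prod_mono conjI)
    fix n :: nat
    define a where "a = (q ^ 4) ^ n"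
    have a: "0 < a" "a \<le> 1" unfolding a_def using q0 q1 by (auto simp: power_le_one)
    have "norm x \<le> 1 + norm x ^ 4"
    proof (cases "norm x \<le> 1")
      case True
      then show ?thesis using zero_le_power[OF norm_ge_zero, of x 4] by linarith
    next
      case False
      then have "norm x ^ 1 \<le> norm x ^ 4" by (intro power_increasing) auto
      then show ?thesis by simp
    qed
    moreover have "1 + norm x ^ 4 \<le> 1 / a + norm x ^ 4" using a by simp
    ultimately have "1 + norm x \<le> 2 * (1 / a + norm x ^ 4)" using zero_le_power[of "norm x" 4] a by (smt (verit) norm_ge_zero)
    also have "\<dots> = 2 / a * (1 + norm x ^ 4 * a)" using a by (simp add: field_simps)
    finally show "1 + norm x \<le> 2 / (q ^ 4) ^ n * (1 + norm x ^ 4 * (q ^ 4) ^ n)" unfolding a_def .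
  qed auto
  also have "\<dots> = (\<Prod>n<N. 2 / (q ^ 4) ^ n) * (\<Prod>n<N. 1 + norm x ^ 4 * (q ^ 4) ^ n)" by (rule prod.distrib)
  also have "\<dots> \<le> (\<Prod>n<N. 2 / (q ^ 4) ^ n) * v" using q0 by (intro mult_left_mono v prod_nonneg) auto
  also have "v \<le> norm (W x)" unfolding v(1) by simp
  finally show ?thesis using q0 by (simp add: mult_left_mono prod_nonneg)
qed

lemma lw_poly_bound:
  "\<exists>C>0. \<forall>x\<in>Lam. norm (lw x * poly A x) \<le> C * norm x / (1 + norm x) ^ 2"
proof -
  obtain K n where K: "K \<ge> 0" "\<And>x. norm (poly A x) \<le> K * (1 + norm x) ^ n" using poly_growth by blast
  \<comment> \<open>Of the n + 2 factors of \<open>W\<close>, n absorb the polynomial and two leave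
    the decay (1 + |x|)^(-2).\<close>
  define c where "c = (\<Prod>i<n + 2. 2 / (q ^ 4) ^ i)"
  have c: "c > 0" unfolding c_def using q0 by (intro prod_pos) auto
  have "norm (lw x * poly A x) \<le> (K + 1) * c * norm x / (1 + norm x) ^ 2" if x: "x \<in> Lam" for x
  proof -
    have W: "norm (W x) > 0" using W_Lam_nz[OF x] by simp
    have sq: "0 < (1 + norm x) ^ 2" by (rule zero_less_power) (simp add: add_pos_nonneg)
    have "norm (poly A x) * (1 + norm x) ^ 2 \<le> (K + 1) * ((1 + norm x) ^ n * (1 + norm x) ^ 2)"
      using mult_right_mono[OF order_trans[OF K(2)[of x] mult_right_mono[of K "K + 1" "(1 + norm x) ^ n"]], of "(1 + norm x) ^ 2"]
      by (simp add: mult_ac)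
    also have "\<dots> \<le> (K + 1) * (c * norm (W x))"
      using W_Lam_ge[OF x, of "n + 2"] K(1) unfolding c_def power_add by (intro mult_left_mono) auto
    finally have "norm (poly A x) / norm (W x) \<le> (K + 1) * c / (1 + norm x) ^ 2"
      using W sq by (simp add: pos_le_divide_eq pos_divide_le_eq mult_ac)
    then have "norm x * (norm (poly A x) / norm (W x)) \<le> norm x * ((K + 1) * c / (1 + norm x) ^ 2)"
      by (intro mult_left_mono) auto
    then show ?thesis by (simp add: lw_def norm_mult norm_divide mult_ac)
  qed
  moreover have "(K + 1) * c > 0" using K c by simp
  ultimately show ?thesis by blast
qed

lemma sqrt_le_1_plus: "0 \<le> r \<Longrightarrow> sqrt r \<le> 1 + r"
  by (rule real_le_lsqrt) (auto simp: power2_eq_square algebra_simps)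

text \<open>The second bound keeps a factor sqrt |x|, which controls Cauchy transforms near the
  origin, where the lattice accumulates.\<close>

lemma lw_poly_ss:
  "\<exists>C>0. \<forall>x\<in>Lam. norm (lw x * poly A x) \<le> C * ss x \<and> norm (lw x * poly A x) \<le> C * ss x * sqrt (norm x)"
proof -
  obtain C where C: "C > 0" "\<And>x. x \<in> Lam \<Longrightarrow> norm (lw x * poly A x) \<le> C * norm x / (1 + norm x) ^ 2"
    using lw_poly_bound by blast
  have "norm (lw x * poly A x) \<le> C * ss x \<and> norm (lw x * poly A x) \<le> C * ss x * sqrt (norm x)" if x: "x \<in> Lam" for x
  proof -
    have "C * norm x / (1 + norm x) ^ 2 = C * ss x * (sqrt (norm x) / (1 + norm x))"
      by (simp add: ss_def power2_eq_square)
    then have le: "norm (lw x * poly A x) \<le> C * ss x * (sqrt (norm x) / (1 + norm x))" using C(2)[OF x] by simp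
    have t1: "sqrt (norm x) / (1 + norm x) \<le> 1"
      using sqrt_le_1_plus[of "norm x"] by (subst pos_divide_le_eq) (auto simp: add_pos_nonneg)
    have "sqrt (norm x) / (1 + norm x) \<le> sqrt (norm x) / 1"
      by (intro divide_left_mono) (auto simp: add_pos_nonneg)
    then have t2: "sqrt (norm x) / (1 + norm x) \<le> sqrt (norm x)" by simp
    have u: "0 \<le> C * ss x" using C(1) by simp
    show ?thesis
      using order_trans[OF le mult_left_mono[OF t1 u]] order_trans[OF le mult_left_mono[OF t2 u]] by simp
  qed
  then show ?thesis using C(1) by blast
qed

lemma lw_poly_abs_summable: "(\<lambda>x. norm (lw x * poly A x)) summable_on Lam"
proof -
  obtain C where C: "C > 0" "\<And>x. x \<in> Lam \<Longrightarrow> norm (lw x * poly A x) \<le> C * ss x" using lw_poly_ss by blast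
  show ?thesis
    by (rule summable_on_comparison_test[OF summable_on_cmult_right[OF ss_summable, of C]]) (use C in auto)
qed

lemma lw_poly_summable: "(\<lambda>x. lw x * poly A x) summable_on Lam"
  using abs_summable_summable[OF lw_poly_abs_summable] .

lemma cau_abs_summable:
  assumes "z \<notin> insert 0 Lam"
  shows "(\<lambda>x. norm (lw x * poly A x / (z - x))) summable_on Lam"
proof -
  obtain d c where dc: "d > 0" "c > 0" "\<And>w x. w \<in> ball z d \<Longrightarrow> x \<in> insert 0 Lam \<Longrightarrow> c * (1 + norm x) \<le> norm (w - x)"
    using closed_distance_bound[OF closed_Lam0 assms] by blast
  have "norm (lw x * poly A x / (z - x)) \<le> 1 / c * norm (lw x * poly A x)" if "x \<in> Lam" for x
  proof -
    have "c * 1 \<le> c * (1 + norm x)" using dc by (intro mult_left_mono) auto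
    then have "c \<le> norm (z - x)" using dc(3)[of z x] dc(1) that by auto
    then show ?thesis using dc(2) frac_le[of "norm (lw x * poly A x)" "norm (lw x * poly A x)" c "norm (z - x)"]
      by (simp add: norm_divide)
  qed
  then show ?thesis
    by (intro summable_on_comparison_test[OF summable_on_cmult_right[OF lw_poly_abs_summable[of A], of "1 / c"]]) auto
qed

lemma cau_summable: "z \<notin> insert 0 Lam \<Longrightarrow> (\<lambda>x. lw x * poly A x / (z - x)) summable_on Lam"
  using abs_summable_summable[OF cau_abs_summable] .

lemma mom_add: "mom (A + B) = mom A + mom B"
  unfolding mom_def poly_add distrib_left by (rule infsum_add[OF lw_poly_summable lw_poly_summable])

lemma mom_smult: "mom (smult c A) = c * mom A"
  unfolding mom_def by (simp add: mult.left_commute flip: infsum_cmult_right[OF lw_poly_summable])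

lemma mom_0 [simp]: "mom 0 = 0" by (simp add: mom_def)

lemma mom_diff: "mom (A - B) = mom A - mom B"
  using mom_add[of A "smult (- 1) B"] mom_smult[of "- 1" B] by simp

lemma lw_uminus: "lw (- x) = lw x" by (simp add: lw_def)

lemma bij_Lam_uminus: "bij_betw uminus Lam Lam"
  by (rule bij_betwI[of _ _ _ uminus]) (auto simp: Lam_uminus)

lemma mom_reflect: "mom (pcompose A [:0, - 1:]) = mom A"
  unfolding mom_def using infsum_reindex_bij_betw[OF bij_Lam_uminus, of "\<lambda>x. lw x * poly A x"]
  by (simp add: poly_pcompose lw_uminus)

lemma mom_jackson:
  "jackson_integral q (\<lambda>x. poly A x * poly B x * w_fun q x) = mom (A * B)"
proof -
  let ?f = "\<lambda>x. lw x * poly (A * B) x"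
  have sA: "?f summable_on range (\<lambda>k. Q powi k)" and sB: "?f summable_on range (\<lambda>k. - (Q powi k))"
    using summable_on_subset_banach[OF lw_poly_summable[of "A * B"]] Lam_parts(1) by auto
  have "mom (A * B) = infsum ?f (range (\<lambda>k. Q powi k)) + infsum ?f (range (\<lambda>k. - (Q powi k)))"
    unfolding mom_def Lam_parts(1) by (rule infsum_Un_disjoint[OF sA sB Lam_parts(2)])
  also have "\<dots> = infsum (\<lambda>k. ?f (Q powi k)) UNIV + infsum (\<lambda>k. ?f (- (Q powi k))) UNIV"
    by (simp add: infsum_reindex[OF Lam_parts(3)] infsum_reindex[OF Lam_parts(4)] o_def)
  also have "\<dots> = infsum (\<lambda>k. ?f (Q powi k) + ?f (- (Q powi k))) UNIV"
    using sA sB by (subst infsum_add) (auto simp: summable_on_reindex[OF Lam_parts(3)] summable_on_reindex[OF Lam_parts(4)] o_def)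
  also have "\<dots> = jackson_integral q (\<lambda>x. poly A x * poly B x * w_fun q x)"
    unfolding jackson_integral_def
  proof (rule infsum_cong)
    fix k :: int
    have "complex_of_real (norm (Q powi k)) = Q powi k" unfolding norm_Q_powi by simp
    then show "?f (Q powi k) + ?f (- (Q powi k)) =
      Q powi k * (poly A (Q powi k) * poly B (Q powi k) * w_fun q (Q powi k) +
        poly A (- (Q powi k)) * poly B (- (Q powi k)) * w_fun q (- (Q powi k)))"
      unfolding lw_def w_fun_W by (simp add: distrib_left)
  qed
  finally show ?thesis by simp
qed

text \<open>The pairing is bilinear, so the conjugate coefficients are put in by hand. Lattice
  points are real, which makes the integrand |A|^2 times a positive mass, and A then has infinitely
  many zeros.\<close>

lemma mom_pos:
  assumes "mom (A * map_poly cnj A) = 0"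
  shows "A = 0"
proof -
  have ev: "lw x * poly (A * map_poly cnj A) x = complex_of_real (norm x / norm (W x) * norm (poly A x) ^ 2)"
    if x: "x \<in> Lam" for x
  proof -
    have "cnj x = x" using x by (auto simp: Lam_iff simp del: of_real_power_int)
    then have "poly (map_poly cnj A) x = cnj (poly A x)" using poly_cnj[of A x] by simp
    then have 1: "poly (A * map_poly cnj A) x = complex_of_real (norm (poly A x) ^ 2)"
      by (simp add: complex_norm_square del: of_real_power)
    obtain v where "W x = complex_of_real v" "1 \<le> v" using W_pos[OF Lam_power4[OF x]] by auto
    then have "W x = complex_of_real (norm (W x))" by simp
    then show ?thesis unfolding 1 lw_def by (metis of_real_divide of_real_mult)
  qed
  have s: "(\<lambda>x. norm x / norm (W x) * norm (poly A x) ^ 2) summable_on Lam"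
  proof (subst summable_on_cong)
    show "norm x / norm (W x) * norm (poly A x) ^ 2 = norm (lw x * poly (A * map_poly cnj A) x)" if "x \<in> Lam" for x
      unfolding ev[OF that] by (subst norm_of_real) simp
  qed (rule lw_poly_abs_summable)
  have "complex_of_real (\<Sum>\<^sub>\<infinity>x\<in>Lam. norm x / norm (W x) * norm (poly A x) ^ 2) = mom (A * map_poly cnj A)"
  proof -
    have "((\<lambda>x. complex_of_real (norm x / norm (W x) * norm (poly A x) ^ 2)) has_sum
       complex_of_real (\<Sum>\<^sub>\<infinity>x\<in>Lam. norm x / norm (W x) * norm (poly A x) ^ 2)) Lam"
      using has_sum_infsum[OF s] by (simp only: has_sum_of_real_iff)
    then have "(\<Sum>\<^sub>\<infinity>x\<in>Lam. complex_of_real (norm x / norm (W x) * norm (poly A x) ^ 2)) =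
       complex_of_real (\<Sum>\<^sub>\<infinity>x\<in>Lam. norm x / norm (W x) * norm (poly A x) ^ 2)" by (rule infsumI)
    then show ?thesis unfolding mom_def using infsum_cong[of Lam, OF ev] by simp
  qed
  then have 0: "(\<Sum>\<^sub>\<infinity>x\<in>Lam. norm x / norm (W x) * norm (poly A x) ^ 2) = 0" using assms by simp
  have "poly A x = 0" if x: "x \<in> Lam" for x
  proof -
    have "norm x / norm (W x) * norm (poly A x) ^ 2 = 0"
      by (rule nonneg_infsum_le_0D[OF _ s _ x]) (use 0 in auto)
    then show ?thesis using W_Lam_nz[OF x] Lam_nz[OF x] by auto
  qed
  then have sub: "Lam \<subseteq> {x. poly A x = 0}" by blast
  have "infinite (range (\<lambda>k. Q powi k))"
    using finite_imageD[OF _ Lam_parts(3)] infinite_UNIV_int by blast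
  then have "infinite Lam" unfolding Lam_parts(1) by simp
  then have "infinite {x. poly A x = 0}" using infinite_super[OF sub] by blast
  then show ?thesis using poly_roots_finite by blast
qed

lemma poly_synthetic_div: "(z - x) * poly (synthetic_div R z) x = poly R z - poly R x" for R :: "complex poly"
  using arg_cong[OF synthetic_div_correct'[of z R], of "\<lambda>p. poly p x"] by (simp add: algebra_simps)

text \<open>Inside the sum R(z) = R(x) + (z - x) S(x), with S the quotient from synthetic division.
  The factor z - x cancels the denominator and leaves a moment; orthogonality evaluates it for A = P
  n.\<close>

lemma cau_identity:
  assumes "z \<notin> insert 0 Lam"
  shows "poly R z * cau A z = cau (R * A) z + mom (synthetic_div R z * A)"
proof -
  have "poly R z * cau A z = (\<Sum>\<^sub>\<infinity>x\<in>Lam. poly R z * (lw x * poly A x / (z - x)))"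
    unfolding cau_def by (rule infsum_cmult_right[OF cau_summable[OF assms], symmetric])
  also have "\<dots> = (\<Sum>\<^sub>\<infinity>x\<in>Lam. lw x * poly (R * A) x / (z - x) + lw x * poly (synthetic_div R z * A) x)"
  proof (rule infsum_cong)
    fix x assume "x \<in> Lam"
    then have nz: "z - x \<noteq> 0" using assms by auto
    have aux: "(r + d * s) * (l * a / d) = l * (r * a) / d + l * (s * a)" if "d \<noteq> 0" for r d s l a :: complex
      using that by (simp add: field_simps)
    have "poly R z = poly R x + (z - x) * poly (synthetic_div R z) x" by (simp add: poly_synthetic_div)
    then show "poly R z * (lw x * poly A x / (z - x)) = lw x * poly (R * A) x / (z - x) + lw x * poly (synthetic_div R z * A) x"
      using aux[OF nz] by (simp only: poly_mult)
  qed
  also have "\<dots> = cau (R * A) z + mom (synthetic_div R z * A)"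
    unfolding cau_def mom_def by (rule infsum_add[OF cau_summable[OF assms] lw_poly_summable])
  finally show ?thesis .
qed

lemma cau_reflect: "cau A (- z) = - cau (pcompose A [:0, - 1:]) z"
proof -
  have "cau A (- z) = (\<Sum>\<^sub>\<infinity>x\<in>Lam. lw (- x) * poly A (- x) / (- z - - x))"
    unfolding cau_def by (rule infsum_reindex_bij_betw[OF bij_Lam_uminus, symmetric])
  also have "\<dots> = (\<Sum>\<^sub>\<infinity>x\<in>Lam. - (lw x * poly (pcompose A [:0, - 1:]) x / (z - x)))"
  proof (rule infsum_cong)
    fix x
    have "- z - - x = - (z - x)" by simp
    then show "lw (- x) * poly A (- x) / (- z - - x) = - (lw x * poly (pcompose A [:0, - 1:]) x / (z - x))"
      unfolding lw_uminus by (simp only: poly_pcompose) (simp add: minus_divide_right)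
  qed
  finally show ?thesis unfolding cau_def by (simp add: infsum_uminus)
qed

lemma holomorphic_cauchy_sum:
  assumes cl: "closed (insert 0 S)" and "(\<lambda>x. norm (c x)) summable_on S"
  shows "(\<lambda>z. \<Sum>\<^sub>\<infinity>x\<in>S. c x / (z - x)) holomorphic_on - insert 0 S"
proof (rule holomorphic_infsum)
  show "open (- insert 0 S)" using cl by (rule open_Compl)
  show "(\<lambda>z. c x / (z - x)) holomorphic_on - insert 0 S" if "x \<in> S" for x
    using that by (auto intro!: holomorphic_intros)
  fix z0 assume "z0 \<in> - insert 0 S"
  then obtain d e where de: "d > 0" "e > 0" "\<And>w x. w \<in> ball z0 d \<Longrightarrow> x \<in> insert 0 S \<Longrightarrow> e * (1 + norm x) \<le> norm (w - x)"
    using closed_distance_bound[OF cl] by (metis ComplD)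
  have "norm (c x / (z - x)) \<le> 1 / e * norm (c x)" if "x \<in> S" "z \<in> ball z0 d" for x z
  proof -
    have "e * 1 \<le> e * (1 + norm x)" using de by (intro mult_left_mono) auto
    then have "e \<le> norm (z - x)" using de(3)[OF that(2), of x] that by auto
    then show ?thesis using de(2) frac_le[of "norm (c x)" "norm (c x)" e "norm (z - x)"] by (simp add: norm_divide)
  qed
  then show "\<exists>d>0. \<exists>M. M summable_on S \<and> (\<forall>x\<in>S. \<forall>z\<in>ball z0 d. norm (c x / (z - x)) \<le> M x)"
    using summable_on_cmult_right[OF assms(2), of "1 / e"] de(1) by blast
qed

lemma holomorphic_cau: "cau A holomorphic_on - insert 0 Lam"
  unfolding cau_def using holomorphic_cauchy_sum[OF closed_Lam0 lw_poly_abs_summable] .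

lemma cau_residue:
  assumes x: "x \<in> Lam"
  shows "((\<lambda>z. (z - x) * cau A z) \<longlongrightarrow> lw x * poly A x) (at x)"
proof -
  let ?S = "Lam - {x}"
  have x0: "x \<noteq> 0" using Lam_nz[OF x] .
  obtain r where r: "r > 0" "ball x r \<inter> insert 0 Lam \<subseteq> {x}" using Lam_discrete[OF x0] by auto
  have eq: "insert 0 ?S = insert 0 Lam \<inter> - ball x r" using r x0 by auto
  have cl: "closed (insert 0 ?S)" unfolding eq by (intro closed_Int closed_Lam0 closed_Compl open_ball)
  let ?R = "\<lambda>z. \<Sum>\<^sub>\<infinity>y\<in>?S. lw y * poly A y / (z - y)"
  have hol: "?R holomorphic_on - insert 0 ?S"
    by (rule holomorphic_cauchy_sum[OF cl summable_on_subset_banach[OF lw_poly_abs_summable]]) auto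
  have "x \<in> - insert 0 ?S" using x0 by auto
  then have "isCont ?R x"
    using holomorphic_on_imp_continuous_on[OF hol] open_Compl[OF cl] continuous_on_eq_continuous_at by blast
  then have "((\<lambda>z. lw x * poly A x + (z - x) * ?R z) \<longlongrightarrow> lw x * poly A x + (x - x) * ?R x) (at x)"
    unfolding isCont_def by (intro tendsto_intros)
  moreover have "eventually (\<lambda>z. lw x * poly A x + (z - x) * ?R z = (z - x) * cau A z) (at x)"
    using eventually_not_Lam[OF x0]
  proof eventually_elim
    case (elim z)
    have "z \<noteq> x" using elim x by auto
    have "cau A z = lw x * poly A x / (z - x) + ?R z"
      unfolding cau_def using infsum_insert[of "\<lambda>y. lw y * poly A y / (z - y)" ?S x] x
        summable_on_subset_banach[OF cau_summable[OF elim], of ?S] by (simp add: insert_absorb)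
    then show ?case using \<open>z \<noteq> x\<close> by (simp add: distrib_left)
  qed
  ultimately have "((\<lambda>z. (z - x) * cau A z) \<longlongrightarrow> lw x * poly A x + (x - x) * ?R x) (at x)"
    by (rule Lim_transform_eventually)
  then show ?thesis by simp
qed

section \<open>Circles of radius \<sigma> q^k and Cauchy transforms on them\<close>

definition GC :: "real \<Rightarrow> complex set" where "GC \<sigma> = {z. \<exists>k::int. norm z = \<sigma> * q powi k}"

text \<open>The picture is invariant under scaling by q, so only two gaps occur: 1 - \<sigma>
  relative to a lattice point farther out, and \<sigma> - q relative to the circle when the lattice
  point is farther in.\<close>

lemma gc_dist:
  assumes \<sigma>: "q < \<sigma>" "\<sigma> < 1"
  shows "\<exists>c>0. \<forall>z\<in>GC \<sigma>. \<forall>x\<in>Lam. c * norm z \<le> norm (z - x) \<and> c * norm x \<le> norm (z - x)"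
proof (intro exI[of _ "min (1 - \<sigma>) (\<sigma> - q)"] conjI ballI)
  show "0 < min (1 - \<sigma>) (\<sigma> - q)" using \<sigma> by simp
  fix z x assume z: "z \<in> GC \<sigma>" and x: "x \<in> Lam"
  obtain k where k: "norm z = \<sigma> * q powi k" using z unfolding GC_def by auto
  obtain j where j: "norm x = q powi j" using x unfolding q_lattice_def by (auto simp: norm_Q_powi)
  let ?c = "min (1 - \<sigma>) (\<sigma> - q)"
  have "?c * norm z \<le> \<bar>norm z - norm x\<bar> \<and> ?c * norm x \<le> \<bar>norm z - norm x\<bar>"
  proof (cases "j \<le> k")
    case True
    have "q powi k = q powi j * q ^ nat (k - j)"
    proof -
      have "q powi k = q powi (j + (k - j))" by simp
      also have "\<dots> = q powi j * q powi (k - j)" by (rule power_int_add) simp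
      also have "\<dots> = q powi j * q ^ nat (k - j)" using True by (simp add: power_int_def)
      finally show ?thesis .
    qed
    moreover have "q ^ nat (k - j) \<le> 1" using q0 q1 by (simp add: power_le_one)
    ultimately have le: "q powi k \<le> q powi j" using mult_left_mono[of "q ^ nat (k - j)" 1 "q powi j"] q0 by simp
    have "?c * norm x \<le> (1 - \<sigma>) * q powi j" unfolding j using q0 by (intro mult_right_mono) auto
    also have "\<dots> \<le> q powi j - \<sigma> * q powi k" using mult_left_mono[OF le, of \<sigma>] \<sigma> q0 by (simp add: algebra_simps)
    finally have 1: "?c * norm x \<le> \<bar>norm z - norm x\<bar>" unfolding j k by linarith
    have "norm z \<le> norm x" unfolding k j using mult_mono[of \<sigma> 1 "q powi k" "q powi j"] le \<sigma> q0 by simp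
    then show ?thesis using 1 order_trans[OF mult_left_mono[of "norm z" "norm x" ?c] 1] \<sigma> by (auto simp: min_def)
  next
    case False
    have "q powi j = q powi k * q * q ^ nat (j - k - 1)"
    proof -
      have "q powi j = q powi (k + 1 + (j - k - 1))" by simp
      also have "\<dots> = q powi (k + 1) * q powi (j - k - 1)" by (rule power_int_add) simp
      also have "q powi (k + 1) = q powi k * q" by (simp add: power_int_add)
      also have "q powi (j - k - 1) = q ^ nat (j - k - 1)" using False by (simp add: power_int_def)
      finally show ?thesis .
    qed
    moreover have "q ^ nat (j - k - 1) \<le> 1" using q0 q1 by (simp add: power_le_one)
    ultimately have le: "q powi j \<le> q powi k * q" using mult_left_mono[of "q ^ nat (j - k - 1)" 1 "q powi k * q"] q0 by simp
    have "?c * q powi k \<le> (\<sigma> - q) * q powi k" using q0 by (intro mult_right_mono) auto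
    also have "\<dots> \<le> norm z - norm x" unfolding j k using le by (simp add: algebra_simps)
    finally have 1: "?c * q powi k \<le> \<bar>norm z - norm x\<bar>" by linarith
    have "norm z \<le> q powi k" unfolding k using \<sigma> q0 by (simp add: mult_le_cancel_right1)
    moreover have "norm x \<le> q powi k"
    proof -
      have a: "q powi k * q \<le> q powi k * 1" by (rule mult_left_mono) (use q1 in \<open>auto simp: less_imp_le\<close>)
      show ?thesis unfolding j using order_trans[OF le a] by simp
    qed
    ultimately show ?thesis using 1 mult_left_mono[of _ "q powi k" ?c] \<sigma> by (meson min_less_iff_conj diff_gt_0_iff_gt less_imp_le order_trans)
  qed
  then show "?c * norm z \<le> norm (z - x)" "?c * norm x \<le> norm (z - x)"
    using norm_triangle_ineq3[of z x] by linarith+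
qed

lemma GC_facts:
  assumes \<sigma>: "q < \<sigma>" "\<sigma> < 1" and z: "z \<in> GC \<sigma>"
  shows "z \<noteq> 0" "z \<notin> Lam" "z \<notin> insert 0 Lam"
proof -
  show z0: "z \<noteq> 0" using z \<sigma> q0 by (auto simp: GC_def)
  obtain c where "c > 0" "\<forall>z\<in>GC \<sigma>. \<forall>x\<in>Lam. c * norm z \<le> norm (z - x) \<and> c * norm x \<le> norm (z - x)"
    using gc_dist[OF \<sigma>] by blast
  then show "z \<notin> Lam" using z z0 by (metis diff_self mult_pos_pos norm_zero not_le zero_less_norm_iff)
  then show "z \<notin> insert 0 Lam" using z0 by auto
qed

text \<open>The first bound uses |z - x| \<ge> c |z| and serves at infinity. The second uses the
  geometric mean |z - x| \<ge> c sqrt(|x| |z|) and is the better one at 0, where it makes z times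
  the transform tend to 0.\<close>

lemma cau_bound:
  assumes \<sigma>: "q < \<sigma>" "\<sigma> < 1"
  shows "\<exists>C\<ge>0. \<forall>z\<in>GC \<sigma>. norm (cau A z) \<le> C / norm z \<and> norm (cau A z) \<le> C / sqrt (norm z)"
proof -
  obtain c where c: "c > 0" "\<And>z x. z \<in> GC \<sigma> \<Longrightarrow> x \<in> Lam \<Longrightarrow> c * norm z \<le> norm (z - x)"
      "\<And>z x. z \<in> GC \<sigma> \<Longrightarrow> x \<in> Lam \<Longrightarrow> c * norm x \<le> norm (z - x)"
    using gc_dist[OF \<sigma>] by metis
  obtain C where C: "C > 0" "\<And>x. x \<in> Lam \<Longrightarrow> norm (lw x * poly A x) \<le> C * ss x"
    "\<And>x. x \<in> Lam \<Longrightarrow> norm (lw x * poly A x) \<le> C * ss x * sqrt (norm x)" using lw_poly_ss by metis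
  define D where "D = C / c * infsum ss Lam"
  have "norm (cau A z) \<le> D / m" if z: "z \<in> GC \<sigma>" and m: "m > 0"
    and t: "\<And>x. x \<in> Lam \<Longrightarrow> norm (lw x * poly A x) / norm (z - x) \<le> C / c / m * ss x" for z m
  proof -
    have s: "(\<lambda>x. norm (lw x * poly A x / (z - x))) summable_on Lam" by (rule cau_abs_summable[OF GC_facts(3)[OF \<sigma> z]])
    have "norm (cau A z) \<le> (\<Sum>\<^sub>\<infinity>x\<in>Lam. norm (lw x * poly A x / (z - x)))"
      unfolding cau_def by (rule norm_infsum_bound[OF s])
    also have "\<dots> \<le> (\<Sum>\<^sub>\<infinity>x\<in>Lam. C / c / m * ss x)"
      by (rule infsum_mono[OF s summable_on_cmult_right[OF ss_summable]]) (use t in \<open>simp add: norm_divide\<close>)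
    also have "\<dots> = D / m" unfolding D_def by (subst infsum_cmult_right) (auto simp: ss_summable)
    finally show ?thesis .
  qed note main = this
  have "norm (cau A z) \<le> D / norm z \<and> norm (cau A z) \<le> D / sqrt (norm z)" if z: "z \<in> GC \<sigma>" for z
  proof
    have z0: "norm z > 0" using GC_facts[OF \<sigma> z] by simp
    show "norm (cau A z) \<le> D / norm z"
    proof (rule main[OF z z0])
      fix x assume x: "x \<in> Lam"
      have "norm (lw x * poly A x) / norm (z - x) \<le> (C * ss x) / (c * norm z)"
        using C(1) c(1) z0 by (intro frac_le C(2)[OF x] c(2)[OF z x]) auto
      then show "norm (lw x * poly A x) / norm (z - x) \<le> C / c / norm z * ss x" by simp
    qed
    have sz: "sqrt (norm z) > 0" using z0 by simp
    show "norm (cau A z) \<le> D / sqrt (norm z)"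
    proof (rule main[OF z sz])
      fix x assume x: "x \<in> Lam"
      have x0: "norm x > 0" using Lam_nz[OF x] by simp
      have "c * (sqrt (norm x) * sqrt (norm z)) = sqrt ((c * norm x) * (c * norm z))"
        using c(1) by (simp add: real_sqrt_mult)
      also have "\<dots> \<le> sqrt (norm (z - x) * norm (z - x))"
        using c x0 z0 x z by (intro real_sqrt_le_mono mult_mono) auto
      finally have le: "c * (sqrt (norm x) * sqrt (norm z)) \<le> norm (z - x)" by simp
      have "norm (lw x * poly A x) / norm (z - x) \<le> (C * ss x * sqrt (norm x)) / (c * (sqrt (norm x) * sqrt (norm z)))"
        using C(1) c(1) sz x0 by (intro frac_le C(3)[OF x] le) auto
      also have "\<dots> = C / c / sqrt (norm z) * ss x" using x0 by simp
      finally show "norm (lw x * poly A x) / norm (z - x) \<le> C / c / sqrt (norm z) * ss x" .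
    qed
  qed
  moreover have "D \<ge> 0" unfolding D_def using C(1) c(1) by (intro mult_nonneg_nonneg infsum_nonneg) auto
  ultimately show ?thesis by blast
qed

end

section \<open>Orthogonal polynomials and their functions of the second kind\<close>

locale ortho = qpar +
  fixes P :: "nat \<Rightarrow> complex poly" and \<gamma> :: "nat \<Rightarrow> complex"
  assumes P: "monic_orthogonal_family q P \<gamma>"
begin

lemma degree_P: "degree (P n) = n" and coeff_P: "coeff (P n) n = 1"
  using P unfolding monic_orthogonal_family_def by metis+

lemma mom_PP: "mom (P n * P m) = (if n = m then \<gamma> n else 0)"
  using P unfolding monic_orthogonal_family_def mom_jackson by blast

lemma mom_P_low:
  assumes "\<And>i. i \<ge> d \<Longrightarrow> coeff R i = 0" "d \<le> n"
  shows "mom (R * P n) = 0"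
  using assms
proof (induction d arbitrary: R)
  case 0
  then have "R = 0" by (intro poly_eqI) auto
  then show ?case by simp
next
  case (Suc d)
  define S where "S = R - smult (coeff R d) (P d)"
  have "coeff S i = 0" if "i \<ge> d" for i
    using that Suc.prems(1)[of i] coeff_P[of d] coeff_eq_0[of "P d" i] degree_P[of d]
    unfolding S_def by (cases "i = d") auto
  then have "mom (S * P n) = 0" using Suc by auto
  moreover have "R * P n = S * P n + smult (coeff R d) (P d * P n)" unfolding S_def by (simp add: algebra_simps)
  ultimately show ?case using Suc.prems(2) mom_PP[of d n] by (simp add: mom_add mom_smult)
qed

lemma mom_P_monic:
  assumes "coeff R n = 1" "degree R = n"
  shows "mom (R * P n) = \<gamma> n"
proof -
  have "coeff (R - P n) i = 0" if "i \<ge> n" for i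
    using that assms coeff_P[of n] coeff_eq_0[of "P n" i] coeff_eq_0[of R i] degree_P[of n] by (cases "i = n") auto
  then have "mom ((R - P n) * P n) = 0" by (rule mom_P_low) auto
  then show ?thesis using mom_PP[of n n] by (simp add: left_diff_distrib mom_diff)
qed

text \<open>The conjugate of P n is again monic of degree n, so \<gamma> n is also the squared norm
  of P n, although the coefficients of P n are not assumed real.\<close>

lemma \<gamma>_nz: "\<gamma> n \<noteq> 0"
proof
  assume "\<gamma> n = 0"
  moreover have "mom (map_poly cnj (P n) * P n) = \<gamma> n"
    by (rule mom_P_monic) (auto simp: coeff_map_poly coeff_P degree_map_poly degree_P)
  ultimately have "mom (P n * map_poly cnj (P n)) = 0" by (simp add: mult.commute)
  then have "P n = 0" by (rule mom_pos)
  then show False using coeff_P[of n] by simp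
qed

text \<open>The weight is even, so the reflected polynomial is orthogonal to lower degrees too. The
  difference D has degree below n and is orthogonal to all such polynomials, in particular to its
  own conjugate.\<close>

lemma P_reflect: "pcompose (P n) [:0, - 1:] = smult ((- 1) ^ n) (P n)"
proof -
  define D where "D = P n - smult ((- 1) ^ n) (pcompose (P n) [:0, - 1:])"
  have cD: "coeff D i = 0" if "i \<ge> n" for i
    using that coeff_P[of n] coeff_eq_0[of "P n" i] degree_P[of n]
    unfolding D_def by (cases "i = n") (auto simp: coeff_pcompose_linear simp flip: power_add)
  have orth: "mom (R * D) = 0" if R: "\<And>i. i \<ge> n \<Longrightarrow> coeff R i = 0" for R
  proof -
    have "R * pcompose (P n) [:0, - 1:] = pcompose (pcompose R [:0, - 1:] * P n) [:0, - 1:]"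
      by (simp add: pcompose_mult flip: pcompose_assoc) (simp add: pcompose_pCons)
    then have "mom (R * pcompose (P n) [:0, - 1:]) = mom (pcompose R [:0, - 1:] * P n)" by (simp add: mom_reflect)
    also have "\<dots> = 0" by (rule mom_P_low[of n]) (use R in \<open>auto simp: coeff_pcompose_linear\<close>)
    finally show ?thesis using mom_P_low[of n R n] R unfolding D_def by (simp add: algebra_simps mom_diff mom_smult)
  qed
  have "mom (D * map_poly cnj D) = 0" using orth[of "map_poly cnj D"] cD by (simp add: coeff_map_poly mult.commute)
  then have "D = 0" by (rule mom_pos)
  then have "smult ((- 1) ^ n) (P n) = smult ((- 1) ^ n * (- 1) ^ n) (pcompose (P n) [:0, - 1:])"
    unfolding D_def by (metis eq_iff_diff_eq_0 smult_smult)
  then show ?thesis by (simp flip: power_add)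
qed

lemma P_parity: "poly (P n) (- z) = (- 1) ^ n * poly (P n) z"
  using arg_cong[OF P_reflect[of n], of "\<lambda>p. poly p z"] by (simp add: poly_pcompose)

lemma cau_smult: "cau (smult c A) z = c * cau A z"
  unfolding cau_def by (simp add: mult.left_commute infsum_cmult_right' flip: times_divide_eq_right)

lemma cau_P_parity: "cau (P n) (- z) = - ((- 1) ^ n * cau (P n) z)"
  by (simp add: cau_reflect P_reflect cau_smult)

text \<open>The correction moment pairs P n with a quotient of degree below n and vanishes.
  Multiplying by z^n thus keeps the transform a transform, so it decays like o(z^(-n)) on the good
  circles.\<close>

lemma cau_low:
  assumes "z \<notin> insert 0 Lam" "degree R \<le> n"
  shows "poly R z * cau (P n) z = cau (R * P n) z"
proof -
  have "mom (synthetic_div R z * P n) = 0"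
  proof (cases "n = 0")
    case True
    then show ?thesis using assms(2) by (simp add: synthetic_div_eq_0_iff[THEN iffD2])
  next
    case False
    show ?thesis by (rule mom_P_low[of n]) (use assms(2) False in \<open>auto intro!: coeff_eq_0 simp: degree_synthetic_div\<close>)
  qed
  then show ?thesis by (simp add: cau_identity[OF assms(1)])
qed

text \<open>One degree higher the quotient is monic of degree n, and its moment against P n is the
  norm.\<close>

lemma cau_top:
  assumes "z \<notin> insert 0 Lam" "degree R = Suc n" "coeff R (Suc n) = 1"
  shows "poly R z * cau (P n) z = cau (R * P n) z + \<gamma> n"
proof -
  have "coeff (synthetic_div R z) n = 1"
    using arg_cong[OF synthetic_div_correct[of R z], of "\<lambda>p. coeff p (Suc n)"] assms(2,3)
    by (simp add: coeff_eq_0 degree_synthetic_div)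
  then have "mom (synthetic_div R z * P n) = \<gamma> n"
    by (rule mom_P_monic) (use assms(2) in \<open>simp add: degree_synthetic_div\<close>)
  then show ?thesis by (simp add: cau_identity[OF assms(1)])
qed

text \<open>The Casorati determinant: both products reduce to the transform of P n P (n+1), one with
  and one without the correction \<gamma> n.\<close>

lemma cau_det:
  assumes "z \<notin> insert 0 Lam"
  shows "poly (P (Suc n)) z * cau (P n) z - poly (P n) z * cau (P (Suc n)) z = \<gamma> n"
  using cau_top[OF assms, of "P (Suc n)" n] cau_low[OF assms, of "P n" "Suc n"] degree_P coeff_P
  by (simp add: mult.commute)

end

section \<open>Circles avoiding the lattice\<close>

context qpar
begin

definition Ginf :: "real \<Rightarrow> complex filter" where "Ginf \<sigma> = inf at_infinity (principal (GC \<sigma>))"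

lemma eventually_Ginf:
  "eventually R (Ginf \<sigma>) \<longleftrightarrow> (\<exists>B. \<forall>z\<in>GC \<sigma>. norm z \<ge> B \<longrightarrow> R z)"
  unfolding Ginf_def eventually_inf_principal eventually_at_infinity by auto

lemma GC_scale: "z \<in> GC \<sigma> \<Longrightarrow> Q powi k * z \<in> GC \<sigma>"
proof -
  assume "z \<in> GC \<sigma>"
  then obtain j where "norm z = \<sigma> * q powi j" unfolding GC_def by auto
  then have "norm (Q powi k * z) = \<sigma> * q powi (k + j)" by (simp add: norm_mult norm_Q_powi power_int_add)
  then show ?thesis unfolding GC_def by blast
qed

lemma GC_shift: "z \<in> GC \<sigma> \<Longrightarrow> z * Q ^ k \<in> GC \<sigma>"
  using GC_scale[of z \<sigma> "int k"] by (simp add: mult.commute)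

lemma GC_inverse: "0 < \<sigma> \<Longrightarrow> 1 / z \<in> GC (1 / \<sigma>) \<longleftrightarrow> z \<in> GC \<sigma>"
proof -
  assume \<sigma>: "0 < \<sigma>"
  have "norm (1 / z) = 1 / \<sigma> * q powi k \<longleftrightarrow> norm z = \<sigma> * q powi (- k)" for k
  proof -
    have p: "q powi k > 0" by simp
    have "norm (1 / z) = 1 / norm z" by (simp add: norm_divide)
    moreover have "1 / norm z = 1 / \<sigma> * q powi k \<longleftrightarrow> norm z = \<sigma> * q powi (- k)"
      using \<sigma> p by (cases "z = 0") (auto simp: power_int_minus field_simps)
    ultimately show ?thesis by simp
  qed
  then have "(\<exists>k. norm (1 / z) = 1 / \<sigma> * q powi k) \<longleftrightarrow> (\<exists>k. norm z = \<sigma> * q powi k)"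
    by (metis minus_minus)
  then show ?thesis unfolding GC_def by simp
qed

lemma filterlim_inverse_Ginf:
  assumes "0 < \<sigma>"
  shows "filterlim (\<lambda>s. 1 / s) (Ginf \<sigma>) (at 0 within GC (1 / \<sigma>))"
  unfolding Ginf_def filterlim_inf filterlim_principal
proof
  show "filterlim (\<lambda>s. 1 / s) at_infinity (at 0 within GC (1 / \<sigma>))"
  proof -
    have "(\<lambda>s::complex. 1 / s) = inverse" by (auto simp: inverse_eq_divide)
    then show ?thesis
      using filterlim_mono[OF filterlim_inverse_at_infinity order_refl at_le[OF subset_UNIV[of "GC (1 / \<sigma>)"]]] by simp
  qed
  have "s \<in> GC (1 / \<sigma>) \<longleftrightarrow> 1 / s \<in> GC \<sigma>" for s using GC_inverse[OF assms, of "1 / s"] by simp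
  then show "eventually (\<lambda>s. 1 / s \<in> GC \<sigma>) (at 0 within GC (1 / \<sigma>))"
    by (simp add: eventually_at_filter)
qed

lemma filterlim_inverse_GC0:
  assumes "0 < \<sigma>"
  shows "filterlim (\<lambda>s. 1 / s) (at 0 within GC (1 / \<sigma>)) (Ginf \<sigma>)"
proof -
  have "filterlim (\<lambda>s::complex. 1 / s) (at 0) (Ginf \<sigma>)"
    unfolding Ginf_def by (rule filterlim_mono[OF filterlim_inverse_at_0 order_refl]) simp
  moreover have "eventually (\<lambda>s. 1 / s \<in> GC (1 / \<sigma>)) (Ginf \<sigma>)"
    unfolding eventually_Ginf using GC_inverse[OF assms] by blast
  ultimately show ?thesis by (auto simp: filterlim_at intro: eventually_conj)
qed

lemma q_scale_between:
  assumes "0 < \<sigma>" "0 < r"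
  shows "\<exists>k. \<sigma> * q powi (k + 1) < r \<and> r \<le> \<sigma> * q powi k"
proof -
  obtain k where k: "q < r / \<sigma> * q powi k" "r / \<sigma> * q powi k \<le> 1" using q_scale[of "r / \<sigma>"] assms by auto
  have p: "q powi k > 0" by simp
  have k': "\<sigma> * q < r * q powi k" "r * q powi k \<le> \<sigma>" using k assms by (simp_all add: field_simps)
  have "q powi (- k + 1) = q / q powi k" "q powi (- k) = 1 / q powi k"
    by (simp_all add: power_int_diff power_int_minus inverse_eq_divide)
  then have "\<sigma> * q powi (- k + 1) < r" "r \<le> \<sigma> * q powi (- k)"
    using k' p by (simp_all add: pos_divide_less_eq pos_le_divide_eq)
  then show ?thesis by blast
qed

lemma GC0_nontrivial: "0 < \<sigma> \<Longrightarrow> at 0 within GC \<sigma> \<noteq> bot"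
proof -
  assume \<sigma>: "0 < \<sigma>"
  have "(\<lambda>n. complex_of_real (\<sigma> * q ^ n)) \<longlonglongrightarrow> complex_of_real (\<sigma> * 0)"
    by (intro tendsto_intros LIMSEQ_realpow_zero) (use q0 q1 in auto)
  moreover have "complex_of_real (\<sigma> * q ^ n) \<in> GC \<sigma> - {0}" for n
    using \<sigma> q0 by (auto simp: GC_def norm_mult norm_power intro!: exI[of _ "int n"])
  ultimately have "0 islimpt GC \<sigma>" unfolding islimpt_sequential by (intro exI[of _ "\<lambda>n. complex_of_real (\<sigma> * q ^ n)"]) auto
  then show ?thesis using trivial_limit_within by blast
qed

text \<open>A limit along the circles alone suffices for Riemann's theorem: between consecutive
  circles the maximum principle bounds z F.\<close>

lemma extend_over_zero:
  assumes \<sigma>: "0 < \<sigma>" and hol: "F holomorphic_on - {0}"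
    and lim: "((\<lambda>z. z * F z) \<longlongrightarrow> 0) (at 0 within GC \<sigma>)"
  obtains G where "G holomorphic_on UNIV" "\<And>z. z \<noteq> 0 \<Longrightarrow> G z = F z"
proof -
  have hol': "(\<lambda>z. z * F z) holomorphic_on - {0}" by (intro holomorphic_intros hol)
  have "((\<lambda>z. z * F z) \<longlongrightarrow> 0) (at 0)"
  proof (rule tendstoI)
    fix e :: real assume e: "e > 0"
    have "eventually (\<lambda>z. dist (z * F z) 0 < e / 2) (at 0 within GC \<sigma>)" by (rule tendstoD[OF lim]) (use e in simp)
    then obtain d where d: "d > 0" "\<And>z. z \<in> GC \<sigma> \<Longrightarrow> z \<noteq> 0 \<Longrightarrow> norm z < d \<Longrightarrow> norm (z * F z) < e / 2"
      unfolding eventually_at by auto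
    \<comment> \<open>The factor q in \<open>q * d\<close> leaves room for the enclosing outer
      circle, whose radius is less than |z| / q.\<close>
    have "norm (z * F z) \<le> e / 2" if z: "z \<noteq> 0" "norm z < q * d" for z
    proof -
      obtain k where k: "\<sigma> * q powi (k + 1) < norm z" "norm z \<le> \<sigma> * q powi k"
        using q_scale_between[OF \<sigma>, of "norm z"] z by auto
      have 1: "\<sigma> * q powi (k + 1) = q * (\<sigma> * q powi k)" by (simp add: power_int_add)
      then have "q * (\<sigma> * q powi k) < q * d" using k(1) z(2) by linarith
      then have 2: "\<sigma> * q powi k < d" using q0 by (simp only: mult_less_cancel_left_pos)
      have 3: "\<sigma> * q powi (k + 1) < d" using k z(2) mult_strict_right_mono[OF q1 d(1)] by linarith
      show ?thesis
      proof (rule maximum_modulus_annulus[OF hol', of "\<sigma> * q powi (k + 1)" z "\<sigma> * q powi k"])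
        show "norm (w * F w) \<le> e / 2" if "norm w = \<sigma> * q powi (k + 1)" for w
        proof -
          have "norm w > 0" "w \<in> GC \<sigma>" unfolding GC_def using that \<sigma> by auto
          then show ?thesis using d(2)[of w] 3 that by force
        qed
        show "norm (w * F w) \<le> e / 2" if "norm w = \<sigma> * q powi k" for w
        proof -
          have "norm w > 0" "w \<in> GC \<sigma>" unfolding GC_def using that \<sigma> by auto
          then show ?thesis using d(2)[of w] 2 that by force
        qed
      qed (use k \<sigma> in auto)
    qed
    then show "eventually (\<lambda>z. dist (z * F z) 0 < e) (at 0)"
      unfolding eventually_at using e d(1) q0 by (intro exI[of _ "q * d"]) force
  qed
  then have "\<exists>G. G holomorphic_on UNIV \<and> (\<forall>z\<in>UNIV - {0}. G z = F z)"
    by (subst holomorphic_on_extend_lim) (use hol in \<open>auto simp: Compl_eq_Diff_UNIV\<close>)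
  then show ?thesis using that by auto
qed

lemma extend_over_infinity:
  assumes \<sigma>: "0 < \<sigma>" and hol: "F holomorphic_on - {0}" and lim: "(F \<longlongrightarrow> L) (Ginf \<sigma>)"
  obtains G where "G holomorphic_on UNIV" "\<And>s. s \<noteq> 0 \<Longrightarrow> G s = F (1 / s)" "G 0 = L"
proof -
  have \<sigma>': "0 < 1 / \<sigma>" using \<sigma> by simp
  define U where "U = (\<lambda>s. F (1 / s))"
  have "(F \<circ> (\<lambda>s. 1 / s)) holomorphic_on - {0}"
    by (rule holomorphic_on_compose_gen[OF _ hol]) (auto intro!: holomorphic_intros)
  then have holU: "U holomorphic_on - {0}" unfolding U_def o_def .
  have limU: "(U \<longlongrightarrow> L) (at 0 within GC (1 / \<sigma>))"
    unfolding U_def by (rule filterlim_compose[OF lim filterlim_inverse_Ginf[OF \<sigma>]])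
  have "((\<lambda>s. s * U s) \<longlongrightarrow> 0 * L) (at 0 within GC (1 / \<sigma>))" by (intro tendsto_intros limU)
  then obtain G where G: "G holomorphic_on UNIV" "\<And>z. z \<noteq> 0 \<Longrightarrow> G z = U z"
    using extend_over_zero[OF \<sigma>' holU] by auto
  have "(G \<longlongrightarrow> G 0) (at 0 within GC (1 / \<sigma>))"
    using G(1) by (metis continuous_on_def holomorphic_on_imp_continuous_on iso_tuple_UNIV_I tendsto_within_subset top_greatest)
  moreover have "eventually (\<lambda>s. G s = U s) (at 0 within GC (1 / \<sigma>))"
    using G(2) by (auto simp: eventually_at_filter)
  ultimately have "(U \<longlongrightarrow> G 0) (at 0 within GC (1 / \<sigma>))" by (rule Lim_transform_eventually)
  then have "G 0 = L" using tendsto_unique[OF GC0_nontrivial[OF \<sigma>'] _ limU] by blast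
  then show ?thesis using that G unfolding U_def by auto
qed

lemma fsigma_punctured: "fsigma (- {0::complex})"
proof -
  have "(\<Union>n. - ball (0::complex) (inverse (real (Suc n)))) = - {0}"
  proof (intro equalityI subsetI)
    fix z :: complex assume "z \<in> - {0}"
    then obtain n where "inverse (real (Suc n)) < norm z" using reals_Archimedean[of "norm z"] by auto
    then show "z \<in> (\<Union>n. - ball 0 (inverse (real (Suc n))))" by (intro UN_I[of n]) auto
  qed auto
  moreover have "fsigma (\<Union>n. - ball (0::complex) (inverse (real (Suc n))))"
    by (intro fsigma.intros closed_Compl open_ball)
  ultimately show ?thesis by simp
qed

text \<open>The zeros of h are zeros of the nonconstant function \<open>GH\<close>, hence countable,
  so some radius in (q, 1) misses all their moduli. Periodicity clears the remaining
  circles.\<close>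

lemma exists_good_radius: "\<exists>\<sigma>. q < \<sigma> \<and> \<sigma> < 1 \<and> (\<forall>z\<in>GC \<sigma>. h z \<noteq> 0)"
proof -
  let ?Z = "{z \<in> - {0}. GH z = 0}"
  have sqz: "GH sq = 0" using sq_facts by (simp add: GH_eq)
  have nc: "\<not> GH constant_on - {0}"
  proof
    assume "GH constant_on - {0}"
    then obtain c where "\<And>z. z \<in> - {0} \<Longrightarrow> GH z = c" unfolding constant_on_def by blast
    from this[of sq] this[of 1] show False using sqz GH_1_nz sq_facts(1) by simp
  qed
  have conn: "connected (- {0::complex})" by (rule connected_punctured_universe) simp
  have "countable ?Z"
    by (rule holomorphic_countable_zeros[OF holomorphic_GH _ conn fsigma_punctured nc]) (simp add: open_Compl)
  then have "countable (norm ` ?Z)" by simp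
  moreover have "uncountable {q<..<1}" using q1 by (simp add: uncountable_open_interval)
  ultimately have "\<not> {q<..<1} \<subseteq> norm ` ?Z" using countable_subset by blast
  then obtain \<sigma> where \<sigma>: "\<sigma> \<in> {q<..<1}" "\<sigma> \<notin> norm ` ?Z" unfolding subset_eq Bex_def Ball_def not_all not_imp by (elim exE conjE)
  have "h z \<noteq> 0" if z: "z \<in> GC \<sigma>" for z
  proof
    assume "h z = 0"
    obtain k where k: "norm z = \<sigma> * q powi k" using z unfolding GC_def by auto
    define w where "w = Q powi (- k) * z"
    have w: "norm w = \<sigma>" unfolding w_def norm_mult norm_Q_powi k by (simp add: power_int_minus)
    have "w \<in> GC \<sigma>" unfolding w_def by (rule GC_scale[OF z])
    then have "w \<noteq> 0" "w \<notin> Lam" using GC_facts \<sigma> by auto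
    moreover have "h w = 0" unfolding w_def using periodic_powi[of h "- k" z] h_periodic \<open>h z = 0\<close> by metis
    ultimately have "w \<in> ?Z" by (simp add: GH_eq)
    then show False using \<sigma>(2) w by auto
  qed
  then show ?thesis using \<sigma> by auto
qed

text \<open>By periodicity the extremes over all circles are those over one compact circle.\<close>

lemma h_bounds:
  assumes \<sigma>: "q < \<sigma>" "\<sigma> < 1" and nz: "\<forall>z\<in>GC \<sigma>. h z \<noteq> 0"
  shows "\<exists>B b. 0 < b \<and> (\<forall>z\<in>GC \<sigma>. b \<le> norm (h z) \<and> norm (h z) \<le> B)"
proof -
  have sub: "sphere 0 \<sigma> \<subseteq> GC \<sigma>" unfolding GC_def by (auto intro!: exI[of _ 0])
  have "sphere 0 \<sigma> \<subseteq> - insert 0 Lam" using sub GC_facts(3)[OF \<sigma>] by blast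
  then have c: "continuous_on (sphere 0 \<sigma>) (\<lambda>z. norm (h z))"
    by (intro continuous_on_norm holomorphic_on_imp_continuous_on holomorphic_on_subset[OF holomorphic_h])
  have "complex_of_real \<sigma> \<in> sphere 0 \<sigma>" using \<sigma> q0 by simp
  then have ne: "sphere 0 \<sigma> \<noteq> ({} :: complex set)" by blast
  obtain u where u: "u \<in> sphere 0 \<sigma>" "\<forall>z\<in>sphere 0 \<sigma>. norm (h z) \<le> norm (h u)"
    using continuous_attains_sup[OF compact_sphere ne c] by (elim bexE)
  obtain v where v: "v \<in> sphere 0 \<sigma>" "\<forall>z\<in>sphere 0 \<sigma>. norm (h v) \<le> norm (h z)"
    using continuous_attains_inf[OF compact_sphere ne c] by (elim bexE)
  have "norm (h v) \<le> norm (h z) \<and> norm (h z) \<le> norm (h u)" if z: "z \<in> GC \<sigma>" for z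
  proof -
    obtain k where k: "norm z = \<sigma> * q powi k" using z unfolding GC_def by auto
    have "norm (Q powi (- k) * z) = \<sigma>" unfolding norm_mult norm_Q_powi k by (simp add: power_int_minus)
    moreover have "h (Q powi (- k) * z) = h z" using periodic_powi[of h "- k" z] h_periodic by metis
    ultimately show ?thesis using u v by (metis mem_sphere_0)
  qed
  moreover have "norm (h v) > 0" using nz v(1) sub by auto
  ultimately show ?thesis by blast
qed

section \<open>Quasi-periodic functions and their growth\<close>

definition quasi :: "(complex \<Rightarrow> complex) \<Rightarrow> bool" where
  "quasi G \<longleftrightarrow> (\<forall>z. z \<noteq> 0 \<longrightarrow> G (Q * z) = - G z / z ^ 2)"

lemma quasi_g: "quasi g" by (simp add: quasi_def g_quasi)
lemma quasi_GH: "quasi GH" by (simp add: quasi_def GH_quasi)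

lemma quasi_shift:
  assumes "quasi G" "z \<noteq> 0"
  shows "z ^ (2 * m) * Q ^ (m * (m - 1)) * G (z * Q ^ m) = (- 1) ^ m * G z"
proof (induction m)
  case (Suc m)
  have e: "Suc m * (Suc m - 1) = m * (m - 1) + 2 * m" by (cases m) auto
  have "z * Q ^ m \<noteq> 0" using assms(2) by simp
  then have e1: "G (z * Q ^ Suc m) = - G (z * Q ^ m) / (z * Q ^ m) ^ 2"
    using assms(1) unfolding quasi_def by (metis mult.assoc mult.commute power_Suc)
  have e2: "Q ^ (m * (m - 1) + 2 * m) = Q ^ (m * (m - 1)) * (Q ^ m) ^ 2"
    by (simp add: power_add mult.commute flip: power_mult)
  have e3: "z ^ (2 * Suc m) = z ^ (2 * m) * z ^ 2" by (simp add: power2_eq_square)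
  have "A * z ^ 2 * (B * Y ^ 2) * (- X / (z * Y) ^ 2) = - (A * B * X)" if "Y \<noteq> 0" for A B X Y
    using that assms(2) by (simp add: field_simps power_mult_distrib)
  then have "z ^ (2 * Suc m) * Q ^ (Suc m * (Suc m - 1)) * G (z * Q ^ Suc m)
     = - (z ^ (2 * m) * Q ^ (m * (m - 1)) * G (z * Q ^ m))"
    unfolding e e1 e2 e3 by simp
  then show ?case using Suc.IH by simp
qed simp

text \<open>The multiplier that undoes k quasi-periods: multiplying by it returns a quasi-periodic
  function at s / q^k to its value at s. It compares behaviour at infinity with a fixed
  annulus.\<close>

definition Nf :: "nat \<Rightarrow> complex \<Rightarrow> complex" where
  "Nf k s = (- 1) ^ k * Q ^ (k * (k + 1)) / s ^ (2 * k)"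

lemma Nf_quasi:
  assumes "quasi G" "s \<noteq> 0"
  shows "Nf k s * G (s / Q ^ k) = G s"
proof -
  have z: "s / Q ^ k \<noteq> 0" using assms by simp
  \<comment> \<open>The total exponent 2 k^2 is what the power (q^k)^(2k) in the denominator
    cancels.\<close>
  have e: "k * (k + 1) + k * (k - 1) = 2 * k * k" by (cases k) (auto simp: algebra_simps)
  have "(- 1) ^ k * G (s / Q ^ k) = (s / Q ^ k) ^ (2 * k) * Q ^ (k * (k - 1)) * G s"
    using quasi_shift[OF assms(1) z, of k] by simp
  then have "Nf k s * G (s / Q ^ k) = Q ^ (k * (k + 1)) / s ^ (2 * k) * ((s / Q ^ k) ^ (2 * k) * Q ^ (k * (k - 1)) * G s)"
    unfolding Nf_def by (simp add: mult_ac)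
  also have "\<dots> = Q ^ (k * (k + 1) + k * (k - 1)) / (Q ^ k) ^ (2 * k) * G s"
    using assms(2) by (simp add: power_divide power_add)
  also have "\<dots> = G s" unfolding e by (simp add: mult_ac flip: power_mult)
  finally show ?thesis .
qed

lemma Nf_nz: "s \<noteq> 0 \<Longrightarrow> Nf k s \<noteq> 0" by (simp add: Nf_def)

lemma norm_Nf: "norm (Nf k s) = q ^ (k * (k + 1)) / norm s ^ (2 * k)"
  using q0 by (simp add: Nf_def norm_divide norm_mult norm_power)

text \<open>The modulus of g on the imaginary axis, where g has no zero and where, factor by factor,
  |g| is largest on the circle of radius r.\<close>

definition TT :: "real \<Rightarrow> real" where "TT r = norm (g (\<i> * complex_of_real r))"

lemma TT_scale: "s \<noteq> 0 \<Longrightarrow> norm (Nf k s) * TT (norm s / q ^ k) = TT (norm s)"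
proof -
  assume s: "s \<noteq> 0"
  have "Nf k (\<i> * complex_of_real (norm s)) * g (\<i> * complex_of_real (norm s) / Q ^ k) = g (\<i> * complex_of_real (norm s))"
    by (rule Nf_quasi[OF quasi_g]) (use s in auto)
  then have "norm (Nf k (\<i> * complex_of_real (norm s))) * norm (g (\<i> * complex_of_real (norm s) / Q ^ k)) = TT (norm s)"
    unfolding TT_def by (metis norm_mult)
  then show ?thesis unfolding norm_Nf TT_def by (simp add: norm_mult)
qed

lemma TT_pos: "0 < r \<Longrightarrow> 0 < TT r"
proof -
  assume r: "0 < r"
  have "\<i> * complex_of_real r \<notin> Lam" using r by (auto simp: Lam_iff complex_eq_iff simp del: of_real_power_int)
  then show ?thesis unfolding TT_def using g_eq_0_iff[of "\<i> * complex_of_real r"] r by auto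
qed

lemma TT_continuous: "continuous_on {0<..} TT"
proof -
  have "continuous_on {0<..} (g \<circ> (\<lambda>r. \<i> * complex_of_real r))"
    by (rule continuous_on_compose[OF _ continuous_on_subset[OF holomorphic_on_imp_continuous_on[OF holomorphic_g]]])
       (auto intro!: continuous_intros)
  then show ?thesis unfolding TT_def o_def by (intro continuous_on_norm)
qed

lemma TT_bounds:
  assumes "0 < r1" "r1 \<le> r2"
  shows "\<exists>m1 m2. 0 < m1 \<and> (\<forall>r. r1 \<le> r \<and> r \<le> r2 \<longrightarrow> m1 \<le> TT r \<and> TT r \<le> m2)"
proof -
  have c: "continuous_on {r1..r2} TT" by (rule continuous_on_subset[OF TT_continuous]) (use assms in auto)
  have ne: "{r1..r2} \<noteq> {}" using assms by auto
  obtain u where u: "u \<in> {r1..r2}" "\<forall>r\<in>{r1..r2}. TT r \<le> TT u"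
    using continuous_attains_sup[OF compact_Icc ne c] by (elim bexE)
  obtain v where v: "v \<in> {r1..r2}" "\<forall>r\<in>{r1..r2}. TT v \<le> TT r"
    using continuous_attains_inf[OF compact_Icc ne c] by (elim bexE)
  have "TT v > 0" using TT_pos[of v] v assms by auto
  then show ?thesis using u v by (intro exI[of _ "TT v"] exI[of _ "TT u"]) auto
qed

end

section \<open>Growth of entire functions close to a theta function\<close>

text \<open>As the maximum looks two steps back, the comparison is with a geometric sequence of
  ratio sqrt \<theta>.\<close>

lemma two_step_contraction:
  fixes x :: "nat \<Rightarrow> real"
  assumes "0 \<le> \<theta>" "\<theta> < 1" and x: "\<And>k. k \<ge> K \<Longrightarrow> x (k + 2) \<le> \<theta> * max (x (k + 1)) (x k)" and nn: "\<And>k. 0 \<le> x k"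
  shows "x \<longlonglongrightarrow> 0"
proof -
  define \<rho> where "\<rho> = sqrt \<theta>"
  have \<rho>: "0 \<le> \<rho>" "\<rho> < 1" "\<rho> * \<rho> = \<theta>" using assms(1,2) by (auto simp: \<rho>_def)
  show ?thesis
  proof (cases "\<rho> = 0")
    case True
    then have "x (n + (K + 2)) = 0" for n
      using x[of "n + K"] nn[of "n + (K + 2)"] \<rho>(3) by (simp add: add_ac)
    then have "(\<lambda>n. x (n + (K + 2))) \<longlonglongrightarrow> 0" by simp
    then show ?thesis by (rule LIMSEQ_offset)
  next
    case False
    then have \<rho>0: "\<rho> > 0" using \<rho> by simp
    define m where "m = max (x K) (x (K + 1) / \<rho>)"
    have m: "m \<ge> 0" unfolding m_def using nn[of K] by simp
    have bnd: "x (K + n) \<le> m * \<rho> ^ n \<and> x (K + n + 1) \<le> m * \<rho> ^ (n + 1)" for n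
    proof (induction n)
      case 0
      have "x (K + 1) / \<rho> \<le> m" unfolding m_def by simp
      then have "x (K + 1) \<le> m * \<rho>" using \<rho>0 by (simp only: pos_divide_le_eq)
      moreover have "x K \<le> m" unfolding m_def by simp
      ultimately show ?case by simp
    next
      case (Suc n)
      have "m * \<rho> ^ (n + 1) \<le> m * \<rho> ^ n" using m \<rho> by (intro mult_left_mono power_decreasing) auto
      then have "max (x (K + n + 1)) (x (K + n)) \<le> m * \<rho> ^ n" using Suc by auto
      then have "x (K + n + 2) \<le> \<theta> * (m * \<rho> ^ n)"
        using x[of "K + n"] mult_left_mono[of _ "m * \<rho> ^ n" \<theta>] assms(1) by (meson le_add1 order_trans)
      also have "\<dots> = m * \<rho> ^ (n + 2)" using \<rho>(3) by (simp add: mult_ac power2_eq_square power_add)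
      finally show ?case using Suc by simp
    qed
    have b: "norm (x (n + K)) \<le> m * \<rho> ^ n" for n
      using nn[of "n + K"] bnd[of n] by (simp add: add.commute[of n K])
    have "(\<lambda>n. m * \<rho> ^ n) \<longlonglongrightarrow> m * 0" using \<rho> by (intro tendsto_intros LIMSEQ_realpow_zero) auto
    then have "(\<lambda>n. x (n + K)) \<longlonglongrightarrow> 0"
      by (intro Lim_null_comparison[OF always_eventually[OF allI[OF b]]]) simp
    then show ?thesis by (rule LIMSEQ_offset)
  qed
qed

context qpar
begin

lemma norm_div_Qk: "norm (s / Q ^ k) = norm s / q ^ k"
  using q0 by (simp add: norm_divide norm_power)

lemma GC_circle_div: "norm s = \<sigma> * q powi j \<Longrightarrow> s / Q ^ k \<in> GC \<sigma>"
proof -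
  assume "norm s = \<sigma> * q powi j"
  then have "norm (s / Q ^ k) = \<sigma> * q powi (j - int k)"
    unfolding norm_div_Qk by (simp add: power_int_diff)
  then show ?thesis unfolding GC_def by blast
qed

lemma scale_large:
  assumes "1 / q ^ (K + 1) \<le> norm z"
  shows "\<exists>k\<ge>K. \<exists>s. z = s / Q ^ k \<and> 1 \<le> norm s \<and> norm s \<le> 1 / q"
proof -
  have z: "norm z > 0" using assms q0 by (meson less_le_trans zero_less_divide_1_iff zero_less_power)
  obtain k0 where k0: "q < norm z * q powi k0" "norm z * q powi k0 \<le> 1" using q_scale[OF z] by auto
  have ge: "k0 \<ge> int K + 1"
  proof (rule ccontr)
    assume "\<not> k0 \<ge> int K + 1"
    then have "q powi k0 * q ^ nat (int K - k0) = q ^ K"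
    proof -
      have "q powi (k0 + (int K - k0)) = q powi k0 * q powi (int K - k0)" by (rule power_int_add) simp
      then show ?thesis using \<open>\<not> k0 \<ge> int K + 1\<close> by (simp add: power_int_def)
    qed
    moreover have "q powi k0 * q ^ nat (int K - k0) \<le> q powi k0 * 1"
      using q0 q1 by (intro mult_left_mono power_le_one) (auto simp: less_imp_le)
    ultimately have "q ^ K \<le> q powi k0" by simp
    then have "1 / q ^ (K + 1) * q ^ K \<le> norm z * q powi k0"
      using assms q0 by (intro mult_mono) auto
    moreover have "1 / q ^ (K + 1) * q ^ K = 1 / q" by simp
    ultimately have "1 / q \<le> 1" using k0(2) by linarith
    then show False using q0 q1 by simp
  qed
  define k where "k = nat (k0 - 1)"
  have k: "int k = k0 - 1" "k \<ge> K" using ge unfolding k_def by auto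
  have "q powi k0 = q * q ^ k"
  proof -
    have "k0 = 1 + int k" using k by simp
    then show ?thesis by (simp add: power_int_add)
  qed
  then have 1: "q < norm z * q ^ k * q" "norm z * q ^ k * q \<le> 1" using k0 by (simp_all add: mult_ac)
  have "1 \<le> norm (z * Q ^ k)" "norm (z * Q ^ k) \<le> 1 / q"
    using 1 q0 by (simp_all add: norm_mult norm_power pos_le_divide_eq)
  moreover have "z = z * Q ^ k / Q ^ k" by simp
  ultimately show ?thesis using k(2) by blast
qed

lemma q_power_small: "0 < y \<Longrightarrow> \<exists>K. \<forall>k\<ge>K. q ^ k < y"
proof -
  assume "0 < y"
  then obtain K where "q ^ K < y" using real_arch_pow_inv[of y q] q1 by blast
  then show ?thesis using power_decreasing[of K _ q] q0 q1 by (meson less_imp_le order_le_less_trans)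
qed

lemma Nf_Suc: "s \<noteq> 0 \<Longrightarrow> Nf (Suc k) s = - (Q ^ (2 * k + 2) / s ^ 2) * Nf k s"
proof -
  assume "s \<noteq> 0"
  have "Suc k * (Suc k + 1) = k * (k + 1) + (2 * k + 2)" by (simp add: algebra_simps)
  then have e1: "Q ^ (Suc k * (Suc k + 1)) = Q ^ (k * (k + 1)) * Q ^ (2 * k + 2)" by (simp only: power_add)
  have e2: "s ^ (2 * Suc k) = s ^ (2 * k) * s ^ 2" by (simp add: power2_eq_square)
  show ?thesis unfolding Nf_def e1 e2 by (simp add: mult_ac)
qed

text \<open>The solutions of the equation for \<open>\<Psi>\<close> are smaller than \<open>g\<close>: after normalisation by the factors \<open>Nf\<close>
  the recurrence along \<open>s, s/q, s/q\<^sup>2, \<dots>\<close> contracts by a factor that tends to \<open>q\<close>.\<close>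

lemma Psi_div_g_tendsto_0:
  assumes \<sigma>: "q < \<sigma>" "\<sigma> < 1" and hol: "\<alpha> holomorphic_on UNIV" and eq: "\<forall>t. Psi_eq q \<alpha> t"
  shows "((\<lambda>t. \<alpha> t / g t) \<longlongrightarrow> 0) (Ginf \<sigma>)"
proof -
  have \<sigma>0: "\<sigma> > 0" using \<sigma> q0 by simp
  define b where "b = (\<lambda>k s. Nf k s * \<alpha> (s / Q ^ k))"
  have holb: "b k holomorphic_on - {0}" for k
  proof -
    have "(\<lambda>s. \<alpha> ((1 / Q ^ k) * s)) holomorphic_on - {0}"
      by (rule holomorphic_scale) (use hol holomorphic_on_subset in auto)
    then have "(\<lambda>s. \<alpha> (s / Q ^ k)) holomorphic_on - {0}" by simp
    then show ?thesis unfolding b_def Nf_def by (intro holomorphic_intros) auto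
  qed
  have "\<exists>w. norm w = \<sigma> \<and> (\<forall>s. norm s = \<sigma> \<longrightarrow> norm (b k s) \<le> norm (b k w))" for k
  proof -
    have "sphere 0 \<sigma> \<subseteq> - {0::complex}" using \<sigma>0 by auto
    from norm_attains_sup_circle[OF holb[of k] this] \<sigma>0 show ?thesis by (metis less_imp_le)
  qed
  then obtain w where w: "\<And>k. norm (w k) = \<sigma>" "\<And>k s. norm s = \<sigma> \<Longrightarrow> norm (b k s) \<le> norm (b k (w k))" by metis
  define x where "x = (\<lambda>k. norm (b k (w k)))"
  \<comment> \<open>The equation for \<Psi> at t = s / q^k, solved for the value at t / q^2 and
    multiplied by \<open>Nf (k + 2) s\<close>. The quasi-periods turn the coefficients into q plus
    terms of order q^(2k) and q^(4k).\<close>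
  have rec: "b (k + 2) s = (Q - (1 + Q) * Q ^ (2 * k + 3) / s ^ 2) * b (k + 1) s - Q ^ (4 * k + 5) / s ^ 4 * b k s"
    if s: "s \<noteq> 0" for k s
  proof -
    define t where "t = s / Q ^ k"
    have t: "t / Q = s / Q ^ (k + 1)" "t / Q ^ 2 = s / Q ^ (k + 2)" "t ^ 2 = s ^ 2 / Q ^ (2 * k)"
    proof -
      show "t / Q = s / Q ^ (k + 1)" by (simp add: t_def mult.commute)
      have "Q ^ (k + 2) = Q ^ k * Q ^ 2" by (rule power_add)
      then show "t / Q ^ 2 = s / Q ^ (k + 2)" unfolding t_def by (simp only: divide_divide_eq_left)
      show "t ^ 2 = s ^ 2 / Q ^ (2 * k)" unfolding t_def by (simp add: power_divide mult.commute flip: power_mult)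
    qed
    have e: "Q * \<alpha> (t / Q ^ 2) = - (t ^ 2 / Q ^ 2 - (1 + Q)) * \<alpha> (t / Q) - \<alpha> t"
      using eq[rule_format, of t] unfolding Psi_eq_def Let_def by (simp add: algebra_simps eq_neg_iff_add_eq_0 add_eq_0_iff)
    define N where "N = Nf k s"
    have N1: "Nf (k + 1) s = - (Q ^ (2 * k + 2) / s ^ 2) * N" using Nf_Suc[OF s, of k] unfolding N_def by simp
    have N2: "Nf (k + 2) s = Q ^ (4 * k + 6) / s ^ 4 * N"
    proof -
      have "Nf (k + 2) s = - (Q ^ (2 * (k + 1) + 2) / s ^ 2) * (- (Q ^ (2 * k + 2) / s ^ 2) * N)"
        using Nf_Suc[OF s, of "k + 1"] N1 by simp
      also have "\<dots> = Q ^ ((2 * (k + 1) + 2) + (2 * k + 2)) / (s ^ 2 * s ^ 2) * N" by (simp only: power_add) simp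
      also have "(2 * (k + 1) + 2) + (2 * k + 2) = 4 * k + 6" by simp
      also have "s ^ 2 * s ^ 2 = s ^ 4" by (simp flip: power_add)
      finally show ?thesis .
    qed
    define P where "P = Q ^ (2 * k)"
    have Pnz: "P \<noteq> 0" unfolding P_def by simp
    have pw: "Q ^ (4 * k + 6) = P ^ 2 * Q ^ 6" "Q ^ (4 * k + 5) = P ^ 2 * Q ^ 5" "Q ^ (2 * k + 2) = P * Q ^ 2" "Q ^ (2 * k + 3) = P * Q ^ 3"
    proof -
      have e: "4 * k + 6 = 2 * k * 2 + 6" "4 * k + 5 = 2 * k * 2 + 5" by simp_all
      show "Q ^ (4 * k + 6) = P ^ 2 * Q ^ 6" "Q ^ (4 * k + 5) = P ^ 2 * Q ^ 5"
        unfolding P_def e power_mult[symmetric] by (rule power_add)+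
      show "Q ^ (2 * k + 2) = P * Q ^ 2" "Q ^ (2 * k + 3) = P * Q ^ 3" unfolding P_def by (rule power_add)+
    qed
    define A1 A0 where "A1 = \<alpha> (t / Q)" and "A0 = \<alpha> t"
    have "\<alpha> (t / Q ^ 2) = (- (t ^ 2 / Q ^ 2 - (1 + Q)) * A1 - A0) / Q" using e unfolding A1_def A0_def by (simp add: field_simps)
    then have b2: "b (k + 2) s = P ^ 2 * Q ^ 6 / s ^ 4 * N * ((- (s ^ 2 / P / Q ^ 2 - (1 + Q)) * A1 - A0) / Q)"
      unfolding b_def N2 t(2)[symmetric] t(3)[folded P_def] pw by simp
    have b1: "b (k + 1) s = - (P * Q ^ 2 / s ^ 2) * N * A1" unfolding b_def N1 A1_def t(1) pw by simp
    have b0: "b k s = N * A0" unfolding b_def N_def A0_def t_def by simp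
    show ?thesis unfolding b2 b1 b0 pw using s Pnz by (simp add: field_simps) (simp add: power_numeral_reduce algebra_simps)
  qed
  \<comment> \<open>Collects both vanishing coefficients on |s| = \<sigma>, each of their powers of
    q reduced to q^k. The index K is where C q^k falls below (1 - q)/2, leaving the contraction
    factor (1 + q)/2.\<close>
  define C where "C = (1 + q) * q ^ 3 / \<sigma> ^ 2 + q ^ 5 / \<sigma> ^ 4"
  have C: "C > 0" unfolding C_def using q0 \<sigma>0 by (intro add_pos_pos divide_pos_pos mult_pos_pos) auto
  obtain K where K: "\<forall>k\<ge>K. q ^ k < (1 - q) / 2 / C" using q_power_small[of "(1 - q) / 2 / C"] C q1 by auto
  have "x \<longlonglongrightarrow> 0"
  proof (rule two_step_contraction[of "(1 + q) / 2" K])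
    fix k assume k: "K \<le> k"
    let ?s = "w (k + 2)"
    let ?m = "max (x (k + 1)) (x k)"
    have s: "?s \<noteq> 0" using w(1)[of "k + 2"] \<sigma>0 by auto
    have b1: "norm (b (k + 1) ?s) \<le> ?m" using w(2)[OF w(1), of "k + 1" "k + 2"] unfolding x_def by linarith
    have b0: "norm (b k ?s) \<le> ?m" using w(2)[OF w(1), of k "k + 2"] unfolding x_def by linarith
    have m: "?m \<ge> 0" using b0 norm_ge_zero order_trans by blast
    have n1: "norm (Q - (1 + Q) * Q ^ (2 * k + 3) / ?s ^ 2) \<le> q + (1 + q) * q ^ (2 * k + 3) / \<sigma> ^ 2"
    proof -
      have "norm (1 + Q) = 1 + q" using q0 by (metis abs_of_pos add_pos_pos norm_of_real of_real_1 of_real_add zero_less_one)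
      then show ?thesis
        using norm_triangle_ineq4[of Q "(1 + Q) * Q ^ (2 * k + 3) / ?s ^ 2"] q0 w(1)[of "k + 2"]
        by (simp add: norm_mult norm_divide norm_power)
    qed
    have n0: "norm (Q ^ (4 * k + 5) / ?s ^ 4) = q ^ (4 * k + 5) / \<sigma> ^ 4"
      using q0 w(1)[of "k + 2"] by (simp add: norm_divide norm_power)
    have "x (k + 2) \<le> norm (Q - (1 + Q) * Q ^ (2 * k + 3) / ?s ^ 2) * norm (b (k + 1) ?s) + norm (Q ^ (4 * k + 5) / ?s ^ 4) * norm (b k ?s)"
    proof -
      have "norm (b (k + 2) ?s) \<le> norm ((Q - (1 + Q) * Q ^ (2 * k + 3) / ?s ^ 2) * b (k + 1) ?s) + norm (Q ^ (4 * k + 5) / ?s ^ 4 * b k ?s)"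
        unfolding rec[OF s, of k] by (rule norm_triangle_ineq4)
      then show ?thesis unfolding x_def norm_mult[of _ "b _ _"] .
    qed
    also have "\<dots> \<le> (q + (1 + q) * q ^ (2 * k + 3) / \<sigma> ^ 2) * ?m + q ^ (4 * k + 5) / \<sigma> ^ 4 * ?m"
      unfolding n0 using q0 \<sigma>0 by (intro add_mono mult_mono n1 b1 b0 m) auto
    also have "\<dots> = (q + (1 + q) * q ^ (2 * k + 3) / \<sigma> ^ 2 + q ^ (4 * k + 5) / \<sigma> ^ 4) * ?m" by (simp add: algebra_simps)
    also have "\<dots> \<le> (q + C * q ^ k) * ?m"
    proof (intro mult_right_mono m)
      have 1: "q ^ (2 * k + 3) \<le> q ^ (k + 3)" "q ^ (4 * k + 5) \<le> q ^ (k + 5)"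
        using q0 q1 by (auto intro!: power_decreasing)
      have "(1 + q) * q ^ (2 * k + 3) / \<sigma> ^ 2 \<le> (1 + q) * q ^ (k + 3) / \<sigma> ^ 2"
        using 1 q0 \<sigma>0 by (intro divide_right_mono mult_left_mono) auto
      moreover have "q ^ (4 * k + 5) / \<sigma> ^ 4 \<le> q ^ (k + 5) / \<sigma> ^ 4"
        using 1 \<sigma>0 by (intro divide_right_mono) auto
      moreover have "C * q ^ k = (1 + q) * q ^ (k + 3) / \<sigma> ^ 2 + q ^ (k + 5) / \<sigma> ^ 4"
        unfolding C_def by (simp add: power_add algebra_simps add_divide_distrib)
      ultimately show "q + (1 + q) * q ^ (2 * k + 3) / \<sigma> ^ 2 + q ^ (4 * k + 5) / \<sigma> ^ 4 \<le> q + C * q ^ k" by linarith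
    qed
    also have "\<dots> \<le> (1 + q) / 2 * ?m"
    proof (intro mult_right_mono m)
      have "q ^ k < (1 - q) / 2 / C" using K k by blast
      then have "C * q ^ k < (1 - q) / 2" using C by (simp only: pos_less_divide_eq mult.commute)
      then show "q + C * q ^ k \<le> (1 + q) / 2" by (simp add: field_simps)
    qed
    finally show "x (k + 2) \<le> (1 + q) / 2 * max (x (k + 1)) (x k)" .
  qed (use q0 q1 in \<open>auto simp: x_def\<close>)
  then have xlim: "\<And>e. e > 0 \<Longrightarrow> \<exists>K. \<forall>k\<ge>K. x k < e" unfolding LIMSEQ_def by (fastforce simp: x_def)
  have holg': "(\<lambda>s. 1 / g s) holomorphic_on - insert 0 Lam"
    by (intro holomorphic_intros holomorphic_on_subset[OF holomorphic_g]) (auto simp: g_eq_0_iff)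
  have "sphere 0 \<sigma> \<subseteq> GC \<sigma>" unfolding GC_def by (auto intro!: exI[of _ 0])
  then have sub: "sphere 0 \<sigma> \<subseteq> - insert 0 Lam" using GC_facts(3)[OF \<sigma>] by blast
  obtain v where v: "norm v = \<sigma>" "\<And>s. norm s = \<sigma> \<Longrightarrow> norm (1 / g s) \<le> norm (1 / g v)"
    using norm_attains_sup_circle[OF holg' sub] \<sigma>0 by (metis less_imp_le)
  define B where "B = norm (1 / g v) + 1"
  have B: "B > 0" unfolding B_def by (simp add: add_nonneg_pos)
  show ?thesis
  proof (rule tendstoI)
    fix e :: real assume e: "e > 0"
    obtain K where K: "\<forall>k\<ge>K. x k < e / B" using xlim[of "e / B"] e B by auto
    have "dist (\<alpha> t / g t) 0 < e" if t: "t \<in> GC \<sigma>" "norm t \<ge> \<sigma> / q ^ K" for t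
    proof -
      obtain j where j: "norm t = \<sigma> * q powi j" using t(1) unfolding GC_def by auto
      have "- j \<ge> int K"
      proof (rule ccontr)
        assume a: "\<not> - j \<ge> int K"
        have "q powi (j + int K) = q ^ nat (j + int K)" using a by (simp add: power_int_def)
        also have "\<dots> < 1" using q_pows(2)[of "nat (j + int K)"] a by simp
        finally have "q powi j * q ^ K < 1" by (simp add: power_int_add)
        moreover have "1 \<le> q powi j * q ^ K" using t(2) \<sigma>0 q0 unfolding j by (simp add: pos_divide_le_eq)
        ultimately show False by simp
      qed
      define k where "k = nat (- j)"
      have k: "k \<ge> K" "j = - int k" using \<open>- j \<ge> int K\<close> unfolding k_def by linarith+
      define s where "s = t * Q ^ k"
      have s: "norm s = \<sigma>" unfolding s_def norm_mult j k(2) using q0 by (simp add: norm_power power_int_minus)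
      have s0: "s \<noteq> 0" using s \<sigma>0 by auto
      have ts: "t = s / Q ^ k" unfolding s_def by simp
      have "\<alpha> t / g t = b k s * (1 / g s)"
        using Nf_quasi[OF quasi_g s0, of k] Nf_nz[OF s0, of k] unfolding b_def ts[symmetric] by (metis mult.right_neutral mult_divide_mult_cancel_left times_divide_eq_right)
      then have "norm (\<alpha> t / g t) = norm (b k s) * norm (1 / g s)" by (simp only: norm_mult)
      also have "\<dots> \<le> x k * B" unfolding x_def B_def using w(2)[OF s, of k] v(2)[OF s] by (intro mult_mono) auto
      also have "\<dots> < e" using K k(1) B by (simp add: pos_less_divide_eq)
      finally show ?thesis by simp
    qed
    then show "eventually (\<lambda>t. dist (\<alpha> t / g t) 0 < e) (Ginf \<sigma>)" unfolding eventually_Ginf by blast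
  qed
qed

text \<open>The size of an entire p for which z^i p behaves like a theta function at infinity.
  Inside the unit disc, where r^(-i) would blow up, it is cut off to a constant.\<close>

definition growth :: "nat \<Rightarrow> real \<Rightarrow> real" where "growth i r = (if r \<le> 1 then 1 else TT r / r ^ i)"

end

text \<open>An entire function normalised at 0 that after multiplication by z^i is asymptotic to c G
  along the good circles. The instances are a (i = 0), b/z (i = 1), and a_inf and t b_inf as
  functions of 1/t (i = 2 and i = 3).\<close>

locale separation = qpar +
  fixes \<sigma> :: real and p G :: "complex \<Rightarrow> complex" and c :: complex and i :: nat
  assumes \<sigma>: "q < \<sigma>" "\<sigma> < 1" and p: "p holomorphic_on UNIV" and p0: "p 0 = 1"
    and G: "G holomorphic_on - {0}" "quasi G" and Gi: "\<And>r. 0 < r \<Longrightarrow> G (\<i> * complex_of_real r) \<noteq> 0"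
    and c: "c \<noteq> 0" and lim: "((\<lambda>z. (z ^ i * p z - c * G z) / g z) \<longlongrightarrow> 0) (Ginf \<sigma>)"
begin

text \<open>The function near the circle |z| = q^(-k) pulled back to a fixed annulus and normalised
  so that its limit there is c G.\<close>

definition An :: "nat \<Rightarrow> complex \<Rightarrow> complex" where
  "An k s = Nf k s * ((s / Q ^ k) ^ i * p (s / Q ^ k))"

lemma holomorphic_An: "An k holomorphic_on - {0}"
proof -
  have "(\<lambda>s. p ((1 / Q ^ k) * s)) holomorphic_on - {0}"
    by (rule holomorphic_scale) (use p holomorphic_on_subset in auto)
  then have "(\<lambda>s. p (s / Q ^ k)) holomorphic_on - {0}" by simp
  then show ?thesis unfolding An_def Nf_def by (intro holomorphic_intros) auto
qed

text \<open>The hypothesis speaks only about good circles. It is applied on the two of radius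
  \<sigma> q^2 and \<sigma> / q^2, and the maximum principle fills the annulus between them. This
  contains the fundamental annulus from 1 to 1/q in its interior.\<close>

lemma An_limit:
  assumes \<epsilon>: "0 < \<epsilon>"
  shows "\<exists>K. \<forall>k\<ge>K. \<forall>s. \<sigma> * q ^ 2 \<le> norm s \<longrightarrow> norm s \<le> \<sigma> / q ^ 2 \<longrightarrow> norm (An k s - c * G s) \<le> \<epsilon>"
proof -
  have \<sigma>0: "\<sigma> > 0" using \<sigma> q0 by simp
  have r: "0 < \<sigma> * q ^ 2" "0 < \<sigma> / q ^ 2" using \<sigma>0 q0 by auto
  have "sphere 0 (\<sigma> * q ^ 2) \<subseteq> - {0::complex}" "sphere 0 (\<sigma> / q ^ 2) \<subseteq> - {0::complex}" using r by auto
  then obtain w1 w2 where w: "\<And>z. norm z = \<sigma> * q ^ 2 \<Longrightarrow> norm (g z) \<le> norm (g w1)" "\<And>z. norm z = \<sigma> / q ^ 2 \<Longrightarrow> norm (g z) \<le> norm (g w2)"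
    using norm_attains_sup_circle[OF holomorphic_g] r by (metis less_imp_le)
  define B where "B = norm (g w1) + norm (g w2) + 1"
  have B: "B > 0" unfolding B_def by (simp add: add_nonneg_pos)
  define D where "D = (\<lambda>z. z ^ i * p z - c * G z)"
  have "eventually (\<lambda>z. dist (D z / g z) 0 < \<epsilon> / B) (Ginf \<sigma>)"
    unfolding D_def by (rule tendstoD[OF lim]) (use \<epsilon> B in simp)
  then obtain X where X: "\<And>z. z \<in> GC \<sigma> \<Longrightarrow> norm z \<ge> X \<Longrightarrow> norm (D z / g z) < \<epsilon> / B"
    unfolding eventually_Ginf by auto
  obtain K where K: "\<forall>k\<ge>K. q ^ k < \<sigma> * q ^ 2 / (\<bar>X\<bar> + 1)" using q_power_small[of "\<sigma> * q ^ 2 / (\<bar>X\<bar> + 1)"] r by auto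
  have eqD: "An k s - c * G s = Nf k s * D (s / Q ^ k)" if "s \<noteq> 0" for k s
    using Nf_quasi[OF G(2) that, of k] unfolding An_def D_def by (simp add: algebra_simps)
  have hol: "(\<lambda>s. An k s - c * G s) holomorphic_on - {0}" for k by (intro holomorphic_intros holomorphic_An G)
  have circ: "norm (An k s - c * G s) \<le> \<epsilon>" if k: "k \<ge> K" and s: "norm s = \<sigma> * q ^ 2 \<or> norm s = \<sigma> / q ^ 2" for k s
  proof -
    define z where "z = s / Q ^ k"
    have s0: "s \<noteq> 0" using s r by auto
    have "norm s = \<sigma> * q powi 2 \<or> norm s = \<sigma> * q powi (- 2)" using s by (auto simp: power_int_minus divide_inverse)
    then have z: "z \<in> GC \<sigma>" unfolding z_def using GC_circle_div by blast
    have "q ^ 2 \<le> 1 / q ^ 2"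
      using q0 q_pows(2)[of 4] by (simp add: pos_le_divide_eq flip: power_add)
    then have "\<sigma> * q ^ 2 \<le> \<sigma> * (1 / q ^ 2)" using \<sigma>0 by (intro mult_left_mono) auto
    then have ge: "\<sigma> * q ^ 2 \<le> norm s" using s by auto
    have "q ^ k * (\<bar>X\<bar> + 1) < \<sigma> * q ^ 2" using K k by (simp add: pos_less_divide_eq)
    then have "(\<bar>X\<bar> + 1) * q ^ k \<le> norm s" using ge by (simp add: mult.commute)
    then have "\<bar>X\<bar> + 1 \<le> norm z" unfolding z_def norm_div_Qk using q0 by (simp add: pos_le_divide_eq)
    then have d: "norm (D z / g z) < \<epsilon> / B" using X[OF z] by simp
    have gz: "g z \<noteq> 0" using GC_facts[OF \<sigma> z] g_eq_0_iff by auto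
    have "Nf k s * D z = D z / g z * (Nf k s * g z)" using gz by simp
    also have "Nf k s * g z = g s" unfolding z_def by (rule Nf_quasi[OF quasi_g s0])
    finally have "norm (Nf k s * D z) = norm (D z / g z) * norm (g s)" by (simp only: norm_mult)
    also have "\<dots> \<le> \<epsilon> / B * B"
      using d s w(1)[of s] w(2)[of s] \<epsilon> B by (intro mult_mono) (auto simp: B_def intro: order_trans)
    finally show ?thesis unfolding eqD[OF s0] z_def[symmetric] using B by simp
  qed
  show ?thesis
  proof (intro exI[of _ K] allI impI)
    fix k and s :: complex assume "K \<le> k" "\<sigma> * q ^ 2 \<le> norm s" "norm s \<le> \<sigma> / q ^ 2"
    then show "norm (An k s - c * G s) \<le> \<epsilon>"
      using maximum_modulus_annulus[OF hol[of k] r(1)] circ by blast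
  qed
qed

lemma annulus_sub: "1 \<le> norm s \<Longrightarrow> norm s \<le> 1 / q \<Longrightarrow> \<sigma> * q ^ 2 < norm s \<and> norm s < \<sigma> / q ^ 2" for s :: complex
proof -
  assume s: "1 \<le> norm s" "norm s \<le> 1 / q"
  have "\<sigma> * q ^ 2 < 1 * 1" using \<sigma> q0 q_pows(2)[of 2] by (intro mult_strict_mono) auto
  moreover have "1 / q < \<sigma> / q ^ 2" using \<sigma> q0 by (simp add: divide_simps power2_eq_square)
  ultimately show ?thesis using s by linarith
qed

text \<open>Otherwise rescaled points with small values accumulate at some l with G l = 0.
  Separation keeps zeros of the rescaled functions out of a fixed disc about l, and Hurwitz's
  theorem then forbids a zero of the limit c G in it.\<close>

lemma large_lower_bound:
  assumes \<delta>: "0 < \<delta>"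
  shows "\<exists>K. \<exists>b>0. \<forall>k\<ge>K. \<forall>s. 1 \<le> norm s \<longrightarrow> norm s \<le> 1 / q \<longrightarrow> zero_separated \<delta> p (s / Q ^ k) \<longrightarrow> b \<le> norm (An k s)"
proof (rule ccontr)
  assume "\<not> ?thesis"
  then have "\<forall>j::nat. \<exists>k\<ge>j. \<exists>s. 1 \<le> norm s \<and> norm s \<le> 1 / q \<and> zero_separated \<delta> p (s / Q ^ k) \<and> norm (An k s) < 1 / real (Suc j)"
    by (metis not_le of_nat_0_less_iff zero_less_Suc zero_less_divide_1_iff)
  then obtain \<kappa> u where \<kappa>: "\<And>j. \<kappa> j \<ge> j" and u: "\<And>j. 1 \<le> norm (u j)" "\<And>j. norm (u j) \<le> 1 / q"
    "\<And>j. zero_separated \<delta> p (u j / Q ^ \<kappa> j)" "\<And>j. norm (An (\<kappa> j) (u j)) < 1 / real (Suc j)"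
    by metis
  let ?A = "cball 0 (1 / q) - ball 0 1 :: complex set"
  have "compact ?A" by (intro compact_diff) auto
  moreover have "\<forall>j. u j \<in> ?A" using u by (auto simp: not_less)
  ultimately obtain l r where l: "l \<in> ?A" "strict_mono r" "(u \<circ> r) \<longlonglongrightarrow> l" unfolding compact_def by meson
  have l1: "1 \<le> norm l" "norm l \<le> 1 / q" using l(1) by auto
  define A' where "A' = {s::complex. \<sigma> * q ^ 2 < norm s \<and> norm s < \<sigma> / q ^ 2}"
  have "open A'" unfolding A'_def by (intro open_Collect_conj open_Collect_less continuous_intros)
  moreover have "l \<in> A'" unfolding A'_def using annulus_sub[OF l1] by simp
  ultimately obtain e0 where e0: "e0 > 0" "ball l e0 \<subseteq> A'" using openE by blast
  \<comment> \<open>In a disc of radius e all |x| \<ge> 1/2. A zero x there would be closer to the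
    separated point than 2 e \<le> \<delta>/4, while separation demands \<delta> |x| \<ge>
    \<delta>/2.\<close>
  define e where "e = min e0 (min (1 / 2) (\<delta> / 8))"
  have e: "e > 0" "ball l e \<subseteq> A'" "e \<le> 1 / 2" "e \<le> \<delta> / 8" using e0 \<delta> unfolding e_def by auto
  have "0 < \<sigma> * q ^ 2" using \<sigma> q0 by simp
  then have A'0: "A' \<subseteq> - {0}" unfolding A'_def by auto
  have bsub: "ball l e \<subseteq> - {0}" using e(2) A'0 by blast
  obtain J where J: "\<And>j. j \<ge> J \<Longrightarrow> norm (u (r j) - l) < e"
    using l(3) e(1) unfolding LIMSEQ_def dist_norm o_def by blast
  \<comment> \<open>The shift by J keeps only members whose points already lie within e of
    l.\<close>
  define F where "F = (\<lambda>j. An (\<kappa> (r (j + J))))"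
  have kge: "\<kappa> (r (j + J)) \<ge> j" for j
    using \<kappa>[of "r (j + J)"] seq_suble[OF l(2), of "j + J"] by linarith
  have Flim: "\<exists>j0. \<forall>j\<ge>j0. \<forall>x\<in>A'. norm (F j x - c * G x) \<le> \<epsilon>" if ep: "\<epsilon> > 0" for \<epsilon>
  proof -
    obtain K where K: "\<forall>k\<ge>K. \<forall>s. \<sigma> * q ^ 2 \<le> norm s \<longrightarrow> norm s \<le> \<sigma> / q ^ 2 \<longrightarrow> norm (An k s - c * G s) \<le> \<epsilon>"
      using An_limit[OF ep] by blast
    have "norm (F j x - c * G x) \<le> \<epsilon>" if "j \<ge> K" "x \<in> A'" for j x
      unfolding F_def using K[rule_format, of "\<kappa> (r (j + J))" x] kge[of j] that unfolding A'_def by auto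
    then show ?thesis by blast
  qed
  have isc: "(c * G l) = 0"
  proof -
    have "(\<lambda>j. c * G (u (r (j + J)))) \<longlonglongrightarrow> c * G l"
    proof -
      have "l \<noteq> 0" using l1(1) by auto
      then have "isCont G l" using isCont_holo[OF G(1), of l] by (simp add: isCont_def)
      moreover have "(\<lambda>j. u (r (j + J))) \<longlonglongrightarrow> l" using LIMSEQ_ignore_initial_segment[OF l(3), of J] by (simp add: o_def)
      ultimately show ?thesis by (rule tendsto_mult[OF tendsto_const isCont_tendsto_compose])
    qed
    moreover have "(\<lambda>j. c * G (u (r (j + J)))) \<longlonglongrightarrow> 0"
    proof (rule LIMSEQ_I)
      fix \<epsilon> :: real assume \<epsilon>: "\<epsilon> > 0"
      obtain j0 where j0: "\<forall>j\<ge>j0. \<forall>x\<in>A'. norm (F j x - c * G x) \<le> \<epsilon> / 2" using Flim[of "\<epsilon> / 2"] \<epsilon> by auto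
      obtain j1 where j1: "1 / real (Suc j1) < \<epsilon> / 2" using nat_approx_posE[of "\<epsilon> / 2"] \<epsilon> by (metis half_gt_zero)
      have X: "norm (c * G (u (r (j + J)))) < \<epsilon>" if j: "j \<ge> max j0 j1" for j
      proof -
        let ?x = "u (r (j + J))"
        have "?x \<in> ball l e" using J[of "j + J"] by (simp add: dist_norm norm_minus_commute)
        then have "norm (F j ?x - c * G ?x) \<le> \<epsilon> / 2" using j0 j e(2) by auto
        moreover have "norm (F j ?x) < 1 / real (Suc (r (j + J)))" unfolding F_def using u(4)[of "r (j + J)"] .
        moreover have "1 / real (Suc (r (j + J))) \<le> 1 / real (Suc j1)"
          using seq_suble[OF l(2), of "j + J"] j by (intro divide_left_mono) auto
        moreover have "norm (c * G ?x) \<le> norm (F j ?x) + norm (F j ?x - c * G ?x)"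
          by (metis norm_triangle_sub norm_minus_commute)
        ultimately show ?thesis using j1 by linarith
      qed
      show "\<exists>no. \<forall>n\<ge>no. norm (c * G (u (r (n + J))) - 0) < \<epsilon>"
        unfolding diff_0_right by (intro exI[of _ "max j0 j1"] allI impI X)
    qed
    ultimately show ?thesis by (rule LIMSEQ_unique)
  qed
  have "c * G l \<noteq> 0"
  proof (rule Hurwitz_no_zeros[of "ball l e" F "\<lambda>x. c * G x"])
    show "F j holomorphic_on ball l e" for j
      unfolding F_def by (rule holomorphic_on_subset[OF holomorphic_An bsub])
    show "(\<lambda>x. c * G x) holomorphic_on ball l e"
      by (intro holomorphic_intros holomorphic_on_subset[OF G(1) bsub])
    show "uniform_limit K F (\<lambda>x. c * G x) sequentially" if K: "compact K" "K \<subseteq> ball l e" for K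
    proof (rule uniform_limitI)
      fix \<epsilon> :: real assume "\<epsilon> > 0"
      then obtain j0 where "\<forall>j\<ge>j0. \<forall>x\<in>A'. norm (F j x - c * G x) \<le> \<epsilon> / 2" using Flim[of "\<epsilon> / 2"] by auto
      then have "\<forall>j\<ge>j0. \<forall>x\<in>K. dist (F j x) (c * G x) < \<epsilon>"
        using K(2) e(2) \<open>\<epsilon> > 0\<close> unfolding dist_norm by (metis field_sum_of_halves less_add_same_cancel1 half_gt_zero order_le_less_trans subsetD)
      then show "\<forall>\<^sub>F j in sequentially. \<forall>x\<in>K. dist (F j x) (c * G x) < \<epsilon>" unfolding eventually_sequentially by blast
    qed
    \<comment> \<open>A constant would have to be 0, contradicting isolated zeros, since G does not
      vanish at the imaginary unit.\<close>
    show "\<not> (\<lambda>x. c * G x) constant_on ball l e"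
    proof
      assume "(\<lambda>x. c * G x) constant_on ball l e"
      then have z: "G x = 0" if "x \<in> ball l e" for x using isc c that e(1) unfolding constant_on_def by (metis centre_in_ball mult_eq_0_iff)
      have conn: "connected (- {0::complex})" by (rule connected_punctured_universe) simp
      have op: "open (- {0::complex})" by (simp add: open_Compl)
      have lz: "l \<in> - {0}" "G l = 0" "\<i> * complex_of_real 1 \<in> - {0}" using l1(1) isc c by auto
      have "\<exists>r'>0. \<forall>z\<in>ball l r' - {l}. G z \<noteq> 0"
      proof (rule isolated_zeros[OF G(1) op conn lz Gi[OF zero_less_one]])
        fix r' assume "0 < r'" "\<And>z. z \<in> ball l r' - {l} \<Longrightarrow> G z \<noteq> 0"
        then show ?thesis by blast
      qed
      then obtain r' where r': "0 < r'" "\<forall>z\<in>ball l r' - {l}. G z \<noteq> 0" by blast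
      define y where "y = l + complex_of_real (min e r' / 2)"
      have "y \<in> ball l e" "y \<in> ball l r' - {l}" unfolding y_def using e(1) r'(1) by (auto simp: dist_norm)
      then show False using z r'(2) by blast
    qed
    show "F j x \<noteq> 0" if x: "x \<in> ball l e" for j x
    proof
      assume "F j x = 0"
      let ?k = "\<kappa> (r (j + J))" and ?u = "u (r (j + J))"
      have x0: "x \<noteq> 0" using x bsub by blast
      then have "p (x / Q ^ ?k) = 0" using \<open>F j x = 0\<close> unfolding F_def An_def by (simp add: Nf_nz)
      then have "\<delta> * norm (x / Q ^ ?k) \<le> dist (?u / Q ^ ?k) (x / Q ^ ?k)"
        using u(3)[of "r (j + J)"] unfolding zero_separated_def by blast
      also have "dist (?u / Q ^ ?k) (x / Q ^ ?k) = norm (?u - x) / q ^ ?k"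
        unfolding dist_norm norm_div_Qk[symmetric] by (simp add: diff_divide_distrib)
      finally have "\<delta> * norm x / q ^ ?k \<le> norm (?u - x) / q ^ ?k" unfolding norm_div_Qk by simp
      then have 1: "\<delta> * norm x \<le> norm (?u - x)" using q0 by (simp add: divide_le_cancel)
      have 2: "norm (?u - x) \<le> norm (?u - l) + norm (l - x)" by (metis norm_triangle_ineq diff_add_cancel add_diff_eq)
      have 3: "norm (?u - l) < e" "norm (l - x) < e" using J[of "j + J"] x by (auto simp: dist_norm)
      have "norm l \<le> norm (l - x) + norm x" by (metis norm_triangle_sub add.commute)
      then have "1 / 2 \<le> norm x" using 3 e(3) l1 by linarith
      then have "\<delta> * (1 / 2) \<le> \<delta> * norm x" using \<delta> by (intro mult_left_mono) auto
      then show False using 1 2 3 e(4) \<delta> by linarith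
    qed
  qed (use e in auto)
  then show False using isc by simp
qed

lemma growth_scale:
  assumes "1 \<le> norm s" "k \<ge> 1"
  shows "norm (Nf k s) * norm (s / Q ^ k) ^ i * growth i (norm (s / Q ^ k)) = TT (norm s)"
proof -
  have "q ^ k < 1" using q_pows(2)[of k] assms by simp
  then have "1 < norm s / q ^ k" using assms q0 by (simp add: pos_less_divide_eq)
  then have "growth i (norm (s / Q ^ k)) = TT (norm s / q ^ k) / (norm s / q ^ k) ^ i" unfolding growth_def norm_div_Qk by simp
  moreover have "norm s / q ^ k \<noteq> 0" using assms q0 by auto
  ultimately show ?thesis using TT_scale[of s k] assms unfolding norm_div_Qk by (simp add: mult_ac)
qed

lemma growth_bounds: "\<exists>m1 m2. 0 < m1 \<and> (\<forall>r. 0 \<le> r \<and> r \<le> R \<longrightarrow> m1 \<le> growth i r \<and> growth i r \<le> m2)"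
proof -
  define R' where "R' = max R 1"
  obtain m1 m2 where m: "0 < m1" "\<And>r. 1 \<le> r \<Longrightarrow> r \<le> R' \<Longrightarrow> m1 \<le> TT r \<and> TT r \<le> m2"
    using TT_bounds[of 1 R'] unfolding R'_def by auto
  have m2: "m1 \<le> m2" using m(2)[of 1] unfolding R'_def by auto
  have "min 1 (m1 / R' ^ i) \<le> growth i r \<and> growth i r \<le> max 1 m2" if r: "0 \<le> r" "r \<le> R" for r
  proof (cases "r \<le> 1")
    case False
    have pw: "1 \<le> r ^ i" "r ^ i \<le> R' ^ i" using False r unfolding R'_def by (auto intro!: one_le_power power_mono)
    have t: "m1 \<le> TT r" "TT r \<le> m2" using m(2)[of r] False r unfolding R'_def by auto
    have "m1 / R' ^ i \<le> TT r / r ^ i" using t pw m(1) by (intro frac_le) auto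
    moreover have "TT r / r ^ i \<le> m2 / 1" using t pw m(1) m2 by (intro frac_le) auto
    ultimately show ?thesis using False unfolding growth_def by auto
  qed (auto simp: growth_def)
  moreover have "0 < min 1 (m1 / R' ^ i)" using m(1) unfolding R'_def by auto
  ultimately show ?thesis by blast
qed

lemma norm_An: "norm (An k s) = norm (Nf k s) * norm (s / Q ^ k) ^ i * norm (p (s / Q ^ k))"
  unfolding An_def by (simp add: norm_mult norm_power)

text \<open>Bounds for the rescaled function on the fundamental annulus, where \<open>TT\<close>
  lies between positive constants, thereby become bounds for p relative to
  \<open>growth\<close>.\<close>

lemma transfer:
  assumes "1 \<le> norm s" "k \<ge> 1"
  shows "norm (An k s) * growth i (norm (s / Q ^ k)) = TT (norm s) * norm (p (s / Q ^ k))"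
  using growth_scale[OF assms] unfolding norm_An by (metis mult.assoc mult.commute)

lemma growth_pos: "0 \<le> r \<Longrightarrow> 0 < growth i r"
  using growth_bounds[of r] by (meson less_le_trans order_refl)

text \<open>Large z are rescaled to the fundamental annulus. For bounded z compactness suffices: a
  zero of p is separated from itself only if it is 0, and p 0 = 1.\<close>

theorem separated_lower_bound:
  assumes \<delta>: "0 < \<delta>"
  shows "\<exists>b>0. \<forall>z. zero_separated \<delta> p z \<longrightarrow> b * growth i (norm z) \<le> norm (p z)"
proof -
  obtain K b where b: "b > 0" "\<And>k s. k \<ge> K \<Longrightarrow> 1 \<le> norm s \<Longrightarrow> norm s \<le> 1 / q \<Longrightarrow> zero_separated \<delta> p (s / Q ^ k) \<Longrightarrow> b \<le> norm (An k s)"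
    using large_lower_bound[OF \<delta>] by blast
  have q1': "1 \<le> 1 / q" using q0 q1 by simp
  obtain t1 t2 where t: "0 < t1" "\<And>r. 1 \<le> r \<Longrightarrow> r \<le> 1 / q \<Longrightarrow> t1 \<le> TT r \<and> TT r \<le> t2" using TT_bounds[of 1 "1 / q"] q1' by auto
  have t2: "t2 > 0" using t q1' by (meson less_le_trans order_refl)
  define R where "R = 1 / q ^ (max K 1 + 1)"
  obtain m1 m2 where m: "0 < m1" "\<And>r. 0 \<le> r \<Longrightarrow> r \<le> R \<Longrightarrow> m1 \<le> growth i r \<and> growth i r \<le> m2" using growth_bounds[of R] by auto
  have large: "b / t2 * growth i (norm z) \<le> norm (p z)" if z: "zero_separated \<delta> p z" "R \<le> norm z" for z
  proof -
    obtain k s where ks: "k \<ge> max K 1" "z = s / Q ^ k" "1 \<le> norm s" "norm s \<le> 1 / q"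
      using scale_large[of "max K 1" z] z(2) unfolding R_def by blast
    have "b \<le> norm (An k s)" using b(2)[of k s] ks z(1) by auto
    then have "b * growth i (norm z) \<le> norm (An k s) * growth i (norm z)" using growth_pos[of "norm z"] by (intro mult_right_mono) auto
    also have "\<dots> = TT (norm s) * norm (p z)" using transfer[of s k] ks by simp
    also have "\<dots> \<le> t2 * norm (p z)" using t(2) ks by (intro mult_right_mono) auto
    finally show ?thesis using t2 by (simp add: pos_divide_le_eq mult.commute)
  qed
  have "closed {z. zero_separated \<delta> p z}"
    unfolding zero_separated_def by (intro closed_Collect_all closed_Collect_imp open_Collect_const closed_Collect_le continuous_intros)
  then have comp: "compact ({z. zero_separated \<delta> p z} \<inter> cball 0 R)" by (intro closed_Int_compact compact_cball)
  have nz: "p z \<noteq> 0" if "zero_separated \<delta> p z" for z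
  proof
    assume "p z = 0"
    then have "\<delta> * norm z \<le> 0" using that unfolding zero_separated_def by force
    then have "z = 0" using \<delta> by (simp add: mult_le_0_iff)
    then show False using p0 \<open>p z = 0\<close> by simp
  qed
  obtain b2 where b2: "b2 > 0" "\<And>z. zero_separated \<delta> p z \<Longrightarrow> norm z \<le> R \<Longrightarrow> b2 \<le> norm (p z)"
  proof (cases "{z. zero_separated \<delta> p z} \<inter> cball 0 R = {}")
    case True
    show ?thesis by (rule that[of 1]) (use True in auto)
  next
    case False
    have "continuous_on ({z. zero_separated \<delta> p z} \<inter> cball 0 R) (\<lambda>z. norm (p z))"
      by (intro continuous_on_norm holomorphic_on_imp_continuous_on holomorphic_on_subset[OF p]) auto
    from continuous_attains_inf[OF comp False this] obtain v where
      v: "v \<in> {z. zero_separated \<delta> p z} \<inter> cball 0 R" "\<forall>y\<in>{z. zero_separated \<delta> p z} \<inter> cball 0 R. norm (p v) \<le> norm (p y)"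
      by (elim bexE)
    show ?thesis by (rule that[of "norm (p v)"]) (use v nz in auto)
  qed
  have R0: "0 \<le> R" unfolding R_def using q0 by simp
  have m2: "0 < m2" using m(2)[of 0] m(1) R0 by linarith
  have small: "b2 / m2 * growth i (norm z) \<le> norm (p z)" if z: "zero_separated \<delta> p z" "norm z \<le> R" for z
  proof -
    have "b2 / m2 * growth i (norm z) \<le> b2 / m2 * m2" using m(2)[of "norm z"] z b2(1) m2 by (intro mult_left_mono) auto
    then show ?thesis using b2(2)[OF z] m2 by simp
  qed
  have "min (b / t2) (b2 / m2) * growth i (norm z) \<le> norm (p z)" if z: "zero_separated \<delta> p z" for z
  proof -
    have "min (b / t2) (b2 / m2) * growth i (norm z) \<le> b / t2 * growth i (norm z)" "min (b / t2) (b2 / m2) * growth i (norm z) \<le> b2 / m2 * growth i (norm z)"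
      using growth_pos[of "norm z"] by (auto intro!: mult_right_mono simp del: times_divide_eq_left)
    then show ?thesis using large[OF z] small[OF z] by (metis linear order_trans)
  qed
  moreover have "min (b / t2) (b2 / m2) > 0" using b b2 t2 m2 by simp
  ultimately show ?thesis by blast
qed

theorem upper_bound: "\<exists>C>0. \<forall>z. norm (p z) \<le> C * growth i (norm z)"
proof -
  have q1': "1 \<le> 1 / q" using q0 q1 by simp
  obtain t1 t2 where t: "0 < t1" "\<And>r. 1 \<le> r \<Longrightarrow> r \<le> 1 / q \<Longrightarrow> t1 \<le> TT r \<and> TT r \<le> t2" using TT_bounds[of 1 "1 / q"] q1' by auto
  obtain K where K: "\<forall>k\<ge>K. \<forall>s. \<sigma> * q ^ 2 \<le> norm s \<longrightarrow> norm s \<le> \<sigma> / q ^ 2 \<longrightarrow> norm (An k s - c * G s) \<le> 1"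
    using An_limit[of 1] by auto
  let ?A = "cball 0 (1 / q) - ball 0 1 :: complex set"
  have "compact (G ` ?A)"
    by (intro compact_continuous_image holomorphic_on_imp_continuous_on holomorphic_on_subset[OF G(1)] compact_diff) auto
  then obtain B where B: "\<And>s. s \<in> ?A \<Longrightarrow> norm (G s) \<le> B" by (meson compact_imp_bounded bounded_iff imageI)
  define R where "R = 1 / q ^ (max K 1 + 1)"
  have R0: "0 < R" unfolding R_def using q0 by simp
  obtain m1 m2 where m: "0 < m1" "\<And>r. 0 \<le> r \<Longrightarrow> r \<le> R \<Longrightarrow> m1 \<le> growth i r \<and> growth i r \<le> m2" using growth_bounds[of R] by auto
  define D where "D = norm c * \<bar>B\<bar> + 1"
  have D: "D > 0" unfolding D_def by (simp add: add_nonneg_pos)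
  have large: "norm (p z) \<le> D / t1 * growth i (norm z)" if z: "R \<le> norm z" for z
  proof -
    obtain k s where ks: "k \<ge> max K 1" "z = s / Q ^ k" "1 \<le> norm s" "norm s \<le> 1 / q"
      using scale_large[of "max K 1" z] z unfolding R_def by blast
    have "norm (An k s - c * G s) \<le> 1" using K ks annulus_sub[OF ks(3,4)] by auto
    moreover have "norm (c * G s) \<le> norm c * \<bar>B\<bar>"
      using B[of s] ks unfolding norm_mult by (intro mult_left_mono) auto
    ultimately have "norm (An k s) \<le> D" unfolding D_def using norm_triangle_sub[of "An k s" "c * G s"] by linarith
    have "t1 * norm (p z) \<le> TT (norm s) * norm (p z)" using t(2) ks by (intro mult_right_mono) auto
    also have "\<dots> = norm (An k s) * growth i (norm z)" using transfer[of s k] ks by simp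
    also have "\<dots> \<le> D * growth i (norm z)" using \<open>norm (An k s) \<le> D\<close> growth_pos[of "norm z"] by (intro mult_right_mono) auto
    finally show ?thesis using t(1) by (simp add: pos_le_divide_eq mult.commute)
  qed
  obtain w where w: "\<And>z. norm z = R \<Longrightarrow> norm (p z) \<le> norm (p w)" using norm_attains_sup_circle[OF p] R0 by (metis less_imp_le top_greatest)
  have small: "norm (p z) \<le> norm (p w) / m1 * growth i (norm z)" if z: "norm z \<le> R" for z
  proof -
    have "norm (p z) \<le> norm (p w)" by (rule maximum_modulus_cball[OF p z R0 w])
    also have "\<dots> = norm (p w) / m1 * m1" using m(1) by simp
    also have "\<dots> \<le> norm (p w) / m1 * growth i (norm z)" using m(1) m(2)[of "norm z"] z by (intro mult_left_mono) auto
    finally show ?thesis .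
  qed
  let ?C = "max (D / t1) (norm (p w) / m1)"
  have "norm (p z) \<le> ?C * growth i (norm z)" for z
  proof -
    have "D / t1 * growth i (norm z) \<le> ?C * growth i (norm z)" "norm (p w) / m1 * growth i (norm z) \<le> ?C * growth i (norm z)"
      using growth_pos[of "norm z"] by (auto intro!: mult_right_mono simp del: times_divide_eq_left)
    then show ?thesis using large[of z] small[of z] by (metis linear order_trans)
  qed
  moreover have "?C > 0" using D t(1) by (simp add: less_max_iff_disj)
  ultimately show ?thesis by blast
qed

text \<open>On the imaginary axis G has no zeros, so for large radii the point there serves without
  any separation. For small radii the maximum modulus is at least |p 0| = 1.\<close>

theorem circle_lower_bound: "\<exists>b>0. \<forall>r\<ge>0. \<exists>\<zeta>. norm \<zeta> = r \<and> b * growth i r \<le> norm (p \<zeta>)"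
proof -
  have q1': "1 \<le> 1 / q" using q0 q1 by simp
  obtain t1 t2 where t: "0 < t1" "\<And>r. 1 \<le> r \<Longrightarrow> r \<le> 1 / q \<Longrightarrow> t1 \<le> TT r \<and> TT r \<le> t2" using TT_bounds[of 1 "1 / q"] q1' by auto
  have t2: "t2 > 0" using t q1' by (meson less_le_trans order_refl)
  have cont: "continuous_on {1..1 / q} (\<lambda>r. norm (c * G (\<i> * complex_of_real r)))"
  proof -
    have "continuous_on {1..1 / q} (G \<circ> (\<lambda>r. \<i> * complex_of_real r))"
      by (rule continuous_on_compose[OF _ continuous_on_subset[OF holomorphic_on_imp_continuous_on[OF G(1)]]])
         (auto intro!: continuous_intros)
    then show ?thesis unfolding o_def by (intro continuous_intros)
  qed
  have ne: "{1..1 / q} \<noteq> {}" using q1' by auto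
  obtain v where v: "v \<in> {1..1 / q}" "\<forall>r\<in>{1..1 / q}. norm (c * G (\<i> * complex_of_real v)) \<le> norm (c * G (\<i> * complex_of_real r))"
    using continuous_attains_inf[OF compact_Icc ne cont] by (elim bexE)
  define d where "d = norm (c * G (\<i> * complex_of_real v))"
  have d: "d > 0" unfolding d_def using c Gi[of v] v(1) by auto
  obtain K where K: "\<forall>k\<ge>K. \<forall>s. \<sigma> * q ^ 2 \<le> norm s \<longrightarrow> norm s \<le> \<sigma> / q ^ 2 \<longrightarrow> norm (An k s - c * G s) \<le> d / 2"
    using An_limit[of "d / 2"] d by auto
  define R where "R = 1 / q ^ (max K 1 + 1)"
  have R0: "0 < R" unfolding R_def using q0 by simp
  obtain m1 m2 where m: "0 < m1" "\<And>r. 0 \<le> r \<Longrightarrow> r \<le> R \<Longrightarrow> m1 \<le> growth i r \<and> growth i r \<le> m2" using growth_bounds[of R] by auto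
  have m2: "0 < m2" using m(2)[of 0] m(1) R0 by linarith
  have large: "d / 2 / t2 * growth i r \<le> norm (p (\<i> * complex_of_real r))" if r: "R \<le> r" for r
  proof -
    let ?z = "\<i> * complex_of_real r"
    have r0: "r > 0" using r R0 by simp
    have nz: "norm ?z = r" using r0 by (simp add: norm_mult)
    obtain k s where ks: "k \<ge> max K 1" "?z = s / Q ^ k" "1 \<le> norm s" "norm s \<le> 1 / q"
      using scale_large[of "max K 1" ?z] r nz unfolding R_def by auto
    have "s = ?z * Q ^ k" using ks(2) by simp
    also have "\<dots> = \<i> * complex_of_real (r * q ^ k)" by simp
    finally have s: "s = \<i> * complex_of_real (norm s)" using r0 q0 by (simp add: norm_mult norm_power)
    have "d \<le> norm (c * G s)" unfolding d_def using v(2) ks(3,4) by (subst s) auto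
    moreover have "norm (An k s - c * G s) \<le> d / 2" using K ks annulus_sub[OF ks(3,4)] by auto
    ultimately have "d / 2 \<le> norm (An k s)" using norm_triangle_sub[of "c * G s" "An k s"] by (simp add: norm_minus_commute)
    then have "d / 2 * growth i r \<le> norm (An k s) * growth i r" using growth_pos[of r] r0 by (intro mult_right_mono) auto
    also have "\<dots> = TT (norm s) * norm (p ?z)" using transfer[of s k] ks nz by simp
    also have "\<dots> \<le> t2 * norm (p ?z)" using t(2) ks by (intro mult_right_mono) auto
    finally show ?thesis using t2 by (simp add: pos_divide_le_eq mult.commute)
  qed
  have "\<exists>\<zeta>. norm \<zeta> = r \<and> min (d / 2 / t2) (1 / m2) * growth i r \<le> norm (p \<zeta>)" if r: "r \<ge> 0" for r
  proof (cases "R \<le> r")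
    case True
    have "min (d / 2 / t2) (1 / m2) * growth i r \<le> d / 2 / t2 * growth i r" using growth_pos[OF r] by (intro mult_right_mono) auto
    then show ?thesis using large[OF True] r by (intro exI[of _ "\<i> * complex_of_real r"]) (auto simp: norm_mult)
  next
    case False
    obtain \<zeta> where \<zeta>: "norm \<zeta> = r" "norm (p 0) \<le> norm (p \<zeta>)" using holomorphic_circle_ge_center[OF p r] by blast
    have "min (d / 2 / t2) (1 / m2) * growth i r \<le> 1 / m2 * growth i r" using growth_pos[OF r] by (intro mult_right_mono) auto
    also have "\<dots> \<le> 1 / m2 * m2" using m(2)[of r] False r m2 by (intro mult_left_mono) auto
    also have "\<dots> \<le> norm (p \<zeta>)" using m2 \<zeta>(2) p0 by simp
    finally show ?thesis using \<zeta>(1) by blast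
  qed
  moreover have "min (d / 2 / t2) (1 / m2) > 0" using d t2 m2 by simp
  ultimately show ?thesis by blast
qed

end

section \<open>Connection constants\<close>

lemma bounded_bigo_1:
  fixes f :: "'a \<Rightarrow> complex"
  shows "eventually (\<lambda>x. norm (f x) \<le> B) F \<Longrightarrow> f \<in> O[F](\<lambda>_. 1 :: complex)"
  by (rule bigoI[of _ B]) auto

lemma tendsto_bigo_1:
  fixes f :: "'a \<Rightarrow> complex"
  assumes "(f \<longlongrightarrow> l) F"
  shows "f \<in> O[F](\<lambda>_. 1 :: complex)"
proof (rule bounded_bigo_1)
  have "eventually (\<lambda>x. dist (f x) l < 1) F" using assms by (rule tendstoD) simp
  then show "eventually (\<lambda>x. norm (f x) \<le> norm l + 1) F"
  proof eventually_elim
    case (elim x)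
    then show ?case using norm_triangle_sub[of "f x" l] by (simp add: dist_norm)
  qed
qed

lemma bigo_mult_bounded:
  fixes f :: "'a \<Rightarrow> complex"
  assumes "h \<in> O[F](\<lambda>_. 1)" "f \<in> O[F](g)"
  shows "(\<lambda>x. h x * f x) \<in> O[F](g)"
  using landau_o.big.mult[OF assms] by simp

lemma bigo_imp_tendsto:
  fixes f :: "'a \<Rightarrow> complex"
  assumes "(\<lambda>x. f x - l) \<in> O[F](g)" "(g \<longlongrightarrow> (0::complex)) F"
  shows "(f \<longlongrightarrow> l) F"
proof -
  obtain c where "eventually (\<lambda>x. norm (f x - l) \<le> c * norm (g x)) F" using landau_o.bigE[OF assms(1)] by blast
  moreover have "((\<lambda>x. c * norm (g x)) \<longlongrightarrow> c * 0) F" using assms(2) by (intro tendsto_intros tendsto_norm_zero)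
  ultimately have "((\<lambda>x. f x - l) \<longlongrightarrow> 0) F" using Lim_null_comparison by fastforce
  then show ?thesis by (simp add: LIM_zero_iff)
qed

lemma bigo_trans_diff:
  fixes f g :: "'a \<Rightarrow> complex"
  shows "(\<lambda>x. f x - l x) \<in> O[F](e) \<Longrightarrow> l \<in> O[F](\<lambda>_. 1) \<Longrightarrow> e \<in> O[F](\<lambda>_. 1) \<Longrightarrow> f \<in> O[F](\<lambda>_. 1)"
  using sum_in_bigo(1)[of "\<lambda>x. f x - l x" F "\<lambda>_. 1" l] landau_o.big_trans[of "\<lambda>x. f x - l x" F e "\<lambda>_. 1"] by simp

text \<open>Apart from s^e only even powers of s = 1/z occur, so the sum is a power series in u =
  s^2. Every u is a square, which transfers convergence to the u-disc of radius r^2.\<close>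

lemma series_at_infinity:
  fixes c :: "nat \<Rightarrow> complex" and f :: "complex \<Rightarrow> complex"
  assumes R: "0 \<le> R" and s: "\<And>z. norm z > R \<Longrightarrow> (\<lambda>j. c j / z ^ (2 * j + e)) sums f z"
  shows "\<exists>F. (\<forall>r. r * R \<le> 1 \<longrightarrow> F holomorphic_on ball 0 r) \<and> F 0 = c 0 \<and>
    (\<forall>s. s \<noteq> 0 \<longrightarrow> norm s * R < 1 \<longrightarrow> f (1 / s) = s ^ e * F s)"
proof -
  define G where "G = (\<lambda>u. \<Sum>j. c j * u ^ j)"
  have main: "(\<lambda>j. c j * (s ^ 2) ^ j) sums G (s ^ 2) \<and> f (1 / s) = s ^ e * G (s ^ 2)" if s0: "s \<noteq> 0" "norm s * R < 1" for s
  proof -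
    have "norm (1 / s) > R" using s0 by (simp add: norm_divide pos_less_divide_eq mult.commute)
    then have "(\<lambda>j. c j / (1 / s) ^ (2 * j + e)) sums f (1 / s)" by (rule s)
    moreover have "c j / (1 / s) ^ (2 * j + e) = s ^ e * (c j * (s ^ 2) ^ j)" for j
      by (simp add: power_divide power_add power_mult)
    ultimately have 1: "(\<lambda>j. s ^ e * (c j * (s ^ 2) ^ j)) sums f (1 / s)" by simp
    then have "(\<lambda>j. s ^ e * (c j * (s ^ 2) ^ j) / s ^ e) sums (f (1 / s) / s ^ e)" by (rule sums_divide)
    then have "(\<lambda>j. c j * (s ^ 2) ^ j) sums (f (1 / s) / s ^ e)" using s0 by simp
    moreover from this have "G (s ^ 2) = f (1 / s) / s ^ e" unfolding G_def by (rule sums_unique[symmetric])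
    ultimately show ?thesis using s0 by (simp add: power_mult)
  qed
  have holG: "G holomorphic_on ball 0 (r ^ 2)" if r: "r > 0" "r * R \<le> 1" for r
  proof (rule power_series_holomorphic)
    fix w :: complex assume w: "w \<in> ball 0 (r ^ 2)"
    show "(\<lambda>n. c n * (w - 0) ^ n) sums G w"
    proof (cases "w = 0")
      case True
      have "(\<lambda>n. c n * 0 ^ n) sums c 0" using sums_single[of 0 c] by (rule sums_cong[THEN iffD1, rotated]) auto
      then show ?thesis unfolding True G_def using sums_unique by force
    next
      case False
      define s where "s = csqrt w"
      have sw: "s ^ 2 = w" unfolding s_def by simp
      have "norm s ^ 2 < r ^ 2" using w sw by (simp flip: norm_power)
      then have "norm s < r" using r(1) by (simp add: power2_less_imp_less)
      then have "norm s * R < 1"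
        using r R by (cases "R = 0") (auto intro: less_le_trans[OF mult_strict_right_mono[of "norm s" r R]])
      moreover have "s \<noteq> 0" using sw False by auto
      ultimately show ?thesis using main[of s] sw by (simp add: power_mult)
    qed
  qed
  define F where "F = (\<lambda>s. G (s ^ 2))"
  have "F holomorphic_on ball 0 r" if r: "r * R \<le> 1" for r
  proof (cases "r > 0")
    case True
    have "(G \<circ> (\<lambda>s. s ^ 2)) holomorphic_on ball 0 r"
      by (rule holomorphic_on_compose_gen[OF _ holG[OF True r]])
         (use True in \<open>auto intro!: holomorphic_intros power_strict_mono simp: norm_power\<close>)
    then show ?thesis unfolding F_def o_def .
  next
    case False
    then have "ball 0 r = ({} :: complex set)" by auto
    then show ?thesis by (simp only: holomorphic_on_empty)
  qed
  moreover have "F 0 = c 0"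
  proof -
    have "(\<lambda>n. c n * 0 ^ n) sums c 0" using sums_single[of 0 c] by (rule sums_cong[THEN iffD1, rotated]) auto
    then show ?thesis unfolding F_def G_def using sums_unique by force
  qed
  moreover have "f (1 / s) = s ^ e * F s" if "s \<noteq> 0" "norm s * R < 1" for s
    using main[OF that] unfolding F_def by simp
  ultimately show ?thesis by (intro exI[of _ F]) blast
qed

lemma holomorphic_diff_bigo:
  fixes F :: "complex \<Rightarrow> complex"
  assumes "F holomorphic_on ball 0 r" "r > 0"
  shows "(\<lambda>s. F s - F 0) \<in> O[at 0](\<lambda>s. s)"
proof -
  have "(F has_field_derivative deriv F 0) (at 0)"
    using assms holomorphic_derivI[of F "ball 0 r" 0 UNIV] by simp
  then have "((\<lambda>s. (F s - F 0) / s) \<longlongrightarrow> deriv F 0) (at 0)"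
    by (simp add: has_field_derivative_iff)
  then show ?thesis by (rule bigoI_tendsto) (simp add: eventually_at_filter)
qed

section \<open>The special functions with their connection formulas, and a good radius\<close>

locale asym = ortho +
  fixes \<sigma> :: real
    and a b phi_even varphi_even varphi_odd :: "complex \<Rightarrow> complex"
    and a_inf b_inf Psi_even Psi_odd tPsi_even tPsi_odd :: "complex \<Rightarrow> complex"
    and eta1 eta2 lam3 lam4 mu1 mu2 mu3 mu4 c_Psi :: complex
  assumes \<sigma>: "q < \<sigma>" "\<sigma> < 1" and h_nz: "\<forall>z\<in>GC \<sigma>. h z \<noteq> 0"
    and a: "normalised_even_entire a"
    and b: "normalised_odd_entire b"
    and phi_even: "normalised_even_series_at_infinity 0 phi_even"
    and varphi_even: "normalised_even_series_at_infinity q varphi_even"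
    and varphi_odd: "normalised_odd_series_at_infinity q varphi_odd"
    and eta: "\<And>z. norm z > q \<Longrightarrow> z \<notin> Lam \<Longrightarrow>
                a z / g z = eta1 * h z * varphi_odd z + eta2 * varphi_even z"
    and lam: "\<And>z. z \<noteq> 0 \<Longrightarrow> z \<notin> Lam \<Longrightarrow> W z \<noteq> 0 \<Longrightarrow>
                phi_even z = g z * (1 / W z) * (lam3 * h z * b z + lam4 * a z)"
    and a_inf: "normalised_even_series_at_infinity 0 a_inf"
    and b_inf: "normalised_odd_series_at_infinity 0 b_inf"
    and Psi_even: "normalised_even_entire Psi_even"
    and Psi_odd: "normalised_odd_entire Psi_odd" "\<forall>t. Psi_eq q Psi_odd t"
    and tPsi_even: "normalised_even_entire tPsi_even"
    and tPsi_odd: "normalised_odd_entire tPsi_odd"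
    and mu_a: "\<And>t. t \<noteq> 0 \<Longrightarrow> t \<notin> Lam \<Longrightarrow>
                a_inf t / g t = mu1 * h t * Psi_odd t + mu2 * Psi_even t"
    and mu_b: "\<And>t. t \<noteq> 0 \<Longrightarrow> t \<notin> Lam \<Longrightarrow>
                b_inf t / g t = mu3 * tPsi_odd t + mu4 * h t * tPsi_even t"
    and c_Psi: "c_Psi \<noteq> 0"
               "\<exists>r>0. (\<lambda>t. tPsi_even t / g t - c_Psi)
                   \<in> O[inf at_infinity (principal {t. \<forall>p\<in>Lam. dist t p > r})](\<lambda>t. 1 / t)"
begin

abbreviation "FF \<equiv> Ginf \<sigma>"

lemma \<sigma>_pos: "0 < \<sigma>" using \<sigma> q0 by linarith

lemma hol_a: "a holomorphic_on S" and a_even: "a (- z) = a z" and a_0: "a 0 = 1"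
  using a holomorphic_on_subset unfolding normalised_even_entire_def by auto

lemma hol_b: "b holomorphic_on S" and b_odd: "b (- z) = - b z" and b_deriv: "deriv b 0 = 1"
  using b holomorphic_on_subset unfolding normalised_odd_entire_def by auto

lemma b_0: "b 0 = 0" using b_odd[of 0] by simp

lemma Psi_hol: "Psi_even holomorphic_on S" "Psi_odd holomorphic_on S" "tPsi_even holomorphic_on S" "tPsi_odd holomorphic_on S"
  using Psi_even Psi_odd tPsi_even tPsi_odd holomorphic_on_subset
  unfolding normalised_even_entire_def normalised_odd_entire_def by auto

lemma Psi_0: "Psi_even 0 = 1" "tPsi_even 0 = 1" "Psi_odd 0 = 0" "tPsi_odd 0 = 0"
proof -
  have "Psi_odd (- 0) = - Psi_odd 0" "tPsi_odd (- 0) = - tPsi_odd 0"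
    using Psi_odd tPsi_odd unfolding normalised_odd_entire_def by blast+
  then show "Psi_odd 0 = 0" "tPsi_odd 0 = 0" by simp_all
qed (use Psi_even tPsi_even in \<open>auto simp: normalised_even_entire_def\<close>)

text \<open>The functions analytic up to infinity are treated as entire functions of s = 1/z with
  value 1 at 0; for b_inf the factor s is split off.\<close>

definition phi_s :: "complex \<Rightarrow> complex" where
  "phi_s = (SOME F. F holomorphic_on UNIV \<and> F 0 = 1 \<and> (\<forall>s. s \<noteq> 0 \<longrightarrow> phi_even (1 / s) = F s))"

definition ainf_s :: "complex \<Rightarrow> complex" where
  "ainf_s = (SOME F. F holomorphic_on UNIV \<and> F 0 = 1 \<and> (\<forall>s. s \<noteq> 0 \<longrightarrow> a_inf (1 / s) = F s))"

definition binf_s :: "complex \<Rightarrow> complex" where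
  "binf_s = (SOME F. F holomorphic_on UNIV \<and> F 0 = 1 \<and> (\<forall>s. s \<noteq> 0 \<longrightarrow> b_inf (1 / s) = s * F s))"

lemma holomorphic_on_UNIV_balls:
  fixes F :: "complex \<Rightarrow> complex"
  assumes "\<And>r. F holomorphic_on ball 0 r"
  shows "F holomorphic_on UNIV"
proof -
  have "F holomorphic_on (\<Union>n::nat. ball 0 (real n))" by (rule holomorphic_on_UN_open) (use assms in auto)
  moreover have "(\<Union>n::nat. ball (0::complex) (real n)) = UNIV" by (auto simp: reals_Archimedean2)
  ultimately show ?thesis by simp
qed

lemma even_series_entire:
  assumes "normalised_even_series_at_infinity 0 f"
  shows "\<exists>F. F holomorphic_on UNIV \<and> F 0 = 1 \<and> (\<forall>s. s \<noteq> 0 \<longrightarrow> f (1 / s) = F s)"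
proof -
  obtain c where c: "c 0 = 1" "\<And>z. norm z > 0 \<Longrightarrow> (\<lambda>j. c j / z ^ (2 * j + 0)) sums f z"
    using assms unfolding normalised_even_series_at_infinity_def by auto
  obtain F where F: "\<And>r. r * 0 \<le> 1 \<Longrightarrow> F holomorphic_on ball 0 r" "F 0 = c 0"
    "\<And>s. s \<noteq> 0 \<Longrightarrow> norm s * 0 < 1 \<Longrightarrow> f (1 / s) = s ^ 0 * F s"
    using series_at_infinity[OF order_refl c(2)] by blast
  have "F holomorphic_on UNIV" by (rule holomorphic_on_UNIV_balls) (use F(1) in auto)
  then show ?thesis using F c(1) by auto
qed

lemma odd_series_entire:
  assumes "normalised_odd_series_at_infinity 0 f"
  shows "\<exists>F. F holomorphic_on UNIV \<and> F 0 = 1 \<and> (\<forall>s. s \<noteq> 0 \<longrightarrow> f (1 / s) = s * F s)"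
proof -
  obtain c where c: "c 0 = 1" "\<And>z. norm z > 0 \<Longrightarrow> (\<lambda>j. c j / z ^ (2 * j + 1)) sums f z"
    using assms unfolding normalised_odd_series_at_infinity_def by auto
  obtain F where F: "\<And>r. r * 0 \<le> 1 \<Longrightarrow> F holomorphic_on ball 0 r" "F 0 = c 0"
    "\<And>s. s \<noteq> 0 \<Longrightarrow> norm s * 0 < 1 \<Longrightarrow> f (1 / s) = s ^ 1 * F s"
    using series_at_infinity[OF order_refl c(2)] by blast
  have "F holomorphic_on UNIV" by (rule holomorphic_on_UNIV_balls) (use F(1) in auto)
  then show ?thesis using F c(1) by auto
qed

lemma phi_s: "phi_s holomorphic_on UNIV" "phi_s 0 = 1" "\<And>z. z \<noteq> 0 \<Longrightarrow> phi_even z = phi_s (1 / z)"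
proof -
  have *: "phi_s holomorphic_on UNIV \<and> phi_s 0 = 1 \<and> (\<forall>s. s \<noteq> 0 \<longrightarrow> phi_even (1 / s) = phi_s s)"
    unfolding phi_s_def by (rule someI_ex[OF even_series_entire[OF phi_even]])
  then show "phi_s holomorphic_on UNIV" "phi_s 0 = 1" by auto
  show "phi_even z = phi_s (1 / z)" if "z \<noteq> 0" for z
    using *[THEN conjunct2, THEN conjunct2, rule_format, of "1 / z"] that by simp
qed

lemma ainf_s: "ainf_s holomorphic_on UNIV" "ainf_s 0 = 1" "\<And>z. z \<noteq> 0 \<Longrightarrow> a_inf z = ainf_s (1 / z)"
proof -
  have *: "ainf_s holomorphic_on UNIV \<and> ainf_s 0 = 1 \<and> (\<forall>s. s \<noteq> 0 \<longrightarrow> a_inf (1 / s) = ainf_s s)"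
    unfolding ainf_s_def by (rule someI_ex[OF even_series_entire[OF a_inf]])
  then show "ainf_s holomorphic_on UNIV" "ainf_s 0 = 1" by auto
  show "a_inf z = ainf_s (1 / z)" if "z \<noteq> 0" for z
    using *[THEN conjunct2, THEN conjunct2, rule_format, of "1 / z"] that by simp
qed

lemma binf_s: "binf_s holomorphic_on UNIV" "binf_s 0 = 1" "\<And>z. z \<noteq> 0 \<Longrightarrow> b_inf z = binf_s (1 / z) / z"
proof -
  have *: "binf_s holomorphic_on UNIV \<and> binf_s 0 = 1 \<and> (\<forall>s. s \<noteq> 0 \<longrightarrow> b_inf (1 / s) = s * binf_s s)"
    unfolding binf_s_def by (rule someI_ex[OF odd_series_entire[OF b_inf]])
  then show "binf_s holomorphic_on UNIV" "binf_s 0 = 1" by auto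
  show "b_inf z = binf_s (1 / z) / z" if "z \<noteq> 0" for z
    using *[THEN conjunct2, THEN conjunct2, rule_format, of "1 / z"] that by simp
qed

lemma hol_inverse_arg: "F holomorphic_on UNIV \<Longrightarrow> (\<lambda>z. F (1 / z)) holomorphic_on - {0}" for F :: "complex \<Rightarrow> complex"
proof -
  assume F: "F holomorphic_on UNIV"
  have "(F \<circ> (\<lambda>z. 1 / z)) holomorphic_on - {0}"
    by (rule holomorphic_on_compose_gen[OF _ F]) (auto intro!: holomorphic_intros)
  then show ?thesis by (simp add: o_def)
qed

lemma hol_phi_even: "phi_even holomorphic_on - {0}"
  by (rule holomorphic_transform[OF hol_inverse_arg[OF phi_s(1)]]) (auto simp: phi_s(3))

lemma hol_a_inf: "a_inf holomorphic_on - {0}"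
  by (rule holomorphic_transform[OF hol_inverse_arg[OF ainf_s(1)]]) (auto simp: ainf_s(3))

lemma hol_b_inf: "b_inf holomorphic_on - {0}"
proof (rule holomorphic_transform)
  show "(\<lambda>z. binf_s (1 / z) / z) holomorphic_on - {0}" by (intro holomorphic_intros hol_inverse_arg[OF binf_s(1)]) auto
qed (auto simp: binf_s(3))

lemma FF_at_infinity: "FF \<le> at_infinity" unfolding Ginf_def by simp

lemma bigo_at_infinity_FF: "u \<in> O[at_infinity](v) \<Longrightarrow> u \<in> O[FF](v)"
  by (rule landau_o.big.filter_mono[OF FF_at_infinity])

lemma bigo_inverse_arg:
  assumes "(\<lambda>s. F s - F 0) \<in> O[at 0](\<lambda>s. s)"
  shows "(\<lambda>z. F (1 / z) - F 0) \<in> O[FF](\<lambda>z. 1 / z)"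
  by (rule bigo_at_infinity_FF[OF landau_o.big.compose[OF assms filterlim_inverse_at_0]])

lemma tendsto_1_div: "((\<lambda>z. 1 / z) \<longlongrightarrow> 0) FF"
proof -
  have "((\<lambda>z::complex. 1 / z) \<longlongrightarrow> 0) at_infinity" using filterlim_inverse_at_0 unfolding filterlim_at by blast
  then show ?thesis using filterlim_mono FF_at_infinity by blast
qed

lemma one_div_bigo_1: "(\<lambda>z. 1 / z) \<in> O[FF](\<lambda>_. 1)"
  by (rule tendsto_bigo_1[OF tendsto_1_div])

lemma eventually_FF_norm: "eventually (\<lambda>z. norm z > B) FF"
  unfolding eventually_Ginf by (intro exI[of _ "B + 1"]) auto

lemma eventually_FF_GC: "eventually (\<lambda>z. z \<in> GC \<sigma>) FF"
  unfolding eventually_Ginf by auto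

lemma W_GC_nz: "z \<in> GC \<sigma> \<Longrightarrow> W z \<noteq> 0"
proof
  assume z: "z \<in> GC \<sigma>" and "W z = 0"
  then obtain j where j: "norm z = q powi j" using W_eq_0_norm by blast
  have "complex_of_real (q powi j) \<in> Lam" unfolding Lam_iff by blast
  moreover have "complex_of_real (norm z) \<in> GC \<sigma>" using z unfolding GC_def by simp
  ultimately show False using GC_facts(2)[OF \<sigma>] j by metis
qed

lemma phi_even_bigo: "(\<lambda>z. phi_even z - 1) \<in> O[FF](\<lambda>z. 1 / z)"
proof -
  have "(\<lambda>z. phi_s (1 / z) - phi_s 0) \<in> O[FF](\<lambda>z. 1 / z)"
    by (rule bigo_inverse_arg[OF entire_diff_bigo[OF phi_s(1)]])
  moreover have "eventually (\<lambda>z. phi_s (1 / z) - phi_s 0 = phi_even z - 1) FF"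
    using eventually_FF_norm[of 0] by eventually_elim (simp add: phi_s)
  ultimately show ?thesis using landau_o.big.in_cong by fast
qed

lemma varphi_even_bigo: "(\<lambda>z. varphi_even z - 1) \<in> O[FF](\<lambda>z. 1 / z)"
proof -
  obtain c where c: "c 0 = 1" "\<And>z. norm z > q \<Longrightarrow> (\<lambda>j. c j / z ^ (2 * j + 0)) sums varphi_even z"
    using varphi_even unfolding normalised_even_series_at_infinity_def by auto
  obtain F where F: "\<And>r. r * q \<le> 1 \<Longrightarrow> F holomorphic_on ball 0 r" "F 0 = c 0"
    "\<And>s. s \<noteq> 0 \<Longrightarrow> norm s * q < 1 \<Longrightarrow> varphi_even (1 / s) = s ^ 0 * F s"
    using series_at_infinity[OF less_imp_le[OF q0] c(2)] by blast
  have "(\<lambda>z. F (1 / z) - F 0) \<in> O[FF](\<lambda>z. 1 / z)"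
    by (rule bigo_inverse_arg[OF holomorphic_diff_bigo[of F 1]]) (use F(1)[of 1] q1 in auto)
  moreover have "eventually (\<lambda>z. F (1 / z) - F 0 = varphi_even z - 1) FF"
    using eventually_FF_norm[of q]
  proof eventually_elim
    case (elim z)
    then have "z \<noteq> 0" "norm (1 / z) * q < 1" using q0 by (auto simp: norm_divide divide_less_eq)
    then show ?case using F(3)[of "1 / z"] F(2) c(1) by simp
  qed
  ultimately show ?thesis using landau_o.big.in_cong by fast
qed

lemma varphi_odd_bigo: "varphi_odd \<in> O[FF](\<lambda>z. 1 / z)"
proof -
  obtain c where c: "c 0 = 1" "\<And>z. norm z > q \<Longrightarrow> (\<lambda>j. c j / z ^ (2 * j + 1)) sums varphi_odd z"
    using varphi_odd unfolding normalised_odd_series_at_infinity_def by auto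
  obtain F where F: "\<And>r. r * q \<le> 1 \<Longrightarrow> F holomorphic_on ball 0 r" "F 0 = c 0"
    "\<And>s. s \<noteq> 0 \<Longrightarrow> norm s * q < 1 \<Longrightarrow> varphi_odd (1 / s) = s ^ 1 * F s"
    using series_at_infinity[OF less_imp_le[OF q0] c(2)] by blast
  have "(\<lambda>z. F (1 / z) - F 0) \<in> O[FF](\<lambda>z. 1 / z)"
    by (rule bigo_inverse_arg[OF holomorphic_diff_bigo[of F 1]]) (use F(1)[of 1] q1 in auto)
  then have "((\<lambda>z. F (1 / z)) \<longlongrightarrow> F 0) FF" by (rule bigo_imp_tendsto[OF _ tendsto_1_div])
  from bigo_mult_bounded[OF tendsto_bigo_1[OF this] landau_o.big_refl]
  have "(\<lambda>z. F (1 / z) * (1 / z)) \<in> O[FF](\<lambda>z. 1 / z)" .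
  moreover have "eventually (\<lambda>z. F (1 / z) * (1 / z) = varphi_odd z) FF"
    using eventually_FF_norm[of q]
  proof eventually_elim
    case (elim z)
    then have "z \<noteq> 0" "norm (1 / z) * q < 1" using q0 by (auto simp: norm_divide divide_less_eq)
    then show ?case using F(3)[of "1 / z"] by simp
  qed
  ultimately show ?thesis using landau_o.big.in_cong by fast
qed

lemma h_bigo_1: "h \<in> O[FF](\<lambda>_. 1)"
proof -
  obtain B c where "\<forall>z\<in>GC \<sigma>. c \<le> norm (h z) \<and> norm (h z) \<le> B" using h_bounds[OF \<sigma> h_nz] by blast
  then show ?thesis using eventually_FF_GC by (intro bounded_bigo_1[of _ B]) (auto elim: eventually_mono)
qed

lemma inverse_h_bigo_1: "(\<lambda>z. 1 / h z) \<in> O[FF](\<lambda>_. 1)"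
proof -
  obtain B c where c: "c > 0" "\<forall>z\<in>GC \<sigma>. c \<le> norm (h z) \<and> norm (h z) \<le> B" using h_bounds[OF \<sigma> h_nz] by blast
  show ?thesis
    by (rule bounded_bigo_1[of _ "1 / c"], rule eventually_mono[OF eventually_FF_GC])
       (use c in \<open>auto simp: norm_divide intro!: divide_left_mono mult_pos_pos elim: less_le_trans\<close>)
qed

section \<open>Zeros of h and nonvanishing of the connection constants\<close>

definition zk :: "nat \<Rightarrow> complex" where "zk k = sq / Q ^ k"

text \<open>These points are the translates of sqrt q under the period of h and tend to infinity.
  The theta quotient takes the same value at all of them because h vanishes there in
  \<open>h_square\<close>.\<close>

lemma zk: "zk k \<noteq> 0" "zk k \<notin> Lam" "h (zk k) = 0" "g (zk k) \<noteq> 0" "W (zk k) \<noteq> 0" "norm (zk k) > q"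
  "Th (zk k) / g (zk k) ^ 2 = Th sq / g sq ^ 2" "1 / zk k = Q ^ k / sq" "zk k ^ 4 = complex_of_real ((sqrt q / q ^ k) ^ 4)"
proof -
  have e: "zk k = Q powi (- int k) * sq" unfolding zk_def by (simp add: power_int_minus field_simps)
  show z0: "zk k \<noteq> 0" unfolding zk_def using sq_facts(1) by simp
  show L: "zk k \<notin> Lam" unfolding e mult.commute[of _ sq] Lam_mult_iff[OF Lam_powi] by (rule sq_facts(3))
  show h0: "h (zk k) = 0" unfolding e using periodic_powi[of h "- int k" sq] h_periodic sq_facts(4) by metis
  show "g (zk k) \<noteq> 0" using z0 L g_eq_0_iff by blast
  show z4: "zk k ^ 4 = complex_of_real ((sqrt q / q ^ k) ^ 4)" unfolding zk_def by simp
  have "0 \<le> (sqrt q / q ^ k) ^ 4" using q0 by simp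
  then show "W (zk k) \<noteq> 0" using W_pos[OF z4] by force
  have "q < sqrt q" using q0 q1 by (simp add: real_less_rsqrt power2_eq_square mult_less_cancel_left1)
  moreover have "sqrt q \<le> sqrt q / q ^ k" using q0 q1 by (simp add: pos_le_divide_eq mult_left_le power_le_one)
  ultimately show "norm (zk k) > q" unfolding zk_def norm_div_Qk using q0 by simp
  show "Th (zk k) / g (zk k) ^ 2 = Th sq / g sq ^ 2"
  proof -
    have "H * (Th (zk k) / g (zk k) ^ 2) = H * (Th sq / g sq ^ 2)"
      using h_square[OF z0 L] h_square[OF sq_facts(1,3)] h0 sq_facts(4) by simp
    then show ?thesis by (rule mult_left_cancel[OF H_nz, THEN iffD1])
  qed
  show "1 / zk k = Q ^ k / sq" unfolding zk_def by simp
qed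

lemma zk_limit: "(\<lambda>k. 1 / zk k) \<longlonglongrightarrow> 0"
proof -
  have "(\<lambda>k. Q ^ k / sq) \<longlonglongrightarrow> 0 / sq"
    by (intro tendsto_intros LIMSEQ_power_zero) (use q0 q1 sq_facts in auto)
  then show ?thesis by (simp add: zk(8))
qed

lemma zk_seq_limit: "F holomorphic_on UNIV \<Longrightarrow> (\<lambda>k. F (1 / zk k)) \<longlonglongrightarrow> F 0" for F :: "complex \<Rightarrow> complex"
  using isCont_tendsto_compose[OF _ zk_limit, of F]
  by (metis continuous_on_eq_continuous_at holomorphic_on_imp_continuous_on iso_tuple_UNIV_I open_UNIV)

lemma Qk_seq_limit: "F holomorphic_on UNIV \<Longrightarrow> (\<lambda>k. F (Q ^ k)) \<longlonglongrightarrow> F 0" for F :: "complex \<Rightarrow> complex"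
proof -
  assume "F holomorphic_on UNIV"
  then have "isCont F 0" by (metis continuous_on_eq_continuous_at holomorphic_on_imp_continuous_on iso_tuple_UNIV_I open_UNIV)
  moreover have "(\<lambda>k. Q ^ k) \<longlonglongrightarrow> 0" by (intro LIMSEQ_power_zero) (use q0 q1 in auto)
  ultimately show ?thesis by (rule isCont_tendsto_compose)
qed

lemma zk_Ginf: "filterlim zk at_infinity sequentially"
proof -
  have "filterlim (\<lambda>k. 1 / zk k) (at 0) sequentially"
    using zk_limit zk(1) by (auto simp: filterlim_at)
  from filterlim_compose[OF filterlim_inverse_at_infinity this] show ?thesis by (simp add: inverse_eq_divide)
qed

text \<open>The points \<open>zk k\<close> are zeros of \<open>h\<close>, where both connection formulas reduce to a single term.\<close>

lemma lam4_eta2: "lam4 * eta2 = Th sq / g sq ^ 2"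
proof -
  \<comment> \<open>With h = 0 the formulas read a = eta2 g varphi_even and phi_even = lam4 g a / W.
    Inserting one in the other and multiplying by Th / g^2, which is constant along
    \<open>zk\<close>, leaves only factors that tend to 1.\<close>
  have e: "phi_even (zk k) * (Th sq / g sq ^ 2) = ff (zk k) * (lam4 * eta2) * varphi_even (zk k)" for k
  proof -
    have "phi_even (zk k) = g (zk k) * (1 / W (zk k)) * (lam4 * a (zk k))"
      using lam[OF zk(1,2,5)] zk(3) by simp
    moreover have "a (zk k) = g (zk k) * (eta2 * varphi_even (zk k))"
      using eta[OF zk(6,2), of k] zk(3,4)[of k] by (simp add: field_simps)
    moreover have "ff (zk k) = Th (zk k) / W (zk k)" using zk(5)[of k] by (simp add: Th_def)
    ultimately show ?thesis using zk(4,5)[of k] unfolding zk(7)[of k, symmetric] by (simp add: power2_eq_square)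
  qed
  have lim1: "(f \<longlongrightarrow> l) at_infinity \<Longrightarrow> (\<lambda>k. f (zk k)) \<longlonglongrightarrow> l" for f and l :: complex
    using filterlim_compose[OF _ zk_Ginf] by blast
  have inv0: "((\<lambda>z::complex. 1 / z) \<longlongrightarrow> 0) at_infinity" using filterlim_inverse_at_0 unfolding filterlim_at by blast
  have "(\<lambda>k. phi_s (1 / zk k)) \<longlonglongrightarrow> phi_s 0" by (rule zk_seq_limit[OF phi_s(1)])
  then have l1: "(\<lambda>k. phi_even (zk k)) \<longlonglongrightarrow> 1" using phi_s(2,3) zk(1) by simp
  have l2: "(\<lambda>k. ff (zk k)) \<longlonglongrightarrow> 1" by (rule lim1[OF bigo_imp_tendsto[OF ff_bigo inv0]])
  have l3: "(\<lambda>k. varphi_even (zk k)) \<longlonglongrightarrow> 1"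
  proof -
    obtain c where c: "c 0 = 1" "\<And>z. norm z > q \<Longrightarrow> (\<lambda>j. c j / z ^ (2 * j + 0)) sums varphi_even z"
      using varphi_even unfolding normalised_even_series_at_infinity_def by auto
    obtain F where F: "\<And>r. r * q \<le> 1 \<Longrightarrow> F holomorphic_on ball 0 r" "F 0 = c 0"
      "\<And>s. s \<noteq> 0 \<Longrightarrow> norm s * q < 1 \<Longrightarrow> varphi_even (1 / s) = s ^ 0 * F s"
      using series_at_infinity[OF less_imp_le[OF q0] c(2)] by blast
    have "isCont F 0"
      using F(1)[of 1] q1 by (metis centre_in_ball continuous_on_eq_continuous_at holomorphic_on_imp_continuous_on less_imp_le mult_1 open_ball zero_less_one)
    then have "(\<lambda>k. F (1 / zk k)) \<longlonglongrightarrow> F 0" by (rule isCont_tendsto_compose[OF _ zk_limit])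
    moreover have "F (1 / zk k) = varphi_even (zk k)" for k
    proof -
      have "norm (1 / zk k) * q < 1" using zk(1,6)[of k] by (simp add: norm_divide pos_divide_less_eq)
      then show ?thesis using F(3)[of "1 / zk k"] zk(1)[of k] by simp
    qed
    ultimately show ?thesis using F(2) c(1) by simp
  qed
  have "(\<lambda>k. phi_even (zk k) * (Th sq / g sq ^ 2)) \<longlonglongrightarrow> 1 * (Th sq / g sq ^ 2)" by (intro tendsto_intros l1) 
  moreover have "(\<lambda>k. ff (zk k) * (lam4 * eta2) * varphi_even (zk k)) \<longlonglongrightarrow> 1 * (lam4 * eta2) * 1" by (intro tendsto_intros l2 l3)
  ultimately show ?thesis using LIMSEQ_unique e by fastforce
qed

lemma kap_eq: "kap = H * eta2 * lam4"
proof -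
  have "kap = H * (Th sq / g sq ^ 2)" unfolding kap_sq by simp
  also have "\<dots> = H * (lam4 * eta2)" by (simp only: lam4_eta2)
  finally show ?thesis by (simp add: mult_ac)
qed

lemma eta2_nz: "eta2 \<noteq> 0"
  using kap_nz unfolding kap_eq by auto

text \<open>If mu2 were 0, a_inf would vanish at every \<open>zk k\<close>, yet it tends to 1 at
  infinity.\<close>

lemma mu2_nz: "mu2 \<noteq> 0"
proof
  assume "mu2 = 0"
  then have "a_inf (zk k) = 0" for k using mu_a[OF zk(1,2), of k] zk(3,4)[of k] by simp
  then have "(\<lambda>k. ainf_s (1 / zk k)) = (\<lambda>k. 0)" using ainf_s(3) zk(1) by metis
  then show False using zk_seq_limit[OF ainf_s(1)] ainf_s(2) LIMSEQ_unique tendsto_const by (metis zero_neq_one)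
qed

text \<open>Without the term containing h, b_inf would be g times an entire function and so vanish
  on the whole lattice. Along q^(-k) this contradicts its leading coefficient 1. The argument for
  lam3 is the same.\<close>

lemma mu4_nz: "mu4 \<noteq> 0"
proof
  assume 0: "mu4 = 0"
  have "b_inf x = 0" if x: "x \<in> Lam" for x
  proof -
    have x0: "x \<noteq> 0" using Lam_nz[OF x] .
    have "((\<lambda>z. g z * (mu3 * tPsi_odd z)) \<longlongrightarrow> g x * (mu3 * tPsi_odd x)) (at x)"
      by (intro tendsto_intros isCont_holo[OF holomorphic_g x0] isCont_holo[OF Psi_hol(4) x0])
    moreover have "eventually (\<lambda>z. g z * (mu3 * tPsi_odd z) = b_inf z) (at x)"
      using eventually_not_Lam[OF x0]
      by eventually_elim (use mu_b 0 g_eq_0_iff in \<open>auto simp: field_simps\<close>)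
    ultimately have "(b_inf \<longlongrightarrow> g x * (mu3 * tPsi_odd x)) (at x)" by (rule Lim_transform_eventually)
    then have "b_inf x = g x * (mu3 * tPsi_odd x)" using isCont_holo[OF hol_b_inf x0] LIM_unique by blast
    then show ?thesis using g_eq_0_iff[OF x0] x by simp
  qed
  then have "b_inf (Q powi (- int k)) = 0" for k using Lam_powi by blast
  then have "binf_s (Q ^ k) = 0" for k
    using binf_s(3)[of "Q powi (- int k)"] by (simp add: power_int_minus divide_inverse)
  then show False using Qk_seq_limit[OF binf_s(1)] binf_s(2) LIMSEQ_unique tendsto_const by (metis (no_types, lifting) ext zero_neq_one)
qed

lemma lam3_nz: "lam3 \<noteq> 0"
proof
  assume 0: "lam3 = 0"
  have "phi_even x = 0" if x: "x \<in> Lam" for x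
  proof -
    have x0: "x \<noteq> 0" using Lam_nz[OF x] .
    have W: "((\<lambda>z. W z) \<longlongrightarrow> W x) (at x)" by (rule isCont_holo[OF holomorphic_W x0])
    have "((\<lambda>z. g z * (1 / W z) * (lam4 * a z)) \<longlongrightarrow> g x * (1 / W x) * (lam4 * a x)) (at x)"
      by (intro tendsto_intros isCont_holo[OF holomorphic_g x0] isCont_holo[OF hol_a x0] W W_Lam_nz[OF x])
    moreover have "eventually (\<lambda>z. g z * (1 / W z) * (lam4 * a z) = phi_even z) (at x)"
      using eventually_not_Lam[OF x0] tendsto_imp_eventually_ne[OF W W_Lam_nz[OF x]]
      by eventually_elim (use lam 0 in auto)
    ultimately have "(phi_even \<longlongrightarrow> g x * (1 / W x) * (lam4 * a x)) (at x)" by (rule Lim_transform_eventually)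
    then have "phi_even x = g x * (1 / W x) * (lam4 * a x)" using isCont_holo[OF hol_phi_even x0] LIM_unique by blast
    then show ?thesis using g_eq_0_iff[OF x0] x by simp
  qed
  then have "phi_even (Q powi (- int k)) = 0" for k using Lam_powi by blast
  then have "phi_s (Q ^ k) = 0" for k
    using phi_s(3)[of "Q powi (- int k)"] by (simp add: power_int_minus divide_inverse)
  then show False using Qk_seq_limit[OF phi_s(1)] phi_s(2) LIMSEQ_unique tendsto_const by (metis (no_types, lifting) ext zero_neq_one)
qed

text \<open>In both entries h times the first component, over \<open>W\<close>, produces the lattice
  residues, and the other term adds none. It is fixed by growth: as a behaves like eta2 g and b like
  h g / (H lam3), the leading parts cancel in \<open>Qa\<close>. In \<open>Qb\<close> the numerator
  is the combination of the connection formula for phi_even.\<close>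

definition Qa :: "complex \<Rightarrow> complex" where "Qa z = (h z * a z - H * eta2 * lam3 * b z) / W z"
definition Qb :: "complex \<Rightarrow> complex" where "Qb z = (h z * b z + lam4 / lam3 * a z) / W z"

lemma Qb_eq:
  assumes "z \<noteq> 0" "z \<notin> Lam" "W z \<noteq> 0"
  shows "Qb z = phi_even z / (lam3 * g z)"
  using lam[OF assms] g_eq_0_iff[OF assms(1)] assms lam3_nz unfolding Qb_def by (simp add: field_simps)

text \<open>Eliminates b by the connection formula and h^2 by \<open>h_square\<close>. The terms
  with lam4 a cancel because \<open>kap\<close> is H eta2 lam4. What remains has no \<open>W\<close>
  in the denominator.\<close>

lemma Qa_eq:
  assumes "z \<noteq> 0" "z \<notin> Lam" "W z \<noteq> 0" "h z \<noteq> 0"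
  shows "Qa z = H / (h z * g z) * (ff z * a z / g z - eta2 * phi_even z)"
proof -
  have g: "g z \<noteq> 0" using g_eq_0_iff assms by blast
  have l: "lam3 * h z * b z = phi_even z * W z / g z - lam4 * a z"
    using lam[OF assms(1-3)] g assms(3) by (simp add: field_simps)
  have hs: "h z ^ 2 = H * Th z / g z ^ 2 - H * eta2 * lam4" using h_square[OF assms(1,2)] unfolding kap_eq by (simp add: algebra_simps)
  have "h z * (h z * a z - H * eta2 * lam3 * b z) = h z ^ 2 * a z - H * eta2 * (lam3 * h z * b z)"
    by (simp add: algebra_simps power2_eq_square)
  also have "\<dots> = H * Th z / g z ^ 2 * a z - H * eta2 * (phi_even z * W z / g z)"
    unfolding l hs by (simp add: algebra_simps)
  also have "\<dots> = W z * (H / g z * (ff z * a z / g z - eta2 * phi_even z))"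
    unfolding Th_def using g by (simp add: algebra_simps power2_eq_square)
  finally show ?thesis unfolding Qa_def using assms g by (simp add: field_simps)
qed

lemma a_asym: "(\<lambda>z. a z / g z - eta2) \<in> O[FF](\<lambda>z. 1 / z)"
proof -
  have "(\<lambda>z. eta1 * (h z * varphi_odd z) + eta2 * (varphi_even z - 1)) \<in> O[FF](\<lambda>z. 1 / z)"
    by (intro sum_in_bigo(1) bigo_mult_bounded[OF bigo_const] bigo_mult_bounded[OF h_bigo_1] varphi_odd_bigo varphi_even_bigo)
  moreover have "eventually (\<lambda>z. eta1 * (h z * varphi_odd z) + eta2 * (varphi_even z - 1) = a z / g z - eta2) FF"
    using eventually_FF_norm[of q] eventually_FF_GC
    by eventually_elim (use eta GC_facts(2)[OF \<sigma>] in \<open>simp add: algebra_simps\<close>)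
  ultimately show ?thesis using landau_o.big.in_cong by fast
qed

lemma ff_FF: "(\<lambda>z. ff z - 1) \<in> O[FF](\<lambda>z. 1 / z)" by (rule bigo_at_infinity_FF[OF ff_bigo])

lemma Qa_asym: "(\<lambda>z. g z * Qa z) \<in> O[FF](\<lambda>z. 1 / z)"
proof -
  have b1: "(\<lambda>z. a z / g z) \<in> O[FF](\<lambda>_. 1)" by (rule bigo_trans_diff[OF a_asym bigo_const one_div_bigo_1])
  have "(\<lambda>z. H * (1 / h z * ((a z / g z * (ff z - 1) + (a z / g z - eta2)) - eta2 * (phi_even z - 1)))) \<in> O[FF](\<lambda>z. 1 / z)"
    by (intro sum_in_bigo bigo_mult_bounded[OF bigo_const] bigo_mult_bounded[OF inverse_h_bigo_1] bigo_mult_bounded[OF b1] ff_FF a_asym phi_even_bigo)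
  moreover have "eventually (\<lambda>z. H * (1 / h z * ((a z / g z * (ff z - 1) + (a z / g z - eta2)) - eta2 * (phi_even z - 1))) = g z * Qa z) FF"
    using eventually_FF_GC
  proof eventually_elim
    case (elim z)
    note z = GC_facts[OF \<sigma> elim]
    have g: "g z \<noteq> 0" using g_eq_0_iff z by blast
    have "H * (1 / h z * ((a z / g z * (ff z - 1) + (a z / g z - eta2)) - eta2 * (phi_even z - 1)))
       = H / h z * (ff z * a z / g z - eta2 * phi_even z)" by (simp add: algebra_simps add_divide_distrib diff_divide_distrib)
    also have "\<dots> = g z * Qa z" unfolding Qa_eq[OF z(1,2) W_GC_nz[OF elim] h_nz[rule_format, OF elim]] using g by simp
    finally show ?case .
  qed
  ultimately show ?thesis using landau_o.big.in_cong by fast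
qed

lemma Qb_asym: "(\<lambda>z. g z * Qb z - 1 / lam3) \<in> O[FF](\<lambda>z. 1 / z)"
proof -
  have "(\<lambda>z. 1 / lam3 * (phi_even z - 1)) \<in> O[FF](\<lambda>z. 1 / z)"
    by (intro bigo_mult_bounded[OF bigo_const] phi_even_bigo)
  moreover have "eventually (\<lambda>z. 1 / lam3 * (phi_even z - 1) = g z * Qb z - 1 / lam3) FF"
    using eventually_FF_GC
  proof eventually_elim
    case (elim z)
    note z = GC_facts[OF \<sigma> elim]
    have g: "g z \<noteq> 0" using g_eq_0_iff z by blast
    show ?case unfolding Qb_eq[OF z(1,2) W_GC_nz[OF elim]] using g by (simp add: algebra_simps diff_divide_distrib)
  qed
  ultimately show ?thesis using landau_o.big.in_cong by fast
qed

text \<open>The connection formula is solved for h b. Since W / g^2 = (h^2 + kap) / (H ff), the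
  contribution of \<open>kap\<close> cancels lam4 eta2 and h^2 / H is left; dividing by h needs the
  good radius.\<close>

lemma b_asym: "(\<lambda>z. b z / g z - h z / (H * lam3)) \<in> O[FF](\<lambda>z. 1 / z)"
proof -
  have hh: "(\<lambda>z. (h z ^ 2 + kap) / H) \<in> O[FF](\<lambda>_. 1)"
  proof -
    have "(\<lambda>z. 1 / H * (h z * h z) + kap / H) \<in> O[FF](\<lambda>_. 1)"
      by (intro sum_in_bigo(1) landau_o.big.mult_in_1 bigo_const h_bigo_1)
    then show ?thesis by (simp add: power2_eq_square add_divide_distrib)
  qed
  have fi: "(\<lambda>z. 1 / ff z) \<in> O[FF](\<lambda>_. 1)"
    using tendsto_divide[OF tendsto_const bigo_imp_tendsto[OF ff_FF tendsto_1_div], of 1] by (intro tendsto_bigo_1) auto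
  have fn: "eventually (\<lambda>z. ff z \<noteq> 0) FF"
    by (rule tendsto_imp_eventually_ne[OF bigo_imp_tendsto[OF ff_FF tendsto_1_div]]) simp
  have "(\<lambda>z. 1 / lam3 * (1 / h z * ((h z ^ 2 + kap) / H * (1 / ff z * ((phi_even z - 1) - (ff z - 1))) - lam4 * (a z / g z - eta2)))) \<in> O[FF](\<lambda>z. 1 / z)"
    by (intro sum_in_bigo bigo_mult_bounded[OF bigo_const] bigo_mult_bounded[OF inverse_h_bigo_1] bigo_mult_bounded[OF hh] bigo_mult_bounded[OF fi]
         ff_FF a_asym phi_even_bigo)
  moreover have "eventually (\<lambda>z. 1 / lam3 * (1 / h z * ((h z ^ 2 + kap) / H * (1 / ff z * ((phi_even z - 1) - (ff z - 1))) - lam4 * (a z / g z - eta2)))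
       = b z / g z - h z / (H * lam3)) FF"
    using eventually_FF_GC fn
  proof eventually_elim
    case (elim z)
    note z = GC_facts[OF \<sigma> elim(1)]
    have g: "g z \<noteq> 0" using g_eq_0_iff z by blast
    have hz: "h z \<noteq> 0" using h_nz elim by blast
    have W: "W z \<noteq> 0" using W_GC_nz elim by blast
    have l: "lam3 * (h z * (b z / g z)) = phi_even z * W z / g z ^ 2 - lam4 * (a z / g z)"
      using lam[OF z(1,2) W] g W by (simp add: field_simps power2_eq_square)
    have "(h z ^ 2 + kap) / H = W z * ff z / g z ^ 2" using h_square[OF z(1,2)] H_nz unfolding Th_def by (simp add: field_simps)
    then have "(h z ^ 2 + kap) / H * phi_even z / ff z = phi_even z * W z / g z ^ 2" using elim(2) by simp
    moreover have "Y * (1 / ff z * ((phi_even z - 1) - (ff z - 1))) = Y * phi_even z / ff z - Y" for Y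
      using elim(2) by (simp add: field_simps)
    ultimately have "(h z ^ 2 + kap) / H * (1 / ff z * ((phi_even z - 1) - (ff z - 1))) = phi_even z * W z / g z ^ 2 - (h z ^ 2 + kap) / H"
      by (simp only:)
    then have E: "(h z ^ 2 + kap) / H * (1 / ff z * ((phi_even z - 1) - (ff z - 1))) - lam4 * (a z / g z - eta2)
       = lam3 * (h z * (b z / g z)) - h z ^ 2 / H"
      unfolding l kap_eq using H_nz by (simp add: field_simps)
    show ?case unfolding E using hz lam3_nz H_nz g by (simp add: field_simps power2_eq_square)
  qed
  ultimately show ?thesis using landau_o.big.in_cong by fast
qed

end

section \<open>Rows with removable singularities\<close>

lemma poly_over_power_tendsto:
  fixes A :: "complex poly"
  assumes "degree A \<le> N"
  shows "((\<lambda>z. poly A z / z ^ N) \<longlongrightarrow> coeff A N) at_infinity"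
proof -
  have inv0: "((\<lambda>z::complex. 1 / z) \<longlongrightarrow> 0) at_infinity" using filterlim_inverse_at_0 unfolding filterlim_at by blast
  have lim: "((\<lambda>z. (1 / z) ^ (N - degree A) * poly (reflect_poly A) (1 / z)) \<longlongrightarrow> 0 ^ (N - degree A) * poly (reflect_poly A) 0) at_infinity"
    by (intro tendsto_intros inv0)
  have val: "0 ^ (N - degree A) * poly (reflect_poly A) 0 = coeff A N"
  proof (cases "degree A = N")
    case True
    then show ?thesis by (simp add: poly_0_coeff_0)
  next
    case False
    then show ?thesis using assms by (simp add: coeff_eq_0)
  qed
  have ev: "eventually (\<lambda>z. (1 / z) ^ (N - degree A) * poly (reflect_poly A) (1 / z) = poly A z / z ^ N) at_infinity"
    using eventually_not_equal_at_infinity[of "0::complex"]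
  proof eventually_elim
    case (elim z)
    have "poly (reflect_poly A) (1 / z) = (1 / z) ^ degree A * poly A z"
      using poly_reflect_poly_nz[of "1 / z" A] elim by (simp add: inverse_eq_divide)
    moreover have "(1 / z) ^ (N - degree A) * (1 / z) ^ degree A = (1 / z) ^ N"
      using assms by (simp flip: power_add)
    ultimately show ?case by (simp add: power_one_over mult.assoc[symmetric])
  qed
  from Lim_transform_eventually[OF lim ev] show ?thesis unfolding val .
qed

context qpar
begin

text \<open>On the positive imaginary axis every term of h is -i times a positive number, so nothing
  can cancel.\<close>

lemma h_imaginary_nz:
  assumes r: "0 < r"
  shows "h (\<i> * complex_of_real r) \<noteq> 0"
proof -
  let ?z = "\<i> * complex_of_real r"
  have zL: "?z \<notin> insert 0 Lam" using r by (auto simp: Lam_iff complex_eq_iff simp del: of_real_power_int)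
  let ?T = "\<lambda>k. 2 * r * q powi k / (r ^ 2 + q powi (2 * k))"
  have trm: "2 * ?z * Q powi k / (?z ^ 2 - Q powi (2 * k)) = - \<i> * complex_of_real (?T k)" for k
  proof -
    have e1: "?z ^ 2 - Q powi (2 * k) = - complex_of_real (r ^ 2 + q powi (2 * k))"
      by (simp add: power_mult_distrib)
    have e2: "2 * ?z * Q powi k = \<i> * complex_of_real (2 * r * q powi k)" by simp
    show ?thesis unfolding e1 e2 of_real_divide by (simp only: minus_divide_right[symmetric] times_divide_eq_right mult_minus_left minus_divide_left)
  qed
  have "(\<lambda>k. 2 * ?z * Q powi k / (?z ^ 2 - Q powi (2 * k))) summable_on UNIV"
    using h_part_facts(2)[of UNIV ?z] closed_Lam0 zL unfolding lat_UNIV by blast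
  then have s1: "(\<lambda>k. - \<i> * complex_of_real (?T k)) summable_on UNIV" unfolding trm .
  have "(\<lambda>k. \<i> * (- \<i> * complex_of_real (?T k))) summable_on UNIV" by (rule summable_on_cmult_right[OF s1])
  then have "(\<lambda>k. complex_of_real (?T k)) summable_on UNIV" by (simp add: mult.assoc[symmetric])
  from summable_on_Re[OF this] have s2: "?T summable_on UNIV" by (simp only: Re_complex_of_real)
  have "h ?z = (\<Sum>\<^sub>\<infinity>k. - \<i> * complex_of_real (?T k))" unfolding h_fun_def trm ..
  also have "\<dots> = - \<i> * complex_of_real (\<Sum>\<^sub>\<infinity>k. ?T k)"
  proof (rule infsumI, rule has_sum_cmult_right)
    show "((\<lambda>k. complex_of_real (?T k)) has_sum complex_of_real (\<Sum>\<^sub>\<infinity>k. ?T k)) UNIV"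
      using has_sum_infsum[OF s2] by (simp only: has_sum_of_real_iff)
  qed
  finally have e: "h ?z = - \<i> * complex_of_real (\<Sum>\<^sub>\<infinity>k. ?T k)" .
  have "(\<Sum>\<^sub>\<infinity>k. ?T k) \<noteq> 0"
  proof
    assume "(\<Sum>\<^sub>\<infinity>k. ?T k) = 0"
    then have "?T 0 = 0" using r q0 by (intro nonneg_infsum_le_0D[OF _ s2, of 0]) (auto intro!: divide_nonneg_pos add_nonneg_pos)
    moreover have "?T 0 > 0" using r by (auto intro!: divide_pos_pos add_pos_pos)
    ultimately show False by linarith
  qed
  then show ?thesis unfolding e by simp
qed

lemma GH_imaginary_nz: "0 < r \<Longrightarrow> GH (\<i> * complex_of_real r) \<noteq> 0"
proof -
  assume r: "0 < r"
  have zL: "\<i> * complex_of_real r \<notin> Lam" using r by (auto simp: Lam_iff complex_eq_iff simp del: of_real_power_int)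
  then show ?thesis using r h_imaginary_nz[OF r] g_eq_0_iff[of "\<i> * complex_of_real r"] by (simp add: GH_eq)
qed

lemma g_imaginary_nz: "0 < r \<Longrightarrow> g (\<i> * complex_of_real r) \<noteq> 0"
  using TT_pos[of r] unfolding TT_def by simp

text \<open>The family of circles determines \<sigma> only up to powers of q. Inversion thus sends
  \<sigma> to q / \<sigma>, which is again between q and 1.\<close>

lemma GC_reciprocal: "GC (1 / \<sigma>) = GC (q / \<sigma>)"
proof -
  have "(\<exists>k. norm z = 1 / \<sigma> * q powi k) \<longleftrightarrow> (\<exists>k. norm z = q / \<sigma> * q powi k)" for z :: complex
  proof
    assume "\<exists>k. norm z = 1 / \<sigma> * q powi k"
    then obtain k where "norm z = 1 / \<sigma> * q powi k" by blast
    then have "norm z = q / \<sigma> * q powi (k - 1)" by (simp add: power_int_diff)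
    then show "\<exists>k. norm z = q / \<sigma> * q powi k" by blast
  next
    assume "\<exists>k. norm z = q / \<sigma> * q powi k"
    then obtain k where "norm z = q / \<sigma> * q powi k" by blast
    then have "norm z = 1 / \<sigma> * q powi (k + 1)" by (simp add: power_int_add)
    then show "\<exists>k. norm z = 1 / \<sigma> * q powi k" by blast
  qed
  then show ?thesis unfolding GC_def by simp
qed

text \<open>The lattice together with the zeros of the denominator of the weight: all places where a
  second row entry may be singular, apart from 0.\<close>

definition BB :: "complex set" where "BB = Lam \<union> {z. W z = 0}"

lemma BB_discrete:
  assumes "x \<noteq> 0"
  shows "\<exists>r>0. ball x r \<inter> BB \<subseteq> {x}"
proof -
  let ?f = "\<lambda>z. g z * W z"
  have hol: "?f holomorphic_on - {0}" by (intro holomorphic_intros holomorphic_g holomorphic_W)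
  have eq: "?f z = 0 \<longleftrightarrow> z \<in> BB" if "z \<noteq> 0" for z using g_eq_0_iff[OF that] unfolding BB_def by auto
  have op: "open (- {0::complex})" by (simp add: open_Compl)
  have conn: "connected (- {0::complex})" by (rule connected_punctured_universe) simp
  have "\<i> \<notin> Lam" by (auto simp: Lam_iff complex_eq_iff simp del: of_real_power_int)
  moreover have "W \<i> \<noteq> 0" using W_pos[of \<i> 1] by force
  ultimately have nz: "?f \<i> \<noteq> 0" using g_eq_0_iff[of \<i>] by simp
  show ?thesis
  proof (cases "x \<in> BB")
    case True
    show ?thesis
    proof (rule isolated_zeros[OF hol op conn _ _ _ nz, of x])
      fix r assume r: "0 < r" "ball x r \<subseteq> - {0}" "\<And>z. z \<in> ball x r - {x} \<Longrightarrow> ?f z \<noteq> 0"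
      then show ?thesis using eq by blast
    qed (use True assms eq in auto)
  next
    case False
    have "open (?f -` (- {0}) \<inter> - {0})"
      by (subst Int_commute, rule continuous_open_preimage[OF holomorphic_on_imp_continuous_on[OF hol] op op])
    moreover have "x \<in> ?f -` (- {0}) \<inter> - {0}" using False assms eq by auto
    ultimately obtain r where "r > 0" "ball x r \<subseteq> ?f -` (- {0}) \<inter> - {0}" using openE by blast
    then show ?thesis using eq by blast
  qed
qed

lemma eventually_not_BB: "x \<noteq> 0 \<Longrightarrow> eventually (\<lambda>z. z \<notin> BB) (at x)"
  using BB_discrete[of x] unfolding eventually_at by (force simp: dist_commute)

text \<open>The residue condition is the one satisfied by the Cauchy transform of any polynomial A,
  up to the factor A(x). One row therefore yields a function analytic off 0 for every A.\<close>

definition row :: "(complex \<Rightarrow> complex) \<Rightarrow> (complex \<Rightarrow> complex) \<Rightarrow> bool" where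
  "row N1 N2 \<longleftrightarrow> N1 holomorphic_on - {0} \<and> N2 holomorphic_on - {0} - BB \<and>
     (\<forall>x\<in>Lam. ((\<lambda>z. (z - x) * N2 z) \<longlongrightarrow> lw x * N1 x) (at x)) \<and>
     (\<forall>x. x \<noteq> 0 \<longrightarrow> x \<notin> Lam \<longrightarrow> W x = 0 \<longrightarrow> ((\<lambda>z. (z - x) * N2 z) \<longlongrightarrow> 0) (at x))"

lemma row_extends:
  assumes "row N1 N2"
  shows "\<exists>X. X holomorphic_on - {0} \<and> (\<forall>z\<in>- {0} - BB. X z = N1 z * cau A z - N2 z * poly A z)"
proof -
  note r = assms[unfolded row_def]
  have hA: "(\<lambda>z. poly A z) holomorphic_on S" for S by (intro holomorphic_intros)
  show ?thesis
  proof (rule holomorphic_extend_discrete[of "- {0}" BB "\<lambda>z. N1 z * cau A z - N2 z * poly A z"])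
    show "\<exists>r>0. ball x r \<inter> BB \<subseteq> {x}" if "x \<in> - {0}" for x using BB_discrete[of x] that by auto
    have "cau A holomorphic_on - {0} - BB" by (rule holomorphic_on_subset[OF holomorphic_cau]) (auto simp: BB_def)
    moreover have "N1 holomorphic_on - {0} - BB" by (rule holomorphic_on_subset[of _ "- {0}"]) (use r in auto)
    ultimately show "(\<lambda>z. N1 z * cau A z - N2 z * poly A z) holomorphic_on - {0} - BB"
      using r by (intro holomorphic_on_diff holomorphic_on_mult hA) auto
    fix x assume x: "x \<in> BB" "x \<in> - {0}"
    then have x0: "x \<noteq> 0" by simp
    have N1: "(N1 \<longlongrightarrow> N1 x) (at x)" by (rule isCont_holo[OF _ x0]) (use r in auto)
    have A: "((\<lambda>z. poly A z) \<longlongrightarrow> poly A x) (at x)" by (intro tendsto_intros)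
    have eq: "(z - x) * (N1 z * cau A z - N2 z * poly A z) = N1 z * ((z - x) * cau A z) - (z - x) * N2 z * poly A z" for z
      by (simp add: algebra_simps)
    show "((\<lambda>z. (z - x) * (N1 z * cau A z - N2 z * poly A z)) \<longlongrightarrow> 0) (at x)"
    proof (cases "x \<in> Lam")
      case True
      then have "((\<lambda>z. N1 z * ((z - x) * cau A z) - (z - x) * N2 z * poly A z) \<longlongrightarrow> N1 x * (lw x * poly A x) - lw x * N1 x * poly A x) (at x)"
        using r True by (intro tendsto_diff[OF tendsto_mult[OF N1 cau_residue[OF True]] tendsto_mult[OF _ A]]) auto
      then show ?thesis unfolding eq by (simp add: mult_ac)
    next
      case False
      have op: "open (- insert 0 Lam)" using closed_Lam0 by (rule open_Compl)
      have "isCont (cau A) x"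
        using holomorphic_on_imp_continuous_on[OF holomorphic_cau[of A]] op False x0 by (simp add: continuous_on_eq_continuous_at)
      then have "((\<lambda>z. N1 z * ((z - x) * cau A z) - (z - x) * N2 z * poly A z) \<longlongrightarrow> N1 x * ((x - x) * cau A x) - 0 * poly A x) (at x)"
        unfolding isCont_def using r False x
        by (intro tendsto_diff[OF tendsto_mult[OF N1 tendsto_mult[OF tendsto_diff[OF tendsto_ident_at tendsto_const]]] tendsto_mult[OF _ A]])
           (auto simp: BB_def)
      then show ?thesis unfolding eq by simp
    qed
  qed (auto simp: open_Compl)
qed

text \<open>The residue |x| of h and the denominator \<open>W\<close> together give the mass
  \<open>lw x\<close>, whatever residue-free term e is added.\<close>

lemma row_intro:
  assumes N1: "N1 holomorphic_on - {0}" and N2: "N2 holomorphic_on - {0} - BB"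
    and eq: "\<And>z. z \<noteq> 0 \<Longrightarrow> z \<notin> BB \<Longrightarrow> N2 z = (h z * N1 z + e z) / W z"
    and e: "\<And>x. x \<in> Lam \<Longrightarrow> ((\<lambda>z. (z - x) * e z) \<longlongrightarrow> 0) (at x)"
    and Z: "\<And>x. x \<noteq> 0 \<Longrightarrow> x \<notin> Lam \<Longrightarrow> W x = 0 \<Longrightarrow> ((\<lambda>z. (z - x) * N2 z) \<longlongrightarrow> 0) (at x)"
  shows "row N1 N2"
  unfolding row_def
proof (intro conjI ballI allI impI N1 N2 Z)
  fix x assume x: "x \<in> Lam"
  have x0: "x \<noteq> 0" using Lam_nz[OF x] .
  have "((\<lambda>z. ((z - x) * h z * N1 z + (z - x) * e z) / W z) \<longlongrightarrow> (norm x * N1 x + 0) / W x) (at x)"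
    by (intro tendsto_intros h_residue[OF x] isCont_holo[OF N1 x0] e[OF x] isCont_holo[OF holomorphic_W x0] W_Lam_nz[OF x])
  moreover have "eventually (\<lambda>z. ((z - x) * h z * N1 z + (z - x) * e z) / W z = (z - x) * N2 z) (at x)"
    using eventually_not_BB[OF x0] eventually_not_Lam[OF x0]
    by eventually_elim (simp add: eq algebra_simps add_divide_distrib diff_divide_distrib)
  ultimately have "((\<lambda>z. (z - x) * N2 z) \<longlongrightarrow> (norm x * N1 x + 0) / W x) (at x)" by (rule Lim_transform_eventually)
  then show "((\<lambda>z. (z - x) * N2 z) \<longlongrightarrow> lw x * N1 x) (at x)" by (simp add: lw_def)
qed

end

context asym
begin

lemma holomorphic_h_BB: "h holomorphic_on - {0} - BB"
  by (rule holomorphic_on_subset[OF holomorphic_h]) (auto simp: BB_def)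

lemma not_BB: "z \<notin> BB \<longleftrightarrow> z \<notin> Lam \<and> W z \<noteq> 0" by (auto simp: BB_def)

lemma small_times_continuous: "(f \<longlongrightarrow> l) (at x) \<Longrightarrow> ((\<lambda>z. (z - x) * f z) \<longlongrightarrow> 0) (at x)" for f :: "complex \<Rightarrow> complex"
  using tendsto_mult[of "\<lambda>z. z - x" 0 "at x" f l] by (auto simp: LIM_zero)

lemma row_b: "row b Qb"
proof (rule row_intro[OF hol_b])
  show "Qb holomorphic_on - {0} - BB" unfolding Qb_def
    by (intro holomorphic_intros holomorphic_h_BB hol_a hol_b holomorphic_W) (auto simp: BB_def)
  show "Qb z = (h z * b z + lam4 / lam3 * a z) / W z" for z by (simp add: Qb_def)
  show "((\<lambda>z. (z - x) * (lam4 / lam3 * a z)) \<longlongrightarrow> 0) (at x)" if "x \<in> Lam" for x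
    by (rule small_times_continuous[OF tendsto_mult[OF tendsto_const isCont_holo[OF hol_a Lam_nz[OF that]]]])
  fix x assume x: "x \<noteq> 0" "x \<notin> Lam" "W x = 0"
  have "((\<lambda>z. phi_even z / (lam3 * g z)) \<longlongrightarrow> phi_even x / (lam3 * g x)) (at x)"
    by (intro tendsto_intros isCont_holo[OF hol_phi_even x(1)] isCont_holo[OF holomorphic_g x(1)])
       (use lam3_nz g_eq_0_iff x in auto)
  then have "((\<lambda>z. (z - x) * (phi_even z / (lam3 * g z))) \<longlongrightarrow> 0) (at x)" by (rule small_times_continuous)
  moreover have "eventually (\<lambda>z. (z - x) * (phi_even z / (lam3 * g z)) = (z - x) * Qb z) (at x)"
    using eventually_not_BB[OF x(1)] eventually_not_Lam[OF x(1)]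
    by eventually_elim (simp add: Qb_eq not_BB)
  ultimately show "((\<lambda>z. (z - x) * Qb z) \<longlongrightarrow> 0) (at x)" by (rule Lim_transform_eventually)
qed

lemma row_a: "row a Qa"
proof (rule row_intro[OF hol_a])
  show "Qa holomorphic_on - {0} - BB" unfolding Qa_def
    by (intro holomorphic_intros holomorphic_h_BB hol_a hol_b holomorphic_W) (auto simp: BB_def)
  show "Qa z = (h z * a z + (- (H * eta2 * lam3) * b z)) / W z" for z by (simp add: Qa_def)
  show "((\<lambda>z. (z - x) * (- (H * eta2 * lam3) * b z)) \<longlongrightarrow> 0) (at x)" if "x \<in> Lam" for x
    by (rule small_times_continuous[OF tendsto_mult[OF tendsto_const isCont_holo[OF hol_b Lam_nz[OF that]]]])
  fix x assume x: "x \<noteq> 0" "x \<notin> Lam" "W x = 0"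
  \<comment> \<open>A zero of \<open>W\<close> is a zero of \<open>Th\<close>, so h^2 = -kap there;
    hence h does not vanish and \<open>Qa_eq\<close> is available near x.\<close>
  have "h x ^ 2 + kap = 0" using h_square[OF x(1,2)] x(3) by (simp add: Th_def)
  then have hx: "h x \<noteq> 0" using kap_nz by auto
  have op: "open (- insert 0 Lam)" using closed_Lam0 by (rule open_Compl)
  have "isCont h x"
    using holomorphic_on_imp_continuous_on[OF holomorphic_h] op x by (simp add: continuous_on_eq_continuous_at)
  then have ht: "(h \<longlongrightarrow> h x) (at x)" by (simp add: isCont_def)
  have "((\<lambda>z. H / (h z * g z) * (ff z * a z / g z - eta2 * phi_even z)) \<longlongrightarrow>
      H / (h x * g x) * (ff x * a x / g x - eta2 * phi_even x)) (at x)"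
    by (intro tendsto_intros ht isCont_holo[OF hol_phi_even x(1)] isCont_holo[OF holomorphic_g x(1)]
         isCont_holo[OF holomorphic_ff x(1)] isCont_holo[OF hol_a x(1)])
       (use hx g_eq_0_iff x in auto)
  then have "((\<lambda>z. (z - x) * (H / (h z * g z) * (ff z * a z / g z - eta2 * phi_even z))) \<longlongrightarrow> 0) (at x)" by (rule small_times_continuous)
  moreover have "eventually (\<lambda>z. (z - x) * (H / (h z * g z) * (ff z * a z / g z - eta2 * phi_even z)) = (z - x) * Qa z) (at x)"
    using eventually_not_BB[OF x(1)] eventually_not_Lam[OF x(1)] tendsto_imp_eventually_ne[OF ht hx]
    by eventually_elim (simp add: Qa_eq not_BB)
  ultimately show "((\<lambda>z. (z - x) * Qa z) \<longlongrightarrow> 0) (at x)" by (rule Lim_transform_eventually)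
qed

section \<open>The far rows and the functions they produce\<close>

definition f1 :: "complex \<Rightarrow> complex" where "f1 t = mu1 * h t * Psi_odd t + mu2 * Psi_even t"
definition f2 :: "complex \<Rightarrow> complex" where "f2 t = mu3 * tPsi_odd t + mu4 * h t * tPsi_even t"

text \<open>The factor between z^(2m) g(t) and g(z) for t = z q^m. It is also the prefactor of a(z)
  in the asymptotics of P_n with n = 2m.\<close>

definition CC :: "nat \<Rightarrow> complex" where "CC m = (- 1) ^ m / Q ^ (m * (m - 1))"

text \<open>Division by \<open>CC m\<close> makes these equal to g(z) times a function of t alone,
  so they are directly comparable with a and b.\<close>

definition F1 :: "nat \<Rightarrow> complex \<Rightarrow> complex" where "F1 m z = z ^ (2 * m) * a_inf (z * Q ^ m) / CC m"
definition F2 :: "nat \<Rightarrow> complex \<Rightarrow> complex" where "F2 m z = z ^ (2 * m) * b_inf (z * Q ^ m) / CC m"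
definition S1 :: "nat \<Rightarrow> complex \<Rightarrow> complex" where "S1 m z = H * mu1 * ff z * Psi_odd (z * Q ^ m) / g z"
definition S2 :: "nat \<Rightarrow> complex \<Rightarrow> complex" where "S2 m z = H * mu4 * ff z * tPsi_even (z * Q ^ m) / g z"

lemma CC_nz: "CC m \<noteq> 0" by (simp add: CC_def)

lemma g_CC: "z \<noteq> 0 \<Longrightarrow> z ^ (2 * m) * g (z * Q ^ m) = CC m * g z"
  using quasi_shift[OF quasi_g, of z m] unfolding CC_def by (simp add: field_simps)

lemma Lam_Qk: "z * Q ^ m \<in> Lam \<longleftrightarrow> z \<in> Lam"
  using Lam_mult_iff[OF Lam_powi[of "int m"], of z] by simp

lemma h_Qk: "h (z * Q ^ m) = h z"
proof -
  have "h (Q powi (int m) * z) = h z" using periodic_powi[of h "int m" z] h_periodic by blast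
  then show ?thesis by (simp add: mult.commute)
qed

lemma F_eq:
  assumes "z \<noteq> 0" "z \<notin> Lam"
  shows "F1 m z = g z * f1 (z * Q ^ m)" "F2 m z = g z * f2 (z * Q ^ m)"
proof -
  have t: "z * Q ^ m \<noteq> 0" "z * Q ^ m \<notin> Lam" using assms Lam_Qk by auto
  have gt: "g (z * Q ^ m) \<noteq> 0" using t g_eq_0_iff by blast
  have "a_inf (z * Q ^ m) = g (z * Q ^ m) * f1 (z * Q ^ m)" using mu_a[OF t] gt unfolding f1_def by (simp add: field_simps)
  then have "F1 m z = z ^ (2 * m) * g (z * Q ^ m) * f1 (z * Q ^ m) / CC m" unfolding F1_def by simp
  then show "F1 m z = g z * f1 (z * Q ^ m)" unfolding g_CC[OF assms(1)] using CC_nz by simp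
  have "b_inf (z * Q ^ m) = g (z * Q ^ m) * f2 (z * Q ^ m)" using mu_b[OF t] gt unfolding f2_def by (simp add: field_simps)
  then have "F2 m z = z ^ (2 * m) * g (z * Q ^ m) * f2 (z * Q ^ m) / CC m" unfolding F2_def by simp
  then show "F2 m z = g z * f2 (z * Q ^ m)" unfolding g_CC[OF assms(1)] using CC_nz by simp
qed

lemma hol_Qk: "f holomorphic_on - {0} \<Longrightarrow> (\<lambda>z. f (z * Q ^ m)) holomorphic_on - {0}" for f :: "complex \<Rightarrow> complex"
  using holomorphic_scale[of f "Q ^ m"] by (simp add: mult.commute)

lemma hol_F: "F1 m holomorphic_on - {0}" "F2 m holomorphic_on - {0}"
  unfolding F1_def F2_def
  by (intro holomorphic_intros hol_Qk[OF hol_a_inf] hol_Qk[OF hol_b_inf]; use CC_nz in auto)+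

lemma hol_S: "S1 m holomorphic_on - insert 0 Lam" "S2 m holomorphic_on - insert 0 Lam"
proof -
  have s: "- insert 0 Lam \<subseteq> - {0}" by auto
  have "(\<lambda>z. Psi_odd (z * Q ^ m)) holomorphic_on - insert 0 Lam" "(\<lambda>z. tPsi_even (z * Q ^ m)) holomorphic_on - insert 0 Lam"
    using holomorphic_on_subset[OF hol_Qk[OF Psi_hol(2)] s] holomorphic_on_subset[OF hol_Qk[OF Psi_hol(3)] s] by auto
  then show "S1 m holomorphic_on - insert 0 Lam" "S2 m holomorphic_on - insert 0 Lam"
    unfolding S1_def S2_def
    by (intro holomorphic_intros holomorphic_on_subset[OF holomorphic_ff s] holomorphic_on_subset[OF holomorphic_g s]; auto simp: g_eq_0_iff)+
qed

text \<open>The residue-free term is chosen as g (kap u - h v): it turns h N1 into g u (h^2 + kap),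
  and \<open>h_square\<close> rewrites this as W H ff u / g. The division by \<open>W\<close> is
  then exact, so its zeros cause no poles.\<close>

lemma far_row:
  assumes hN1: "N1 holomorphic_on - {0}" and hN2: "N2 holomorphic_on - insert 0 Lam"
    and u: "u holomorphic_on - {0}" and v: "v holomorphic_on - {0}"
    and N1: "\<And>z. z \<noteq> 0 \<Longrightarrow> z \<notin> Lam \<Longrightarrow> N1 z = g z * (h z * u z + v z)"
    and N2: "\<And>z. z \<noteq> 0 \<Longrightarrow> z \<notin> Lam \<Longrightarrow> N2 z = H * ff z * u z / g z"
  shows "row N1 N2"
proof (rule row_intro[OF hN1])
  show "N2 holomorphic_on - {0} - BB" by (rule holomorphic_on_subset[OF hN2]) (auto simp: BB_def)
  show "N2 z = (h z * N1 z + g z * (kap * u z - h z * v z)) / W z" if z: "z \<noteq> 0" "z \<notin> BB" for z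
  proof -
    have zL: "z \<notin> Lam" "W z \<noteq> 0" using z not_BB by auto
    have g: "g z \<noteq> 0" using z zL g_eq_0_iff by blast
    have "h z * N1 z + g z * (kap * u z - h z * v z) = g z * u z * (h z ^ 2 + kap)"
      unfolding N1[OF z(1) zL(1)] by (simp add: algebra_simps power2_eq_square)
    also have "\<dots> = g z * u z * (H * (W z * ff z) / g z ^ 2)" using h_square[OF z(1) zL(1)] unfolding Th_def by simp
    also have "\<dots> = W z * (H * ff z * u z / g z)" using g by (simp add: power2_eq_square)
    finally show ?thesis unfolding N2[OF z(1) zL(1)] using zL by simp
  qed
  show "((\<lambda>z. (z - x) * (g z * (kap * u z - h z * v z))) \<longlongrightarrow> 0) (at x)" if x: "x \<in> Lam" for x
  proof -
    have x0: "x \<noteq> 0" using Lam_nz[OF x] .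
    have "((\<lambda>z. g z * (kap * ((z - x) * u z) - (z - x) * h z * v z)) \<longlongrightarrow> g x * (kap * 0 - norm x * v x)) (at x)"
      by (intro tendsto_intros isCont_holo[OF holomorphic_g x0] small_times_continuous[OF isCont_holo[OF u x0]] h_residue[OF x] isCont_holo[OF v x0])
    moreover have "g x = 0" using g_eq_0_iff[OF x0] x by blast
    ultimately show ?thesis by (simp add: algebra_simps)
  qed
  fix x assume x: "x \<noteq> 0" "x \<notin> Lam" "W x = 0"
  have op: "open (- insert 0 Lam)" using closed_Lam0 by (rule open_Compl)
  have "isCont N2 x"
    using holomorphic_on_imp_continuous_on[OF hN2] op x by (simp add: continuous_on_eq_continuous_at)
  then show "((\<lambda>z. (z - x) * N2 z) \<longlongrightarrow> 0) (at x)" unfolding isCont_def by (rule small_times_continuous)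
qed

lemma row_F1: "row (F1 m) (S1 m)"
proof (rule far_row[OF hol_F(1) hol_S(1)])
  show "(\<lambda>z. mu1 * Psi_odd (z * Q ^ m)) holomorphic_on - {0}" "(\<lambda>z. mu2 * Psi_even (z * Q ^ m)) holomorphic_on - {0}"
    by (intro holomorphic_intros hol_Qk Psi_hol)+
qed (auto simp: F_eq f1_def S1_def h_Qk algebra_simps)

lemma row_F2: "row (F2 m) (S2 m)"
proof (rule far_row[OF hol_F(2) hol_S(2)])
  show "(\<lambda>z. mu4 * tPsi_even (z * Q ^ m)) holomorphic_on - {0}" "(\<lambda>z. mu3 * tPsi_odd (z * Q ^ m)) holomorphic_on - {0}"
    by (intro holomorphic_intros hol_Qk Psi_hol)+
qed (auto simp: F_eq f2_def S2_def h_Qk algebra_simps)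

lemma GC_not_BB: "z \<in> GC \<sigma> \<Longrightarrow> z \<noteq> 0 \<and> z \<notin> BB"
  using GC_facts[OF \<sigma>] W_GC_nz not_BB by blast

text \<open>On the good circles the combination is O(|z|^(-1/2)) at 0, because of the square-root
  bound for the Cauchy transform. This is too weak for a pole, so the origin is removable.\<close>

lemma near_entire:
  assumes r: "row N1 N2" and N1: "N1 holomorphic_on UNIV" and N2: "N2 \<in> O[at 0 within GC \<sigma>](\<lambda>_. 1)"
  shows "\<exists>Y. Y holomorphic_on UNIV \<and> (\<forall>z. z \<noteq> 0 \<longrightarrow> z \<notin> BB \<longrightarrow> Y z = N1 z * cau A z - N2 z * poly A z)"
proof -
  obtain X where X: "X holomorphic_on - {0}" "\<And>z. z \<in> - {0} - BB \<Longrightarrow> X z = N1 z * cau A z - N2 z * poly A z"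
    using row_extends[OF r, of A] by blast
  let ?G0 = "at 0 within GC \<sigma>"
  have z0: "((\<lambda>z. z) \<longlongrightarrow> (0::complex)) ?G0" by (rule tendsto_ident_at)
  obtain C where C: "C \<ge> 0" "\<And>z. z \<in> GC \<sigma> \<Longrightarrow> norm (cau A z) \<le> C / sqrt (norm z)" using cau_bound[OF \<sigma>, of A] by blast
  have zc: "((\<lambda>z. z * cau A z) \<longlongrightarrow> 0) ?G0"
  proof (rule Lim_null_comparison)
    have "((\<lambda>z. C * sqrt (norm z)) \<longlongrightarrow> C * sqrt (norm (0::complex))) ?G0" by (intro tendsto_intros z0)
    then show "((\<lambda>z. C * sqrt (norm z)) \<longlongrightarrow> 0) ?G0" by simp
    show "eventually (\<lambda>z. norm (z * cau A z) \<le> C * sqrt (norm z)) ?G0"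
      unfolding eventually_at_filter
    proof (rule always_eventually, intro allI impI)
      fix z :: complex assume z: "z \<noteq> 0" "z \<in> GC \<sigma>"
      have "norm (z * cau A z) \<le> norm z * (C / sqrt (norm z))" unfolding norm_mult using C(2)[OF z(2)] by (intro mult_left_mono) auto
      also have "\<dots> = C * (norm z / sqrt (norm z))" by simp
      also have "\<dots> = C * sqrt (norm z)" by (simp only: real_div_sqrt norm_ge_zero)
      finally show "norm (z * cau A z) \<le> C * sqrt (norm z)" .
    qed
  qed
  have cN: "(N1 \<longlongrightarrow> N1 0) ?G0"
    using N1 by (metis continuous_on_def holomorphic_on_imp_continuous_on iso_tuple_UNIV_I tendsto_within_subset top_greatest)
  have "((\<lambda>z. N2 z * z) \<longlongrightarrow> 0) ?G0"
  proof (rule bigo_imp_tendsto[where g = "\<lambda>z. z"])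
    show "(\<lambda>z. N2 z * z - 0) \<in> O[?G0](\<lambda>z. z)" using bigo_mult_bounded[OF N2 landau_o.big_refl] by simp
  qed (rule z0)
  then have "((\<lambda>z. N1 z * (z * cau A z) - N2 z * z * poly A z) \<longlongrightarrow> N1 0 * 0 - 0 * poly A 0) ?G0"
    by (intro tendsto_intros cN zc z0) 
  moreover have "eventually (\<lambda>z. N1 z * (z * cau A z) - N2 z * z * poly A z = z * X z) ?G0"
    unfolding eventually_at_filter
  proof (rule always_eventually, intro allI impI)
    fix z assume "z \<noteq> 0" "z \<in> GC \<sigma>"
    then have E: "X z = N1 z * cau A z - N2 z * poly A z" using X(2)[of z] GC_not_BB[of z] by simp
    show "N1 z * (z * cau A z) - N2 z * z * poly A z = z * X z" unfolding E by (simp add: algebra_simps)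
  qed
  ultimately have "((\<lambda>z. z * X z) \<longlongrightarrow> N1 0 * 0 - 0 * poly A 0) ?G0" by (rule Lim_transform_eventually)
  then have "((\<lambda>z. z * X z) \<longlongrightarrow> 0) ?G0" by simp
  from extend_over_zero[OF \<sigma>_pos X(1) this] obtain G where "G holomorphic_on UNIV" "\<And>z. z \<noteq> 0 \<Longrightarrow> G z = X z" by blast
  then show ?thesis using X(2) by (intro exI[of _ G]) auto
qed

lemma far_entire:
  assumes r: "row N1 N2" and L: "((\<lambda>z. N1 z * cau A z - N2 z * poly A z) \<longlongrightarrow> L) FF"
  shows "\<exists>U. U holomorphic_on UNIV \<and> U 0 = L \<and>
    (\<forall>z. z \<noteq> 0 \<longrightarrow> z \<notin> BB \<longrightarrow> U (1 / z) = N1 z * cau A z - N2 z * poly A z)"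
proof -
  obtain X where X: "X holomorphic_on - {0}" "\<And>z. z \<in> - {0} - BB \<Longrightarrow> X z = N1 z * cau A z - N2 z * poly A z"
    using row_extends[OF r, of A] by blast
  have "eventually (\<lambda>z. N1 z * cau A z - N2 z * poly A z = X z) FF"
    using eventually_FF_GC by eventually_elim (use X(2) GC_not_BB in auto)
  with L have "(X \<longlongrightarrow> L) FF" by (rule Lim_transform_eventually)
  from extend_over_infinity[OF \<sigma>_pos X(1) this] obtain G where
    "G holomorphic_on UNIV" "\<And>s. s \<noteq> 0 \<Longrightarrow> G s = X (1 / s)" "G 0 = L" by blast
  then show ?thesis using X(2) by (intro exI[of _ G]) auto
qed

lemma filterlim_Qk: "filterlim (\<lambda>z. z * Q ^ m) FF FF"
  unfolding Ginf_def filterlim_inf filterlim_principal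
proof
  have "filterlim (\<lambda>z. Q ^ m * z) at_infinity at_infinity"
    by (rule tendsto_mult_filterlim_at_infinity[OF tendsto_const]) (auto simp: filterlim_ident)
  then show "filterlim (\<lambda>z. z * Q ^ m) at_infinity (inf at_infinity (principal (GC \<sigma>)))"
    using filterlim_mono[OF _ order_refl inf_le1] by (simp add: mult.commute)
  show "eventually (\<lambda>z. z * Q ^ m \<in> GC \<sigma>) (inf at_infinity (principal (GC \<sigma>)))"
    unfolding eventually_inf_principal using GC_shift by (auto intro: always_eventually)
qed

text \<open>The distance of a good circle to the lattice is at least c |z|, so the circles
  eventually leave every fixed r-neighbourhood of the lattice.\<close>

lemma tPsi_limit: "((\<lambda>t. tPsi_even t / g t) \<longlongrightarrow> c_Psi) FF"
proof -
  obtain r where r: "r > 0" "(\<lambda>t. tPsi_even t / g t - c_Psi) \<in> O[inf at_infinity (principal {t. \<forall>p\<in>Lam. dist t p > r})](\<lambda>t. 1 / t)"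
    using c_Psi by blast
  obtain c where c: "c > 0" "\<forall>z\<in>GC \<sigma>. \<forall>x\<in>Lam. c * norm z \<le> norm (z - x) \<and> c * norm x \<le> norm (z - x)"
    using gc_dist[OF \<sigma>] by blast
  have "FF \<le> inf at_infinity (principal {t. \<forall>p\<in>Lam. dist t p > r})"
  proof (rule inf_greatest[OF FF_at_infinity], rule filter_leI)
    fix R :: "complex \<Rightarrow> bool" assume "eventually R (principal {t. \<forall>p\<in>Lam. dist t p > r})"
    then have R: "\<And>t. \<forall>p\<in>Lam. dist t p > r \<Longrightarrow> R t" unfolding eventually_principal by blast
    show "eventually R FF"
      unfolding eventually_Ginf
    proof (intro exI[of _ "r / c + 1"] ballI impI R)
      fix z p assume z: "z \<in> GC \<sigma>" "r / c + 1 \<le> norm z" and p: "p \<in> Lam"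
      have "r < c * norm z" using z(2) c(1) by (simp add: field_simps)
      also have "\<dots> \<le> dist z p" using c(2) z(1) p unfolding dist_norm by blast
      finally show "r < dist z p" .
    qed
  qed
  from landau_o.big.filter_mono[OF this r(2)] show ?thesis by (rule bigo_imp_tendsto[OF _ tendsto_1_div])
qed

lemma Psi_limit: "((\<lambda>t. Psi_odd t / g t) \<longlongrightarrow> 0) FF"
  by (rule Psi_div_g_tendsto_0[OF \<sigma> Psi_hol(2) Psi_odd(2)])

lemma cau_limit: "(cau A \<longlongrightarrow> 0) FF"
proof -
  obtain C where C: "C \<ge> 0" "\<And>z. z \<in> GC \<sigma> \<Longrightarrow> norm (cau A z) \<le> C / norm z" using cau_bound[OF \<sigma>, of A] by blast
  show ?thesis
  proof (rule Lim_null_comparison)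
    show "eventually (\<lambda>z. norm (cau A z) \<le> C * norm (1 / z)) FF"
      using eventually_FF_GC by eventually_elim (use C(2) in \<open>simp add: norm_divide\<close>)
    have "((\<lambda>z. C * norm (1 / z)) \<longlongrightarrow> C * 0) FF" by (intro tendsto_intros tendsto_norm_zero tendsto_1_div)
    then show "((\<lambda>z. C * norm (1 / z)) \<longlongrightarrow> 0) FF" by simp
  qed
qed

lemma inf_limits: "((\<lambda>z. a_inf (z * Q ^ m)) \<longlongrightarrow> 1) FF" "((\<lambda>z. b_inf (z * Q ^ m)) \<longlongrightarrow> 0) FF"
proof -
  have inv: "((\<lambda>z. 1 / (z * Q ^ m)) \<longlongrightarrow> 0) FF" by (rule filterlim_compose[OF tendsto_1_div filterlim_Qk])
  have c: "isCont F 0" if "F holomorphic_on UNIV" for F :: "complex \<Rightarrow> complex"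
    using that by (metis continuous_on_eq_continuous_at holomorphic_on_imp_continuous_on iso_tuple_UNIV_I open_UNIV)
  have l1: "((\<lambda>z. ainf_s (1 / (z * Q ^ m))) \<longlongrightarrow> ainf_s 0) FF" by (rule isCont_tendsto_compose[OF c[OF ainf_s(1)] inv])
  have l2: "((\<lambda>z. binf_s (1 / (z * Q ^ m)) * (1 / (z * Q ^ m))) \<longlongrightarrow> binf_s 0 * 0) FF"
    by (intro tendsto_mult isCont_tendsto_compose[OF c[OF binf_s(1)] inv] inv)
  have "eventually (\<lambda>z. ainf_s (1 / (z * Q ^ m)) = a_inf (z * Q ^ m)) FF"
    "eventually (\<lambda>z. binf_s (1 / (z * Q ^ m)) * (1 / (z * Q ^ m)) = b_inf (z * Q ^ m)) FF"
    by (rule eventually_mono[OF eventually_FF_norm[of 0]]; simp add: ainf_s(3) binf_s(3))+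
  then show "((\<lambda>z. a_inf (z * Q ^ m)) \<longlongrightarrow> 1) FF" "((\<lambda>z. b_inf (z * Q ^ m)) \<longlongrightarrow> 0) FF"
    using Lim_transform_eventually[OF l1] Lim_transform_eventually[OF l2] ainf_s(2) by auto
qed

text \<open>Passing from g(z) to g(t) costs z^(-2m), which balances a polynomial of degree at most
  2m. The limit picks out its top coefficient, multiplied by the limit of the
  \<Psi>-quotient.\<close>

lemma S_limits:
  assumes A: "degree A \<le> 2 * m"
  shows "((\<lambda>z. S1 m z * poly A z) \<longlongrightarrow> 0) FF"
    "((\<lambda>z. S2 m z * poly A z) \<longlongrightarrow> CC m * (H * mu4 * c_Psi) * coeff A (2 * m)) FF"
proof -
  have p: "((\<lambda>z. poly A z / z ^ (2 * m)) \<longlongrightarrow> coeff A (2 * m)) FF"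
    by (rule tendsto_mono[OF FF_at_infinity poly_over_power_tendsto[OF A]])
  have f: "(ff \<longlongrightarrow> 1) FF" by (rule bigo_imp_tendsto[OF ff_FF tendsto_1_div])
  have eq: "u / g z = CC m * (u / g (z * Q ^ m)) / z ^ (2 * m)" if "z \<in> GC \<sigma>" for z u
  proof -
    have z: "z \<noteq> 0" "z \<notin> Lam" using GC_facts[OF \<sigma> that] by auto
    have "g z \<noteq> 0" "g (z * Q ^ m) \<noteq> 0" using z g_eq_0_iff Lam_Qk by auto
    then show ?thesis using g_CC[OF z(1), of m] z(1) CC_nz[of m] by (simp add: field_simps)
  qed
  have "((\<lambda>z. CC m * (H * mu1 * ff z * (Psi_odd (z * Q ^ m) / g (z * Q ^ m))) * (poly A z / z ^ (2 * m)))
       \<longlongrightarrow> CC m * (H * mu1 * 1 * 0) * coeff A (2 * m)) FF"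
    by (intro tendsto_intros p f filterlim_compose[OF Psi_limit filterlim_Qk])
  moreover have "eventually (\<lambda>z. CC m * (H * mu1 * ff z * (Psi_odd (z * Q ^ m) / g (z * Q ^ m))) * (poly A z / z ^ (2 * m)) = S1 m z * poly A z) FF"
    using eventually_FF_GC by eventually_elim (simp add: S1_def eq)
  ultimately have "((\<lambda>z. S1 m z * poly A z) \<longlongrightarrow> CC m * (H * mu1 * 1 * 0) * coeff A (2 * m)) FF" by (rule Lim_transform_eventually)
  then show "((\<lambda>z. S1 m z * poly A z) \<longlongrightarrow> 0) FF" by simp
  have "((\<lambda>z. CC m * (H * mu4 * ff z * (tPsi_even (z * Q ^ m) / g (z * Q ^ m))) * (poly A z / z ^ (2 * m)))
       \<longlongrightarrow> CC m * (H * mu4 * 1 * c_Psi) * coeff A (2 * m)) FF"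
    by (intro tendsto_intros p f filterlim_compose[OF tPsi_limit filterlim_Qk])
  moreover have "eventually (\<lambda>z. CC m * (H * mu4 * ff z * (tPsi_even (z * Q ^ m) / g (z * Q ^ m))) * (poly A z / z ^ (2 * m)) = S2 m z * poly A z) FF"
    using eventually_FF_GC by eventually_elim (simp add: S2_def eq)
  ultimately have "((\<lambda>z. S2 m z * poly A z) \<longlongrightarrow> CC m * (H * mu4 * 1 * c_Psi) * coeff A (2 * m)) FF" by (rule Lim_transform_eventually)
  then show "((\<lambda>z. S2 m z * poly A z) \<longlongrightarrow> CC m * (H * mu4 * c_Psi) * coeff A (2 * m)) FF" by simp
qed

lemma power_cau_low: "((\<lambda>z. z ^ n * cau (P n) z) \<longlongrightarrow> 0) FF"
proof -
  have "eventually (\<lambda>z. cau (monom 1 n * P n) z = z ^ n * cau (P n) z) FF"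
    using eventually_FF_GC
    by eventually_elim (use cau_low[OF GC_facts(3)[OF \<sigma>], of _ "monom 1 n" n] in \<open>simp add: degree_monom_eq poly_monom\<close>)
  with cau_limit show ?thesis by (rule Lim_transform_eventually)
qed

lemma power_cau_top: "((\<lambda>z. z ^ Suc n * cau (P n) z) \<longlongrightarrow> \<gamma> n) FF"
proof -
  have "((\<lambda>z. cau (monom 1 (Suc n) * P n) z + \<gamma> n) \<longlongrightarrow> 0 + \<gamma> n) FF" by (intro tendsto_intros cau_limit)
  moreover have "eventually (\<lambda>z. cau (monom 1 (Suc n) * P n) z + \<gamma> n = z ^ Suc n * cau (P n) z) FF"
    using eventually_FF_GC
    by eventually_elim (use cau_top[OF GC_facts(3)[OF \<sigma>], of _ "monom 1 (Suc n)" n] in \<open>simp add: degree_monom_eq poly_monom\<close>)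
  ultimately have "((\<lambda>z. z ^ Suc n * cau (P n) z) \<longlongrightarrow> 0 + \<gamma> n) FF" by (rule Lim_transform_eventually)
  then show ?thesis by simp
qed

text \<open>The two nonzero limits have different sources: \<gamma> comes from the Cauchy transform
  of P_(n-1), the other one from the leading coefficient of P_n through \<open>S2\<close>. They
  become the diagonal normalisation at infinity.\<close>

lemma far_limits:
  assumes m: "m \<ge> 1"
  defines "n \<equiv> 2 * m" and "n' \<equiv> 2 * m - 1"
  shows "((\<lambda>z. F1 m z * cau (P n') z - S1 m z * poly (P n') z) \<longlongrightarrow> \<gamma> n' / CC m) FF"
    "((\<lambda>z. F2 m z * cau (P n') z - S2 m z * poly (P n') z) \<longlongrightarrow> 0) FF"
    "((\<lambda>z. F1 m z * cau (P n) z - S1 m z * poly (P n) z) \<longlongrightarrow> 0) FF"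
    "((\<lambda>z. F2 m z * cau (P n) z - S2 m z * poly (P n) z) \<longlongrightarrow> - (CC m * (H * mu4 * c_Psi))) FF"
proof -
  have n': "Suc n' = 2 * m" unfolding n'_def using m by simp
  have c': "((\<lambda>z. z ^ (2 * m) * cau (P n') z) \<longlongrightarrow> \<gamma> n') FF" using power_cau_top[of n'] unfolding n' .
  have c: "((\<lambda>z. z ^ (2 * m) * cau (P n) z) \<longlongrightarrow> 0) FF" using power_cau_low[of n] unfolding n_def .
  have d': "degree (P n') \<le> 2 * m" "coeff (P n') (2 * m) = 0" using degree_P[of n'] n' by (auto intro!: coeff_eq_0)
  have d: "degree (P n) \<le> 2 * m" "coeff (P n) (2 * m) = 1" using degree_P[of n] coeff_P[of n] unfolding n_def by auto
  have F: "F1 m z * w = a_inf (z * Q ^ m) * (z ^ (2 * m) * w) / CC m" "F2 m z * w = b_inf (z * Q ^ m) * (z ^ (2 * m) * w) / CC m" for z w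
    unfolding F1_def F2_def by simp_all
  have t1: "((\<lambda>z. a_inf (z * Q ^ m) * (z ^ (2 * m) * cau (P n') z) / CC m - S1 m z * poly (P n') z) \<longlongrightarrow> 1 * \<gamma> n' / CC m - 0) FF"
    by (intro tendsto_intros inf_limits c' S_limits d' CC_nz)
  then show "((\<lambda>z. F1 m z * cau (P n') z - S1 m z * poly (P n') z) \<longlongrightarrow> \<gamma> n' / CC m) FF" unfolding F by simp
  have t2: "((\<lambda>z. b_inf (z * Q ^ m) * (z ^ (2 * m) * cau (P n') z) / CC m - S2 m z * poly (P n') z) \<longlongrightarrow> 0 * \<gamma> n' / CC m - CC m * (H * mu4 * c_Psi) * coeff (P n') (2 * m)) FF"
    by (intro tendsto_intros inf_limits c' S_limits d' CC_nz)
  then show "((\<lambda>z. F2 m z * cau (P n') z - S2 m z * poly (P n') z) \<longlongrightarrow> 0) FF" unfolding F d'(2) by simp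
  have t3: "((\<lambda>z. a_inf (z * Q ^ m) * (z ^ (2 * m) * cau (P n) z) / CC m - S1 m z * poly (P n) z) \<longlongrightarrow> 1 * 0 / CC m - 0) FF"
    by (intro tendsto_intros inf_limits c S_limits d CC_nz)
  then show "((\<lambda>z. F1 m z * cau (P n) z - S1 m z * poly (P n) z) \<longlongrightarrow> 0) FF" unfolding F by simp
  have t4: "((\<lambda>z. b_inf (z * Q ^ m) * (z ^ (2 * m) * cau (P n) z) / CC m - S2 m z * poly (P n) z) \<longlongrightarrow> 0 * 0 / CC m - CC m * (H * mu4 * c_Psi) * coeff (P n) (2 * m)) FF"
    by (intro tendsto_intros inf_limits c S_limits d CC_nz)
  then show "((\<lambda>z. F2 m z * cau (P n) z - S2 m z * poly (P n) z) \<longlongrightarrow> - (CC m * (H * mu4 * c_Psi))) FF" unfolding F d(2) by simp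
qed

end

section \<open>The connection matrix on the matching circles\<close>

lemma bigo_prod_diff:
  fixes u v u0 v0 e :: "'a \<Rightarrow> complex"
  assumes u: "(\<lambda>x. u x - u0 x) \<in> O[F](e)" and v: "(\<lambda>x. v x - v0 x) \<in> O[F](e)"
    and u0: "u0 \<in> O[F](\<lambda>_. 1)" and v0: "v0 \<in> O[F](\<lambda>_. 1)" and e: "e \<in> O[F](\<lambda>_. 1)"
  shows "(\<lambda>x. u x * v x - u0 x * v0 x) \<in> O[F](e)"
proof -
  have "v \<in> O[F](\<lambda>_. 1)" by (rule bigo_trans_diff[OF v v0 e])
  then have "(\<lambda>x. v x * (u x - u0 x) + u0 x * (v x - v0 x)) \<in> O[F](e)"
    by (intro sum_in_bigo(1) bigo_mult_bounded u v u0)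
  moreover have "(\<lambda>x. v x * (u x - u0 x) + u0 x * (v x - v0 x)) = (\<lambda>x. u x * v x - u0 x * v0 x)"
    by (auto simp: algebra_simps)
  ultimately show ?thesis by simp
qed

lemma bigo_quotient:
  fixes u d e :: "'a \<Rightarrow> complex"
  assumes u: "(\<lambda>x. u x - u0) \<in> O[F](e)" and d: "(\<lambda>x. d x - d0) \<in> O[F](e)"
    and d0: "d0 \<noteq> 0" and e: "(e \<longlongrightarrow> 0) F"
  shows "(\<lambda>x. u x / d x - u0 / d0) \<in> O[F](e)"
proof -
  have lim: "(d \<longlongrightarrow> d0) F" by (rule bigo_imp_tendsto[OF d e])
  have nz: "eventually (\<lambda>x. d x \<noteq> 0) F" by (rule tendsto_imp_eventually_ne[OF lim d0])
  have i: "(\<lambda>x. 1 / d x) \<in> O[F](\<lambda>_. 1)" by (rule tendsto_bigo_1[OF tendsto_divide[OF tendsto_const lim d0]])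
  have "(\<lambda>x. 1 / d x * ((u x - u0) - u0 / d0 * (d x - d0))) \<in> O[F](e)"
    by (intro bigo_mult_bounded[OF i] sum_in_bigo(2) u bigo_mult_bounded[OF bigo_const] d)
  moreover have "eventually (\<lambda>x. 1 / d x * ((u x - u0) - u0 / d0 * (d x - d0)) = u x / d x - u0 / d0) F"
    using nz by eventually_elim (use d0 in \<open>simp add: field_simps\<close>)
  ultimately show ?thesis using landau_o.big.in_cong by fast
qed

context asym
begin

abbreviation "G0 \<equiv> at 0 within GC \<sigma>"

lemma tendsto_id_G0: "((\<lambda>t. t) \<longlongrightarrow> (0::complex)) G0" by (rule tendsto_ident_at)

lemma id_bigo_1: "(\<lambda>t. t) \<in> O[G0](\<lambda>_. 1 :: complex)" by (rule tendsto_bigo_1[OF tendsto_id_G0])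

lemma entire_G0: "F holomorphic_on UNIV \<Longrightarrow> (\<lambda>t. F t - F 0) \<in> O[G0](\<lambda>t. t)" for F :: "complex \<Rightarrow> complex"
  by (rule landau_o.big.filter_mono[OF at_le[OF subset_UNIV] entire_diff_bigo])

lemma h_bigo_G0: "h \<in> O[G0](\<lambda>_. 1)"
proof -
  obtain B c where "\<forall>z\<in>GC \<sigma>. c \<le> norm (h z) \<and> norm (h z) \<le> B" using h_bounds[OF \<sigma> h_nz] by blast
  then show ?thesis by (intro bounded_bigo_1[of _ B]) (auto simp: eventually_at_filter intro!: always_eventually)
qed

lemma f1_asym: "(\<lambda>t. f1 t - mu2) \<in> O[G0](\<lambda>t. t)"
proof -
  have "(\<lambda>t. mu1 * (h t * (Psi_odd t - Psi_odd 0)) + mu2 * (Psi_even t - Psi_even 0)) \<in> O[G0](\<lambda>t. t)"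
    by (intro sum_in_bigo(1) bigo_mult_bounded[OF bigo_const] bigo_mult_bounded[OF h_bigo_G0] entire_G0 Psi_hol)
  then show ?thesis unfolding Psi_0 f1_def by (simp add: algebra_simps)
qed

lemma f2_asym: "(\<lambda>t. f2 t - mu4 * h t) \<in> O[G0](\<lambda>t. t)"
proof -
  have "(\<lambda>t. mu3 * (tPsi_odd t - tPsi_odd 0) + mu4 * (h t * (tPsi_even t - tPsi_even 0))) \<in> O[G0](\<lambda>t. t)"
    by (intro sum_in_bigo(1) bigo_mult_bounded[OF bigo_const] bigo_mult_bounded[OF h_bigo_G0] entire_G0 Psi_hol)
  then show ?thesis unfolding Psi_0 f2_def by (simp add: algebra_simps)
qed

text \<open>\<open>separation\<close> wants the value 1 at 0, so the simple zero of b at the origin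
  is divided out.\<close>

definition pb :: "complex \<Rightarrow> complex" where "pb z = (if z = 0 then 1 else b z / z)"

lemma pb: "pb holomorphic_on UNIV" "pb 0 = 1" "b z = z * pb z"
proof -
  have "(\<lambda>z. if z = 0 then deriv b 0 else (b z - b 0) / (z - 0)) holomorphic_on UNIV"
    by (rule pole_lemma_open) (auto simp: hol_b)
  moreover have "(\<lambda>z. if z = 0 then deriv b 0 else (b z - b 0) / (z - 0)) = pb"
    by (auto simp: pb_def b_deriv b_0)
  ultimately show "pb holomorphic_on UNIV" by simp
qed (auto simp: pb_def b_0)

lemma sep_a: "separation q \<sigma> a g eta2 0"
proof (unfold_locales; (fact \<sigma> hol_a a_0 holomorphic_g quasi_g eta2_nz g_imaginary_nz)?)
  have "((\<lambda>z. a z / g z - eta2) \<longlongrightarrow> 0) FF"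
    by (rule bigo_imp_tendsto[OF _ tendsto_1_div]) (use a_asym in simp)
  moreover have "eventually (\<lambda>z. a z / g z - eta2 = (z ^ 0 * a z - eta2 * g z) / g z) FF"
    using eventually_FF_GC by eventually_elim (use GC_facts[OF \<sigma>] g_eq_0_iff in \<open>auto simp: diff_divide_distrib\<close>)
  ultimately show "((\<lambda>z. (z ^ 0 * a z - eta2 * g z) / g z) \<longlongrightarrow> 0) FF" by (rule Lim_transform_eventually)
qed

lemma sep_b: "separation q \<sigma> pb GH (1 / (H * lam3)) 1"
proof (unfold_locales; (fact \<sigma> pb holomorphic_GH quasi_GH GH_imaginary_nz)?)
  show "1 / (H * lam3) \<noteq> 0" using H_nz lam3_nz by simp
  have "((\<lambda>z. b z / g z - h z / (H * lam3)) \<longlongrightarrow> 0) FF"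
    by (rule bigo_imp_tendsto[OF _ tendsto_1_div]) (use b_asym in simp)
  moreover have "eventually (\<lambda>z. b z / g z - h z / (H * lam3) = (z ^ 1 * pb z - 1 / (H * lam3) * GH z) / g z) FF"
    using eventually_FF_GC
    by eventually_elim (use GC_facts[OF \<sigma>] g_eq_0_iff in \<open>auto simp: diff_divide_distrib GH_eq pb(3)\<close>)
  ultimately show "((\<lambda>z. (z ^ 1 * pb z - 1 / (H * lam3) * GH z) / g z) \<longlongrightarrow> 0) FF" by (rule Lim_transform_eventually)
qed

abbreviation "\<sigma>' \<equiv> q / \<sigma>"

lemma \<sigma>': "q < \<sigma>'" "\<sigma>' < 1"
  using \<sigma> q0 \<sigma>_pos by (auto simp: pos_less_divide_eq pos_divide_less_eq)

lemma inverse_to_G0: "filterlim (\<lambda>s. 1 / s) G0 (Ginf \<sigma>')"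
proof -
  have "filterlim (\<lambda>s. 1 / s) (at 0 within GC (1 / (1 / \<sigma>))) (Ginf (1 / \<sigma>))"
    by (rule filterlim_inverse_GC0) (use \<sigma>_pos in simp)
  moreover have "Ginf (1 / \<sigma>) = Ginf \<sigma>'" unfolding Ginf_def GC_reciprocal ..
  ultimately show ?thesis by simp
qed

lemma eventually_Ginf': "eventually (\<lambda>s. s \<noteq> 0 \<and> s \<notin> Lam) (Ginf \<sigma>')"
  unfolding eventually_Ginf using GC_facts[OF \<sigma>'] by blast

text \<open>Inverting the argument of g costs the factor -1/s^2. The odd function contributes one
  more s, whence the exponents 2 and 3 in the next two interpretations.\<close>

lemma far_at_reciprocal:
  assumes "s \<noteq> 0" "s \<notin> Lam"
  shows "s ^ 2 * ainf_s s = - (g s * f1 (1 / s))" "s ^ 3 * binf_s s = - (g s * f2 (1 / s))"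
proof -
  have t: "1 / s \<noteq> 0" "1 / s \<notin> Lam"
    using assms Lam_inverse[of "1 / s"] by auto
  have gt: "g (1 / s) \<noteq> 0" using t g_eq_0_iff by blast
  have "ainf_s s = g (1 / s) * f1 (1 / s)" using mu_a[OF t] gt ainf_s(3)[OF t(1)] unfolding f1_def by (simp add: field_simps)
  then show "s ^ 2 * ainf_s s = - (g s * f1 (1 / s))" unfolding g_inverse[OF assms(1)] using assms(1) by simp
  have "s * binf_s s = g (1 / s) * f2 (1 / s)" using mu_b[OF t] gt binf_s(3)[OF t(1)] unfolding f2_def by (simp add: field_simps)
  then have "s ^ 2 * (s * binf_s s) = - (g s * f2 (1 / s))" unfolding g_inverse[OF assms(1)] using assms(1) by simp
  then show "s ^ 3 * binf_s s = - (g s * f2 (1 / s))" by (simp add: power_numeral_reduce mult_ac)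
qed

lemma sep_ainf: "separation q \<sigma>' ainf_s g (- mu2) 2"
proof (unfold_locales; (fact \<sigma>' ainf_s holomorphic_g quasi_g g_imaginary_nz)?)
  show "- mu2 \<noteq> 0" using mu2_nz by simp
  have "((\<lambda>t. - (f1 t - mu2)) \<longlongrightarrow> - 0) G0"
    by (intro tendsto_minus bigo_imp_tendsto[OF _ tendsto_id_G0]) (use f1_asym in simp)
  then have "((\<lambda>s. - (f1 (1 / s) - mu2)) \<longlongrightarrow> 0) (Ginf \<sigma>')"
    using filterlim_compose[OF _ inverse_to_G0] unfolding minus_zero by blast
  moreover have "eventually (\<lambda>s. - (f1 (1 / s) - mu2) = (s ^ 2 * ainf_s s - - mu2 * g s) / g s) (Ginf \<sigma>')"
    using eventually_Ginf'
  proof eventually_elim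
    case (elim s)
    then have s: "s \<noteq> 0" "s \<notin> Lam" by blast+
    then have "g s \<noteq> 0" using g_eq_0_iff by blast
    then show ?case unfolding far_at_reciprocal(1)[OF s] by (simp add: field_simps)
  qed
  ultimately show "((\<lambda>s. (s ^ 2 * ainf_s s - - mu2 * g s) / g s) \<longlongrightarrow> 0) (Ginf \<sigma>')" by (rule Lim_transform_eventually)
qed

text \<open>The sign of g under inversion cancels against that of h, so the constant is mu4 here but
  -mu2 for \<open>ainf_s\<close>.\<close>

lemma sep_binf: "separation q \<sigma>' binf_s GH mu4 3"
proof (unfold_locales; (fact \<sigma>' binf_s holomorphic_GH quasi_GH GH_imaginary_nz mu4_nz)?)
  have "((\<lambda>t. - (f2 t - mu4 * h t)) \<longlongrightarrow> - 0) G0"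
    by (intro tendsto_minus bigo_imp_tendsto[OF _ tendsto_id_G0]) (use f2_asym in simp)
  then have "((\<lambda>s. - (f2 (1 / s) - mu4 * h (1 / s))) \<longlongrightarrow> 0) (Ginf \<sigma>')"
    using filterlim_compose[OF _ inverse_to_G0] unfolding minus_zero by blast
  moreover have "eventually (\<lambda>s. - (f2 (1 / s) - mu4 * h (1 / s)) = (s ^ 3 * binf_s s - mu4 * GH s) / g s) (Ginf \<sigma>')"
    using eventually_Ginf'
  proof eventually_elim
    case (elim s)
    then have s: "s \<noteq> 0" "s \<notin> Lam" by blast+
    then have "g s \<noteq> 0" using g_eq_0_iff by blast
    then show ?case unfolding far_at_reciprocal(2)[OF s] h_inverse[OF s(1)] GH_eq[OF s] by (simp add: field_simps)
  qed
  ultimately show "((\<lambda>s. (s ^ 3 * binf_s s - mu4 * GH s) / g s) \<longlongrightarrow> 0) (Ginf \<sigma>')" by (rule Lim_transform_eventually)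
qed

section \<open>The matching circles and asymptotics uniform on them\<close>

definition R1 :: "nat \<Rightarrow> real" where "R1 m = \<sigma> / q ^ (m div 2)"
text \<open>Two good circles around radius q^(-m/2) = q^(-n/4). A ratio of q^2 absorbs the rounding
  in \<open>m div 2\<close> for either parity of m and any admissible \<sigma>.\<close>

definition R2 :: "nat \<Rightarrow> real" where "R2 m = R1 m / q ^ 2"
definition circ :: "nat \<Rightarrow> complex \<Rightarrow> bool" where "circ m z \<longleftrightarrow> norm z = R1 m \<or> norm z = R2 m"
definition ep :: "nat \<Rightarrow> real" where "ep m = q powr (real m / 2)"

text \<open>m tends to infinity while z is on either matching circle of index m. Estimates uniform
  in z become ordinary O-statements for this filter and can be multiplied and divided as
  such.\<close>

definition Phi :: "(nat \<times> complex) filter" where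
  "Phi = inf (filtercomap fst sequentially) (principal {(m, z). circ m z})"

lemma eventually_Phi: "eventually R Phi \<longleftrightarrow> (\<exists>N. \<forall>m\<ge>N. \<forall>z. circ m z \<longrightarrow> R (m, z))"
proof
  assume "eventually R Phi"
  then obtain X where X: "eventually X sequentially" "\<forall>x. X (fst x) \<longrightarrow> x \<in> {(m, z). circ m z} \<longrightarrow> R x"
    unfolding Phi_def eventually_inf_principal eventually_filtercomap by auto
  obtain N where "\<forall>m\<ge>N. X m" using X(1) unfolding eventually_sequentially by blast
  then show "\<exists>N. \<forall>m\<ge>N. \<forall>z. circ m z \<longrightarrow> R (m, z)" using X(2) by (intro exI[of _ N]) auto
next
  assume "\<exists>N. \<forall>m\<ge>N. \<forall>z. circ m z \<longrightarrow> R (m, z)"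
  then obtain N where N: "\<forall>m\<ge>N. \<forall>z. circ m z \<longrightarrow> R (m, z)" by blast
  show "eventually R Phi"
    unfolding Phi_def eventually_inf_principal eventually_filtercomap
    by (intro exI[of _ "\<lambda>m. m \<ge> N"] conjI eventually_ge_at_top) (use N in auto)
qed

lemma R1_pos: "0 < R1 m" unfolding R1_def using \<sigma>_pos q0 by simp

lemma R12: "R1 m \<le> R2 m" "0 < R2 m"
proof -
  have q2: "0 < q ^ 2" "q ^ 2 \<le> 1" using q0 q1 by (auto simp: power_le_one)
  then show "R1 m \<le> R2 m" unfolding R2_def using R1_pos[of m] by (simp add: pos_le_divide_eq mult_left_le)
  then show "0 < R2 m" using R1_pos[of m] by linarith
qed

lemma circ_bounds: "circ m z \<Longrightarrow> R1 m \<le> norm z \<and> norm z \<le> R2 m"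
  unfolding circ_def using R12[of m] by auto

lemma circ_GC: "circ m z \<Longrightarrow> z \<in> GC \<sigma>"
proof -
  have e: "\<sigma> / q ^ k = \<sigma> * q powi (- int k)" for k by (simp add: power_int_minus divide_inverse)
  assume "circ m z"
  then have "norm z = \<sigma> / q ^ (m div 2) \<or> norm z = \<sigma> / q ^ (m div 2 + 2)"
    unfolding circ_def R1_def R2_def power_add by (simp only: divide_divide_eq_left)
  then show ?thesis unfolding GC_def e by blast
qed

lemma ep_pos: "0 < ep m" unfolding ep_def using q0 by simp

lemma q_half_power: "q ^ (m div 2) \<le> ep m / q"
proof -
  have "q ^ (m div 2) = q powr real (m div 2)" using q0 by (simp add: powr_realpow)
  also have "\<dots> \<le> q powr (real m / 2 - 1)" using q0 q1 by (intro powr_mono') linarith+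
  also have "\<dots> = ep m / q" unfolding ep_def using q0 by (simp add: powr_diff)
  finally show ?thesis .
qed

lemma q_half_power': "q ^ (m - m div 2) \<le> ep m"
proof -
  have "q ^ (m - m div 2) = q powr real (m - m div 2)" by (rule powr_realpow[OF q0, symmetric])
  also have "\<dots> \<le> q powr (real m / 2)" using q0 q1 by (intro powr_mono') linarith+
  finally show ?thesis unfolding ep_def .
qed

lemma ep_tendsto: "ep \<longlonglongrightarrow> 0"
proof -
  have "ep = (\<lambda>m. sqrt q ^ m)"
  proof
    fix m
    have "sqrt q ^ m = (q powr (1 / 2)) powr real m" using q0 by (simp add: powr_half_sqrt powr_realpow)
    then show "ep m = sqrt q ^ m" unfolding ep_def by (simp add: powr_powr)
  qed
  moreover have "(\<lambda>m. sqrt q ^ m) \<longlonglongrightarrow> 0" using q0 q1 by (intro LIMSEQ_realpow_zero) auto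
  ultimately show ?thesis by simp
qed

definition ee :: "nat \<times> complex \<Rightarrow> complex" where "ee x = complex_of_real (ep (fst x))"

lemma fst_Phi: "filterlim fst sequentially Phi"
  unfolding Phi_def by (rule filterlim_mono[OF filterlim_filtercomap order_refl inf_le1])

lemma ee_tendsto: "(ee \<longlongrightarrow> 0) Phi"
proof -
  have "((\<lambda>x. complex_of_real (ep (fst x))) \<longlongrightarrow> complex_of_real 0) Phi"
    by (intro tendsto_of_real filterlim_compose[OF ep_tendsto fst_Phi])
  then show ?thesis unfolding ee_def[abs_def] by simp
qed

lemma ee_bigo_1: "ee \<in> O[Phi](\<lambda>_. 1)" by (rule tendsto_bigo_1[OF ee_tendsto])

lemma inverse_z_bigo: "(\<lambda>x. 1 / snd x) \<in> O[Phi](ee)"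
proof (rule bigoI[of _ "1 / (\<sigma> * q)"])
  show "eventually (\<lambda>x. norm (1 / snd x) \<le> 1 / (\<sigma> * q) * norm (ee x)) Phi"
    unfolding eventually_Phi
  proof (intro exI[of _ 0] allI impI)
    fix m z assume "circ m z"
    then have "R1 m \<le> norm z" using circ_bounds by blast
    then have "1 / norm z \<le> 1 / R1 m" using R1_pos[of m] by (intro frac_le) auto
    also have "\<dots> = q ^ (m div 2) / \<sigma>" unfolding R1_def by simp
    also have "\<dots> \<le> (ep m / q) / \<sigma>" using q_half_power[of m] \<sigma>_pos by (intro divide_right_mono) auto
    finally show "norm (1 / snd (m, z)) \<le> 1 / (\<sigma> * q) * norm (ee (m, z))"
      using ep_pos[of m] by (simp add: ee_def norm_divide mult.commute)
  qed
qed

lemma t_norm_bound: "circ m z \<Longrightarrow> norm (z * Q ^ m) \<le> \<sigma> / q ^ 2 * ep m"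
proof -
  assume "circ m z"
  then have "norm z \<le> R2 m" using circ_bounds by blast
  then have "norm (z * Q ^ m) \<le> R2 m * q ^ m" using q0 by (simp add: norm_mult norm_power mult_right_mono)
  also have "\<dots> = \<sigma> / q ^ 2 * q ^ (m - m div 2)"
  proof -
    have "q ^ m = q ^ (m div 2) * q ^ (m - m div 2)" by (simp flip: power_add)
    then show ?thesis unfolding R2_def R1_def by simp
  qed
  also have "\<dots> \<le> \<sigma> / q ^ 2 * ep m" using q_half_power'[of m] \<sigma>_pos by (intro mult_left_mono) auto
  finally show ?thesis .
qed

lemma t_bigo: "(\<lambda>x. snd x * Q ^ fst x) \<in> O[Phi](ee)"
proof (rule bigoI[of _ "\<sigma> / q ^ 2"])
  show "eventually (\<lambda>x. norm (snd x * Q ^ fst x) \<le> \<sigma> / q ^ 2 * norm (ee x)) Phi"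
    unfolding eventually_Phi using t_norm_bound ep_pos by (intro exI[of _ 0]) (auto simp: ee_def less_imp_le)
qed

lemma z_FF: "filterlim snd FF Phi"
  unfolding filterlim_def le_filter_def eventually_filtermap
proof (intro allI impI)
  fix R assume "eventually R FF"
  then obtain B where B: "\<And>z. z \<in> GC \<sigma> \<Longrightarrow> norm z \<ge> B \<Longrightarrow> R z" unfolding eventually_Ginf by blast
  obtain N where N: "\<And>m. m \<ge> N \<Longrightarrow> ep m < q * \<sigma> / (\<bar>B\<bar> + 1)"
    using order_tendstoD(2)[OF ep_tendsto, of "q * \<sigma> / (\<bar>B\<bar> + 1)"] q0 \<sigma>_pos unfolding eventually_sequentially by auto
  show "eventually (\<lambda>x. R (snd x)) Phi"
    unfolding eventually_Phi
  proof (intro exI[of _ N] allI impI)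
    fix m z assume m: "N \<le> m" and z: "circ m z"
    have "q ^ (m div 2) \<le> ep m / q" by (rule q_half_power)
    also have "\<dots> < \<sigma> / (\<bar>B\<bar> + 1)" using N[OF m] q0 by (simp add: field_simps)
    finally have "q ^ (m div 2) * (\<bar>B\<bar> + 1) < \<sigma>" by (simp add: pos_less_divide_eq)
    then have "\<bar>B\<bar> + 1 < R1 m" unfolding R1_def using q0 by (simp add: pos_less_divide_eq mult.commute)
    then have "B \<le> norm z" using circ_bounds[OF z] by linarith
    then show "R (snd (m, z))" using B circ_GC[OF z] by simp
  qed
qed

lemma t_G0: "filterlim (\<lambda>x. snd x * Q ^ fst x) G0 Phi"
proof -
  have "((\<lambda>x. snd x * Q ^ fst x) \<longlongrightarrow> 0) Phi"
    using bigo_imp_tendsto[of "\<lambda>x. snd x * Q ^ fst x" 0] t_bigo ee_tendsto by simp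
  moreover have "eventually (\<lambda>x. snd x * Q ^ fst x \<in> GC \<sigma>) Phi"
    unfolding eventually_Phi using circ_GC GC_shift by auto
  moreover have "eventually (\<lambda>x. snd x * Q ^ fst x \<noteq> 0) Phi"
    unfolding eventually_Phi using circ_GC GC_not_BB by auto
  ultimately show ?thesis unfolding filterlim_at by (auto intro: eventually_conj)
qed

text \<open>On the matching circles 1/z and t = z q^m are both O(\<open>ep m\<close>). An error
  O(1/z) of a near function and, in the next lemma, an error O(t) of a far one thus have the same
  size.\<close>

lemma from_FF: "u \<in> O[FF](\<lambda>z. 1 / z) \<Longrightarrow> (\<lambda>x. u (snd x)) \<in> O[Phi](ee)"
  using landau_o.big_trans[OF landau_o.big.compose[OF _ z_FF] inverse_z_bigo] .

lemma from_G0: "u \<in> O[G0](\<lambda>t. t) \<Longrightarrow> (\<lambda>x. u (snd x * Q ^ fst x)) \<in> O[Phi](ee)"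
  using landau_o.big_trans[OF landau_o.big.compose[OF _ t_G0] t_bigo] .

text \<open>The near rows are expressed through the far rows by Cramer's rule. Dividing first
  entries by g and multiplying second entries by g bounds everything, and the determinant tends to
  mu2 H mu4, which is nonzero.\<close>

lemma connection_matrix:
  "\<exists>K N. \<forall>m\<ge>N. \<forall>z. circ m z \<longrightarrow> (\<exists>J11 J12 J21 J22.
     a z = J11 * F1 m z + J12 * F2 m z \<and> Qa z = J11 * S1 m z + J12 * S2 m z \<and>
     b z = J21 * F1 m z + J22 * F2 m z \<and> Qb z = J21 * S1 m z + J22 * S2 m z \<and>
     norm (J11 - eta2 / mu2) \<le> K * ep m \<and> norm J12 \<le> K * ep m \<and>
     norm J21 \<le> K * ep m \<and> norm (J22 - 1 / (lam3 * H * mu4)) \<le> K * ep m)"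
proof -
  define al where "al = (\<lambda>x::nat \<times> complex. a (snd x) / g (snd x))"
  define be where "be = (\<lambda>x::nat \<times> complex. b (snd x) / g (snd x))"
  define qa where "qa = (\<lambda>x::nat \<times> complex. g (snd x) * Qa (snd x))"
  define qb where "qb = (\<lambda>x::nat \<times> complex. g (snd x) * Qb (snd x))"
  define p1 where "p1 = (\<lambda>x. f1 (snd x * Q ^ fst x))"
  define p2 where "p2 = (\<lambda>x. f2 (snd x * Q ^ fst x))"
  define s1 where "s1 = (\<lambda>x. H * mu1 * ff (snd x) * Psi_odd (snd x * Q ^ fst x))"
  define s2 where "s2 = (\<lambda>x. H * mu4 * ff (snd x) * tPsi_even (snd x * Q ^ fst x))"
  define hh where "hh = (\<lambda>x::nat \<times> complex. h (snd x))"
  have hh: "hh \<in> O[Phi](\<lambda>_. 1)" unfolding hh_def by (rule landau_o.big.compose[OF h_bigo_1 z_FF])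
  note c1 = bigo_const
  have o1: "(\<lambda>x. k * hh x) \<in> O[Phi](\<lambda>_. 1)" for k by (rule bigo_mult_bounded[OF c1 hh])
  have al: "(\<lambda>x. al x - eta2) \<in> O[Phi](ee)" unfolding al_def by (rule from_FF[OF a_asym])
  have be: "(\<lambda>x. be x - 1 / (H * lam3) * hh x) \<in> O[Phi](ee)" unfolding be_def hh_def using from_FF[OF b_asym] by simp
  have qa: "(\<lambda>x. qa x - 0) \<in> O[Phi](ee)" unfolding qa_def using from_FF[OF Qa_asym] by simp
  have qb: "(\<lambda>x. qb x - 1 / lam3) \<in> O[Phi](ee)" unfolding qb_def by (rule from_FF[OF Qb_asym])
  have p1: "(\<lambda>x. p1 x - mu2) \<in> O[Phi](ee)" unfolding p1_def by (rule from_G0[OF f1_asym])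
  have p2: "(\<lambda>x. p2 x - mu4 * hh x) \<in> O[Phi](ee)" unfolding p2_def hh_def using from_G0[OF f2_asym] by (simp add: h_Qk)
  have ffx: "(\<lambda>x. ff (snd x) - 1) \<in> O[Phi](ee)" by (rule from_FF[OF ff_FF])
  have s1: "(\<lambda>x. s1 x - 0) \<in> O[Phi](ee)"
  proof -
    have "(\<lambda>x. Psi_odd (snd x * Q ^ fst x) - 0) \<in> O[Phi](ee)" using from_G0[OF entire_G0[OF Psi_hol(2)]] unfolding Psi_0 .
    from bigo_mult_bounded[OF c1[of "H * mu1"] bigo_prod_diff[OF ffx this c1 c1 ee_bigo_1]]
    show ?thesis unfolding s1_def by (simp add: mult_ac)
  qed
  have s2: "(\<lambda>x. s2 x - H * mu4) \<in> O[Phi](ee)"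
  proof -
    have "(\<lambda>x. tPsi_even (snd x * Q ^ fst x) - 1) \<in> O[Phi](ee)" using from_G0[OF entire_G0[OF Psi_hol(3)]] unfolding Psi_0 .
    from bigo_mult_bounded[OF c1[of "H * mu4"] bigo_prod_diff[OF ffx this c1 c1 ee_bigo_1]]
    show ?thesis unfolding s2_def by (simp add: algebra_simps)
  qed
  define d where "d = (\<lambda>x. p1 x * s2 x - p2 x * s1 x)"
  have d: "(\<lambda>x. d x - mu2 * (H * mu4)) \<in> O[Phi](ee)"
    using sum_in_bigo(2)[OF bigo_prod_diff[OF p1 s2 c1 c1 ee_bigo_1] bigo_prod_diff[OF p2 s1 o1 c1 ee_bigo_1]]
    unfolding d_def by (simp add: algebra_simps)
  have d0: "mu2 * (H * mu4) \<noteq> 0" using mu2_nz mu4_nz H_nz by simp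
  have n11: "(\<lambda>x. (al x * s2 x - qa x * p2 x) - eta2 * (H * mu4)) \<in> O[Phi](ee)"
    using sum_in_bigo(2)[OF bigo_prod_diff[OF al s2 c1 c1 ee_bigo_1] bigo_prod_diff[OF qa p2 c1 o1 ee_bigo_1]] by (simp add: algebra_simps)
  have n12: "(\<lambda>x. (qa x * p1 x - al x * s1 x) - 0) \<in> O[Phi](ee)"
    using sum_in_bigo(2)[OF bigo_prod_diff[OF qa p1 c1 c1 ee_bigo_1] bigo_prod_diff[OF al s1 c1 c1 ee_bigo_1]] by simp
  \<comment> \<open>Here neither product is small; their leading terms h / (H lam3) times H mu4, and
    1 / lam3 times mu4 h, cancel exactly.\<close>
  have n21: "(\<lambda>x. (be x * s2 x - qb x * p2 x) - 0) \<in> O[Phi](ee)"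
    using sum_in_bigo(2)[OF bigo_prod_diff[OF be s2 o1 c1 ee_bigo_1] bigo_prod_diff[OF qb p2 c1 o1 ee_bigo_1]] H_nz by simp
  have n22: "(\<lambda>x. (qb x * p1 x - be x * s1 x) - mu2 / lam3) \<in> O[Phi](ee)"
    using sum_in_bigo(2)[OF bigo_prod_diff[OF qb p1 c1 c1 ee_bigo_1] bigo_prod_diff[OF be s1 o1 c1 ee_bigo_1]] by (simp add: algebra_simps)
  note q11 = bigo_quotient[OF n11 d d0 ee_tendsto]
  note q12 = bigo_quotient[OF n12 d d0 ee_tendsto]
  note q21 = bigo_quotient[OF n21 d d0 ee_tendsto]
  note q22 = bigo_quotient[OF n22 d d0 ee_tendsto]
  obtain k1 where k1: "k1 > 0" "eventually (\<lambda>x. norm ((al x * s2 x - qa x * p2 x) / d x - eta2 * (H * mu4) / (mu2 * (H * mu4))) \<le> k1 * norm (ee x)) Phi" using landau_o.bigE[OF q11] by blast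
  obtain k2 where k2: "k2 > 0" "eventually (\<lambda>x. norm ((qa x * p1 x - al x * s1 x) / d x - 0 / (mu2 * (H * mu4))) \<le> k2 * norm (ee x)) Phi" using landau_o.bigE[OF q12] by blast
  obtain k3 where k3: "k3 > 0" "eventually (\<lambda>x. norm ((be x * s2 x - qb x * p2 x) / d x - 0 / (mu2 * (H * mu4))) \<le> k3 * norm (ee x)) Phi" using landau_o.bigE[OF q21] by blast
  obtain k4 where k4: "k4 > 0" "eventually (\<lambda>x. norm ((qb x * p1 x - be x * s1 x) / d x - mu2 / lam3 / (mu2 * (H * mu4))) \<le> k4 * norm (ee x)) Phi" using landau_o.bigE[OF q22] by blast
  define K where "K = k1 + k2 + k3 + k4"
  have dn: "eventually (\<lambda>x. d x \<noteq> 0) Phi" by (rule tendsto_imp_eventually_ne[OF bigo_imp_tendsto[OF d ee_tendsto] d0])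
  have "eventually (\<lambda>x. circ (fst x) (snd x)) Phi" unfolding eventually_Phi by auto
  then have "eventually (\<lambda>x. \<exists>J11 J12 J21 J22.
     a (snd x) = J11 * F1 (fst x) (snd x) + J12 * F2 (fst x) (snd x) \<and> Qa (snd x) = J11 * S1 (fst x) (snd x) + J12 * S2 (fst x) (snd x) \<and>
     b (snd x) = J21 * F1 (fst x) (snd x) + J22 * F2 (fst x) (snd x) \<and> Qb (snd x) = J21 * S1 (fst x) (snd x) + J22 * S2 (fst x) (snd x) \<and>
     norm (J11 - eta2 / mu2) \<le> K * ep (fst x) \<and> norm J12 \<le> K * ep (fst x) \<and>
     norm J21 \<le> K * ep (fst x) \<and> norm (J22 - 1 / (lam3 * H * mu4)) \<le> K * ep (fst x)) Phi"
    using k1(2) k2(2) k3(2) k4(2) dn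
  proof eventually_elim
    case (elim x)
    let ?z = "snd x" and ?m = "fst x"
    have z: "?z \<noteq> 0" "?z \<notin> Lam" using GC_facts[OF \<sigma> circ_GC[OF elim(1)]] by auto
    have g: "g ?z \<noteq> 0" using z g_eq_0_iff by blast
    have e: "norm (ee x) = ep ?m" unfolding ee_def using ep_pos[of ?m] by simp
    let ?J11 = "(al x * s2 x - qa x * p2 x) / d x" and ?J12 = "(qa x * p1 x - al x * s1 x) / d x"
    let ?J21 = "(be x * s2 x - qb x * p2 x) / d x" and ?J22 = "(qb x * p1 x - be x * s1 x) / d x"
    have F: "F1 ?m ?z = g ?z * p1 x" "F2 ?m ?z = g ?z * p2 x" "S1 ?m ?z = s1 x / g ?z" "S2 ?m ?z = s2 x / g ?z"
      unfolding p1_def p2_def s1_def s2_def S1_def S2_def by (auto simp: F_eq[OF z])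
    have A: "a ?z = g ?z * al x" "b ?z = g ?z * be x" "Qa ?z = qa x / g ?z" "Qb ?z = qb x / g ?z"
      unfolding al_def be_def qa_def qb_def using g by simp_all
    have cr: "(u * s2 x - v * p2 x) / d x * p1 x + (v * p1 x - u * s1 x) / d x * p2 x = u"
      "(u * s2 x - v * p2 x) / d x * s1 x + (v * p1 x - u * s1 x) / d x * s2 x = v" for u v
    proof -
      have "(u * s2 x - v * p2 x) * p1 x + (v * p1 x - u * s1 x) * p2 x = u * d x" unfolding d_def by (simp add: algebra_simps)
      then have "((u * s2 x - v * p2 x) * p1 x + (v * p1 x - u * s1 x) * p2 x) / d x = u" using elim(6) by simp
      then show "(u * s2 x - v * p2 x) / d x * p1 x + (v * p1 x - u * s1 x) / d x * p2 x = u" by (simp add: add_divide_distrib)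
      have "(u * s2 x - v * p2 x) * s1 x + (v * p1 x - u * s1 x) * s2 x = v * d x" unfolding d_def by (simp add: algebra_simps)
      then have "((u * s2 x - v * p2 x) * s1 x + (v * p1 x - u * s1 x) * s2 x) / d x = v" using elim(6) by simp
      then show "(u * s2 x - v * p2 x) / d x * s1 x + (v * p1 x - u * s1 x) / d x * s2 x = v" by (simp add: add_divide_distrib)
    qed
    have fac: "j * (y * u) + k * (y * v) = y * (j * u + k * v)" "j * (u / y) + k * (v / y) = (j * u + k * v) / y" for j k u v y :: complex
      by (simp_all add: algebra_simps add_divide_distrib)
    have "a ?z = ?J11 * F1 ?m ?z + ?J12 * F2 ?m ?z" "Qa ?z = ?J11 * S1 ?m ?z + ?J12 * S2 ?m ?z"
      "b ?z = ?J21 * F1 ?m ?z + ?J22 * F2 ?m ?z" "Qb ?z = ?J21 * S1 ?m ?z + ?J22 * S2 ?m ?z"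
      unfolding F A fac cr by simp_all
    moreover have "eta2 * (H * mu4) / (mu2 * (H * mu4)) = eta2 / mu2" using H_nz mu4_nz by simp
    moreover have "mu2 / lam3 / (mu2 * (H * mu4)) = 1 / (lam3 * H * mu4)" using mu2_nz by simp
    moreover have "k1 * ep ?m \<le> K * ep ?m" "k2 * ep ?m \<le> K * ep ?m" "k3 * ep ?m \<le> K * ep ?m" "k4 * ep ?m \<le> K * ep ?m"
      unfolding K_def using k1(1) k2(1) k3(1) k4(1) ep_pos[of ?m] by (auto intro!: mult_right_mono)
    ultimately show ?case
      using elim(2-5) unfolding e by (intro exI[of _ ?J11] exI[of _ ?J12] exI[of _ ?J21] exI[of _ ?J22]) auto
  qed
  then show ?thesis unfolding eventually_Phi by auto
qed

end

section \<open>Recovering the polynomials\<close>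

text \<open>The inverse of a matrix within e of diag(x, y). The threshold k ensures e A \<le>
  |xy|/2, so the determinant keeps at least half of its size.\<close>

lemma cramer_perturbation:
  fixes x y :: complex
  assumes "x \<noteq> 0" "y \<noteq> 0"
  shows "\<exists>k>0. \<exists>c\<ge>0. \<forall>X1 X2 Y1 Y2 e. e \<le> k \<longrightarrow> norm (X1 - x) \<le> e \<longrightarrow> norm X2 \<le> e \<longrightarrow>
     norm Y1 \<le> e \<longrightarrow> norm (Y2 - y) \<le> e \<longrightarrow>
     X1 * Y2 - X2 * Y1 \<noteq> 0 \<and> norm (1 / (X1 * Y2 - X2 * Y1)) \<le> c \<and>
     norm (Y2 / (X1 * Y2 - X2 * Y1) - 1 / x) \<le> c * e \<and> norm (X1 / (X1 * Y2 - X2 * Y1) - 1 / y) \<le> c * e"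
proof -
  define A where "A = norm x + norm y + 2"
  define d where "d = norm (x * y) / 2"
  define k where "k = min 1 (d / A)"
  define c where "c = (1 + A / norm x + A / norm y) / d"
  have A: "A > 0" "d > 0" using assms by (auto simp: A_def d_def add_nonneg_pos)
  have k: "k > 0" unfolding k_def using A by simp
  have c: "1 / d \<le> c" "A / norm x / d \<le> c" "A / norm y / d \<le> c" "0 \<le> c"
  proof -
    have "0 \<le> A / norm x" "0 \<le> A / norm y" using A by auto
    then show "1 / d \<le> c" "A / norm x / d \<le> c" "A / norm y / d \<le> c" "0 \<le> c"
      unfolding c_def using A by (auto intro!: divide_right_mono divide_nonneg_pos simp del: divide_divide_eq_left)
  qed
  have "X1 * Y2 - X2 * Y1 \<noteq> 0 \<and> norm (1 / (X1 * Y2 - X2 * Y1)) \<le> c \<and>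
     norm (Y2 / (X1 * Y2 - X2 * Y1) - 1 / x) \<le> c * e \<and> norm (X1 / (X1 * Y2 - X2 * Y1) - 1 / y) \<le> c * e"
    if e: "e \<le> k" and X1: "norm (X1 - x) \<le> e" and X2: "norm X2 \<le> e" and Y1: "norm Y1 \<le> e" and Y2: "norm (Y2 - y) \<le> e"
    for X1 X2 Y1 Y2 e
  proof -
    define D where "D = X1 * Y2 - X2 * Y1"
    have e1: "0 \<le> e" "e \<le> 1" "e * A \<le> d"
    proof -
      show "0 \<le> e" using order_trans[OF norm_ge_zero Y1] .
      show "e \<le> 1" using e unfolding k_def by simp
      have "e \<le> d / A" using e unfolding k_def by simp
      then show "e * A \<le> d" using A by (simp add: pos_le_divide_eq)
    qed
    have e2: "e * e \<le> e" using e1 by (simp add: mult_left_le)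
    have Y2n: "norm Y2 \<le> norm y + e" using Y2 norm_triangle_ineq2[of Y2 y] by linarith
    have X1n: "norm X1 \<le> norm x + e" using X1 norm_triangle_ineq2[of X1 x] by linarith
    have XY: "norm (X2 * Y1) \<le> e" using mult_mono[OF X2 Y1 e1(1) norm_ge_zero] e2 by (simp add: norm_mult)
    have m1: "norm ((X1 - x) * Y2) \<le> e * norm y + e"
    proof -
      have "norm ((X1 - x) * Y2) \<le> e * (norm y + e)" unfolding norm_mult by (intro mult_mono X1 Y2n) (use e1 in auto)
      then show ?thesis using e2 by (simp add: distrib_left)
    qed
    have m2: "norm (X1 * (Y2 - y)) \<le> e * norm x + e"
    proof -
      have "norm (X1 * (Y2 - y)) \<le> (norm x + e) * e" unfolding norm_mult by (intro mult_mono X1n Y2) (use e1 in auto)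
      then show ?thesis using e2 by (simp add: algebra_simps)
    qed
    have m3: "norm (x * (Y2 - y)) \<le> e * norm x" unfolding norm_mult using mult_left_mono[OF Y2 norm_ge_zero[of x]] by (simp add: mult.commute)
    have xA: "e * norm y + e + e \<le> e * A" "e * norm x + e + e \<le> e * A"
      unfolding A_def using e1(1) by (auto simp: algebra_simps)
    have "norm (D - x * y) \<le> e * A"
    proof -
      have "D - x * y = (X1 - x) * Y2 + x * (Y2 - y) - X2 * Y1" unfolding D_def by (simp add: algebra_simps)
      then have "norm (D - x * y) \<le> norm ((X1 - x) * Y2) + norm (x * (Y2 - y)) + norm (X2 * Y1)"
        using norm_triangle_ineq4[of "(X1 - x) * Y2 + x * (Y2 - y)" "X2 * Y1"] norm_triangle_ineq[of "(X1 - x) * Y2" "x * (Y2 - y)"] by simp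
      also have "\<dots> \<le> (e * norm y + e) + e * norm x + e" using m1 m3 XY by linarith
      also have "\<dots> = e * A" unfolding A_def by (simp add: algebra_simps)
      finally show ?thesis .
    qed
    then have Dd: "d \<le> norm D"
      using norm_triangle_ineq2[of "x * y" "x * y - D"] e1(3) norm_minus_commute[of D "x * y"] unfolding d_def by simp
    then have D0: "D \<noteq> 0" using A by auto
    have "norm (1 / D) \<le> 1 / d" using Dd A by (simp add: norm_divide frac_le)
    moreover have "norm (Y2 / D - 1 / x) \<le> A / norm x / d * e"
    proof -
      have "x * Y2 - D = - ((X1 - x) * Y2) + X2 * Y1" unfolding D_def by (simp add: algebra_simps)
      then have n: "norm (x * Y2 - D) \<le> e * A"
        using norm_triangle_ineq[of "- ((X1 - x) * Y2)" "X2 * Y1"] m1 XY xA(1) by simp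
      have "Y2 / D - 1 / x = (x * Y2 - D) / (x * D)" using D0 assms by (simp add: field_simps)
      then have "norm (Y2 / D - 1 / x) = norm (x * Y2 - D) / (norm x * norm D)" by (simp add: norm_divide norm_mult)
      also have "\<dots> \<le> e * A / (norm x * d)" using n Dd A assms e1(1) by (intro frac_le mult_left_mono) auto
      finally show ?thesis by (simp add: field_simps)
    qed
    moreover have "norm (X1 / D - 1 / y) \<le> A / norm y / d * e"
    proof -
      have "y * X1 - D = - (X1 * (Y2 - y)) + X2 * Y1" unfolding D_def by (simp add: algebra_simps)
      then have n: "norm (y * X1 - D) \<le> e * A"
        using norm_triangle_ineq[of "- (X1 * (Y2 - y))" "X2 * Y1"] m2 XY xA(2) by simp
      have "X1 / D - 1 / y = (y * X1 - D) / (y * D)" using D0 assms by (simp add: field_simps)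
      then have "norm (X1 / D - 1 / y) = norm (y * X1 - D) / (norm y * norm D)" by (simp add: norm_divide norm_mult)
      also have "\<dots> \<le> e * A / (norm y * d)" using n Dd A assms e1(1) by (intro frac_le mult_left_mono) auto
      finally show ?thesis by (simp add: field_simps)
    qed
    ultimately show ?thesis
      using D0 c mult_right_mono[OF c(2) e1(1)] mult_right_mono[OF c(3) e1(1)] unfolding D_def by fastforce
  qed
  with k c(4) show ?thesis by blast
qed

context asym
begin

lemma Qab_bigo_G0: "Qa \<in> O[G0](\<lambda>_. 1)" "Qb \<in> O[G0](\<lambda>_. 1)"
proof -
  have e: "F \<in> O[G0](\<lambda>_. 1)" if "F holomorphic_on UNIV" for F :: "complex \<Rightarrow> complex"
    by (rule bigo_trans_diff[OF entire_G0[OF that] bigo_const id_bigo_1])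
  have W0: "W 0 = 1" by (simp add: qpoch_inf_def)
  have "((\<lambda>z. W z) \<longlongrightarrow> W 0) G0"
    by (rule bigo_imp_tendsto[OF entire_G0[OF holomorphic_W] tendsto_id_G0])
  then have "((\<lambda>z. 1 / W z) \<longlongrightarrow> 1 / W 0) G0"
    by (intro tendsto_intros) (use W0 in auto)
  then have iW: "(\<lambda>z. 1 / W z) \<in> O[G0](\<lambda>_. 1)" by (rule tendsto_bigo_1)
  have "(\<lambda>z. 1 / W z * (h z * a z - H * eta2 * lam3 * b z)) \<in> O[G0](\<lambda>_. 1)"
    by (intro bigo_mult_bounded[OF iW] sum_in_bigo(2) bigo_mult_bounded[OF h_bigo_G0] bigo_mult_bounded[OF bigo_const] e hol_a hol_b)
  then show "Qa \<in> O[G0](\<lambda>_. 1)" unfolding Qa_def[abs_def] by simp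
  have "(\<lambda>z. 1 / W z * (h z * b z + lam4 / lam3 * a z)) \<in> O[G0](\<lambda>_. 1)"
    by (intro bigo_mult_bounded[OF iW] sum_in_bigo(1) bigo_mult_bounded[OF h_bigo_G0] bigo_mult_bounded[OF bigo_const] e hol_a hol_b)
  then show "Qb \<in> O[G0](\<lambda>_. 1)" unfolding Qb_def[abs_def] by simp
qed

text \<open>The scalings of \<open>colx\<close> and \<open>coly\<close> are chosen so that the far
  rows have the values (1, 0) and (0, H mu4 c_Psi) at infinity, independently of m.\<close>

definition colx :: "nat \<Rightarrow> (complex \<Rightarrow> complex) \<Rightarrow> (complex \<Rightarrow> complex) \<Rightarrow> complex \<Rightarrow> complex" where
  "colx m M N z = CC m / \<gamma> (2 * m - 1) * (M z * cau (P (2 * m - 1)) z - N z * poly (P (2 * m - 1)) z)"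

definition coly :: "nat \<Rightarrow> (complex \<Rightarrow> complex) \<Rightarrow> (complex \<Rightarrow> complex) \<Rightarrow> complex \<Rightarrow> complex" where
  "coly m M N z = - 1 / CC m * (M z * cau (P (2 * m)) z - N z * poly (P (2 * m)) z)"

lemma col_linear:
  assumes "M z = j * M1 z + k * M2 z" "N z = j * N1 z + k * N2 z"
  shows "colx m M N z = j * colx m M1 N1 z + k * colx m M2 N2 z"
    "coly m M N z = j * coly m M1 N1 z + k * coly m M2 N2 z"
  unfolding colx_def coly_def assms by (simp_all add: algebra_simps)

lemma near_columns:
  assumes "row M N" "M holomorphic_on UNIV" "N \<in> O[G0](\<lambda>_. 1)"
  shows "\<exists>X Y. X holomorphic_on UNIV \<and> Y holomorphic_on UNIV \<and>
     (\<forall>z. z \<noteq> 0 \<longrightarrow> z \<notin> BB \<longrightarrow> X z = colx m M N z \<and> Y z = coly m M N z)"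
proof -
  obtain X where X: "X holomorphic_on UNIV" "\<And>z. z \<noteq> 0 \<Longrightarrow> z \<notin> BB \<Longrightarrow> X z = M z * cau (P (2 * m - 1)) z - N z * poly (P (2 * m - 1)) z"
    using near_entire[OF assms, of "P (2 * m - 1)"] by blast
  obtain Y where Y: "Y holomorphic_on UNIV" "\<And>z. z \<noteq> 0 \<Longrightarrow> z \<notin> BB \<Longrightarrow> Y z = M z * cau (P (2 * m)) z - N z * poly (P (2 * m)) z"
    using near_entire[OF assms, of "P (2 * m)"] by blast
  have "(\<lambda>z. CC m / \<gamma> (2 * m - 1) * X z) holomorphic_on UNIV" "(\<lambda>z. - 1 / CC m * Y z) holomorphic_on UNIV"
    by (intro holomorphic_on_mult holomorphic_on_const X(1) Y(1))+
  then show ?thesis using X(2) Y(2)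
    by (intro exI[of _ "\<lambda>z. CC m / \<gamma> (2 * m - 1) * X z"] exI[of _ "\<lambda>z. - 1 / CC m * Y z"]) (auto simp: colx_def coly_def)
qed

lemma far_columns:
  assumes r: "row M N"
    and Lx: "((\<lambda>z. M z * cau (P (2 * m - 1)) z - N z * poly (P (2 * m - 1)) z) \<longlongrightarrow> lx) FF"
    and Ly: "((\<lambda>z. M z * cau (P (2 * m)) z - N z * poly (P (2 * m)) z) \<longlongrightarrow> ly) FF"
  shows "\<exists>U V. U holomorphic_on UNIV \<and> V holomorphic_on UNIV \<and>
     U 0 = CC m / \<gamma> (2 * m - 1) * lx \<and> V 0 = - 1 / CC m * ly \<and>
     (\<forall>z. z \<noteq> 0 \<longrightarrow> z \<notin> BB \<longrightarrow> U (1 / z) = colx m M N z \<and> V (1 / z) = coly m M N z)"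
proof -
  obtain U where U: "U holomorphic_on UNIV" "U 0 = lx"
    "\<And>z. z \<noteq> 0 \<Longrightarrow> z \<notin> BB \<Longrightarrow> U (1 / z) = M z * cau (P (2 * m - 1)) z - N z * poly (P (2 * m - 1)) z"
    using far_entire[OF r Lx] by blast
  obtain V where V: "V holomorphic_on UNIV" "V 0 = ly"
    "\<And>z. z \<noteq> 0 \<Longrightarrow> z \<notin> BB \<Longrightarrow> V (1 / z) = M z * cau (P (2 * m)) z - N z * poly (P (2 * m)) z"
    using far_entire[OF r Ly] by blast
  have "(\<lambda>z. CC m / \<gamma> (2 * m - 1) * U z) holomorphic_on UNIV" "(\<lambda>z. - 1 / CC m * V z) holomorphic_on UNIV"
    by (intro holomorphic_on_mult holomorphic_on_const U(1) V(1))+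
  then show ?thesis using U(2,3) V(2,3)
    by (intro exI[of _ "\<lambda>z. CC m / \<gamma> (2 * m - 1) * U z"] exI[of _ "\<lambda>z. - 1 / CC m * V z"]) (auto simp: colx_def coly_def)
qed

text \<open>Cramer's rule recovers both polynomials from the normalised columns; by \<open>cau_det\<close> the
  determinant of the columns equals the determinant of the two rows.\<close>

lemma columns_cramer:
  assumes m: "m \<ge> 1" and hol: "X1 holomorphic_on - {0}" "X2 holomorphic_on - {0}" "Y1 holomorphic_on - {0}" "Y2 holomorphic_on - {0}"
    "M1 holomorphic_on - {0}" "M2 holomorphic_on - {0}"
    and eq: "\<And>z. z \<noteq> 0 \<Longrightarrow> z \<notin> BB \<Longrightarrow> X1 z = colx m M1 N1 z \<and> Y1 z = coly m M1 N1 z"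
      "\<And>z. z \<noteq> 0 \<Longrightarrow> z \<notin> BB \<Longrightarrow> X2 z = colx m M2 N2 z \<and> Y2 z = coly m M2 N2 z"
    and z: "z \<noteq> 0"
  shows "poly (P (2 * m)) z * (X1 z * Y2 z - X2 z * Y1 z) = CC m * (M1 z * Y2 z - M2 z * Y1 z)"
    "poly (P (2 * m - 1)) z * (X1 z * Y2 z - X2 z * Y1 z) = \<gamma> (2 * m - 1) / CC m * (M2 z * X1 z - M1 z * X2 z)"
proof -
  note cont = hol[THEN holomorphic_on_imp_continuous_on]
  have op: "open (- {0::complex})" by auto
  have disc: "\<exists>r>0. ball x r \<inter> BB \<subseteq> {x}" if "x \<in> - {0}" for x using BB_discrete[of x] that by simp
  have cP: "continuous_on (- {0}) (\<lambda>z. poly (P k) z)" for k by (intro continuous_intros)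
  have off: "poly (P (2 * m)) w * (X1 w * Y2 w - X2 w * Y1 w) = CC m * (M1 w * Y2 w - M2 w * Y1 w) \<and>
     poly (P (2 * m - 1)) w * (X1 w * Y2 w - X2 w * Y1 w) = \<gamma> (2 * m - 1) / CC m * (M2 w * X1 w - M1 w * X2 w)"
    if w: "w \<in> - {0} - BB" for w
  proof -
    define p where "p = poly (P (2 * m)) w"
    define p' where "p' = poly (P (2 * m - 1)) w"
    define c where "c = cau (P (2 * m)) w"
    define c' where "c' = cau (P (2 * m - 1)) w"
    define G where "G = \<gamma> (2 * m - 1)"
    have w': "w \<noteq> 0" "w \<notin> BB" using w by auto
    have G0: "G \<noteq> 0" unfolding G_def by (rule \<gamma>_nz)
    have "Suc (2 * m - 1) = 2 * m" using m by simp
    then have det: "p * c' - p' * c = G"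
      using cau_det[of w "2 * m - 1"] w' unfolding p_def p'_def c_def c'_def G_def by (auto simp: BB_def)
    define D where "D = M1 w * N2 w - M2 w * N1 w"
    have x: "X1 w = CC m / G * (M1 w * c' - N1 w * p')" "X2 w = CC m / G * (M2 w * c' - N2 w * p')"
      "Y1 w = - 1 / CC m * (M1 w * c - N1 w * p)" "Y2 w = - 1 / CC m * (M2 w * c - N2 w * p)"
      using eq(1)[OF w'] eq(2)[OF w'] unfolding colx_def coly_def p_def p'_def c_def c'_def G_def by auto
    have alg: "(u / k * r) * (- 1 / u * s) = - (r * s) / k" if "u \<noteq> 0" for u k r s :: complex using that by simp
    have "X1 w * Y2 w - X2 w * Y1 w
        = - ((M1 w * c' - N1 w * p') * (M2 w * c - N2 w * p)) / G - - ((M2 w * c' - N2 w * p') * (M1 w * c - N1 w * p)) / G"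
      unfolding x alg[OF CC_nz] ..
    also have "\<dots> = D * (p * c' - p' * c) / G" unfolding D_def diff_divide_distrib[symmetric] by (simp add: algebra_simps)
    also have "\<dots> = D" unfolding det using G0 by simp
    finally have 1: "X1 w * Y2 w - X2 w * Y1 w = D" .
    have "CC m * (M1 w * Y2 w - M2 w * Y1 w) = - (M1 w * (M2 w * c - N2 w * p)) + M2 w * (M1 w * c - N1 w * p)"
      unfolding x using CC_nz[of m] by (simp add: algebra_simps)
    also have "\<dots> = p * D" unfolding D_def by (simp add: algebra_simps)
    finally have 2: "CC m * (M1 w * Y2 w - M2 w * Y1 w) = p * D" .
    have "G / CC m * (M2 w * X1 w - M1 w * X2 w) = M2 w * (M1 w * c' - N1 w * p') - M1 w * (M2 w * c' - N2 w * p')"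
    proof -
      have "G / k * (M2 w * (k / G * r) - M1 w * (k / G * s)) = M2 w * r - M1 w * s" if "k \<noteq> 0" for k r s
        using that G0 by (simp add: field_simps)
      then show ?thesis unfolding x using CC_nz[of m] by blast
    qed
    also have "\<dots> = p' * D" unfolding D_def by (simp add: algebra_simps)
    finally show ?thesis using 1 2 unfolding p_def p'_def G_def by simp
  qed
  have z': "z \<in> - {0}" using z by simp
  show "poly (P (2 * m)) z * (X1 z * Y2 z - X2 z * Y1 z) = CC m * (M1 z * Y2 z - M2 z * Y1 z)"
    by (rule eq_off_discrete[OF op _ _ disc _ z', where f = "\<lambda>z. poly (P (2 * m)) z * (X1 z * Y2 z - X2 z * Y1 z)"
          and g = "\<lambda>z. CC m * (M1 z * Y2 z - M2 z * Y1 z)"])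
       (use off in \<open>auto intro!: continuous_intros cont cP\<close>)
  show "poly (P (2 * m - 1)) z * (X1 z * Y2 z - X2 z * Y1 z) = \<gamma> (2 * m - 1) / CC m * (M2 z * X1 z - M1 z * X2 z)"
    by (rule eq_off_discrete[OF op _ _ disc _ z', where f = "\<lambda>z. poly (P (2 * m - 1)) z * (X1 z * Y2 z - X2 z * Y1 z)"
          and g = "\<lambda>z. \<gamma> (2 * m - 1) / CC m * (M2 z * X1 z - M1 z * X2 z)"])
       (use off CC_nz in \<open>auto intro!: continuous_intros cont cP\<close>)
qed

lemma extend_identity_0:
  assumes "u holomorphic_on UNIV" "v holomorphic_on UNIV" "\<And>z. z \<noteq> 0 \<Longrightarrow> u z = v z"
  shows "u z = (v z :: complex)"
proof (rule eq_off_discrete[where S = UNIV and B = "{0}" and f = u and g = v])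
  fix x :: complex
  show "\<exists>r>0. ball x r \<inter> {0} \<subseteq> {x}"
  proof (cases "x = 0")
    case False
    then show ?thesis by (intro exI[of _ "norm x"]) (auto simp: dist_norm)
  qed (auto intro: exI[of _ 1])
qed (use assms in \<open>auto intro: holomorphic_on_imp_continuous_on\<close>)

text \<open>P_(2m-1) and b are odd while its Cauchy transform and \<open>Qb\<close> are even, so the
  column entry is odd. Its zero at the origin is what allows a relative error where b
  vanishes.\<close>

lemma near_x2_odd:
  assumes m: "m \<ge> 1" and X: "X holomorphic_on UNIV" "\<And>z. z \<noteq> 0 \<Longrightarrow> z \<notin> BB \<Longrightarrow> X z = colx m b Qb z"
  shows "X 0 = 0"
proof -
  have odd: "odd (2 * m - 1)" using m by simp
  have refl: "- w \<notin> BB" if "w \<notin> BB" for w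
    using that Lam_uminus[of "- w"] unfolding not_BB by auto
  have "Qb (- w) = Qb w" for w by (simp add: Qb_def a_even b_odd h_odd)
  then have col: "colx m b Qb (- w) = - colx m b Qb w" for w
    unfolding colx_def using odd by (simp add: P_parity cau_P_parity b_odd algebra_simps)
  have hX: "(\<lambda>z. X (- z)) holomorphic_on UNIV"
    using holomorphic_on_compose_gen[OF holomorphic_on_minus[OF holomorphic_on_ident] X(1), of UNIV] by (simp add: o_def)
  have "X (- z) = - X z" if z: "z \<noteq> 0" for z
  proof (rule eq_off_discrete[where S = "- {0}" and B = BB and f = "\<lambda>z. X (- z)" and g = "\<lambda>z. - X z"])
    show "continuous_on (- {0}) (\<lambda>z. X (- z))" "continuous_on (- {0}) (\<lambda>z. - X z)"
      using holomorphic_on_imp_continuous_on[OF hX] holomorphic_on_imp_continuous_on[OF X(1)]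
      by (auto intro: continuous_on_subset intro!: continuous_intros)
    fix w assume "w \<in> - {0} - BB"
    then show "X (- w) = - X w" using X(2)[of w] X(2)[of "- w"] refl col by auto
  qed (use z BB_discrete in auto)
  then have "X (- 0) = - X 0"
    by (rule extend_identity_0[where u = "\<lambda>z. X (- z)" and v = "\<lambda>z. - X z", OF hX holomorphic_on_minus[OF X(1)]])
  then show ?thesis by simp
qed

lemma R1_q: "R1 m * q ^ m \<le> 1"
proof -
  have "q ^ m \<le> q ^ (m div 2)" using q0 q1 by (intro power_decreasing) auto
  then have "R1 m * q ^ m \<le> R1 m * q ^ (m div 2)" using R1_pos[of m] by (intro mult_left_mono) auto
  also have "\<dots> = \<sigma>" unfolding R1_def by simp
  finally show ?thesis using \<sigma> by simp
qed

lemma R2_ge_1: "1 \<le> R2 m"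
proof -
  have "q ^ (m div 2 + 2) \<le> q ^ 1" using q0 q1 by (intro power_decreasing) auto
  then have "q ^ (m div 2) * q ^ 2 \<le> q" unfolding power_add power_one_right .
  then have "q ^ (m div 2) * q ^ 2 \<le> \<sigma>" using \<sigma>(1) by linarith
  then have "1 \<le> \<sigma> / (q ^ (m div 2) * q ^ 2)" using q0 by (subst pos_le_divide_eq) auto
  then show ?thesis unfolding R2_def R1_def by (simp only: divide_divide_eq_left)
qed

text \<open>The limits of X1 and Y2 are the reciprocals of the constants in the two near
  asymptotics. X2 alone has the extra factor \<open>min 1 (norm z)\<close>, because it multiplies a
  in an error that must be compared with b.\<close>

definition near_bound :: "nat \<Rightarrow> real \<Rightarrow> (complex \<Rightarrow> complex) \<Rightarrow> (complex \<Rightarrow> complex) \<Rightarrow> (complex \<Rightarrow> complex) \<Rightarrow> (complex \<Rightarrow> complex) \<Rightarrow> bool" where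
  "near_bound m e X1 X2 Y1 Y2 \<longleftrightarrow>
     X1 holomorphic_on UNIV \<and> X2 holomorphic_on UNIV \<and> Y1 holomorphic_on UNIV \<and> Y2 holomorphic_on UNIV \<and>
     (\<forall>z. z \<noteq> 0 \<longrightarrow> z \<notin> BB \<longrightarrow> X1 z = colx m a Qa z \<and> Y1 z = coly m a Qa z) \<and>
     (\<forall>z. z \<noteq> 0 \<longrightarrow> z \<notin> BB \<longrightarrow> X2 z = colx m b Qb z \<and> Y2 z = coly m b Qb z) \<and>
     (\<forall>z. norm z \<le> R2 m \<longrightarrow> norm (X1 z - eta2 / mu2) \<le> e \<and> norm (X2 z) \<le> e * min 1 (norm z) \<and>
        norm (Y1 z) \<le> e \<and> norm (Y2 z - c_Psi / lam3) \<le> e)"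

text \<open>U2 has the extra factor \<open>R1 m * norm s\<close> for the analogous reason: it
  multiplies \<open>F1\<close>, and the error is compared with \<open>F2\<close>, which is one power
  of 1/t smaller at infinity.\<close>

definition far_bound :: "nat \<Rightarrow> real \<Rightarrow> (complex \<Rightarrow> complex) \<Rightarrow> (complex \<Rightarrow> complex) \<Rightarrow> (complex \<Rightarrow> complex) \<Rightarrow> (complex \<Rightarrow> complex) \<Rightarrow> bool" where
  "far_bound m e U1 U2 V1 V2 \<longleftrightarrow>
     U1 holomorphic_on UNIV \<and> U2 holomorphic_on UNIV \<and> V1 holomorphic_on UNIV \<and> V2 holomorphic_on UNIV \<and>
     (\<forall>z. z \<noteq> 0 \<longrightarrow> z \<notin> BB \<longrightarrow> U1 (1 / z) = colx m (F1 m) (S1 m) z \<and> V1 (1 / z) = coly m (F1 m) (S1 m) z) \<and>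
     (\<forall>z. z \<noteq> 0 \<longrightarrow> z \<notin> BB \<longrightarrow> U2 (1 / z) = colx m (F2 m) (S2 m) z \<and> V2 (1 / z) = coly m (F2 m) (S2 m) z) \<and>
     (\<forall>s. norm s \<le> 1 / R1 m \<longrightarrow> norm (U1 s - 1) \<le> e \<and> norm (U2 s) \<le> e * (R1 m * norm s) \<and>
        norm (V1 s) \<le> e \<and> norm (V2 s - H * mu4 * c_Psi) \<le> e)"

lemma columns_bounds:
  "\<exists>K N. K \<ge> 0 \<and> (\<forall>m\<ge>N. m \<ge> 1 \<and> (\<exists>X1 X2 Y1 Y2. near_bound m (K * ep m) X1 X2 Y1 Y2) \<and>
     (\<exists>U1 U2 V1 V2. far_bound m (K * ep m) U1 U2 V1 V2))"
proof -
  define j1 where "j1 = eta2 / mu2"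
  define j2 where "j2 = 1 / (lam3 * H * mu4)"
  define y0 where "y0 = H * mu4 * c_Psi"
  have j: "j1 \<noteq> 0" "j2 \<noteq> 0" unfolding j1_def j2_def using eta2_nz mu2_nz lam3_nz H_nz mu4_nz by auto
  have jy: "j2 * y0 = c_Psi / lam3" unfolding j2_def y0_def using H_nz mu4_nz by simp
  obtain K0 N0 where K0': "\<forall>m\<ge>N0. \<forall>z. circ m z \<longrightarrow> (\<exists>J11 J12 J21 J22.
     a z = J11 * F1 m z + J12 * F2 m z \<and> Qa z = J11 * S1 m z + J12 * S2 m z \<and>
     b z = J21 * F1 m z + J22 * F2 m z \<and> Qb z = J21 * S1 m z + J22 * S2 m z \<and>
     norm (J11 - j1) \<le> K0 * ep m \<and> norm J12 \<le> K0 * ep m \<and>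
     norm J21 \<le> K0 * ep m \<and> norm (J22 - j2) \<le> K0 * ep m)"
    using connection_matrix unfolding j1_def j2_def by blast
  define K1 where "K1 = \<bar>K0\<bar>"
  have K1: "0 \<le> K1" "K0 * ep m \<le> K1 * ep m" for m unfolding K1_def using ep_pos[of m] by (auto intro!: mult_right_mono)
  define \<kappa> where "\<kappa> = q ^ 2"
  have \<kappa>: "0 < \<kappa>" "\<kappa> < 1" unfolding \<kappa>_def using q_pows[of 2] by auto
  \<comment> \<open>The smallness condition of \<open>annulus_splitting_system\<close> reads L times
    \<open>ep m\<close> \<le> 1/2; the index N1 guarantees it.\<close>
  define L where "L = 2 / (1 - \<kappa>) * K1 * (1 / norm j1 + 1 / norm j2)"
  have L0: "0 \<le> L" unfolding L_def using \<kappa> K1(1) by auto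
  obtain N1 where N1: "\<And>m. m \<ge> N1 \<Longrightarrow> ep m < 1 / (2 * (L + 1))"
    using order_tendstoD(2)[OF ep_tendsto, of "1 / (2 * (L + 1))"] L0 unfolding eventually_sequentially by auto
  \<comment> \<open>The values of the far columns at infinity are 1 and 0, or 0 and y0, so 1 + |y0|
    bounds the sums of moduli in both systems.\<close>
  define K2 where "K2 = 4 / (1 - \<kappa>) * K1 * (1 + norm y0)"
  \<comment> \<open>The terms 1/|j1| and 1/|j2| undo the factors j1 and j2 in the far conclusions of
    the splitting.\<close>
  define K where "K = K2 * (1 + 1 / norm j1 + 1 / norm j2)"
  have K2: "0 \<le> K2" unfolding K2_def using \<kappa> K1(1) by auto
  have i0: "0 \<le> 1 / norm j1" "0 \<le> 1 / norm j2" by auto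
  have KK: "K2 \<le> K" "K2 / norm j1 \<le> K" "K2 / norm j2 \<le> K" "0 \<le> K"
  proof -
    have "K2 * 1 \<le> K" "K2 * (1 / norm j1) \<le> K" "K2 * (1 / norm j2) \<le> K"
      unfolding K_def using i0 by (intro mult_left_mono K2; linarith)+
    then show "K2 \<le> K" "K2 / norm j1 \<le> K" "K2 / norm j2 \<le> K" "0 \<le> K" using K2 by auto
  qed
  have "m \<ge> 1 \<and> (\<exists>X1 X2 Y1 Y2. near_bound m (K * ep m) X1 X2 Y1 Y2) \<and> (\<exists>U1 U2 V1 V2. far_bound m (K * ep m) U1 U2 V1 V2)"
    if mN: "m \<ge> max (max N0 N1) 1" for m
  proof -
    have m: "m \<ge> 1" "m \<ge> N0" "m \<ge> N1" using mN by auto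
    obtain X1 Y1 where N1h: "X1 holomorphic_on UNIV" "Y1 holomorphic_on UNIV"
      "\<forall>z. z \<noteq> 0 \<longrightarrow> z \<notin> BB \<longrightarrow> X1 z = colx m a Qa z \<and> Y1 z = coly m a Qa z"
      using near_columns[OF row_a hol_a Qab_bigo_G0(1), of m] by blast
    obtain X2 Y2 where N2h: "X2 holomorphic_on UNIV" "Y2 holomorphic_on UNIV"
      "\<forall>z. z \<noteq> 0 \<longrightarrow> z \<notin> BB \<longrightarrow> X2 z = colx m b Qb z \<and> Y2 z = coly m b Qb z"
      using near_columns[OF row_b hol_b Qab_bigo_G0(2), of m] by blast
    obtain U1 V1 where U1: "U1 holomorphic_on UNIV" "V1 holomorphic_on UNIV"
      "U1 0 = CC m / \<gamma> (2 * m - 1) * (\<gamma> (2 * m - 1) / CC m)" "V1 0 = - 1 / CC m * 0"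
      "\<forall>z. z \<noteq> 0 \<longrightarrow> z \<notin> BB \<longrightarrow> U1 (1 / z) = colx m (F1 m) (S1 m) z \<and> V1 (1 / z) = coly m (F1 m) (S1 m) z"
      using far_columns[OF row_F1 far_limits(1)[OF m(1)] far_limits(3)[OF m(1)]] by blast
    obtain U2 V2 where U2: "U2 holomorphic_on UNIV" "V2 holomorphic_on UNIV"
      "U2 0 = CC m / \<gamma> (2 * m - 1) * 0" "V2 0 = - 1 / CC m * - (CC m * (H * mu4 * c_Psi))"
      "\<forall>z. z \<noteq> 0 \<longrightarrow> z \<notin> BB \<longrightarrow> U2 (1 / z) = colx m (F2 m) (S2 m) z \<and> V2 (1 / z) = coly m (F2 m) (S2 m) z"
      using far_columns[OF row_F2 far_limits(2)[OF m(1)] far_limits(4)[OF m(1)]] by blast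
    have v: "U1 0 = 1" "V1 0 = 0" "U2 0 = 0" "V2 0 = y0"
      unfolding U1(3,4) U2(3,4) y0_def using CC_nz[of m] \<gamma>_nz[of "2 * m - 1"] by auto
    define \<epsilon> where "\<epsilon> = K1 * ep m"
    have \<epsilon>: "0 \<le> \<epsilon>" unfolding \<epsilon>_def using K1(1) ep_pos[of m] by simp
    have r: "0 < R1 m" "R2 m = R1 m / \<kappa>" unfolding R2_def \<kappa>_def using R1_pos by auto
    have small: "2 / (1 - \<kappa>) * \<epsilon> * (1 / norm j1 + 1 / norm j2) \<le> 1 / 2"
    proof -
      have "2 / (1 - \<kappa>) * \<epsilon> * (1 / norm j1 + 1 / norm j2) = L * ep m" unfolding L_def \<epsilon>_def by (simp only: mult_ac)
      also have "\<dots> \<le> (L + 1) * (1 / (2 * (L + 1)))" using N1[OF m(3)] L0 ep_pos[of m] by (intro mult_mono) auto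
      also have "\<dots> = 1 / 2" using L0 by simp
      finally show ?thesis .
    qed
    have E: "norm (X1 z - j1 * U1 (1 / z)) \<le> \<epsilon> * (norm (U1 (1 / z)) + norm (U2 (1 / z)))"
      "norm (X2 z - j2 * U2 (1 / z)) \<le> \<epsilon> * (norm (U1 (1 / z)) + norm (U2 (1 / z)))"
      "norm (Y1 z - j1 * V1 (1 / z)) \<le> \<epsilon> * (norm (V1 (1 / z)) + norm (V2 (1 / z)))"
      "norm (Y2 z - j2 * V2 (1 / z)) \<le> \<epsilon> * (norm (V1 (1 / z)) + norm (V2 (1 / z)))"
      if "norm z = R1 m \<or> norm z = R2 m" for z
    proof -
      have c: "circ m z" using that unfolding circ_def .
      have z: "z \<noteq> 0" "z \<notin> BB" using GC_not_BB[OF circ_GC[OF c]] by auto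
      obtain J11 J12 J21 J22 where J: "a z = J11 * F1 m z + J12 * F2 m z" "Qa z = J11 * S1 m z + J12 * S2 m z"
        "b z = J21 * F1 m z + J22 * F2 m z" "Qb z = J21 * S1 m z + J22 * S2 m z"
        and J0: "norm (J11 - j1) \<le> K0 * ep m" "norm J12 \<le> K0 * ep m" "norm J21 \<le> K0 * ep m" "norm (J22 - j2) \<le> K0 * ep m"
        using K0' m(2) c by blast
      have Jn: "norm (J11 - j1) \<le> \<epsilon>" "norm J12 \<le> \<epsilon>" "norm J21 \<le> \<epsilon>" "norm (J22 - j2) \<le> \<epsilon>"
        using J0 K1(2)[of m] unfolding \<epsilon>_def by linarith+
      have nb: "norm (x * u + y * w) \<le> \<epsilon> * (norm u + norm w)" if "norm x \<le> \<epsilon>" "norm y \<le> \<epsilon>" for x y u w :: complex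
      proof -
        have "norm (x * u + y * w) \<le> norm x * norm u + norm y * norm w"
          using norm_triangle_ineq[of "x * u" "y * w"] by (simp add: norm_mult)
        also have "\<dots> \<le> \<epsilon> * norm u + \<epsilon> * norm w" using that by (intro add_mono mult_right_mono) auto
        finally show ?thesis by (simp add: distrib_left)
      qed
      have e1: "X1 z = J11 * U1 (1 / z) + J12 * U2 (1 / z)" "Y1 z = J11 * V1 (1 / z) + J12 * V2 (1 / z)"
        using N1h(3) U1(5) U2(5) z col_linear[of a z J11 "F1 m" J12 "F2 m" Qa "S1 m" "S2 m" m, OF J(1,2)] by auto
      have e2: "X2 z = J21 * U1 (1 / z) + J22 * U2 (1 / z)" "Y2 z = J21 * V1 (1 / z) + J22 * V2 (1 / z)"
        using N2h(3) U1(5) U2(5) z col_linear[of b z J21 "F1 m" J22 "F2 m" Qb "S1 m" "S2 m" m, OF J(3,4)] by auto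
      have "X1 z - j1 * U1 (1 / z) = (J11 - j1) * U1 (1 / z) + J12 * U2 (1 / z)"
        "Y1 z - j1 * V1 (1 / z) = (J11 - j1) * V1 (1 / z) + J12 * V2 (1 / z)"
        "X2 z - j2 * U2 (1 / z) = J21 * U1 (1 / z) + (J22 - j2) * U2 (1 / z)"
        "Y2 z - j2 * V2 (1 / z) = J21 * V1 (1 / z) + (J22 - j2) * V2 (1 / z)"
        unfolding e1 e2 by (simp_all add: algebra_simps)
      then show "norm (X1 z - j1 * U1 (1 / z)) \<le> \<epsilon> * (norm (U1 (1 / z)) + norm (U2 (1 / z)))"
        "norm (X2 z - j2 * U2 (1 / z)) \<le> \<epsilon> * (norm (U1 (1 / z)) + norm (U2 (1 / z)))"
        "norm (Y1 z - j1 * V1 (1 / z)) \<le> \<epsilon> * (norm (V1 (1 / z)) + norm (V2 (1 / z)))"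
        "norm (Y2 z - j2 * V2 (1 / z)) \<le> \<epsilon> * (norm (V1 (1 / z)) + norm (V2 (1 / z)))"
        using nb Jn by auto
    qed
    note sx = annulus_splitting_system[OF N1h(1) N2h(1) U1(1) U2(1) r(1) \<kappa> r(2) \<epsilon> E(1,2) j small]
    note sy = annulus_splitting_system[OF N1h(2) N2h(2) U1(2) U2(2) r(1) \<kappa> r(2) \<epsilon> E(3,4) j small]
    define e where "e = K * ep m"
    have i1: "4 / (1 - \<kappa>) * \<epsilon> * (norm (U1 0) + norm (U2 0)) \<le> K2 * ep m"
      "4 / (1 - \<kappa>) * \<epsilon> * (norm (V1 0) + norm (V2 0)) \<le> K2 * ep m"
    proof -
      have le: "4 / (1 - \<kappa>) * \<epsilon> * x \<le> 4 / (1 - \<kappa>) * \<epsilon> * (1 + norm y0)" if "x \<le> 1 + norm y0" for x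
        using that \<kappa> \<epsilon> by (intro mult_left_mono) auto
      have eq: "4 / (1 - \<kappa>) * \<epsilon> * (1 + norm y0) = K2 * ep m" unfolding K2_def \<epsilon>_def by (simp only: mult_ac)
      show "4 / (1 - \<kappa>) * \<epsilon> * (norm (U1 0) + norm (U2 0)) \<le> K2 * ep m"
        "4 / (1 - \<kappa>) * \<epsilon> * (norm (V1 0) + norm (V2 0)) \<le> K2 * ep m" unfolding v norm_zero norm_one eq[symmetric] by (rule le; simp)+
    qed
    have e: "K2 * ep m \<le> e" "K2 * ep m / norm j1 \<le> e" "K2 * ep m / norm j2 \<le> e" "0 \<le> e"
      unfolding e_def using mult_right_mono[OF KK(1), of "ep m"] mult_right_mono[OF KK(2), of "ep m"]
        mult_right_mono[OF KK(3), of "ep m"] KK(4) ep_pos[of m] by auto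
    have nx: "norm (X1 z - j1) \<le> e" "norm (X2 z) \<le> e" "norm (Y1 z) \<le> e" "norm (Y2 z - j2 * y0) \<le> e" if "norm z \<le> R2 m" for z
      using order_trans[OF sx(1)[OF _ _ that] i1(1)] order_trans[OF sx(2)[OF _ _ that] i1(1)]
        order_trans[OF sy(1)[OF _ _ that] i1(2)] order_trans[OF sy(2)[OF _ _ that] i1(2)] e(1) E unfolding v by auto
    have X20: "X2 0 = 0" using near_x2_odd[OF m(1) N2h(1)] N2h(3) by blast
    have x2: "norm (X2 z) \<le> e * min 1 (norm z)" if "norm z \<le> R2 m" for z
    proof -
      have "norm (X2 z - X2 0) \<le> e * norm z / R2 m"
        by (rule schwarz_growth[OF N2h(1) that R12(2)]) (use nx(2) X20 in auto)
      also have "\<dots> \<le> e * norm z / 1" using R2_ge_1[of m] e(4) by (intro divide_left_mono) auto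
      finally show ?thesis using nx(2)[OF that] X20 unfolding min_def by auto
    qed
    have "near_bound m e X1 X2 Y1 Y2"
      unfolding near_bound_def using N1h N2h nx x2 unfolding jy j1_def by blast
    moreover have fs: "norm (U1 s - 1) \<le> e * (R1 m * norm s)" "norm (U2 s) \<le> e * (R1 m * norm s)"
      "norm (V1 s) \<le> e * (R1 m * norm s)" "norm (V2 s - y0) \<le> e * (R1 m * norm s)" if s: "norm s \<le> 1 / R1 m" for s
    proof -
      have rs: "0 \<le> R1 m * norm s" using r by simp
      have gen: "norm w \<le> e * (R1 m * norm s)"
        if "norm (j * w) \<le> B * (R1 m * norm s)" "B \<le> K2 * ep m" "K2 * ep m / norm j \<le> e" "j \<noteq> 0" for j w :: complex and B
      proof -
        have "norm j * norm w \<le> K2 * ep m * (R1 m * norm s)"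
          using that(1) mult_right_mono[OF that(2) rs] unfolding norm_mult by linarith
        then have "norm w \<le> K2 * ep m * (R1 m * norm s) / norm j" using that(4) by (simp add: pos_le_divide_eq mult.commute)
        also have "\<dots> = K2 * ep m / norm j * (R1 m * norm s)" by simp
        also have "\<dots> \<le> e * (R1 m * norm s)" by (rule mult_right_mono[OF that(3) rs])
        finally show ?thesis .
      qed
      show "norm (U1 s - 1) \<le> e * (R1 m * norm s)"
        by (rule gen[OF _ i1(1) e(2) j(1)]) (use sx(3)[OF _ _ s] E in \<open>auto simp: v right_diff_distrib\<close>)
      show "norm (U2 s) \<le> e * (R1 m * norm s)"
        by (rule gen[OF _ i1(1) e(3) j(2)]) (use sx(4)[OF _ _ s] E in \<open>auto simp: v\<close>)
      show "norm (V1 s) \<le> e * (R1 m * norm s)"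
        by (rule gen[OF _ i1(2) e(2) j(1)]) (use sy(3)[OF _ _ s] E in \<open>auto simp: v\<close>)
      show "norm (V2 s - y0) \<le> e * (R1 m * norm s)"
        by (rule gen[OF _ i1(2) e(3) j(2)]) (use sy(4)[OF _ _ s] E in \<open>auto simp: v right_diff_distrib\<close>)
    qed
    moreover have "e * (R1 m * norm s) \<le> e" if "norm s \<le> 1 / R1 m" for s :: complex
    proof -
      have "R1 m * norm s \<le> 1" using that r by (simp add: pos_le_divide_eq mult.commute)
      then show ?thesis using e(4) by (simp add: mult_left_le)
    qed
    ultimately have "near_bound m e X1 X2 Y1 Y2" "far_bound m e U1 U2 V1 V2"
      unfolding far_bound_def y0_def[symmetric] using U1(1,2,5) U2(1,2,5) order_trans by blast+
    then show ?thesis unfolding e_def using m(1) by blast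
  qed
  then show ?thesis using KK(4) by blast
qed

lemma near_cramer:
  assumes m: "m \<ge> 1" and nb: "near_bound m e X1 X2 Y1 Y2"
  shows "poly (P (2 * m)) z * (X1 z * Y2 z - X2 z * Y1 z) = CC m * (a z * Y2 z - b z * Y1 z)"
    "poly (P (2 * m - 1)) z * (X1 z * Y2 z - X2 z * Y1 z) = \<gamma> (2 * m - 1) / CC m * (b z * X1 z - a z * X2 z)"
proof -
  have n: "X1 holomorphic_on S" "X2 holomorphic_on S" "Y1 holomorphic_on S" "Y2 holomorphic_on S" for S
    using nb holomorphic_on_subset unfolding near_bound_def by blast+
  have eq: "\<And>z. z \<noteq> 0 \<Longrightarrow> z \<notin> BB \<Longrightarrow> X1 z = colx m a Qa z \<and> Y1 z = coly m a Qa z"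
    "\<And>z. z \<noteq> 0 \<Longrightarrow> z \<notin> BB \<Longrightarrow> X2 z = colx m b Qb z \<and> Y2 z = coly m b Qb z"
    using nb unfolding near_bound_def by blast+
  note A = columns_cramer[OF m n(1) n(2) n(3) n(4) hol_a hol_b eq]
  have hP: "(\<lambda>z. poly (P k) z) holomorphic_on UNIV" for k by (intro holomorphic_intros)
  have hD: "(\<lambda>z. poly (P k) z * (X1 z * Y2 z - X2 z * Y1 z)) holomorphic_on UNIV" for k
    by (intro holomorphic_on_mult holomorphic_on_diff hP n)
  have hN: "(\<lambda>z. CC m * (a z * Y2 z - b z * Y1 z)) holomorphic_on UNIV"
    "(\<lambda>z. \<gamma> (2 * m - 1) / CC m * (b z * X1 z - a z * X2 z)) holomorphic_on UNIV"
    by (intro holomorphic_on_mult holomorphic_on_diff holomorphic_on_const hol_a hol_b n)+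
  show "poly (P (2 * m)) z * (X1 z * Y2 z - X2 z * Y1 z) = CC m * (a z * Y2 z - b z * Y1 z)"
    by (rule extend_identity_0[OF hD hN(1) A(1)])
  show "poly (P (2 * m - 1)) z * (X1 z * Y2 z - X2 z * Y1 z) = \<gamma> (2 * m - 1) / CC m * (b z * X1 z - a z * X2 z)"
    by (rule extend_identity_0[OF hD hN(2) A(2)])
qed

lemma far_cramer:
  assumes m: "m \<ge> 1" and fb: "far_bound m e U1 U2 V1 V2" and z: "z \<noteq> 0"
  shows "poly (P (2 * m)) z * (U1 (1 / z) * V2 (1 / z) - U2 (1 / z) * V1 (1 / z)) = CC m * (F1 m z * V2 (1 / z) - F2 m z * V1 (1 / z))"
    "poly (P (2 * m - 1)) z * (U1 (1 / z) * V2 (1 / z) - U2 (1 / z) * V1 (1 / z)) = \<gamma> (2 * m - 1) / CC m * (F2 m z * U1 (1 / z) - F1 m z * U2 (1 / z))"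
proof -
  have i: "(\<lambda>z. 1 / z) holomorphic_on - {0::complex}" by (intro holomorphic_intros) auto
  have f: "(\<lambda>z. U (1 / z)) holomorphic_on - {0}" if "U holomorphic_on UNIV" for U :: "complex \<Rightarrow> complex"
    using holomorphic_on_compose_gen[OF i that] by (simp add: o_def)
  have h: "(\<lambda>z. U1 (1 / z)) holomorphic_on - {0}" "(\<lambda>z. U2 (1 / z)) holomorphic_on - {0}"
    "(\<lambda>z. V1 (1 / z)) holomorphic_on - {0}" "(\<lambda>z. V2 (1 / z)) holomorphic_on - {0}"
    using fb f unfolding far_bound_def by blast+
  have eq: "\<And>z. z \<noteq> 0 \<Longrightarrow> z \<notin> BB \<Longrightarrow> U1 (1 / z) = colx m (F1 m) (S1 m) z \<and> V1 (1 / z) = coly m (F1 m) (S1 m) z"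
    "\<And>z. z \<noteq> 0 \<Longrightarrow> z \<notin> BB \<Longrightarrow> U2 (1 / z) = colx m (F2 m) (S2 m) z \<and> V2 (1 / z) = coly m (F2 m) (S2 m) z"
    using fb unfolding far_bound_def by blast+
  show "poly (P (2 * m)) z * (U1 (1 / z) * V2 (1 / z) - U2 (1 / z) * V1 (1 / z)) = CC m * (F1 m z * V2 (1 / z) - F2 m z * V1 (1 / z))"
    by (rule columns_cramer(1)[OF m h hol_F eq z])
  show "poly (P (2 * m - 1)) z * (U1 (1 / z) * V2 (1 / z) - U2 (1 / z) * V1 (1 / z)) = \<gamma> (2 * m - 1) / CC m * (F2 m z * U1 (1 / z) - F1 m z * U2 (1 / z))"
    by (rule columns_cramer(2)[OF m h hol_F eq z])
qed

text \<open>The number \<rho> carries the additional smallness of X2 into the error of the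
  odd-degree polynomial, where n1 is not dominated by n2.\<close>

lemma cramer_errors:
  fixes p p' C G n1 n2 X1 X2 Y1 Y2 x y :: complex
  assumes D: "D = X1 * Y2 - X2 * Y1" "D \<noteq> 0" "norm (1 / D) \<le> c" "norm (Y2 / D - 1 / x) \<le> c * e" "norm (X1 / D - 1 / y) \<le> c * e"
    and p: "p * D = C * (n1 * Y2 - n2 * Y1)" "p' * D = G * (n2 * X1 - n1 * X2)"
    and Y1: "norm Y1 \<le> e" and X2: "norm X2 \<le> e * \<rho>" and c: "0 \<le> c" and e: "0 \<le> e"
  shows "norm (p - C * n1 * (1 / x)) \<le> norm C * (c * e * (norm n1 + norm n2))"
    "norm (p' - G * n2 * (1 / y)) \<le> norm G * (c * e * (norm n2 + \<rho> * norm n1))"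
proof -
  have "p - C * n1 * (1 / x) = C * (n1 * (Y2 / D - 1 / x) - n2 * (Y1 * (1 / D)))"
  proof -
    have "p = C * (n1 * Y2 - n2 * Y1) / D" using p(1) D(2) by (simp add: eq_divide_eq)
    then show ?thesis by (simp add: algebra_simps diff_divide_distrib)
  qed
  then have "norm (p - C * n1 * (1 / x)) \<le> norm C * (norm n1 * norm (Y2 / D - 1 / x) + norm n2 * (norm Y1 * norm (1 / D)))"
    using norm_triangle_ineq4[of "n1 * (Y2 / D - 1 / x)" "n2 * (Y1 * (1 / D))"] by (simp only: norm_mult mult_left_mono norm_ge_zero)
  also have "\<dots> \<le> norm C * (norm n1 * (c * e) + norm n2 * (e * c))"
    using D(3,4) Y1 c e by (intro mult_left_mono add_mono mult_mono) auto
  finally show "norm (p - C * n1 * (1 / x)) \<le> norm C * (c * e * (norm n1 + norm n2))" by (simp add: algebra_simps)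
  have "p' - G * n2 * (1 / y) = G * (n2 * (X1 / D - 1 / y) - n1 * (X2 * (1 / D)))"
  proof -
    have "p' = G * (n2 * X1 - n1 * X2) / D" using p(2) D(2) by (simp add: eq_divide_eq)
    then show ?thesis by (simp add: algebra_simps diff_divide_distrib)
  qed
  then have "norm (p' - G * n2 * (1 / y)) \<le> norm G * (norm n2 * norm (X1 / D - 1 / y) + norm n1 * (norm X2 * norm (1 / D)))"
    using norm_triangle_ineq4[of "n2 * (X1 / D - 1 / y)" "n1 * (X2 * (1 / D))"] by (simp only: norm_mult mult_left_mono norm_ge_zero)
  also have "\<dots> \<le> norm G * (norm n2 * (c * e) + norm n1 * ((e * \<rho>) * c))"
    using D(3,5) X2 c order_trans[OF norm_ge_zero X2] by (intro mult_left_mono add_mono mult_mono) auto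
  finally show "norm (p' - G * n2 * (1 / y)) \<le> norm G * (c * e * (norm n2 + \<rho> * norm n1))" by (simp add: algebra_simps)
qed

theorem polynomial_bounds:
  "\<exists>K N. K \<ge> 0 \<and> (\<forall>m\<ge>N. m \<ge> 1 \<and>
     (\<forall>z. norm z \<le> R2 m \<longrightarrow>
        norm (poly (P (2 * m)) z - CC m * a z * (mu2 / eta2)) \<le> norm (CC m) * (K * ep m * (norm (a z) + norm (b z))) \<and>
        norm (poly (P (2 * m - 1)) z - \<gamma> (2 * m - 1) / CC m * b z * (lam3 / c_Psi))
          \<le> norm (\<gamma> (2 * m - 1) / CC m) * (K * ep m * (norm (b z) + min 1 (norm z) * norm (a z)))) \<and>
     (\<forall>z. R1 m \<le> norm z \<longrightarrow>
        norm (poly (P (2 * m)) z - CC m * F1 m z * (1 / 1)) \<le> norm (CC m) * (K * ep m * (norm (F1 m z) + norm (F2 m z))) \<and>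
        norm (poly (P (2 * m - 1)) z - \<gamma> (2 * m - 1) / CC m * F2 m z * (1 / (H * mu4 * c_Psi)))
          \<le> norm (\<gamma> (2 * m - 1) / CC m) * (K * ep m * (norm (F2 m z) + R1 m / norm z * norm (F1 m z)))))"
proof -
  obtain K0 N0 where K0: "K0 \<ge> 0" "\<And>m. m \<ge> N0 \<Longrightarrow> m \<ge> 1 \<and> (\<exists>X1 X2 Y1 Y2. near_bound m (K0 * ep m) X1 X2 Y1 Y2) \<and>
     (\<exists>U1 U2 V1 V2. far_bound m (K0 * ep m) U1 U2 V1 V2)" using columns_bounds by blast
  have nz: "eta2 / mu2 \<noteq> 0" "c_Psi / lam3 \<noteq> 0" "H * mu4 * c_Psi \<noteq> 0" "(1::complex) \<noteq> 0"
    using eta2_nz mu2_nz c_Psi(1) lam3_nz H_nz mu4_nz by auto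
  obtain k1 c1 where k1: "k1 > 0" "c1 \<ge> 0" and C1: "\<And>X1 X2 Y1 Y2 e. e \<le> k1 \<Longrightarrow> norm (X1 - eta2 / mu2) \<le> e \<Longrightarrow> norm X2 \<le> e \<Longrightarrow>
     norm Y1 \<le> e \<Longrightarrow> norm (Y2 - c_Psi / lam3) \<le> e \<Longrightarrow>
     X1 * Y2 - X2 * Y1 \<noteq> 0 \<and> norm (1 / (X1 * Y2 - X2 * Y1)) \<le> c1 \<and>
     norm (Y2 / (X1 * Y2 - X2 * Y1) - 1 / (eta2 / mu2)) \<le> c1 * e \<and> norm (X1 / (X1 * Y2 - X2 * Y1) - 1 / (c_Psi / lam3)) \<le> c1 * e"
    using cramer_perturbation[OF nz(1,2)] by metis
  obtain k2 c2 where k2: "k2 > 0" "c2 \<ge> 0" and C2: "\<And>X1 X2 Y1 Y2 e. e \<le> k2 \<Longrightarrow> norm (X1 - 1) \<le> e \<Longrightarrow> norm X2 \<le> e \<Longrightarrow>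
     norm Y1 \<le> e \<Longrightarrow> norm (Y2 - H * mu4 * c_Psi) \<le> e \<Longrightarrow>
     X1 * Y2 - X2 * Y1 \<noteq> 0 \<and> norm (1 / (X1 * Y2 - X2 * Y1)) \<le> c2 \<and>
     norm (Y2 / (X1 * Y2 - X2 * Y1) - 1 / 1) \<le> c2 * e \<and> norm (X1 / (X1 * Y2 - X2 * Y1) - 1 / (H * mu4 * c_Psi)) \<le> c2 * e"
    using cramer_perturbation[OF nz(4,3)] by metis
  define k where "k = min k1 k2"
  obtain N1 where N1: "\<And>m. m \<ge> N1 \<Longrightarrow> ep m < k / (K0 + 1)"
    using order_tendstoD(2)[OF ep_tendsto, of "k / (K0 + 1)"] K0(1) k1(1) k2(1) unfolding eventually_sequentially k_def by auto
  define K where "K = (c1 + c2) * K0"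
  have "m \<ge> 1 \<and>
     (\<forall>z. norm z \<le> R2 m \<longrightarrow>
        norm (poly (P (2 * m)) z - CC m * a z * (mu2 / eta2)) \<le> norm (CC m) * (K * ep m * (norm (a z) + norm (b z))) \<and>
        norm (poly (P (2 * m - 1)) z - \<gamma> (2 * m - 1) / CC m * b z * (lam3 / c_Psi))
          \<le> norm (\<gamma> (2 * m - 1) / CC m) * (K * ep m * (norm (b z) + min 1 (norm z) * norm (a z)))) \<and>
     (\<forall>z. R1 m \<le> norm z \<longrightarrow>
        norm (poly (P (2 * m)) z - CC m * F1 m z * (1 / 1)) \<le> norm (CC m) * (K * ep m * (norm (F1 m z) + norm (F2 m z))) \<and>
        norm (poly (P (2 * m - 1)) z - \<gamma> (2 * m - 1) / CC m * F2 m z * (1 / (H * mu4 * c_Psi)))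
          \<le> norm (\<gamma> (2 * m - 1) / CC m) * (K * ep m * (norm (F2 m z) + R1 m / norm z * norm (F1 m z))))"
    if mN: "m \<ge> max N0 N1" for m
  proof -
    define e where "e = K0 * ep m"
    have e0: "0 \<le> e" unfolding e_def using K0(1) ep_pos[of m] by simp
    have ek: "e \<le> k1" "e \<le> k2"
    proof -
      have "e \<le> (K0 + 1) * ep m" unfolding e_def using ep_pos[of m] by (intro mult_right_mono) auto
      also have "\<dots> \<le> k" using N1[of m] mN K0(1) by (simp add: pos_less_divide_eq mult.commute)
      finally show "e \<le> k1" "e \<le> k2" unfolding k_def by auto
    qed
    have cK: "c1 * e * w \<le> K * ep m * w" "c2 * e * w \<le> K * ep m * w" if "0 \<le> w" for w
    proof -
      have "c1 * (K0 * ep m) \<le> (c1 + c2) * (K0 * ep m)" "c2 * (K0 * ep m) \<le> (c1 + c2) * (K0 * ep m)"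
        using k1(2) k2(2) K0(1) ep_pos[of m] by (intro mult_right_mono; simp)+
      then have "c1 * e \<le> K * ep m" "c2 * e \<le> K * ep m" unfolding e_def K_def by (simp_all only: mult.assoc)
      then show "c1 * e * w \<le> K * ep m * w" "c2 * e * w \<le> K * ep m * w" using that by (auto intro: mult_right_mono)
    qed
    have m: "m \<ge> 1" using K0(2) mN by auto
    obtain X1 X2 Y1 Y2 where nb: "near_bound m e X1 X2 Y1 Y2" using K0(2)[of m] mN unfolding e_def by auto
    obtain U1 U2 V1 V2 where fb: "far_bound m e U1 U2 V1 V2" using K0(2)[of m] mN unfolding e_def by auto
    note nb' = nb[unfolded near_bound_def]
    note fb' = fb[unfolded far_bound_def]
    note n1 = near_cramer[OF m nb]
    note f1 = far_cramer[OF m fb]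
    have inv: "1 / (eta2 / mu2) = mu2 / eta2" "1 / (c_Psi / lam3) = lam3 / c_Psi" by auto
    have near: "norm (poly (P (2 * m)) z - CC m * a z * (mu2 / eta2)) \<le> norm (CC m) * (K * ep m * (norm (a z) + norm (b z))) \<and>
        norm (poly (P (2 * m - 1)) z - \<gamma> (2 * m - 1) / CC m * b z * (lam3 / c_Psi))
          \<le> norm (\<gamma> (2 * m - 1) / CC m) * (K * ep m * (norm (b z) + min 1 (norm z) * norm (a z)))" if z: "norm z \<le> R2 m" for z
    proof -
      have B: "norm (X1 z - eta2 / mu2) \<le> e" "norm (X2 z) \<le> e * min 1 (norm z)" "norm (Y1 z) \<le> e" "norm (Y2 z - c_Psi / lam3) \<le> e"
        using nb' z by blast+
      have B2: "norm (X2 z) \<le> e" using order_trans[OF B(2) mult_left_le[OF min.cobounded1 e0]] .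
      note C = C1[OF ek(1) B(1) B2 B(3,4)]
      have "norm (poly (P (2 * m)) z - CC m * a z * (1 / (eta2 / mu2))) \<le> norm (CC m) * (c1 * e * (norm (a z) + norm (b z)))"
        "norm (poly (P (2 * m - 1)) z - \<gamma> (2 * m - 1) / CC m * b z * (1 / (c_Psi / lam3)))
           \<le> norm (\<gamma> (2 * m - 1) / CC m) * (c1 * e * (norm (b z) + min 1 (norm z) * norm (a z)))"
        using cramer_errors[OF refl _ _ _ _ n1[of z] B(3,2) k1(2) e0, of "eta2 / mu2" "c_Psi / lam3"] C by blast+
      then show ?thesis unfolding inv
        using mult_left_mono[OF cK(1), of "norm (a z) + norm (b z)" "norm (CC m)"]
          mult_left_mono[OF cK(1), of "norm (b z) + min 1 (norm z) * norm (a z)" "norm (\<gamma> (2 * m - 1) / CC m)"]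
        by (smt (verit) mult_nonneg_nonneg norm_ge_zero min_def)
    qed
    have far: "norm (poly (P (2 * m)) z - CC m * F1 m z * (1 / 1)) \<le> norm (CC m) * (K * ep m * (norm (F1 m z) + norm (F2 m z))) \<and>
        norm (poly (P (2 * m - 1)) z - \<gamma> (2 * m - 1) / CC m * F2 m z * (1 / (H * mu4 * c_Psi)))
          \<le> norm (\<gamma> (2 * m - 1) / CC m) * (K * ep m * (norm (F2 m z) + R1 m / norm z * norm (F1 m z)))" if z: "R1 m \<le> norm z" for z
    proof -
      have z0: "z \<noteq> 0" "norm z > 0" using z R1_pos[of m] by auto
      have s: "norm (1 / z) \<le> 1 / R1 m" using z z0 R1_pos[of m] by (simp add: norm_divide frac_le)
      have r: "R1 m * norm (1 / z) = R1 m / norm z" by (simp add: norm_divide)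
      have r1: "R1 m / norm z \<le> 1" "0 \<le> R1 m / norm z" using z z0 R1_pos[of m] by (auto simp: pos_divide_le_eq)
      have B: "norm (U1 (1 / z) - 1) \<le> e" "norm (U2 (1 / z)) \<le> e * (R1 m / norm z)" "norm (V1 (1 / z)) \<le> e" "norm (V2 (1 / z) - H * mu4 * c_Psi) \<le> e"
        using fb' s unfolding r[symmetric] by blast+
      have B2: "norm (U2 (1 / z)) \<le> e" using order_trans[OF B(2) mult_left_le[OF r1(1) e0]] .
      note C = C2[OF ek(2) B(1) B2 B(3,4)]
      have "norm (poly (P (2 * m)) z - CC m * F1 m z * (1 / 1)) \<le> norm (CC m) * (c2 * e * (norm (F1 m z) + norm (F2 m z)))"
        "norm (poly (P (2 * m - 1)) z - \<gamma> (2 * m - 1) / CC m * F2 m z * (1 / (H * mu4 * c_Psi)))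
           \<le> norm (\<gamma> (2 * m - 1) / CC m) * (c2 * e * (norm (F2 m z) + R1 m / norm z * norm (F1 m z)))"
        using cramer_errors[OF refl _ _ _ _ f1[OF z0(1)] B(3,2) k2(2) e0, of 1 "H * mu4 * c_Psi"] C by blast+
      moreover have "0 \<le> norm (F2 m z) + R1 m / norm z * norm (F1 m z)" by (intro add_nonneg_nonneg mult_nonneg_nonneg r1(2) norm_ge_zero)
      ultimately show ?thesis
        using mult_left_mono[OF cK(2), of "norm (F1 m z) + norm (F2 m z)" "norm (CC m)"]
          mult_left_mono[OF cK(2), of "norm (F2 m z) + R1 m / norm z * norm (F1 m z)" "norm (\<gamma> (2 * m - 1) / CC m)"]
        by (smt (verit) mult_nonneg_nonneg norm_ge_zero)
    qed
    show ?thesis using m near far by blast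
  qed
  moreover have "0 \<le> K" unfolding K_def using k1 k2 K0(1) by simp
  ultimately show ?thesis by blast
qed

end

section \<open>Relative errors\<close>

text \<open>Absolute errors are measured by a zero-free majorant B. They become relative once B is
  bounded by |A| away from the zeros of A, and by some value of |A| on each circle.\<close>

lemma uniform_asymp_evenI:
  assumes "0 \<le> K" and \<epsilon>: "\<And>n. 0 \<le> \<epsilon> n"
    and bound: "\<And>n z. n \<ge> N \<Longrightarrow> even n \<Longrightarrow> z \<in> D n \<Longrightarrow> norm (F n z - A n z * c) \<le> K * \<epsilon> n * B n z"
    and sep: "\<And>\<delta>. \<delta> > 0 \<Longrightarrow> \<exists>b>0. \<forall>n z. z \<in> D n \<longrightarrow> zero_separated \<delta> (A n) z \<longrightarrow> b * B n z \<le> norm (A n z)"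
    and circ: "\<exists>b>0. \<forall>n z. z \<in> D n \<longrightarrow> (\<exists>\<zeta>. norm \<zeta> = norm z \<and> b * B n z \<le> norm (A n \<zeta>))"
  shows "uniform_asymp_even F A c \<epsilon> D"
  unfolding uniform_asymp_even_def
proof (intro allI impI)
  fix \<delta> :: real assume "0 < \<delta>"
  then obtain b1 where b1: "b1 > 0" "\<And>n z. z \<in> D n \<Longrightarrow> zero_separated \<delta> (A n) z \<Longrightarrow> b1 * B n z \<le> norm (A n z)" using sep by blast
  obtain b2 where b2: "b2 > 0" "\<And>n z. z \<in> D n \<Longrightarrow> \<exists>\<zeta>. norm \<zeta> = norm z \<and> b2 * B n z \<le> norm (A n \<zeta>)" using circ by blast
  have le: "norm w \<le> (K / b1 + K / b2) * \<epsilon> n * x"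
    if w: "norm w \<le> K * \<epsilon> n * B n z" and b: "b = b1 \<or> b = b2" and x: "b * B n z \<le> x" "0 \<le> x" for w :: complex and n z b x
  proof -
    have b0: "b > 0" using b b1 b2 by auto
    have "B n z \<le> x / b" using x b0 by (simp add: pos_le_divide_eq mult.commute)
    then have "norm w \<le> K * \<epsilon> n * (x / b)" using w assms(1) \<epsilon>[of n] by (meson mult_left_mono mult_nonneg_nonneg order_trans)
    also have "\<dots> = K / b * (\<epsilon> n * x)" by simp
    also have "\<dots> \<le> (K / b1 + K / b2) * (\<epsilon> n * x)"
      using b b1(1) b2(1) assms(1) \<epsilon>[of n] x(2) by (intro mult_right_mono) auto
    finally show ?thesis by (simp only: mult.assoc)
  qed
  show "\<exists>K N. \<forall>n\<ge>N. even n \<longrightarrow> (\<forall>z\<in>D n.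
        (zero_separated \<delta> (A n) z \<longrightarrow> (\<exists>e. norm e \<le> K * \<epsilon> n \<and> F n z = A n z * (c + e))) \<and>
        (\<exists>\<zeta>. norm \<zeta> = norm z \<and> norm (F n z - A n z * c) \<le> K * \<epsilon> n * norm (A n \<zeta>)))"
  proof (intro exI[of _ "K / b1 + K / b2"] exI[of _ N] allI impI ballI conjI)
    fix n z assume n: "n \<ge> N" "even n" and z: "z \<in> D n"
    note w = bound[OF n z]
    show "\<exists>\<zeta>. norm \<zeta> = norm z \<and> norm (F n z - A n z * c) \<le> (K / b1 + K / b2) * \<epsilon> n * norm (A n \<zeta>)"
    proof -
      obtain \<zeta> where "norm \<zeta> = norm z" "b2 * B n z \<le> norm (A n \<zeta>)" using b2(2)[OF z] by blast
      then show ?thesis using le[OF w, of b2 "norm (A n \<zeta>)"] by auto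
    qed
    assume "zero_separated \<delta> (A n) z"
    then have wA: "norm (F n z - A n z * c) \<le> (K / b1 + K / b2) * \<epsilon> n * norm (A n z)"
      using b1(2)[OF z] le[OF w, of b1 "norm (A n z)"] by auto
    show "\<exists>e. norm e \<le> (K / b1 + K / b2) * \<epsilon> n \<and> F n z = A n z * (c + e)"
    \<comment> \<open>A separated point can still be a zero of A, namely at the origin. The bound
      then forces F to vanish too, and e = 0 works.\<close>
    proof (cases "A n z = 0")
      case True
      then show ?thesis using wA \<epsilon>[of n] assms(1) b1(1) b2(1) by (intro exI[of _ 0]) auto
    next
      case False
      then show ?thesis using wA
        by (intro exI[of _ "(F n z - A n z * c) / A n z"]) (auto simp: norm_divide pos_divide_le_eq field_simps)
    qed
  qed
qed

lemma mult_two_mono: "b * w \<le> v \<Longrightarrow> 0 \<le> x \<Longrightarrow> 0 \<le> y \<Longrightarrow> b * (x * (y * w)) \<le> x * (y * v)" for b x y w v :: real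
  using mult_left_mono[of "b * w" v "x * y"] by (simp add: mult_ac)

text \<open>Up to constants relative distance survives inversion: with \<zeta> = 1/(w r) one has
  |1/(z r) - \<zeta>| / |\<zeta>| = |z - w| / |z|. Replacing |w| by |z| in the separation costs the
  change from \<delta> to \<delta>/(1 + \<delta>).\<close>

lemma zero_separated_reciprocal:
  assumes sep: "zero_separated \<delta> A z" and \<delta>: "\<delta> > 0" and z: "z \<noteq> 0" and r: "r \<noteq> 0"
    and zero: "\<And>w. w \<noteq> 0 \<Longrightarrow> p (1 / (w * r)) = 0 \<Longrightarrow> A w = 0"
  shows "zero_separated (\<delta> / (1 + \<delta>)) p (1 / (z * r))"
  unfolding zero_separated_def
proof (intro allI impI)
  fix \<zeta> assume p: "p \<zeta> = 0"
  show "\<delta> / (1 + \<delta>) * norm \<zeta> \<le> dist (1 / (z * r)) \<zeta>"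
  proof (cases "\<zeta> = 0")
    case False
    define w where "w = 1 / (\<zeta> * r)"
    have w: "w \<noteq> 0" "\<zeta> = 1 / (w * r)" unfolding w_def using False r by auto
    have "\<delta> * norm w \<le> norm (z - w)" using sep zero[OF w(1)] p w(2) unfolding zero_separated_def dist_norm by auto
    then have "\<delta> * norm z \<le> (1 + \<delta>) * norm (z - w)"
      using mult_left_mono[OF norm_triangle_ineq2[of z w], of \<delta>] \<delta> by (simp add: algebra_simps)
    then have a: "\<delta> / (1 + \<delta>) \<le> norm (z - w) / norm z"
      using \<delta> z by (simp add: pos_divide_le_eq pos_le_divide_eq mult.commute)
    have "1 / (z * r) - \<zeta> = - ((z - w) / z) * \<zeta>" unfolding w(2) using z w(1) r by (simp add: field_simps)
    then have "norm (1 / (z * r) - \<zeta>) = norm (z - w) / norm z * norm \<zeta>" by (simp add: norm_mult norm_divide)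
    then show ?thesis unfolding dist_norm using mult_right_mono[OF a norm_ge_zero] by simp
  qed simp
qed

context qpar
begin

lemma growth_nonneg: "0 \<le> growth i r" unfolding growth_def using TT_pos[of r] by auto

text \<open>Up to radius 1 both growth functions are 1, beyond it they differ by one power of r; the
  minimum covers both regimes. This matches the extra factor of X2 to the zero of b.\<close>

lemma growth_shift: "0 \<le> r \<Longrightarrow> min 1 r * growth i r = r * growth (Suc i) r"
  unfolding growth_def by auto

lemma growth_mult_le: "0 \<le> r \<Longrightarrow> r * growth (Suc i) r \<le> growth i r"
  using mult_right_mono[OF min.cobounded1[of 1 r] growth_nonneg[of i r]] by (simp flip: growth_shift)

lemma near_asymp:
  assumes s: "separation q \<tau> p G c' i" and A: "\<And>n z. A n z = k n * (z ^ j * p z)"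
    and K: "0 \<le> K" and \<epsilon>: "\<And>n. 0 \<le> \<epsilon> n"
    and bound: "\<And>n z. n \<ge> N \<Longrightarrow> even n \<Longrightarrow> z \<in> D n \<Longrightarrow>
      norm (F n z - A n z * c) \<le> K * \<epsilon> n * (norm (k n) * (norm z ^ j * growth i (norm z)))"
  shows "uniform_asymp_even F A c \<epsilon> D"
proof (rule uniform_asymp_evenI[OF K \<epsilon> bound])
  fix \<delta> :: real assume "0 < \<delta>"
  then obtain b where b: "b > 0" "\<And>z. zero_separated \<delta> p z \<Longrightarrow> b * growth i (norm z) \<le> norm (p z)" using separation.separated_lower_bound[OF s] by blast
  have "b * (norm (k n) * (norm z ^ j * growth i (norm z))) \<le> norm (A n z)" if "zero_separated \<delta> (A n) z" for n z
  proof -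
    have "zero_separated \<delta> p z" using that unfolding zero_separated_def A by auto
    from mult_two_mono[OF b(2)[OF this]] show ?thesis unfolding A by (simp add: norm_mult norm_power)
  qed
  with b(1) show "\<exists>b>0. \<forall>n z. z \<in> D n \<longrightarrow> zero_separated \<delta> (A n) z \<longrightarrow> b * (norm (k n) * (norm z ^ j * growth i (norm z))) \<le> norm (A n z)" by blast
next
  obtain b where b: "b > 0" "\<And>r. r \<ge> 0 \<Longrightarrow> \<exists>\<zeta>. norm \<zeta> = r \<and> b * growth i r \<le> norm (p \<zeta>)" using separation.circle_lower_bound[OF s] by blast
  have "\<exists>\<zeta>. norm \<zeta> = norm z \<and> b * (norm (k n) * (norm z ^ j * growth i (norm z))) \<le> norm (A n \<zeta>)" for n z
  proof -
    obtain \<zeta> where z: "norm \<zeta> = norm z" "b * growth i (norm z) \<le> norm (p \<zeta>)" using b(2)[of "norm z"] by auto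
    from mult_two_mono[OF z(2)] show ?thesis
      unfolding A using z(1) by (intro exI[of _ \<zeta>]) (simp add: norm_mult norm_power)
  qed
  with b(1) show "\<exists>b>0. \<forall>n z. z \<in> D n \<longrightarrow> (\<exists>\<zeta>. norm \<zeta> = norm z \<and> b * (norm (k n) * (norm z ^ j * growth i (norm z))) \<le> norm (A n \<zeta>))" by blast
qed

lemma far_asymp:
  assumes s: "separation q \<tau> p G c' i" and r: "\<And>n. r n \<noteq> 0"
    and A: "\<And>n z. z \<noteq> 0 \<Longrightarrow> A n z = k n * (z ^ n * (1 / (z * r n)) ^ j * p (1 / (z * r n)))"
    and D: "\<And>n z. z \<in> D n \<Longrightarrow> z \<noteq> 0"
    and K: "0 \<le> K" and \<epsilon>: "\<And>n. 0 \<le> \<epsilon> n"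
    and bound: "\<And>n z. n \<ge> N \<Longrightarrow> even n \<Longrightarrow> z \<in> D n \<Longrightarrow> norm (F n z - A n z * c)
      \<le> K * \<epsilon> n * (norm (k n) * (norm z ^ n * norm (1 / (z * r n)) ^ j * growth i (norm (1 / (z * r n)))))"
  shows "uniform_asymp_even F A c \<epsilon> D"
proof -
  let ?B = "\<lambda>n z. norm (k n) * (norm z ^ n * norm (1 / (z * r n)) ^ j * growth i (norm (1 / (z * r n))))"
  have nA: "norm (A n z) = norm (k n) * (norm z ^ n * norm (1 / (z * r n)) ^ j * norm (p (1 / (z * r n))))" if "z \<noteq> 0" for n z
    unfolding A[OF that] by (simp only: norm_mult norm_power)
  show ?thesis
  proof (rule uniform_asymp_evenI[OF K \<epsilon> bound])
    fix \<delta> :: real assume \<delta>: "0 < \<delta>"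
    then have "\<delta> / (1 + \<delta>) > 0" by simp
    then obtain b where b: "b > 0" "\<And>z. zero_separated (\<delta> / (1 + \<delta>)) p z \<Longrightarrow> b * growth i (norm z) \<le> norm (p z)"
      using separation.separated_lower_bound[OF s] by blast
    have "b * ?B n z \<le> norm (A n z)" if z: "z \<in> D n" and sep: "zero_separated \<delta> (A n) z" for n z
    proof -
      have "zero_separated (\<delta> / (1 + \<delta>)) p (1 / (z * r n))"
        by (rule zero_separated_reciprocal[OF sep \<delta> D[OF z] r]) (simp add: A)
      from mult_two_mono[OF b(2)[OF this]] show ?thesis unfolding nA[OF D[OF z]] by simp
    qed
    with b(1) show "\<exists>b>0. \<forall>n z. z \<in> D n \<longrightarrow> zero_separated \<delta> (A n) z \<longrightarrow> b * ?B n z \<le> norm (A n z)" by blast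
  next
    obtain b where b: "b > 0" "\<And>r. r \<ge> 0 \<Longrightarrow> \<exists>\<zeta>. norm \<zeta> = r \<and> b * growth i r \<le> norm (p \<zeta>)" using separation.circle_lower_bound[OF s] by blast
    have "\<exists>\<zeta>. norm \<zeta> = norm z \<and> b * ?B n z \<le> norm (A n \<zeta>)" if "z \<in> D n" for n z
    proof -
      have z: "z \<noteq> 0" using D that by blast
      obtain x where x: "norm x = norm (1 / (z * r n))" "b * growth i (norm (1 / (z * r n))) \<le> norm (p x)" using b(2)[of "norm (1 / (z * r n))"] by auto
      define \<zeta> where "\<zeta> = 1 / (x * r n)"
      have x0: "x \<noteq> 0" using x(1) z r[of n] by auto
      have \<zeta>: "\<zeta> \<noteq> 0" "1 / (\<zeta> * r n) = x" unfolding \<zeta>_def using x0 r[of n] by auto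
      have "norm \<zeta> = norm z" unfolding \<zeta>_def using x(1) r[of n] by (simp add: norm_divide norm_mult)
      then show ?thesis
        using mult_two_mono[OF x(2), of "norm (k n)" "norm z ^ n * norm (1 / (z * r n)) ^ j"] nA[OF \<zeta>(1), of n] x(1)
        unfolding \<zeta>(2) by (intro exI[of _ \<zeta>]) simp
    qed
    with b(1) show "\<exists>b>0. \<forall>n z. z \<in> D n \<longrightarrow> (\<exists>\<zeta>. norm \<zeta> = norm z \<and> b * ?B n z \<le> norm (A n \<zeta>))" by blast
  qed
qed

end

context asym
begin

lemma powr_conversions:
  fixes m :: nat
  defines "x \<equiv> real (2 * m)"
  shows "(- 1) ^ m * complex_of_real (q powr (- (x / 2) * (x / 2 - 1))) = CC m"
    "(- 1) ^ m * complex_of_real (q powr (x / 2 * (x / 2 - 1))) = 1 / CC m"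
    "complex_of_real (q powr (x * (x / 2 - 1))) = 1 / CC m * (1 / CC m)"
    "complex_of_real (q powr (x / 2)) = Q ^ m"
    "q powr (x / 4) = ep m"
proof -
  have x: "x / 2 = real m" unfolding x_def by simp
  have mm: "real m * (real m - 1) = real (m * (m - 1))" by (cases m) (auto simp: algebra_simps)
  have pw: "q powr real k = q ^ k" for k using q0 by (rule powr_realpow)
  have sgn: "(- 1 :: complex) ^ m * (- 1) ^ m = 1" by (simp flip: power_mult_distrib)
  have i: "1 / CC m = (- 1) ^ m * Q ^ (m * (m - 1))"
  proof -
    have "CC m * ((- 1) ^ m * Q ^ (m * (m - 1))) = ((- 1) ^ m * (- 1) ^ m) * (Q ^ (m * (m - 1)) / Q ^ (m * (m - 1)))"
      unfolding CC_def by simp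
    then have "CC m * ((- 1) ^ m * Q ^ (m * (m - 1))) = 1" unfolding sgn by simp
    then show ?thesis using CC_nz[of m] by (simp add: divide_eq_eq mult.commute)
  qed
  have "q powr (- (x / 2) * (x / 2 - 1)) = 1 / q ^ (m * (m - 1))"
    unfolding x using mm by (simp add: powr_minus_divide pw del: of_nat_mult)
  then show "(- 1) ^ m * complex_of_real (q powr (- (x / 2) * (x / 2 - 1))) = CC m" unfolding CC_def by simp
  have 2: "q powr (x / 2 * (x / 2 - 1)) = q ^ (m * (m - 1))" unfolding x mm pw ..
  show "(- 1) ^ m * complex_of_real (q powr (x / 2 * (x / 2 - 1))) = 1 / CC m" unfolding 2 i by simp
  have "x * (x / 2 - 1) = real (m * (m - 1)) + real (m * (m - 1))" unfolding mm[symmetric] x_def by (simp add: algebra_simps)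
  then have 3: "q powr (x * (x / 2 - 1)) = q ^ (m * (m - 1)) * q ^ (m * (m - 1))" by (simp only: powr_add pw)
  have "1 / CC m * (1 / CC m) = ((- 1) ^ m * (- 1) ^ m) * (Q ^ (m * (m - 1)) * Q ^ (m * (m - 1)))" unfolding i by (simp only: mult_ac)
  then show "complex_of_real (q powr (x * (x / 2 - 1))) = 1 / CC m * (1 / CC m)" unfolding 3 sgn by simp
  show "complex_of_real (q powr (x / 2)) = Q ^ m" unfolding x pw by simp
  show "q powr (x / 4) = ep m" unfolding ep_def x_def by simp
qed

text \<open>Both regions fall inside the ranges of validity, which overlap between
  \<open>R1 m\<close> and \<open>R2 m\<close>. Since \<sigma> > q, the outer radius exceeds q^(-(m
  div 2 + 1)); since \<sigma> < 1, the inner one is below q^(-(m div 2)).\<close>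

lemma region_bounds:
  "norm z \<le> q powr (- (real (2 * m) / 4)) \<Longrightarrow> norm z \<le> R2 m"
  "norm z > q powr (- (real (2 * m) / 4)) \<Longrightarrow> R1 m \<le> norm z"
proof -
  have pw: "q powr (- real k) = 1 / q ^ k" for k using q0 by (simp add: powr_minus_divide powr_realpow)
  have "q powr (- (real (2 * m) / 4)) \<le> q powr (- real (m div 2 + 1))" using q0 q1 by (intro powr_mono') linarith+
  also have "\<dots> = q / (q ^ (m div 2) * q ^ 2)" unfolding pw by (simp add: power2_eq_square)
  also have "\<dots> \<le> \<sigma> / (q ^ (m div 2) * q ^ 2)" using \<sigma>(1) q0 by (intro divide_right_mono) auto
  also have "\<dots> = R2 m" unfolding R2_def R1_def by simp
  finally show "norm z \<le> q powr (- (real (2 * m) / 4)) \<Longrightarrow> norm z \<le> R2 m" by linarith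
  have "R1 m \<le> 1 / q ^ (m div 2)" unfolding R1_def using \<sigma>(2) q0 by (intro divide_right_mono) auto
  also have "\<dots> = q powr (- real (m div 2))" unfolding pw ..
  also have "\<dots> \<le> q powr (- (real (2 * m) / 4))" using q0 q1 by (intro powr_mono') linarith+
  finally show "norm z > q powr (- (real (2 * m) / 4)) \<Longrightarrow> R1 m \<le> norm z" by linarith
qed

lemma far_functions:
  assumes "z \<noteq> 0"
  shows "z ^ n * a_inf (z * Q ^ m) = z ^ n * (1 / (z * Q ^ m)) ^ 0 * ainf_s (1 / (z * Q ^ m))"
    "z ^ n * b_inf (z * Q ^ m) = z ^ n * (1 / (z * Q ^ m)) ^ 1 * binf_s (1 / (z * Q ^ m))"
  using ainf_s(3)[of "z * Q ^ m"] binf_s(3)[of "z * Q ^ m"] assms by (simp_all)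

text \<open>Replaces the special functions in the errors by zero-free growth functions. For even
  degree the larger of the two dominates; for odd degree the factors \<open>min 1 (norm z)\<close>
  and R1/|z| bring the larger one down to the smaller.\<close>

theorem majorised_bounds:
  "\<exists>K N. K \<ge> 0 \<and> (\<forall>m\<ge>N.
     (\<forall>z. norm z \<le> R2 m \<longrightarrow>
        norm (poly (P (2 * m)) z - CC m * a z * (mu2 / eta2)) \<le> K * ep m * (norm (CC m) * growth 0 (norm z)) \<and>
        norm (poly (P (2 * m - 1)) z - 1 / CC m * \<gamma> (2 * m - 1) * b z * (lam3 / c_Psi))
          \<le> K * ep m * (norm (1 / CC m * \<gamma> (2 * m - 1)) * (norm z * growth 1 (norm z)))) \<and>
     (\<forall>z. R1 m \<le> norm z \<longrightarrow>
        norm (poly (P (2 * m)) z - z ^ (2 * m) * a_inf (z * Q ^ m))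
          \<le> K * ep m * (norm z ^ (2 * m) * growth 2 (norm (1 / (z * Q ^ m)))) \<and>
        norm (poly (P (2 * m - 1)) z - 1 / CC m * (1 / CC m) * \<gamma> (2 * m - 1) / (mu4 * H * c_Psi) * (z ^ (2 * m) * b_inf (z * Q ^ m)))
          \<le> K * ep m * (norm (1 / CC m * (1 / CC m) * \<gamma> (2 * m - 1) / (mu4 * H * c_Psi))
              * (norm z ^ (2 * m) * (norm (1 / (z * Q ^ m)) * growth 3 (norm (1 / (z * Q ^ m))))))))"
proof -
  obtain K0 N where K0: "K0 \<ge> 0" and near: "\<And>m z. m \<ge> N \<Longrightarrow> norm z \<le> R2 m \<Longrightarrow>
        norm (poly (P (2 * m)) z - CC m * a z * (mu2 / eta2)) \<le> norm (CC m) * (K0 * ep m * (norm (a z) + norm (b z))) \<and>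
        norm (poly (P (2 * m - 1)) z - \<gamma> (2 * m - 1) / CC m * b z * (lam3 / c_Psi))
          \<le> norm (\<gamma> (2 * m - 1) / CC m) * (K0 * ep m * (norm (b z) + min 1 (norm z) * norm (a z)))"
    and far: "\<And>m z. m \<ge> N \<Longrightarrow> R1 m \<le> norm z \<Longrightarrow>
        norm (poly (P (2 * m)) z - CC m * F1 m z * (1 / 1)) \<le> norm (CC m) * (K0 * ep m * (norm (F1 m z) + norm (F2 m z))) \<and>
        norm (poly (P (2 * m - 1)) z - \<gamma> (2 * m - 1) / CC m * F2 m z * (1 / (H * mu4 * c_Psi)))
          \<le> norm (\<gamma> (2 * m - 1) / CC m) * (K0 * ep m * (norm (F2 m z) + R1 m / norm z * norm (F1 m z)))"
    using polynomial_bounds by blast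
  obtain C1 where C1: "C1 > 0" "\<And>z. norm (a z) \<le> C1 * growth 0 (norm z)" using separation.upper_bound[OF sep_a] by blast
  obtain C2 where C2: "C2 > 0" "\<And>z. norm (pb z) \<le> C2 * growth 1 (norm z)" using separation.upper_bound[OF sep_b] by blast
  obtain C3 where C3: "C3 > 0" "\<And>z. norm (ainf_s z) \<le> C3 * growth 2 (norm z)" using separation.upper_bound[OF sep_ainf] by blast
  obtain C4 where C4: "C4 > 0" "\<And>z. norm (binf_s z) \<le> C4 * growth 3 (norm z)" using separation.upper_bound[OF sep_binf] by blast
  define k where "k = mu4 * H * c_Psi"
  have k0: "k \<noteq> 0" unfolding k_def using mu4_nz H_nz c_Psi(1) by simp
  \<comment> \<open>The factor 1 + |k| compensates for the division by k = mu4 H c_Psi in the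
    prefactor of the odd far estimate.\<close>
  define K where "K = K0 * (C1 + C2 + C3 + C4) * (1 + norm k)"
  have K: "K0 * (C1 + C2) \<le> K" "K0 * (C3 + C4) \<le> K" "K0 * (C3 + C4) * norm k \<le> K" "0 \<le> K"
  proof -
    have "K0 * (C1 + C2) * 1 \<le> K" "K0 * (C3 + C4) * 1 \<le> K" "K0 * (C3 + C4) * norm k \<le> K"
      unfolding K_def using K0 C1(1) C2(1) C3(1) C4(1) by (intro mult_mono mult_left_mono; simp)+
    moreover have "0 \<le> K" unfolding K_def using K0 C1(1) C2(1) C3(1) C4(1) by simp
    ultimately show "K0 * (C1 + C2) \<le> K" "K0 * (C3 + C4) \<le> K" "K0 * (C3 + C4) * norm k \<le> K" "0 \<le> K" by simp_all
  qed
  have shift: "r * growth (Suc i) r \<le> growth i r" "min 1 r * growth i r = r * growth (Suc i) r" if "0 \<le> r" for r i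
    using growth_mult_le growth_shift that by auto
  have collect: "x * (K0 * e * y) \<le> K * e * (x * w)"
    if "y \<le> L * w" "K0 * L \<le> K" "0 \<le> x" "0 \<le> e" "0 \<le> w" for x e y w L
  proof -
    have "x * (K0 * e * y) \<le> x * (K0 * e * (L * w))" using that K0 by (intro mult_left_mono) auto
    also have "\<dots> = K0 * L * (x * e * w)" by simp
    also have "\<dots> \<le> K * (x * e * w)" using that by (intro mult_right_mono) auto
    finally show ?thesis by (simp add: mult_ac)
  qed
  have e0: "0 \<le> ep m" for m using ep_pos[of m] by simp
  have "norm (poly (P (2 * m)) z - CC m * a z * (mu2 / eta2)) \<le> K * ep m * (norm (CC m) * growth 0 (norm z)) \<and>
        norm (poly (P (2 * m - 1)) z - 1 / CC m * \<gamma> (2 * m - 1) * b z * (lam3 / c_Psi))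
          \<le> K * ep m * (norm (1 / CC m * \<gamma> (2 * m - 1)) * (norm z * growth 1 (norm z)))"
    if mz: "m \<ge> N" "norm z \<le> R2 m" for m z
  proof -
    let ?r = "norm z"
    have r: "0 \<le> ?r" "0 \<le> growth 0 ?r" "0 \<le> ?r * growth 1 ?r" using growth_nonneg by auto
    have bz: "norm (b z) \<le> C2 * (?r * growth 1 ?r)"
      using mult_left_mono[OF C2(2), of ?r z] unfolding pb(3)[of z] by (simp add: norm_mult mult_ac)
    have "norm (a z) + norm (b z) \<le> (C1 + C2) * growth 0 ?r"
      using C1(2)[of z] bz mult_left_mono[OF shift(1)[OF r(1), of 0], of C2] C2(1)
      unfolding distrib_right One_nat_def by linarith
    from order_trans[OF conjunct1[OF near[OF mz]] collect[OF this K(1) norm_ge_zero e0 r(2)]]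
    have 1: "norm (poly (P (2 * m)) z - CC m * a z * (mu2 / eta2)) \<le> K * ep m * (norm (CC m) * growth 0 (norm z))" .
    have "norm (b z) + min 1 ?r * norm (a z) \<le> (C1 + C2) * (?r * growth 1 ?r)"
    proof -
      have "min 1 ?r * norm (a z) \<le> min 1 ?r * (C1 * growth 0 ?r)" by (intro mult_left_mono C1(2)) auto
      also have "\<dots> = C1 * (?r * growth 1 ?r)" using shift(2)[OF r(1), of 0] by simp
      finally show ?thesis using bz by (simp add: distrib_right)
    qed
    from order_trans[OF conjunct2[OF near[OF mz]] collect[OF this K(1) norm_ge_zero e0 r(3)]]
    show ?thesis using 1 by simp
  qed
  moreover have "norm (poly (P (2 * m)) z - z ^ (2 * m) * a_inf (z * Q ^ m))
          \<le> K * ep m * (norm z ^ (2 * m) * growth 2 (norm (1 / (z * Q ^ m)))) \<and>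
        norm (poly (P (2 * m - 1)) z - 1 / CC m * (1 / CC m) * \<gamma> (2 * m - 1) / (mu4 * H * c_Psi) * (z ^ (2 * m) * b_inf (z * Q ^ m)))
          \<le> K * ep m * (norm (1 / CC m * (1 / CC m) * \<gamma> (2 * m - 1) / (mu4 * H * c_Psi))
              * (norm z ^ (2 * m) * (norm (1 / (z * Q ^ m)) * growth 3 (norm (1 / (z * Q ^ m))))))"
    if mz: "m \<ge> N" "R1 m \<le> norm z" for m z
  proof -
    have z: "z \<noteq> 0" "0 < norm z" using mz(2) R1_pos[of m] by auto
    define s where "s = 1 / (z * Q ^ m)"
    define zn where "zn = norm z ^ (2 * m)"
    define c where "c = norm (CC m)"
    let ?r = "norm s"
    have r: "0 \<le> ?r" "0 \<le> growth 2 ?r" "0 \<le> ?r * growth 3 ?r" "0 \<le> zn" "0 < c" unfolding zn_def c_def using growth_nonneg CC_nz by auto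
    have s23: "Suc 2 = 3" by simp
    have F1n: "norm (F1 m z) = zn * norm (ainf_s s) / c"
      unfolding F1_def far_functions(1)[OF z(1), of "2 * m" m] s_def[symmetric] zn_def c_def
      by (simp add: norm_mult norm_divide norm_power)
    have F2n: "norm (F2 m z) = zn * (?r * norm (binf_s s)) / c"
      unfolding F2_def far_functions(2)[OF z(1), of "2 * m" m] s_def[symmetric] zn_def c_def
      by (simp add: norm_mult norm_divide norm_power)
    have A: "norm (ainf_s s) \<le> C3 * growth 2 ?r" by (rule C3(2))
    have B: "?r * norm (binf_s s) \<le> C4 * (?r * growth 3 ?r)"
      using mult_left_mono[OF C4(2)[of s] r(1)] by (simp add: mult_ac)
    have B': "?r * norm (binf_s s) \<le> C4 * growth 2 ?r"
      using B mult_left_mono[OF shift(1)[OF r(1), of 2], of C4] C4(1) unfolding s23 by linarith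
    \<comment> \<open>The bound by |s| = |1/t| is R1 q^m \<le> 1, and the bound by 1 is the region
      itself; \<open>growth_shift\<close> needs both.\<close>
    have rho: "R1 m / norm z \<le> min 1 ?r"
    proof -
      have "?r = 1 / (norm z * q ^ m)" unfolding s_def using q0 by (simp add: norm_divide norm_mult norm_power)
      moreover have "R1 m / norm z \<le> 1 / (norm z * q ^ m)"
        using R1_q[of m] z(2) q0 by (simp add: field_simps)
      moreover have "R1 m / norm z \<le> 1" using mz(2) z(2) by (simp add: pos_divide_le_eq)
      ultimately show ?thesis by simp
    qed
    have e1: "norm (F1 m z) + norm (F2 m z) \<le> (C3 + C4) * (zn * growth 2 ?r / c)"
    proof -
      have "norm (F1 m z) + norm (F2 m z) = zn / c * (norm (ainf_s s) + ?r * norm (binf_s s))"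
        unfolding F1n F2n by (simp add: algebra_simps)
      also have "\<dots> \<le> zn / c * (C3 * growth 2 ?r + C4 * growth 2 ?r)" using A B' r by (intro mult_left_mono add_mono) auto
      finally show ?thesis by (simp add: algebra_simps add_divide_distrib)
    qed
    have e2: "norm (F2 m z) + R1 m / norm z * norm (F1 m z) \<le> (C3 + C4) * (zn * (?r * growth 3 ?r) / c)"
    proof -
      have "R1 m / norm z * norm (ainf_s s) \<le> min 1 ?r * (C3 * growth 2 ?r)"
        using rho A r(1,2) C3(1) by (intro mult_mono) auto
      also have "\<dots> = C3 * (?r * growth 3 ?r)" using shift(2)[OF r(1), of 2] unfolding s23 by simp
      finally have A': "R1 m / norm z * norm (ainf_s s) \<le> C3 * (?r * growth 3 ?r)" .
      have "norm (F2 m z) + R1 m / norm z * norm (F1 m z) = zn / c * (?r * norm (binf_s s) + R1 m / norm z * norm (ainf_s s))"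
        unfolding F1n F2n by (simp add: algebra_simps)
      also have "\<dots> \<le> zn / c * (C4 * (?r * growth 3 ?r) + C3 * (?r * growth 3 ?r))" using A' B r by (intro mult_left_mono add_mono) auto
      finally show ?thesis by (simp add: algebra_simps add_divide_distrib)
    qed
    have n1: "0 \<le> zn * growth 2 ?r / c" "0 \<le> zn * (?r * growth 3 ?r) / c" using r by auto
    have f1: "CC m * F1 m z * (1 / 1) = z ^ (2 * m) * a_inf (z * Q ^ m)" unfolding F1_def using CC_nz[of m] by simp
    have f2: "\<gamma> (2 * m - 1) / CC m * F2 m z * (1 / (H * mu4 * c_Psi))
        = 1 / CC m * (1 / CC m) * \<gamma> (2 * m - 1) / (mu4 * H * c_Psi) * (z ^ (2 * m) * b_inf (z * Q ^ m))"
      unfolding F2_def by (simp add: mult_ac)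
    have "norm (poly (P (2 * m)) z - z ^ (2 * m) * a_inf (z * Q ^ m)) \<le> K * ep m * (c * (zn * growth 2 ?r / c))"
      using order_trans[OF conjunct1[OF far[OF mz]] collect[OF e1 K(2) norm_ge_zero e0 n1(1)]] unfolding f1 c_def .
    then have 1: "norm (poly (P (2 * m)) z - z ^ (2 * m) * a_inf (z * Q ^ m)) \<le> K * ep m * (zn * growth 2 ?r)"
      using r(5) by simp
    define G where "G = norm (\<gamma> (2 * m - 1) / CC m)"
    have G: "norm (1 / CC m * (1 / CC m) * \<gamma> (2 * m - 1) / (mu4 * H * c_Psi)) = G / c / norm k"
      unfolding G_def c_def k_def by (simp add: norm_mult norm_divide mult_ac)
    have G0: "0 \<le> G" unfolding G_def by simp
    have "norm (poly (P (2 * m - 1)) z - \<gamma> (2 * m - 1) / CC m * F2 m z * (1 / (H * mu4 * c_Psi)))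
        \<le> G * (K0 * ep m * ((C3 + C4) * (zn * (?r * growth 3 ?r) / c)))"
      using order_trans[OF conjunct2[OF far[OF mz]] mult_left_mono[OF mult_left_mono[OF e2], of "K0 * ep m" "norm (\<gamma> (2 * m - 1) / CC m)"]]
        K0 e0[of m] unfolding G_def by simp
    also have "\<dots> = K0 * (C3 + C4) * norm k * (ep m * (G / c / norm k * (zn * (?r * growth 3 ?r))))"
      using k0 r(5) by (simp add: field_simps)
    also have "\<dots> \<le> K * (ep m * (G / c / norm k * (zn * (?r * growth 3 ?r))))"
      using e0 G0 r by (intro mult_right_mono K(3)) auto
    finally have 2: "norm (poly (P (2 * m - 1)) z - \<gamma> (2 * m - 1) / CC m * F2 m z * (1 / (H * mu4 * c_Psi)))
        \<le> K * ep m * (G / c / norm k * (zn * (?r * growth 3 ?r)))" by (simp only: mult.assoc)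
    show ?thesis using 1 2 unfolding f2 G zn_def s_def by blast
  qed
  ultimately show ?thesis using K(4) by blast
qed

theorem asymptotics:
  "uniform_asymp_even
           (\<lambda>n z. poly (P n) z)
           (\<lambda>n z. (- 1) ^ (n div 2) * complex_of_real (q powr (- (real n / 2) * (real n / 2 - 1))) * a z)
           (mu2 / eta2)
           (\<lambda>n. q powr (real n / 4))
           (\<lambda>n. {z. norm z \<le> q powr (- (real n / 4))})"
    (is ?E)
  "uniform_asymp_even
           (\<lambda>n z. poly (P n) z)
           (\<lambda>n z. z ^ n * a_inf (z * complex_of_real (q powr (real n / 2))))
           1
           (\<lambda>n. q powr (real n / 4))
           (\<lambda>n. {z. norm z > q powr (- (real n / 4))})"
    (is ?F)
  "uniform_asymp_even
           (\<lambda>n z. poly (P (n - 1)) z)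
           (\<lambda>n z. (- 1) ^ (n div 2) * complex_of_real (q powr (real n / 2 * (real n / 2 - 1)))
                    * \<gamma> (n - 1) * b z)
           (lam3 / c_Psi)
           (\<lambda>n. q powr (real n / 4))
           (\<lambda>n. {z. norm z \<le> q powr (- (real n / 4))})"
    (is ?G)
  "uniform_asymp_even
           (\<lambda>n z. poly (P (n - 1)) z)
           (\<lambda>n z. complex_of_real (q powr (real n * (real n / 2 - 1))) * \<gamma> (n - 1)
                    / (mu4 * H * c_Psi)
                    * z ^ n * b_inf (z * complex_of_real (q powr (real n / 2))))
           1
           (\<lambda>n. q powr (real n / 4))
           (\<lambda>n. {z. norm z > q powr (- (real n / 4))})"
    (is ?I)
proof -
  obtain K N where K: "K \<ge> 0" and near: "\<And>m z. m \<ge> N \<Longrightarrow> norm z \<le> R2 m \<Longrightarrow>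
        norm (poly (P (2 * m)) z - CC m * a z * (mu2 / eta2)) \<le> K * ep m * (norm (CC m) * growth 0 (norm z)) \<and>
        norm (poly (P (2 * m - 1)) z - 1 / CC m * \<gamma> (2 * m - 1) * b z * (lam3 / c_Psi))
          \<le> K * ep m * (norm (1 / CC m * \<gamma> (2 * m - 1)) * (norm z * growth 1 (norm z)))"
    and far: "\<And>m z. m \<ge> N \<Longrightarrow> R1 m \<le> norm z \<Longrightarrow>
        norm (poly (P (2 * m)) z - z ^ (2 * m) * a_inf (z * Q ^ m))
          \<le> K * ep m * (norm z ^ (2 * m) * growth 2 (norm (1 / (z * Q ^ m)))) \<and>
        norm (poly (P (2 * m - 1)) z - 1 / CC m * (1 / CC m) * \<gamma> (2 * m - 1) / (mu4 * H * c_Psi) * (z ^ (2 * m) * b_inf (z * Q ^ m)))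
          \<le> K * ep m * (norm (1 / CC m * (1 / CC m) * \<gamma> (2 * m - 1) / (mu4 * H * c_Psi))
              * (norm z ^ (2 * m) * (norm (1 / (z * Q ^ m)) * growth 3 (norm (1 / (z * Q ^ m))))))"
    using majorised_bounds by blast
  have \<epsilon>: "0 \<le> q powr (real n / 4)" for n by simp
  have half: "\<exists>m\<ge>N. n = 2 * m" if "n \<ge> 2 * N" "even n" for n using that by (elim evenE) auto
  have rn: "complex_of_real (q powr (real n / 2)) \<noteq> 0" for n using q0 by simp
  have D: "z \<noteq> 0" if "z \<in> {z. norm z > q powr (- (real n / 4))}" for z :: complex and n
    using that powr_ge_zero[of q "- (real n / 4)"] by (auto simp del: powr_ge_zero)
  have inv: "b_inf t = (1 / t) ^ 1 * binf_s (1 / t)" "a_inf t = (1 / t) ^ 0 * ainf_s (1 / t)" if "t \<noteq> 0" for t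
    using ainf_s(3)[OF that] binf_s(3)[OF that] by simp_all
  show ?E
  proof (rule near_asymp[OF sep_a _ K \<epsilon>, where N = "2 * N" and j = 0])
    fix n and z :: complex assume "n \<ge> 2 * N" "even n" and z: "z \<in> {z. norm z \<le> q powr (- (real n / 4))}"
    then obtain m where m: "m \<ge> N" "n = 2 * m" using half by blast
    have zR: "norm z \<le> R2 m" using region_bounds(1)[of z m] z unfolding m(2) by blast
    have d: "2 * m div 2 = m" by simp
    show "norm (poly (P n) z - (- 1) ^ (n div 2) * complex_of_real (q powr (- (real n / 2) * (real n / 2 - 1))) * a z * (mu2 / eta2))
       \<le> K * q powr (real n / 4) * (norm ((- 1) ^ (n div 2) * complex_of_real (q powr (- (real n / 2) * (real n / 2 - 1)))) * (norm z ^ 0 * growth 0 (norm z)))"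
      using near[OF m(1) zR] unfolding m(2) d powr_conversions power_0 mult_1 by blast
  qed simp
  show ?F
  proof (rule far_asymp[OF sep_ainf rn _ D K \<epsilon>, where N = "2 * N" and j = 0 and k = "\<lambda>_. 1"])
    fix n and z :: complex assume "n \<ge> 2 * N" "even n" and z: "z \<in> {z. norm z > q powr (- (real n / 4))}"
    then obtain m where m: "m \<ge> N" "n = 2 * m" using half by blast
    have zR: "R1 m \<le> norm z" using region_bounds(2)[of m z] z unfolding m(2) by blast
    show "norm (poly (P n) z - z ^ n * a_inf (z * complex_of_real (q powr (real n / 2))) * 1)
       \<le> K * q powr (real n / 4) * (norm (1::complex) * (norm z ^ n * norm (1 / (z * complex_of_real (q powr (real n / 2)))) ^ 0
            * growth 2 (norm (1 / (z * complex_of_real (q powr (real n / 2)))))))"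
      using far[OF m(1) zR] unfolding m(2) powr_conversions power_0 norm_one mult_1 mult_1_right by blast
  qed (simp add: inv rn)
  show ?G
  proof (rule near_asymp[OF sep_b _ K \<epsilon>, where N = "2 * N" and j = 1
        and k = "\<lambda>n. (- 1) ^ (n div 2) * complex_of_real (q powr (real n / 2 * (real n / 2 - 1))) * \<gamma> (n - 1)"])
    fix n and z :: complex assume "n \<ge> 2 * N" "even n" and z: "z \<in> {z. norm z \<le> q powr (- (real n / 4))}"
    then obtain m where m: "m \<ge> N" "n = 2 * m" using half by blast
    have zR: "norm z \<le> R2 m" using region_bounds(1)[of z m] z unfolding m(2) by blast
    have d: "2 * m div 2 = m" by simp
    show "norm (poly (P (n - 1)) z - (- 1) ^ (n div 2) * complex_of_real (q powr (real n / 2 * (real n / 2 - 1))) * \<gamma> (n - 1) * b z * (lam3 / c_Psi))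
       \<le> K * q powr (real n / 4) * (norm ((- 1) ^ (n div 2) * complex_of_real (q powr (real n / 2 * (real n / 2 - 1))) * \<gamma> (n - 1))
          * (norm z ^ 1 * growth 1 (norm z)))"
      using near[OF m(1) zR] unfolding m(2) d powr_conversions power_one_right by blast
  qed (simp add: pb(3))
  show ?I
  proof (rule far_asymp[OF sep_binf rn _ D K \<epsilon>, where N = "2 * N" and j = 1
        and k = "\<lambda>n. complex_of_real (q powr (real n * (real n / 2 - 1))) * \<gamma> (n - 1) / (mu4 * H * c_Psi)"])
    fix n and z :: complex assume "n \<ge> 2 * N" "even n" and z: "z \<in> {z. norm z > q powr (- (real n / 4))}"
    then obtain m where m: "m \<ge> N" "n = 2 * m" using half by blast
    have zR: "R1 m \<le> norm z" using region_bounds(2)[of m z] z unfolding m(2) by blast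
    show "norm (poly (P (n - 1)) z - complex_of_real (q powr (real n * (real n / 2 - 1))) * \<gamma> (n - 1) / (mu4 * H * c_Psi)
            * z ^ n * b_inf (z * complex_of_real (q powr (real n / 2))) * 1)
       \<le> K * q powr (real n / 4) * (norm (complex_of_real (q powr (real n * (real n / 2 - 1))) * \<gamma> (n - 1) / (mu4 * H * c_Psi))
            * (norm z ^ n * norm (1 / (z * complex_of_real (q powr (real n / 2)))) ^ 1
            * growth 3 (norm (1 / (z * complex_of_real (q powr (real n / 2)))))))"
      using far[OF m(1) zR] unfolding m(2) powr_conversions power_one_right mult_1_right mult.assoc[of "_ / _"] mult.assoc[of "norm z ^ _"] by blast
  next
    fix n and z :: complex assume z: "z \<noteq> 0"
    have t: "z * complex_of_real (q powr (real n / 2)) \<noteq> 0" using z rn by simp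
    show "complex_of_real (q powr (real n * (real n / 2 - 1))) * \<gamma> (n - 1) / (mu4 * H * c_Psi)
            * z ^ n * b_inf (z * complex_of_real (q powr (real n / 2)))
        = complex_of_real (q powr (real n * (real n / 2 - 1))) * \<gamma> (n - 1) / (mu4 * H * c_Psi)
            * (z ^ n * (1 / (z * complex_of_real (q powr (real n / 2)))) ^ 1 * binf_s (1 / (z * complex_of_real (q powr (real n / 2)))))"
      unfolding inv(1)[OF t] by (simp only: mult.assoc)
  qed
qed

end

theorem theorem1p5:
  fixes q :: real
    and P :: "nat \<Rightarrow> complex poly" and \<gamma> :: "nat \<Rightarrow> complex"
    and a b phi_even varphi_even varphi_odd :: "complex \<Rightarrow> complex"
    and a_inf b_inf Psi_even Psi_odd tPsi_even tPsi_odd :: "complex \<Rightarrow> complex"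
    and eta1 eta2 lambda3 lambda4 mu1 mu2 mu3 mu4 c_Psi :: complex
  assumes q: "0 < q" "q < 1"
    and P: "monic_orthogonal_family q P \<gamma>"
    and a: "normalised_even_entire a" "\<forall>z. near_eq q a z"
    and b: "normalised_odd_entire b" "\<forall>z. near_eq q b z"
    and phi_even: "normalised_even_series_at_infinity 0 phi_even"
                  "\<forall>z. z \<noteq> 0 \<longrightarrow> phi_eq q phi_even z"
    and varphi_even: "normalised_even_series_at_infinity q varphi_even"
                     "\<forall>z. norm z > q \<longrightarrow> varphi_eq q varphi_even z"
    and varphi_odd: "normalised_odd_series_at_infinity q varphi_odd"
                    "\<forall>z. norm z > q \<longrightarrow> varphi_eq q varphi_odd z"
    and eta: "\<forall>z. norm z > q \<and> z \<notin> q_lattice q \<longrightarrow>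
                a z / g_fun q z = eta1 * h_fun q z * varphi_odd z + eta2 * varphi_even z"
    and lambda: "\<forall>z. z \<noteq> 0 \<and> z \<notin> q_lattice q \<and> qpoch_inf (- (z ^ 4)) (q ^ 4) \<noteq> 0 \<longrightarrow>
                phi_even z = g_fun q z * w_fun q z * (lambda3 * h_fun q z * b z + lambda4 * a z)"
    and a_inf: "normalised_even_series_at_infinity 0 a_inf"
               "\<forall>t. t \<noteq> 0 \<longrightarrow> far_even_eq q a_inf t"
    and b_inf: "normalised_odd_series_at_infinity 0 b_inf"
               "\<forall>t. t \<noteq> 0 \<longrightarrow> far_odd_eq q b_inf t"
    and Psi_even: "normalised_even_entire Psi_even" "\<forall>t. Psi_eq q Psi_even t"
    and Psi_odd: "normalised_odd_entire Psi_odd" "\<forall>t. Psi_eq q Psi_odd t"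
    and tPsi_even: "normalised_even_entire tPsi_even" "\<forall>t. tPsi_eq q tPsi_even t"
    and tPsi_odd: "normalised_odd_entire tPsi_odd" "\<forall>t. tPsi_eq q tPsi_odd t"
    and mu_a: "\<forall>t. t \<noteq> 0 \<and> t \<notin> q_lattice q \<longrightarrow>
                a_inf t / g_fun q t = mu1 * h_fun q t * Psi_odd t + mu2 * Psi_even t"
    and mu_b: "\<forall>t. t \<noteq> 0 \<and> t \<notin> q_lattice q \<longrightarrow>
                b_inf t / g_fun q t = mu3 * tPsi_odd t + mu4 * h_fun q t * tPsi_even t"
    and c_Psi: "c_Psi \<noteq> 0"
               "\<exists>r>0. (\<lambda>t. tPsi_even t / g_fun q t - c_Psi)
                   \<in> O[inf at_infinity (principal {t. \<forall>p\<in>q_lattice q. dist t p > r})](\<lambda>t. 1 / t)"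
  shows "uniform_asymp_even
           (\<lambda>n z. poly (P n) z)
           (\<lambda>n z. (- 1) ^ (n div 2) * complex_of_real (q powr (- (real n / 2) * (real n / 2 - 1))) * a z)
           (mu2 / eta2)
           (\<lambda>n. q powr (real n / 4))
           (\<lambda>n. {z. norm z \<le> q powr (- (real n / 4))}) \<and>
         uniform_asymp_even
           (\<lambda>n z. poly (P n) z)
           (\<lambda>n z. z ^ n * a_inf (z * complex_of_real (q powr (real n / 2))))
           1
           (\<lambda>n. q powr (real n / 4))
           (\<lambda>n. {z. norm z > q powr (- (real n / 4))}) \<and>
         uniform_asymp_even
           (\<lambda>n z. poly (P (n - 1)) z)
           (\<lambda>n z. (- 1) ^ (n div 2) * complex_of_real (q powr (real n / 2 * (real n / 2 - 1)))
                    * \<gamma> (n - 1) * b z)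
           (lambda3 / c_Psi)
           (\<lambda>n. q powr (real n / 4))
           (\<lambda>n. {z. norm z \<le> q powr (- (real n / 4))}) \<and>
         uniform_asymp_even
           (\<lambda>n z. poly (P (n - 1)) z)
           (\<lambda>n z. complex_of_real (q powr (real n * (real n / 2 - 1))) * \<gamma> (n - 1)
                    / (mu4 * H_const q * c_Psi)
                    * z ^ n * b_inf (z * complex_of_real (q powr (real n / 2))))
           1
           (\<lambda>n. q powr (real n / 4))
           (\<lambda>n. {z. norm z > q powr (- (real n / 4))})"
proof -
  interpret qpar q by unfold_locales (use q in auto)
  obtain \<sigma> where \<sigma>: "q < \<sigma>" "\<sigma> < 1" "\<forall>z\<in>GC \<sigma>. h_fun q z \<noteq> 0" using exists_good_radius by blast
  interpret asym q P \<gamma> \<sigma> a b phi_even varphi_even varphi_odd a_inf b_inf Psi_even Psi_odd tPsi_even tPsi_odd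
    eta1 eta2 lambda3 lambda4 mu1 mu2 mu3 mu4 c_Psi
    by unfold_locales (use P \<sigma> a(1) b(1) phi_even(1) varphi_even(1) varphi_odd(1) eta lambda a_inf(1) b_inf(1) Psi_even(1) Psi_odd
      tPsi_even(1) tPsi_odd(1) mu_a mu_b c_Psi in \<open>simp_all add: w_fun_W\<close>)
  show ?thesis by (intro conjI asymptotics)
qed

end
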